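(* Let $n\ge2$, $1\le k\le n-1$, $r\ge n+1$, and let $\mathcal T_h$ be a conforming simplicial mesh of a bounded domain $\Omega\subset\mathbb R^n$. For each $f\in\Delta_\ell(\mathcal T_h)$, $\ell=0,\dots,n-1$, choose a $t$-$n$ basis depending only on $f$, and let $V_h\subset H(\mathrm{div},\Omega;\mathbb X)$ be the space of all $\omega\in L^2(\Omega;\mathbb X)$ such that $\omega|_T\in\mathbb P_r(T;\mathbb X)$ for all $T\in\mathcal T_h$ and the following degrees of freedom are single-valued: (a) $\omega(\mathtt v)$, for $\mathtt v\in\Delta_0(\mathcal T_h)$; (b) $(\omega,\eta)_f$, for $\eta\in\mathbb P_{r-(\ell+1)}(f)\otimes\mathrm{span}\{\mathrm d\hat y^f_\sigma\otimes*\mathrm d\hat y^f_i:(\sigma,i)\text{ is free},\ i\in\mathscr N^f\}$, $f\in\Delta_\ell(\mathcal T_h)$, $\ell=1,\dots,n-1$. Let $Q_h=\{q_h\in L^2(\Omega;\mathrm{Alt}^k):q_h|_T\in\mathbb P_{r-1}(T;\mathrm{Alt}^k)\ \forall T\in\mathcal T_h\}$. Then $$\mathrm{div}\,V_h=Q_h.$$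
   Context: Forms. $\mathrm{Alt}^j$ is the space of alternating $j$-linear forms on $\mathbb R^n$ with the inner product for which $\{\mathrm dx_\sigma\}$ is orthonormal ($\mathrm dx_i$ the standard orthonormal basis of $\mathrm{Alt}^1$); $\mathrm{Alt}^{k,n-1}=\mathrm{Alt}^k\otimes\mathrm{Alt}^{n-1}$ has the tensor product inner product $\langle\cdot,\cdot\rangle$. The map $s^{k,n-1}:\mathrm{Alt}^{k,n-1}\to\mathrm{Alt}^{k-1}\otimes\mathrm{Alt}^n$ is $$s^{k,n-1}\omega(w_1,\dots,w_{k-1})(v_1,\dots,v_n)=\sum_{i=1}^n(-1)^{i-1}\omega(v_i,w_1,\dots,w_{k-1})(v_1,\dots,\widehat{v_i},\dots,v_n),$$ and $\mathbb X:=\ker(s^{k,n-1})$. $(\omega,\eta)_f=\int_f\langle\omega,\eta\rangle\,\mathrm dx_f$. Index notation. $\Sigma(1:j,1:n)$ is the set of increasing sequences of length $j$ in $\{1,\dots,n\}$, identified with subsets; $\sigma^c$ is the complement; $i+\tau=\tau\cup\{i\}$ for $i\notin\tau$. For a basis $\{\mathrm dy_i\}$ of $\mathrm{Alt}^1$: $\mathrm dy_\sigma=\mathrm dy_{\sigma(1)}\wedge\cdots\wedge \mathrm dy_{\sigma(k)}$, $*\mathrm dy_i=(-1)^{i-1}\mathrm dy_1\wedge\cdots\wedge\widehat{\mathrm dy_i}\wedge\cdots\wedge \mathrm dy_n$, and the dual basis $\{\mathrm d\hat y_i\}$ satisfies $\langle \mathrm d\hat y_i,\mathrm dy_j\rangle=\delta_{i,j}$.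 Free indices. For $\tau\in\Sigma(1:k-1,1:n)$ with $\tau^c=\{i_1<\dots<i_{n-k+1}\}$, the constraint sequence of $\tau$ is $\{(i_m+\tau,i_m)\}_{m=1}^{n-k+1}$ and $(i_1+\tau,i_1)$ is its pair index. An index $(\sigma,i)$, $\sigma\in\Sigma(1:k,1:n)$, $1\le i\le n$, is free if it is not the pair index of any constraint sequence. $t$-$n$ basis. $\Delta_\ell(\mathcal T_h)$ is the set of $\ell$-dimensional sub-simplices of $\mathcal T_h$. A $t$-$n$ basis of $f$ (of dimension $\ell$) consists of $\ell$ linearly independent unit vectors $\boldsymbol t_i^f$ tangential to $f$ followed by $n-\ell$ linearly independent unit vectors $\boldsymbol n_j^f$ orthogonal to the tangent plane of $f$. The corresponding basis of $\mathrm{Alt}^1$ is $\mathrm dy_i^f(w)=\boldsymbol t_i^f\cdot w$ for $1\le i\le\ell$ and $\mathrm dy_i^f(w)=\boldsymbol n_{i-\ell}^f\cdot w$ for $\ell+1\le i\le n$ (the latter range is written $i\in\mathscr N^f$); $\{\mathrm d\hat y_i^f\}$ is its dual basis. Spaces. A mesh is conforming if any two simplices intersect in the empty set or a common sub-simplex. $\mathbb P_r(f)$: polynomials of degree $\le r$ on $f$ ($\{0\}$ if $r<0$). For $\omega=\sum_{\sigma,i}a_{\sigma,i}\,\mathrm dx_\sigma\otimes*\mathrm dx_i$, $\mathrm{div}\,\omega=\sum_\sigma\big(\sum_i\partial_{x_i}a_{\sigma,i}\big)\mathrm dx_\sigma$ ($\mathrm{Alt}^k$-valued), and $H(\mathrm{div},\Omega;\mathbb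 X)=\{\omega\in L^2(\Omega;\mathbb X):\mathrm{div}\,\omega\in L^2\}$. A degree of freedom attached to $f$ is single-valued if its values computed from $\omega|_T$ and $\omega|_{T'}$ coincide for all $T,T'\in\mathcal T_h$ containing $f$. *)

theory Defs
  imports "HOL-Analysis.Analysis"
begin

text \<open>
  Points and vectors live in \<open>real ^ 'n\<close> with \<open>n = CARD('n)\<close>.  The linearly ordered index type
  \<open>'n\<close> plays the role of \<open>{1, \<dots>, n}\<close>, so that an increasing sequence of length \<open>j\<close> is a set
  \<open>\<sigma> :: 'n set\<close> with \<open>card \<sigma> = j\<close> and its complement is \<open>- \<sigma>\<close>.  \<open>pos i\<close> is the zero-based
  position of \<open>i\<close>; the factor \<open>(-1)^(i-1)\<close> of one-based notation is therefore \<open>(-1) ^ pos i\<close>.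
\<close>

type_synonym 'n pt = "(real, 'n) vec"

definition pos :: "'n::{finite,linorder} \<Rightarrow> nat" where
  "pos i = card {j. j < i}"


section \<open>Alternating forms\<close>

text \<open>
  A \<open>j\<close>-form takes the list of its arguments.  Forms are required to vanish on lists of the wrong
  length, so that equality of forms is equality of functions.
\<close>

type_synonym 'n form = "'n pt list \<Rightarrow> real"

definition Alt :: "nat \<Rightarrow> 'n::finite form set" where
  "Alt j = {\<alpha>.
     (\<forall>vs. length vs \<noteq> j \<longrightarrow> \<alpha> vs = 0) \<and>
     (\<forall>vs i. length vs = j \<and> i < j \<longrightarrow> linear (\<lambda>v. \<alpha> (vs[i := v]))) \<and>
     (\<forall>vs i i'. length vs = j \<and> i < j \<and> i' < j \<and> i \<noteq> i' \<and> vs ! i = vs ! i' \<longrightarrow> \<alpha> vs = 0)}"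

text \<open>
  \<open>AltT k m\<close> is \<open>Alt\<^sup>k \<otimes> Alt\<^sup>m\<close>, realised as the space of maps
  \<open>\<omega>(w\<^sub>1, \<dots>, w\<^sub>k)(v\<^sub>1, \<dots>, v\<^sub>m)\<close> that are alternating multilinear in either group of arguments.
\<close>

type_synonym 'n tform = "'n pt list \<Rightarrow> 'n pt list \<Rightarrow> real"

definition AltT :: "nat \<Rightarrow> nat \<Rightarrow> 'n::finite tform set" where
  "AltT k m = {\<omega>. (\<forall>vs. (\<lambda>ws. \<omega> ws vs) \<in> Alt k) \<and> (\<forall>ws. \<omega> ws \<in> Alt m)}"

definition tensor :: "'n form \<Rightarrow> 'n form \<Rightarrow> 'n tform" where
  "tensor \<alpha> \<beta> = (\<lambda>ws vs. \<alpha> ws * \<beta> vs)"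

definition std_vecs :: "'n::{finite,linorder} set \<Rightarrow> 'n pt list" where
  "std_vecs \<sigma> = map (\<lambda>i. axis i 1) (sorted_list_of_set \<sigma>)"

text \<open>
  The coefficient of \<open>\<alpha>\<close> at \<open>dx\<^sub>\<sigma>\<close> is \<open>\<alpha> (std_vecs \<sigma>)\<close>; hence these are the inner products for
  which \<open>dx\<^sub>\<sigma>\<close>, respectively \<open>dx\<^sub>\<sigma> \<otimes> dx\<^sub>\<rho>\<close>, is an orthonormal basis.
\<close>

definition form_inner :: "nat \<Rightarrow> 'n::{finite,linorder} form \<Rightarrow> 'n form \<Rightarrow> real" where
  "form_inner j \<alpha> \<beta> = (\<Sum>\<sigma> | card \<sigma> = j. \<alpha> (std_vecs \<sigma>) * \<beta> (std_vecs \<sigma>))"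

definition tform_inner :: "nat \<Rightarrow> nat \<Rightarrow> 'n::{finite,linorder} tform \<Rightarrow> 'n tform \<Rightarrow> real" where
  "tform_inner k m \<omega> \<eta> =
     (\<Sum>\<sigma> | card \<sigma> = k. \<Sum>\<rho> | card \<rho> = m.
        \<omega> (std_vecs \<sigma>) (std_vecs \<rho>) * \<eta> (std_vecs \<sigma>) (std_vecs \<rho>))"

text \<open>Wedge product of a list of 1-forms, \<open>(\<alpha>\<^sub>1 \<and> \<dots> \<and> \<alpha>\<^sub>j)(v\<^sub>1, \<dots>, v\<^sub>j) = det (\<alpha>\<^sub>a (v\<^sub>b))\<close>.\<close>

definition wedge :: "'n form list \<Rightarrow> 'n form" where
  "wedge \<alpha>s = (\<lambda>vs. if length vs = length \<alpha>s
     then (\<Sum>p | p permutes {..<length \<alpha>s}.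
             real_of_int (sign p) * (\<Prod>a<length \<alpha>s. (\<alpha>s ! a) [vs ! p a]))
     else 0)"

text \<open>For a basis \<open>dy\<close> of \<open>Alt 1\<close>: \<open>dy\<^sub>\<sigma>\<close>, \<open>* dy\<^sub>i\<close> and the dual basis.\<close>

definition wedge_set :: "('n::{finite,linorder} \<Rightarrow> 'n form) \<Rightarrow> 'n set \<Rightarrow> 'n form" where
  "wedge_set dy \<sigma> = wedge (map dy (sorted_list_of_set \<sigma>))"

definition star :: "('n::{finite,linorder} \<Rightarrow> 'n form) \<Rightarrow> 'n \<Rightarrow> 'n form" where
  "star dy i = (\<lambda>vs. (-1) ^ pos i * wedge_set dy (- {i}) vs)"

definition dual_basis :: "('n::{finite,linorder} \<Rightarrow> 'n form) \<Rightarrow> ('n \<Rightarrow> 'n form)" where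
  "dual_basis dy = (THE dz. (\<forall>i. dz i \<in> Alt 1) \<and>
     (\<forall>i j. form_inner 1 (dz i) (dy j) = (if i = j then 1 else 0)))"

definition s_map :: "'n tform \<Rightarrow> 'n tform" where
  "s_map \<omega> = (\<lambda>ws vs. \<Sum>i<length vs.
     (-1) ^ i * \<omega> (vs ! i # ws) (take i vs @ drop (Suc i) vs))"

definition XX :: "nat \<Rightarrow> 'n::finite tform set" where
  "XX k = {\<omega> \<in> AltT k (CARD('n) - 1). s_map \<omega> = (\<lambda>ws vs. 0)}"


section \<open>Free indices\<close>

definition constraint_seq :: "'n::{finite,linorder} set \<Rightarrow> ('n set \<times> 'n) list" where
  "constraint_seq \<tau> = map (\<lambda>i. (insert i \<tau>, i)) (sorted_list_of_set (- \<tau>))"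

definition pair_index :: "'n::{finite,linorder} set \<Rightarrow> 'n set \<times> 'n" where
  "pair_index \<tau> = hd (constraint_seq \<tau>)"

definition free_index :: "nat \<Rightarrow> 'n::{finite,linorder} set \<times> 'n \<Rightarrow> bool" where
  "free_index k \<sigma>i \<longleftrightarrow> card (fst \<sigma>i) = k \<and> (\<forall>\<tau>. card \<tau> = k - 1 \<longrightarrow> \<sigma>i \<noteq> pair_index \<tau>)"


section \<open>Meshes and bases adapted to a face\<close>

text \<open>
  The library's \<open>triangulation\<close> is a finite set of simplices any two of which intersect in a common
  (possibly empty) face.
\<close>

definition conforming_mesh :: "'n::finite pt set \<Rightarrow> 'n pt set set \<Rightarrow> bool" where
  "conforming_mesh \<Omega> \<T> \<longleftrightarrow>
     triangulation \<T> \<and> (\<forall>T\<in>\<T>. int CARD('n) simplex T) \<and> \<Union>\<T> = closure \<Omega>"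

definition subsimplices :: "nat \<Rightarrow> 'n::finite pt set set \<Rightarrow> 'n pt set set" where
  "subsimplices l \<T> = {f. int l simplex f \<and> (\<exists>T\<in>\<T>. f face_of T)}"

definition tangent_space :: "'n::finite pt set \<Rightarrow> 'n pt set" where
  "tangent_space f = span {x - y | x y. x \<in> f \<and> y \<in> f}"

text \<open>
  The first \<open>l\<close> vectors of \<open>b\<close> are the tangential ones, the remaining ones the normal ones.
\<close>

definition tn_basis ::
    "nat \<Rightarrow> 'n::{finite,linorder} pt set \<Rightarrow> ('n \<Rightarrow> 'n pt) \<Rightarrow> bool" where
  "tn_basis l f b \<longleftrightarrow>
     (\<forall>i. norm (b i) = 1) \<and>
     (\<forall>i. pos i < l \<longrightarrow> b i \<in> tangent_space f) \<and>
     (\<forall>i. l \<le> pos i \<longrightarrow> (\<forall>w\<in>tangent_space f. b i \<bullet> w = 0)) \<and>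
     inj_on b {i. pos i < l} \<and> independent (b ` {i. pos i < l}) \<and>
     inj_on b {i. l \<le> pos i} \<and> independent (b ` {i. l \<le> pos i})"

definition dy_of :: "('n::finite \<Rightarrow> 'n pt) \<Rightarrow> 'n \<Rightarrow> 'n form" where
  "dy_of b i = (\<lambda>vs. if length vs = 1 then b i \<bullet> hd vs else 0)"

definition normal_indices :: "nat \<Rightarrow> 'n::{finite,linorder} set" where
  "normal_indices l = {i. l \<le> pos i}"


section \<open>Integration over a face\<close>

definition orthonormal :: "'n::finite pt set \<Rightarrow> bool" where
  "orthonormal B \<longleftrightarrow> pairwise orthogonal B \<and> (\<forall>b\<in>B. norm b = 1)"

text \<open>
  The \<open>l\<close>-dimensional Lebesgue measure on the affine hull of an \<open>l\<close>-dimensional simplex: the image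
  of the product Lebesgue measure under an isometric parametrisation.  It does not depend on the
  chosen origin and orthonormal basis.
\<close>

definition face_measure :: "'n::finite pt set \<Rightarrow> 'n pt measure" where
  "face_measure f =
     (let B = (SOME B. orthonormal B \<and> span B = tangent_space f);
          a = (SOME a. a \<in> f)
      in distr (PiM B (\<lambda>_. lborel)) borel (\<lambda>t. a + (\<Sum>b\<in>B. t b *\<^sub>R b)))"

definition face_inner ::
    "nat \<Rightarrow> 'n::{finite,linorder} pt set \<Rightarrow> ('n pt \<Rightarrow> 'n tform) \<Rightarrow> ('n pt \<Rightarrow> 'n tform)
      \<Rightarrow> real" where
  "face_inner k f \<omega> \<eta> =
     set_lebesgue_integral (face_measure f) f (\<lambda>x. tform_inner k (CARD('n) - 1) (\<omega> x) (\<eta> x))"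


section \<open>Polynomial spaces and degrees of freedom\<close>

definition poly_fun :: "nat \<Rightarrow> ('n::finite pt \<Rightarrow> real) set" where
  "poly_fun r = {p. \<exists>c. \<forall>x. p x =
     (\<Sum>\<alpha> | (\<Sum>i\<in>UNIV. \<alpha> i) \<le> r. c \<alpha> * (\<Prod>i\<in>UNIV. (x $ i) ^ \<alpha> i))}"

text \<open>
  Polynomials on a simplex are represented by polynomials on the whole space, of which only the
  restriction to that simplex is used.
\<close>

definition poly_form :: "nat \<Rightarrow> 'n::finite form set \<Rightarrow> ('n pt \<Rightarrow> 'n form) set" where
  "poly_form r E = {p. (\<forall>x. p x \<in> E) \<and> (\<forall>vs. (\<lambda>x. p x vs) \<in> poly_fun r)}"

definition poly_tform :: "nat \<Rightarrow> 'n::finite tform set \<Rightarrow> ('n pt \<Rightarrow> 'n tform) set" where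
  "poly_tform r E = {p. (\<forall>x. p x \<in> E) \<and> (\<forall>ws vs. (\<lambda>x. p x ws vs) \<in> poly_fun r)}"

text \<open>
  The space of test functions \<open>\<eta>\<close> of the face degrees of freedom: the polynomials of degree
  \<open>\<le> r - (l + 1)\<close> tensor the span of the \<open>d\<hat>y\<^sub>\<sigma> \<otimes> * d\<hat>y\<^sub>i\<close> with \<open>(\<sigma>, i)\<close> free and \<open>i\<close> normal.
  In the degree \<open>r - (l + 1)\<close> nothing is truncated when \<open>l < n < r\<close>.
\<close>

definition dof_space ::
    "nat \<Rightarrow> nat \<Rightarrow> nat \<Rightarrow> ('n::{finite,linorder} \<Rightarrow> 'n pt) \<Rightarrow> ('n pt \<Rightarrow> 'n tform) set" where
  "dof_space k r l b =
     (let dz = dual_basis (dy_of b) in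
      {\<eta>. \<exists>p. (\<forall>\<sigma> i. p \<sigma> i \<in> poly_fun (r - (l + 1))) \<and>
        \<eta> = (\<lambda>x ws vs. \<Sum>(\<sigma>, i) | free_index k (\<sigma>, i) \<and> i \<in> normal_indices l.
               p \<sigma> i x * tensor (wedge_set dz \<sigma>) (star dz i) ws vs)})"


section \<open>Function spaces\<close>

text \<open>
  Elements of \<open>L\<^sup>2(\<Omega>)\<close> are represented by functions; all spaces below are closed under changing a
  function on a null set (within the value space) and arbitrarily outside \<open>\<Omega>\<close>.
\<close>

definition L2 :: "'n::finite pt set \<Rightarrow> ('n pt \<Rightarrow> real) set" where
  "L2 \<Omega> = {f. set_borel_measurable lebesgue \<Omega> f \<and> set_integrable lebesgue \<Omega> (\<lambda>x. (f x)\<^sup>2)}"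

definition L2_form :: "'n::finite pt set \<Rightarrow> 'n form set \<Rightarrow> ('n pt \<Rightarrow> 'n form) set" where
  "L2_form \<Omega> E = {q. (\<forall>x\<in>\<Omega>. q x \<in> E) \<and> (\<forall>vs. (\<lambda>x. q x vs) \<in> L2 \<Omega>)}"

definition L2_tform :: "'n::finite pt set \<Rightarrow> 'n tform set \<Rightarrow> ('n pt \<Rightarrow> 'n tform) set" where
  "L2_tform \<Omega> E = {\<omega>. (\<forall>x\<in>\<Omega>. \<omega> x \<in> E) \<and> (\<forall>ws vs. (\<lambda>x. \<omega> x ws vs) \<in> L2 \<Omega>)}"

definition partial :: "'n::finite \<Rightarrow> ('n pt \<Rightarrow> real) \<Rightarrow> ('n pt \<Rightarrow> real)" where
  "partial i \<phi> = (\<lambda>x. frechet_derivative \<phi> (at x) (axis i 1))"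

definition smooth :: "('n::finite pt \<Rightarrow> real) \<Rightarrow> bool" where
  "smooth \<phi> \<longleftrightarrow> (\<forall>is x. foldr partial is \<phi> differentiable (at x))"

definition test_fun :: "'n::finite pt set \<Rightarrow> ('n pt \<Rightarrow> real) set" where
  "test_fun \<Omega> = {\<phi>. smooth \<phi> \<and> compact (closure {x. \<phi> x \<noteq> 0}) \<and> closure {x. \<phi> x \<noteq> 0} \<subseteq> \<Omega>}"

text \<open>
  The coefficient \<open>a\<^sub>\<sigma>\<^sub>,\<^sub>i\<close> of \<open>\<omega> = \<Sum> a\<^sub>\<sigma>\<^sub>,\<^sub>i dx\<^sub>\<sigma> \<otimes> * dx\<^sub>i\<close>; recall that \<open>* dx\<^sub>i\<close> is
  \<open>(-1) ^ pos i\<close> times \<open>dx\<close> indexed by the complement of \<open>{i}\<close>.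
\<close>

definition coef :: "'n::{finite,linorder} tform \<Rightarrow> 'n set \<Rightarrow> 'n \<Rightarrow> real" where
  "coef \<omega> \<sigma> i = (-1) ^ pos i * \<omega> (std_vecs \<sigma>) (std_vecs (- {i}))"

text \<open>\<open>q = div \<omega>\<close> on \<open>\<Omega>\<close> in the sense of distributions, coefficient by coefficient.\<close>

definition is_div ::
    "nat \<Rightarrow> 'n::{finite,linorder} pt set \<Rightarrow> ('n pt \<Rightarrow> 'n tform) \<Rightarrow> ('n pt \<Rightarrow> 'n form)
      \<Rightarrow> bool" where
  "is_div k \<Omega> \<omega> q \<longleftrightarrow> (\<forall>\<sigma>. card \<sigma> = k \<longrightarrow> (\<forall>\<phi>\<in>test_fun \<Omega>.
     set_lebesgue_integral lebesgue \<Omega> (\<lambda>x. q x (std_vecs \<sigma>) * \<phi> x) =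
     - set_lebesgue_integral lebesgue \<Omega> (\<lambda>x. \<Sum>i\<in>UNIV. coef (\<omega> x) \<sigma> i * partial i \<phi> x)))"

definition H_div :: "nat \<Rightarrow> 'n::{finite,linorder} pt set \<Rightarrow> ('n pt \<Rightarrow> 'n tform) set" where
  "H_div k \<Omega> = {\<omega> \<in> L2_tform \<Omega> (XX k). \<exists>q \<in> L2_form \<Omega> (Alt k). is_div k \<Omega> \<omega> q}"

definition div_image ::
    "nat \<Rightarrow> 'n::{finite,linorder} pt set \<Rightarrow> ('n pt \<Rightarrow> 'n tform) set
      \<Rightarrow> ('n pt \<Rightarrow> 'n form) set" where
  "div_image k \<Omega> V = {q \<in> L2_form \<Omega> (Alt k). \<exists>\<omega>\<in>V. is_div k \<Omega> \<omega> q}"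


section \<open>The finite element spaces\<close>

text \<open>
  \<open>P T\<close> is the polynomial that represents \<open>\<omega>\<close> on the element \<open>T\<close>; it is unique, and the degrees
  of freedom computed from the restriction of \<open>\<omega>\<close> to \<open>T\<close> are those of \<open>P T\<close>.
\<close>

definition V_h ::
    "nat \<Rightarrow> nat \<Rightarrow> 'n::{finite,linorder} pt set \<Rightarrow> 'n pt set set
      \<Rightarrow> ('n pt set \<Rightarrow> 'n \<Rightarrow> 'n pt) \<Rightarrow> ('n pt \<Rightarrow> 'n tform) set" where
  "V_h k r \<Omega> \<T> b = {\<omega> \<in> L2_tform \<Omega> (XX k). \<exists>P.
     (\<forall>T\<in>\<T>. P T \<in> poly_tform r (XX k) \<and> (AE x in lebesgue. x \<in> \<Omega> \<inter> T \<longrightarrow> \<omega> x = P T x)) \<and>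
     (\<forall>v. {v} \<in> subsimplices 0 \<T> \<longrightarrow>
        (\<forall>T\<in>\<T>. \<forall>T'\<in>\<T>. v \<in> T \<and> v \<in> T' \<longrightarrow> P T v = P T' v)) \<and>
     (\<forall>l \<in> {1..CARD('n) - 1}. \<forall>f \<in> subsimplices l \<T>. \<forall>\<eta> \<in> dof_space k r l (b f).
        \<forall>T\<in>\<T>. \<forall>T'\<in>\<T>. f \<subseteq> T \<and> f \<subseteq> T' \<longrightarrow> face_inner k f (P T) \<eta> = face_inner k f (P T') \<eta>)}"

definition Q_h ::
    "nat \<Rightarrow> nat \<Rightarrow> 'n::finite pt set \<Rightarrow> 'n pt set set \<Rightarrow> ('n pt \<Rightarrow> 'n form) set" where
  "Q_h k r \<Omega> \<T> = {q \<in> L2_form \<Omega> (Alt k).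
     \<forall>T\<in>\<T>. \<exists>p \<in> poly_form (r - 1) (Alt k). AE x in lebesgue. x \<in> \<Omega> \<inter> T \<longrightarrow> q x = p x}"

end

theory Submission
  imports Defs "HOL-Computational_Algebra.Polynomial"
begin


text \<open>
  The vertex values and face moments determine the normal component on every facet.  Hence a member
  of \<open>V\<^sub>h\<close> is a piecewise polynomial with continuous normal traces, and its weak divergence is the
  elementwise one.

  For surjectivity, project the prescribed divergence orthogonally onto the divergences of those
  piecewise polynomials whose components normal to each face agree on it; they form a subspace of
  \<open>V\<^sub>h\<close>.  Let \<open>R\<close> be the residual.  For an edge \<open>e\<close> with end points \<open>v\<close>, \<open>w\<close> and a form \<open>\<alpha>\<close> of degree
  \<open>k + 1\<close>, testing \<open>R\<close> with the field \<open>\<lambda>\<^sub>v \<lambda>\<^sub>w p (\<iota>\<^sub>e \<alpha>) \<otimes> e\<close>, which is admissible because it is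
  tangential to the edge, gives \<open>\<partial>\<^sub>e \<langle>R, \<iota>\<^sub>e \<alpha>\<rangle> = 0\<close>.  This is quadratic in \<open>e\<close> and a simplex has
  enough edges to extend it to all vectors \<open>e\<close>; polarisation then makes all second derivatives of \<open>R\<close>
  vanish, so \<open>R\<close> is affine on each element.  Testing with facet bubbles shows that \<open>R\<close> does not jump
  across interior facets and vanishes on elements with a boundary facet.  The elements with \<open>R \<noteq> 0\<close>
  would therefore form a mesh without boundary, which the divergence theorem excludes.

  The divergence theorem on a mesh comes from smooth cutoffs of the simplices.  Their gradients live
  in thin layers along the facets, and a linear map that differs from the identity by a map of rank
  one carries the layer on one side of a facet to the layer on the other.
\<close>


section \<open>Polynomial functions\<close>

text \<open>The contraction of a (\<open>k\<close> + 1)-form with \<open>e\<close>, tensored with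
  the contraction of the volume form with the same \<open>e\<close>, satisfies the constraint by
  itself: Cramer's rule turns the constraint into \<alpha>(e, e, ...) times the volume form. These
  rank-one tensors are all that is ever tested with, so no basis of the constrained space is built
  and no dimension is counted. The bound r \<ge> n + 1 enters on the facets. A facet bubble has
  degree n, and the field tested there is the bubble times the jump of \<open>R\<close>. It fits
  only because the edge tests have already made \<open>R\<close> affine, so the order of the two
  steps matters. The bound \<open>k\<close> < n supplies an index outside each \<sigma> with
  \<open>k\<close> elements, and with it the (\<open>k\<close> + 1)-form from which the component at
  \<sigma> is recovered. Two conditions on piecewise polynomials are kept apart:
  \<open>dof_family\<close> is the one of the statement, \<open>normal_family\<close> speaks of all
  normal vectors of a shared subsimplex and not of the chosen bases. The first gives continuity of
  normal traces, the second is what explicit fields can be checked against.\<close>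

definition monomial_fun :: "('n::finite \<Rightarrow> nat) \<Rightarrow> 'n pt \<Rightarrow> real" where
  "monomial_fun \<alpha> x = (\<Prod>i\<in>UNIV. (x $ i) ^ \<alpha> i)"

lemma finite_exponents [simp]: "finite {\<alpha>::'n::finite \<Rightarrow> nat. (\<Sum>i\<in>UNIV. \<alpha> i) \<le> r}"
proof (rule finite_subset)
  show "{\<alpha>::'n \<Rightarrow> nat. (\<Sum>i\<in>UNIV. \<alpha> i) \<le> r} \<subseteq> UNIV \<rightarrow>\<^sub>E {..r}"
  proof
    fix \<alpha> :: "'n \<Rightarrow> nat" assume "\<alpha> \<in> {\<alpha>. (\<Sum>i\<in>UNIV. \<alpha> i) \<le> r}"
    then have "\<alpha> i \<le> r" for i
      using member_le_sum[of i UNIV \<alpha>] by auto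
    then show "\<alpha> \<in> UNIV \<rightarrow>\<^sub>E {..r}" by auto
  qed
  show "finite (UNIV \<rightarrow>\<^sub>E {..r} :: ('n \<Rightarrow> nat) set)" by (simp add: finite_PiE)
qed

lemma poly_fun_iff:
  "p \<in> poly_fun r \<longleftrightarrow> (\<exists>c. \<forall>x. p x = (\<Sum>\<alpha> | (\<Sum>i\<in>UNIV. \<alpha> i) \<le> r. c \<alpha> * monomial_fun \<alpha> x))"
  by (simp add: poly_fun_def monomial_fun_def)

lemma poly_fun_monomial:
  assumes "(\<Sum>i\<in>UNIV. \<alpha> i) \<le> r"
  shows "(\<lambda>x. c * monomial_fun \<alpha> x) \<in> poly_fun r"
  unfolding poly_fun_iff
proof (intro exI allI)
  fix x
  have "(\<Sum>\<beta> | sum \<beta> UNIV \<le> r. (if \<beta> = \<alpha> then c else 0) * monomial_fun \<beta> x)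
      = (\<Sum>\<beta> | sum \<beta> UNIV \<le> r. if \<beta> = \<alpha> then c * monomial_fun \<alpha> x else 0)"
    by (rule sum.cong) auto
  then show "c * monomial_fun \<alpha> x = (\<Sum>\<beta> | sum \<beta> UNIV \<le> r. (if \<beta> = \<alpha> then c else 0) * monomial_fun \<beta> x)"
    using assms by (simp add: sum.delta)
qed

lemma poly_fun_add:
  assumes "p \<in> poly_fun r" "q \<in> poly_fun r"
  shows "(\<lambda>x. p x + q x) \<in> poly_fun r"
proof -
  obtain c d where "\<And>x. p x = (\<Sum>\<alpha> | (\<Sum>i\<in>UNIV. \<alpha> i) \<le> r. c \<alpha> * monomial_fun \<alpha> x)"
    "\<And>x. q x = (\<Sum>\<alpha> | (\<Sum>i\<in>UNIV. \<alpha> i) \<le> r. d \<alpha> * monomial_fun \<alpha> x)"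
    using assms unfolding poly_fun_iff by blast
  then have "\<And>x. p x + q x = (\<Sum>\<alpha> | (\<Sum>i\<in>UNIV. \<alpha> i) \<le> r. (c \<alpha> + d \<alpha>) * monomial_fun \<alpha> x)"
    by (simp add: sum.distrib distrib_right)
  then show ?thesis unfolding poly_fun_iff by (intro exI[of _ "\<lambda>\<alpha>. c \<alpha> + d \<alpha>"]) simp
qed

lemma poly_fun_const: "(\<lambda>x. c) \<in> poly_fun r"
  using poly_fun_monomial[of "\<lambda>_. 0" r c] by (simp add: monomial_fun_def)

lemma poly_fun_sum:
  "(\<And>j. j \<in> J \<Longrightarrow> p j \<in> poly_fun r) \<Longrightarrow> (\<lambda>x. \<Sum>j\<in>J. p j x) \<in> poly_fun r"
  by (induction J rule: infinite_finite_induct) (auto intro: poly_fun_const poly_fun_add)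

lemma monomial_fun_Suc: "monomial_fun (\<alpha>(i := Suc (\<alpha> i))) x = x $ i * monomial_fun \<alpha> x"
proof -
  have "monomial_fun (\<alpha>(i := Suc (\<alpha> i))) x
      = (\<Prod>j\<in>UNIV. (if j = i then x $ i else 1) * (x $ j) ^ \<alpha> j)"
    unfolding monomial_fun_def by (rule prod.cong) auto
  also have "\<dots> = (\<Prod>j\<in>UNIV. if j = i then x $ i else 1) * monomial_fun \<alpha> x"
    by (simp only: prod.distrib monomial_fun_def)
  finally show ?thesis by simp
qed

lemma sum_upd_Suc: "(\<Sum>j\<in>UNIV. (\<alpha>(i := Suc (\<alpha> i))) j) = Suc (\<Sum>j\<in>UNIV. \<alpha> (j::'n::finite))"
proof -
  have "(\<Sum>j\<in>UNIV. (\<alpha>(i := Suc (\<alpha> i))) j) = (\<Sum>j\<in>UNIV. (if j = i then 1 else 0) + \<alpha> j)"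
    by (rule sum.cong) auto
  then show ?thesis by (simp add: sum.distrib)
qed

lemma poly_fun_coord_mult:
  assumes "p \<in> poly_fun r"
  shows "(\<lambda>x. x $ i * p x) \<in> poly_fun (Suc r)"
proof -
  obtain c where "\<And>x. p x = (\<Sum>\<alpha> | (\<Sum>i\<in>UNIV. \<alpha> i) \<le> r. c \<alpha> * monomial_fun \<alpha> x)"
    using assms unfolding poly_fun_iff by blast
  then have "(\<lambda>x. x $ i * p x)
      = (\<lambda>x. \<Sum>\<alpha> | (\<Sum>i\<in>UNIV. \<alpha> i) \<le> r. c \<alpha> * monomial_fun (\<alpha>(i := Suc (\<alpha> i))) x)"
    by (simp add: sum_distrib_left monomial_fun_Suc mult.left_commute)
  then show ?thesis
    by (auto intro!: poly_fun_sum poly_fun_monomial simp: sum_upd_Suc simp del: fun_upd_apply)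
qed

lemma poly_fun_mono: "p \<in> poly_fun r \<Longrightarrow> r \<le> s \<Longrightarrow> p \<in> poly_fun s"
proof -
  assume "p \<in> poly_fun r" and rs: "r \<le> s"
  then obtain c where c: "\<And>x. p x = (\<Sum>\<alpha> | (\<Sum>i\<in>UNIV. \<alpha> i) \<le> r. c \<alpha> * monomial_fun \<alpha> x)"
    unfolding poly_fun_iff by blast
  then have "p = (\<lambda>x. \<Sum>\<alpha> | (\<Sum>i\<in>UNIV. \<alpha> i) \<le> r. c \<alpha> * monomial_fun \<alpha> x)" by auto
  with rs show ?thesis by (auto intro!: poly_fun_sum poly_fun_monomial)
qed

text \<open>The degree bound is an argument of the predicate, and only multiplication by a
  coordinate raises it. With this rule, bounds for products, affine substitution, division and
  differentiation need no further handling of exponents.\<close>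

lemma poly_fun_induct [consumes 1, case_names const add coord]:
  assumes "p \<in> poly_fun r"
    and const: "\<And>r c. Q r (\<lambda>_. c)"
    and add: "\<And>r p q. p \<in> poly_fun r \<Longrightarrow> q \<in> poly_fun r \<Longrightarrow> Q r p \<Longrightarrow> Q r q \<Longrightarrow> Q r (\<lambda>x. p x + q x)"
    and coord: "\<And>r p i. p \<in> poly_fun r \<Longrightarrow> Q r p \<Longrightarrow> Q (Suc r) (\<lambda>x. x $ i * p x)"
  shows "Q r (p :: 'n::finite pt \<Rightarrow> real)"
proof -
  have mono: "Q r (\<lambda>x. c * monomial_fun \<alpha> x)" if "(\<Sum>i\<in>UNIV. \<alpha> i) \<le> r" for \<alpha> :: "'n \<Rightarrow> nat" and c r
    using that
  proof (induction r arbitrary: \<alpha>)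
    case 0
    then have "\<alpha> = (\<lambda>_. 0)" by auto
    then show ?case by (simp add: monomial_fun_def const)
  next
    case (Suc r)
    show ?case
    proof (cases "\<exists>i. \<alpha> i > 0")
      case False
      then have "\<alpha> = (\<lambda>_. 0)" by auto
      then show ?thesis by (simp add: monomial_fun_def const)
    next
      case True
      then obtain i where i: "\<alpha> i > 0" by blast
      define \<beta> where "\<beta> = \<alpha>(i := \<alpha> i - 1)"
      have \<alpha>: "\<alpha> = \<beta>(i := Suc (\<beta> i))" using i by (auto simp: \<beta>_def)
      have le: "(\<Sum>i\<in>UNIV. \<beta> i) \<le> r" using Suc.prems sum_upd_Suc[of \<beta> i] \<alpha> by simp
      have "Q (Suc r) (\<lambda>x. x $ i * (c * monomial_fun \<beta> x))"
        by (intro coord Suc.IH le poly_fun_monomial)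
      moreover have "(\<lambda>x. x $ i * (c * monomial_fun \<beta> x)) = (\<lambda>x. c * monomial_fun \<alpha> x)"
        by (subst \<alpha>) (simp add: monomial_fun_Suc mult.left_commute)
      ultimately show ?thesis by simp
    qed
  qed
  obtain c where c: "p = (\<lambda>x. \<Sum>\<alpha> | (\<Sum>i\<in>UNIV. \<alpha> i) \<le> r. c \<alpha> * monomial_fun \<alpha> x)"
    using assms(1) unfolding poly_fun_iff by blast
  have "Q r (\<lambda>x. \<Sum>\<alpha>\<in>A. c \<alpha> * monomial_fun \<alpha> x)"
    if "finite A" "A \<subseteq> {\<alpha>. (\<Sum>i\<in>UNIV. \<alpha> i) \<le> r}" for A
    using that
    by (induction A) (auto intro!: const add mono poly_fun_sum poly_fun_monomial)
  then show ?thesis using c by auto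
qed

lemma poly_fun_cmult: "p \<in> poly_fun r \<Longrightarrow> (\<lambda>x. c * p x) \<in> poly_fun r"
proof (induction rule: poly_fun_induct)
  case (coord r p i)
  then show ?case using poly_fun_coord_mult[OF coord(2), of i] by (simp add: mult.left_commute)
qed (auto intro: poly_fun_const poly_fun_add simp: distrib_left)

lemma poly_fun_multc: "p \<in> poly_fun r \<Longrightarrow> (\<lambda>x. p x * c) \<in> poly_fun r"
  using poly_fun_cmult[of p r c] by (simp add: mult.commute)

lemma poly_fun_uminus: "p \<in> poly_fun r \<Longrightarrow> (\<lambda>x. - p x) \<in> poly_fun r"
  using poly_fun_cmult[of p r "-1"] by simp

lemma poly_fun_diff: "p \<in> poly_fun r \<Longrightarrow> q \<in> poly_fun r \<Longrightarrow> (\<lambda>x. p x - q x) \<in> poly_fun r"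
  using poly_fun_add[OF _ poly_fun_uminus, of p r q] by simp

lemma poly_fun_mult:
  assumes "p \<in> poly_fun r" "q \<in> poly_fun s"
  shows "(\<lambda>x. p x * q x) \<in> poly_fun (r + s)"
  using assms(1)
proof (induction rule: poly_fun_induct)
  case (const r c)
  show ?case using poly_fun_cmult[OF assms(2), of c] by (rule poly_fun_mono) simp
next
  case (add r p q)
  then show ?case by (simp add: distrib_right poly_fun_add)
next
  case (coord r p i)
  then show ?case using poly_fun_coord_mult[OF coord(2), of i] by (simp add: mult.assoc)
qed

lemma poly_fun_prod:
  assumes "\<And>j. j \<in> J \<Longrightarrow> p j \<in> poly_fun 1" "finite J"
  shows "(\<lambda>x. \<Prod>j\<in>J. p j x) \<in> poly_fun (card J)"
  using assms(2,1)
proof (induction J)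
  case (insert a J)
  then show ?case using poly_fun_mult[of "p a" 1 "\<lambda>x. \<Prod>j\<in>J. p j x" "card J"] by simp
qed (simp add: poly_fun_const)

lemma poly_fun_coord: "(\<lambda>x. x $ i) \<in> poly_fun 1"
  using poly_fun_coord_mult[OF poly_fun_const, of i 1 0] by simp

lemma poly_fun_inner: "(\<lambda>x. g \<bullet> x) \<in> poly_fun 1"
  unfolding inner_vec_def inner_real_def by (intro poly_fun_sum poly_fun_cmult poly_fun_coord)

lemma poly_fun_affine: "(\<lambda>x. g \<bullet> x + c) \<in> poly_fun 1"
  by (intro poly_fun_add poly_fun_inner poly_fun_const)

text \<open>When \<open>g\<close> \<bullet> \<open>u\<close> = 1, the substituted point is the
  projection of \<open>x\<close> along \<open>u\<close> onto the hyperplane where \<open>g\<close>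
  \<bullet> \<open>x\<close> + \<open>c\<close> = 0.\<close>

lemma poly_fun_compose_proj:
  assumes "p \<in> poly_fun r"
  shows "(\<lambda>x. p (x - (g \<bullet> x + c) *\<^sub>R u)) \<in> poly_fun r"
  using assms
proof (induction rule: poly_fun_induct)
  case (coord r p i)
  have "(\<lambda>x. (x - (g \<bullet> x + c) *\<^sub>R u) $ i) \<in> poly_fun 1"
    unfolding vector_minus_component vector_scaleR_component real_scaleR_def
    by (intro poly_fun_diff poly_fun_coord poly_fun_multc poly_fun_affine)
  from poly_fun_mult[OF this coord(2)] show ?case by simp
qed (auto intro: poly_fun_const poly_fun_add)

text \<open>Division by an affine function, with the value at the projected point as remainder. A
  polynomial that vanishes at the projected points is then a multiple of the affine function; bubble
  factors are split off in this way.\<close>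

lemma poly_fun_division:
  assumes "p \<in> poly_fun r"
  obtains q where "q \<in> poly_fun (r - 1)"
    "\<And>x. p x = p (x - (g \<bullet> x + c) *\<^sub>R u) + (g \<bullet> x + c) * q x"
proof -
  \<comment> \<open>At \<open>r\<close> = 0 the truncated \<open>r - 1\<close> is again 0 and would
    admit nonzero constant quotients. Demanding quotient 0 there keeps the product of a coordinate
    with \<open>q\<close> within degree \<open>r\<close> in the coordinate case.\<close>
  have "\<exists>q\<in>poly_fun (r - 1). (r = 0 \<longrightarrow> q = (\<lambda>_. 0)) \<and>
      (\<forall>x. p x = p (x - (g \<bullet> x + c) *\<^sub>R u) + (g \<bullet> x + c) * q x)"
    using assms
  proof (induction rule: poly_fun_induct)
    case (const r d)
    show ?case by (intro bexI[of _ "\<lambda>_. 0"]) (auto intro: poly_fun_const)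
  next
    case (add r p q)
    then obtain p' q' where pq: "p' \<in> poly_fun (r - 1)" "q' \<in> poly_fun (r - 1)"
      "r = 0 \<longrightarrow> p' = (\<lambda>_. 0)" "r = 0 \<longrightarrow> q' = (\<lambda>_. 0)"
      and p': "\<And>x. p x = p (x - (g \<bullet> x + c) *\<^sub>R u) + (g \<bullet> x + c) * p' x"
      and q': "\<And>x. q x = q (x - (g \<bullet> x + c) *\<^sub>R u) + (g \<bullet> x + c) * q' x"
      by blast
    show ?case
    proof (intro bexI[of _ "\<lambda>x. p' x + q' x"] poly_fun_add pq conjI allI)
      show "p x + q x = p (x - (g \<bullet> x + c) *\<^sub>R u) + q (x - (g \<bullet> x + c) *\<^sub>R u)
          + (g \<bullet> x + c) * (p' x + q' x)" for x
        by (subst p', subst q') (simp add: distrib_left)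
    qed (use pq in auto)
  next
    case (coord r p i)
    then obtain q where q: "q \<in> poly_fun (r - 1)" "r = 0 \<longrightarrow> q = (\<lambda>_. 0)"
      "\<And>x. p x = p (x - (g \<bullet> x + c) *\<^sub>R u) + (g \<bullet> x + c) * q x" by blast
    have 1: "(\<lambda>x. x $ i * q x) \<in> poly_fun r"
    proof (cases "r = 0")
      case True then show ?thesis using q(2) by (simp add: poly_fun_const)
    next
      case False then show ?thesis using poly_fun_coord_mult[OF q(1), of i] by simp
    qed
    have 2: "(\<lambda>x. u $ i * p (x - (g \<bullet> x + c) *\<^sub>R u)) \<in> poly_fun r"
      by (intro poly_fun_cmult poly_fun_compose_proj coord)
    show ?case
    proof (intro bexI[of _ "\<lambda>x. x $ i * q x + u $ i * p (x - (g \<bullet> x + c) *\<^sub>R u)"] conjI allI)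
      show "(\<lambda>x. x $ i * q x + u $ i * p (x - (g \<bullet> x + c) *\<^sub>R u)) \<in> poly_fun (Suc r - 1)"
        using 1 2 by (simp add: poly_fun_add)
      show "x $ i * p x = (x - (g \<bullet> x + c) *\<^sub>R u) $ i * p (x - (g \<bullet> x + c) *\<^sub>R u) +
          (g \<bullet> x + c) * (x $ i * q x + u $ i * p (x - (g \<bullet> x + c) *\<^sub>R u))" for x
        by (subst q(3)) (simp add: algebra_simps)
    qed auto
  qed
  then show ?thesis using that by blast
qed

text \<open>The derivatives are first produced as polynomials and only afterwards identified with
  \<open>partial\<close>. The clause for \<open>r\<close> = 0 guards against the truncation of
  \<open>r - 1\<close>, as in the division lemma.\<close>

lemma poly_fun_deriv_exists:
  assumes "p \<in> poly_fun r"
  shows "\<exists>D. (\<forall>i. D i \<in> poly_fun (r - 1)) \<and> (r = 0 \<longrightarrow> (\<forall>i. D i = (\<lambda>_. 0))) \<and>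
    (\<forall>x. (p has_derivative (\<lambda>h. \<Sum>i\<in>UNIV. h $ i * D i x)) (at x))"
  using assms
proof (induction rule: poly_fun_induct)
  case (const r c)
  show ?case by (intro exI[of _ "\<lambda>_ _. 0"]) (auto intro: poly_fun_const)
next
  case (add r p q)
  then obtain D E where "\<forall>i. D i \<in> poly_fun (r - 1)" "r = 0 \<longrightarrow> (\<forall>i. D i = (\<lambda>_. 0))"
    "\<forall>x. (p has_derivative (\<lambda>h. \<Sum>i\<in>UNIV. h $ i * D i x)) (at x)"
    "\<forall>i. E i \<in> poly_fun (r - 1)" "r = 0 \<longrightarrow> (\<forall>i. E i = (\<lambda>_. 0))"
    "\<forall>x. (q has_derivative (\<lambda>h. \<Sum>i\<in>UNIV. h $ i * E i x)) (at x)" by blast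
  moreover from this have "((\<lambda>x. p x + q x) has_derivative
      (\<lambda>h. (\<Sum>i\<in>UNIV. h $ i * D i x) + (\<Sum>i\<in>UNIV. h $ i * E i x))) (at x)" for x
    by (intro has_derivative_add) blast+
  ultimately show ?case
    by (intro exI[of _ "\<lambda>i x. D i x + E i x"] conjI allI impI)
      (simp_all add: poly_fun_add distrib_left sum.distrib)
next
  case (coord r p j)
  then obtain D where D: "\<forall>i. D i \<in> poly_fun (r - 1)" "r = 0 \<longrightarrow> (\<forall>i. D i = (\<lambda>_. 0))"
    "\<And>x. (p has_derivative (\<lambda>h. \<Sum>i\<in>UNIV. h $ i * D i x)) (at x)" by blast
  have 1: "(\<lambda>x. x $ j * D i x) \<in> poly_fun r" for i
  proof (cases "r = 0")
    case True then show ?thesis using D(2) by (simp add: poly_fun_const)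
  next
    case False then show ?thesis using poly_fun_coord_mult[of "D i" "r - 1" j] D(1) by simp
  qed
  show ?case
  proof (intro exI[of _ "\<lambda>i x. x $ j * D i x + (if i = j then p x else 0)"] conjI allI impI)
    show "(\<lambda>x. x $ j * D i x + (if i = j then p x else 0)) \<in> poly_fun (Suc r - 1)" for i
    proof -
      have "(\<lambda>x. if i = j then p x else 0) \<in> poly_fun r"
        using coord.hyps by (cases "i = j") (auto intro: poly_fun_const)
      with 1[of i] show ?thesis by (simp add: poly_fun_add)
    qed
    fix x
    have "((\<lambda>x. x $ j * p x) has_derivative
        (\<lambda>h. x $ j * (\<Sum>i\<in>UNIV. h $ i * D i x) + h $ j * p x)) (at x)"
      by (intro has_derivative_mult D bounded_linear.has_derivative[OF bounded_linear_vec_nth] has_derivative_ident)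
    moreover have "(\<lambda>h. x $ j * (\<Sum>i\<in>UNIV. h $ i * D i x) + h $ j * p x) =
       (\<lambda>h. \<Sum>i\<in>UNIV. h $ i * (x $ j * D i x + (if i = j then p x else 0)))"
    proof
      fix h :: "'a pt"
      have "(\<Sum>i\<in>UNIV. h $ i * (if i = j then p x else 0)) = (\<Sum>i\<in>UNIV. if i = j then h $ j * p x else 0)"
        by (rule sum.cong) auto
      then show "x $ j * (\<Sum>i\<in>UNIV. h $ i * D i x) + h $ j * p x =
       (\<Sum>i\<in>UNIV. h $ i * (x $ j * D i x + (if i = j then p x else 0)))"
        by (simp add: distrib_left sum.distrib sum_distrib_left mult.left_commute)
    qed
    ultimately show "((\<lambda>x. x $ j * p x) has_derivative
        (\<lambda>h. \<Sum>i\<in>UNIV. h $ i * (x $ j * D i x + (if i = j then p x else 0)))) (at x)" by simp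
  qed auto
qed

lemma sum_axis: "(\<Sum>i\<in>UNIV. axis j (1::real) $ i * D i) = D (j::'n::finite)"
proof -
  have "(\<Sum>i\<in>UNIV. axis j (1::real) $ i * D i) = (\<Sum>i\<in>UNIV. if i = j then D j else 0)"
    by (rule sum.cong) (auto simp: axis_def)
  then show ?thesis by simp
qed

lemma partial_eq:
  assumes "(p has_derivative (\<lambda>h. \<Sum>i\<in>UNIV. h $ i * D i)) (at x)"
  shows "partial i p x = D i"
  unfolding partial_def frechet_derivative_at[OF assms, symmetric] by (rule sum_axis)

lemma
  assumes "p \<in> poly_fun r"
  shows poly_fun_partial: "partial i p \<in> poly_fun (r - 1)"
    and poly_fun_has_derivative: "(p has_derivative (\<lambda>h. \<Sum>i\<in>UNIV. h $ i * partial i p x)) (at x)"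
proof -
  obtain D where D: "\<forall>i. D i \<in> poly_fun (r - 1)"
    "\<And>x. (p has_derivative (\<lambda>h. \<Sum>i\<in>UNIV. h $ i * D i x)) (at x)"
    using poly_fun_deriv_exists[OF assms] by blast
  have "partial i p = D i" for i using partial_eq[OF D(2)] by auto
  then show "partial i p \<in> poly_fun (r - 1)"
    "(p has_derivative (\<lambda>h. \<Sum>i\<in>UNIV. h $ i * partial i p x)) (at x)"
    using D by auto
qed

lemma poly_fun_continuous_on: "p \<in> poly_fun r \<Longrightarrow> continuous_on S p"
  by (intro continuous_at_imp_continuous_on ballI has_derivative_continuous[OF poly_fun_has_derivative])

section \<open>A smooth cutoff profile\<close>

definition flat :: "real poly \<Rightarrow> real \<Rightarrow> real" where
  "flat p t = (if t > 0 then poly p (1 / t) * exp (- (1 / t)) else 0)"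

text \<open>Functions p(1/t) exp(-1/t) are closed under differentiation: the chain rule gives the
  factor t^-2 times (p - p')(1/t), and \<open>[:0, 0, 1:]\<close> is that factor as a polynomial in
  1/t.\<close>

definition flat_deriv :: "real poly \<Rightarrow> real poly" where
  "flat_deriv p = [:0, 0, 1:] * (p - pderiv p)"

lemma power_exp_minus_tendsto: "((\<lambda>u::real. u ^ k * exp (- u)) \<longlongrightarrow> 0) at_top"
  using tendsto_power_div_exp_0[of k] by (simp add: exp_minus field_simps)

lemma poly_exp_minus_tendsto: "((\<lambda>u::real. poly p u * exp (- u)) \<longlongrightarrow> 0) at_top"
proof -
  have "((\<lambda>u::real. \<Sum>i\<le>degree p. coeff p i * (u ^ i * exp (- u))) \<longlongrightarrow> (\<Sum>i\<le>degree p. coeff p i * 0)) at_top"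
    by (intro tendsto_intros power_exp_minus_tendsto)
  then show ?thesis by (simp add: poly_altdef sum_distrib_right mult.assoc)
qed

lemma flat_at_right_0: "(flat p \<longlongrightarrow> 0) (at_right 0)"
proof -
  have "((\<lambda>t. poly p (inverse t) * exp (- (inverse t))) \<longlongrightarrow> 0) (at_right 0)"
    by (rule filterlim_compose[OF poly_exp_minus_tendsto filterlim_inverse_at_top_right])
  moreover have "\<forall>\<^sub>F t in at_right (0::real). poly p (inverse t) * exp (- (inverse t)) = flat p t"
    by (auto simp: eventually_at_right_field flat_def divide_inverse intro!: exI[of _ 1])
  ultimately show ?thesis by (rule Lim_transform_eventually)
qed

lemma flat_DERIV: "(flat p has_real_derivative flat (flat_deriv p) t) (at t)"
proof -
  consider "t > 0" | "t < 0" | "t = 0" by linarith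
  then show ?thesis
  proof cases
    case 1
    have "((\<lambda>t. poly p (1 / t) * exp (- (1 / t))) has_real_derivative flat (flat_deriv p) t) (at t)"
      using 1 by (auto intro!: derivative_eq_intros DERIV_chain2[OF poly_DERIV]
          simp: flat_def flat_deriv_def power2_eq_square field_simps)
    then show ?thesis
      by (rule DERIV_cong_ev[THEN iffD1, rotated 3])
        (use 1 in \<open>auto simp: flat_def eventually_nhds intro!: exI[of _ "{0<..}"]\<close>)
  next
    case 2
    have "((\<lambda>t. 0) has_real_derivative flat (flat_deriv p) t) (at t)"
      using 2 by (simp add: flat_def)
    then show ?thesis
      by (rule DERIV_cong_ev[THEN iffD1, rotated 3])
        (use 2 in \<open>auto simp: flat_def eventually_nhds intro!: exI[of _ "{..<0}"]\<close>)
  next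
    case 3
    \<comment> \<open>For \<open>h\<close> > 0 the difference quotient at 0 is again of the form
      \<open>flat\<close>, with \<open>p\<close> multiplied by its variable, and so it tends to
      0.\<close>
    have "((\<lambda>h. (flat p (0 + h) - flat p 0) / h) \<longlongrightarrow> 0) (at_right 0)"
    proof (rule Lim_transform_eventually)
      show "(flat ([:0, 1:] * p) \<longlongrightarrow> 0) (at_right 0)" by (rule flat_at_right_0)
      show "\<forall>\<^sub>F h in at_right 0. flat ([:0, 1:] * p) h = (flat p (0 + h) - flat p 0) / h"
        by (auto simp: eventually_at_right_field flat_def intro!: exI[of _ 1])
    qed
    moreover have "((\<lambda>h. (flat p (0 + h) - flat p 0) / h) \<longlongrightarrow> 0) (at_left 0)"
      by (rule Lim_transform_eventually[OF tendsto_const])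
        (auto simp: eventually_at_left_field flat_def intro!: exI[of _ "-1"])
    ultimately have "((\<lambda>h. (flat p (0 + h) - flat p 0) / h) \<longlongrightarrow> 0) (at 0)"
      by (simp add: filterlim_split_at)
    then show ?thesis using 3 by (simp add: DERIV_def flat_def)
  qed
qed

lemma flat_continuous: "continuous_on S (flat p)"
  using flat_DERIV by (meson DERIV_isCont continuous_at_imp_continuous_on)

text \<open>exp(-1/t) for positive t and 0 otherwise. It tends to 1 at infinity, so rescaling by m
  makes it approach the indicator of the positive half line.\<close>

definition bump :: "real \<Rightarrow> real" where "bump = flat 1"
definition bump' :: "real \<Rightarrow> real" where "bump' = flat [:0, 0, 1:]"

lemma bump_DERIV: "(bump has_real_derivative bump' t) (at t)"
  using flat_DERIV[of 1 t] by (simp add: bump_def bump'_def flat_deriv_def)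

lemma bump_continuous [continuous_intros]: "continuous_on S f \<Longrightarrow> continuous_on S (\<lambda>x. bump (f x))"
  and bump'_continuous [continuous_intros]: "continuous_on S f \<Longrightarrow> continuous_on S (\<lambda>x. bump' (f x))"
  unfolding bump_def bump'_def
  by (rule continuous_on_compose2[OF flat_continuous[of UNIV]]; simp)+

lemma bump_nonneg: "0 \<le> bump t" and bump_le_1: "bump t \<le> 1"
  and bump_0: "t \<le> 0 \<Longrightarrow> bump t = 0" and bump'_0: "t \<le> 0 \<Longrightarrow> bump' t = 0"
  and bump_pos: "t > 0 \<Longrightarrow> bump t > 0"
  and bump'_nonneg: "0 \<le> bump' t"
  by (auto simp: bump_def bump'_def flat_def)

text \<open>From 1/t \<le> exp(1/t). The bound survives rescaling and therefore dominates the
  boundary layers: differentiating a cutoff brings out a factor m, and a function that vanishes on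
  the facet contributes the missing barycentric coordinate.\<close>

lemma bump'_bound: "t * bump' t \<le> 1" and bump'_bound0: "0 \<le> t * bump' t"
proof -
  have "1 / t \<le> exp (1 / t)" using exp_ge_add_one_self[of "1/t"] by linarith
  then show "t * bump' t \<le> 1"
    by (auto simp: bump'_def flat_def exp_minus field_simps)
  show "0 \<le> t * bump' t" by (auto simp: bump'_def flat_def)
qed

lemma bump_tendsto: "t > 0 \<Longrightarrow> (\<lambda>m. bump (real m * t)) \<longlonglongrightarrow> 1"
  and bump'_tendsto: "t > 0 \<Longrightarrow> (\<lambda>m. (real m * t) * bump' (real m * t)) \<longlonglongrightarrow> 0"
proof -
  assume t: "t > 0"
  have lim: "filterlim (\<lambda>m. real m * t) at_top sequentially"
    using t by (intro filterlim_at_top_mult_tendsto_pos[OF tendsto_const] filterlim_real_sequentially)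
  have 0: "((\<lambda>s::real. 1 / s) \<longlongrightarrow> 0) at_top"
    using tendsto_inverse_0_at_top[OF filterlim_ident] by (simp add: inverse_eq_divide)
  have "((\<lambda>s. exp (- (1 / s))) \<longlongrightarrow> exp (- 0)) (at_top :: real filter)"
    by (intro tendsto_intros 0)
  moreover have "\<forall>\<^sub>F s in at_top. exp (- (1 / s)) = bump s"
    unfolding eventually_at_top_linorder by (intro exI[of _ 1]) (auto simp: bump_def flat_def)
  ultimately have "(bump \<longlongrightarrow> 1) at_top"
    using Lim_transform_eventually by force
  then show "(\<lambda>m. bump (real m * t)) \<longlonglongrightarrow> 1" by (rule filterlim_compose[OF _ lim])
  have "((\<lambda>s. (1 / s) * exp (- (1 / s))) \<longlongrightarrow> 0 * exp (- 0)) (at_top :: real filter)"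
    by (intro tendsto_intros 0)
  moreover have "\<forall>\<^sub>F s in at_top. (1 / s) * exp (- (1 / s)) = s * bump' s"
    unfolding eventually_at_top_linorder
    by (intro exI[of _ 1]) (auto simp: bump'_def flat_def divide_simps)
  ultimately have "((\<lambda>s. s * bump' s) \<longlongrightarrow> 0) at_top"
    using Lim_transform_eventually by force
  then show "(\<lambda>m. (real m * t) * bump' (real m * t)) \<longlonglongrightarrow> 0"
    by (rule filterlim_compose[OF _ lim])
qed


section \<open>Continuously differentiable functions\<close>

definition C1 :: "('n::finite pt \<Rightarrow> real) \<Rightarrow> bool" where
  "C1 p \<longleftrightarrow> (\<forall>x. (p has_derivative (\<lambda>h. \<Sum>i\<in>UNIV. h $ i * partial i p x)) (at x)) \<and>
     (\<forall>i. continuous_on UNIV (partial i p))"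

lemma C1_I:
  assumes "\<And>x. (p has_derivative (\<lambda>h. \<Sum>i\<in>UNIV. h $ i * D i x)) (at x)"
    and "\<And>i. continuous_on UNIV (D i)"
  shows "C1 p" and "partial i p = D i"
proof -
  have *: "partial i p = D i" for i using partial_eq[OF assms(1)] by auto
  then show "C1 p" "partial i p = D i" using assms by (auto simp: C1_def)
qed

lemma C1_has_derivative: "C1 p \<Longrightarrow> (p has_derivative (\<lambda>h. \<Sum>i\<in>UNIV. h $ i * partial i p x)) (at x)"
  and C1_partial_continuous: "C1 p \<Longrightarrow> continuous_on UNIV (partial i p)"
  by (auto simp: C1_def)

lemma C1_continuous: "C1 p \<Longrightarrow> continuous_on S p"
  by (intro continuous_at_imp_continuous_on ballI has_derivative_continuous[OF C1_has_derivative])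

lemma C1_poly_fun: "p \<in> poly_fun r \<Longrightarrow> C1 p"
  unfolding C1_def
  by (intro conjI allI poly_fun_has_derivative poly_fun_continuous_on[OF poly_fun_partial])

lemma
  assumes "C1 p" "C1 q"
  shows C1_add: "C1 (\<lambda>x. p x + q x)"
    and partial_add: "partial i (\<lambda>x. p x + q x) = (\<lambda>x. partial i p x + partial i q x)"
proof -
  have 1: "((\<lambda>x. p x + q x) has_derivative (\<lambda>h. \<Sum>i\<in>UNIV. h $ i * (partial i p x + partial i q x))) (at x)" for x
    using has_derivative_add[OF C1_has_derivative[OF assms(1)] C1_has_derivative[OF assms(2)], of x]
    by (simp add: distrib_left sum.distrib)
  have 2: "continuous_on UNIV (\<lambda>x. partial i p x + partial i q x)" for i
    by (intro continuous_intros C1_partial_continuous assms)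
  show "C1 (\<lambda>x. p x + q x)" by (rule C1_I(1)[OF 1 2])
  show "partial i (\<lambda>x. p x + q x) = (\<lambda>x. partial i p x + partial i q x)"
    by (rule C1_I(2)[OF 1 2])
qed

lemma
  assumes "C1 p" "C1 q"
  shows C1_mult: "C1 (\<lambda>x. p x * q x)"
    and partial_mult: "partial i (\<lambda>x. p x * q x) = (\<lambda>x. p x * partial i q x + partial i p x * q x)"
proof -
  have 1: "((\<lambda>x. p x * q x) has_derivative (\<lambda>h. \<Sum>i\<in>UNIV. h $ i * (p x * partial i q x + partial i p x * q x))) (at x)" for x
    using has_derivative_mult[OF C1_has_derivative[OF assms(1)] C1_has_derivative[OF assms(2)], of x]
    by (simp add: distrib_left sum.distrib sum_distrib_left sum_distrib_right mult_ac)
  have 2: "continuous_on UNIV (\<lambda>x. p x * partial i q x + partial i p x * q x)" for i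
    by (intro continuous_intros C1_partial_continuous C1_continuous assms)
  show "C1 (\<lambda>x. p x * q x)" by (rule C1_I(1)[OF 1 2])
  show "partial i (\<lambda>x. p x * q x) = (\<lambda>x. p x * partial i q x + partial i p x * q x)"
    by (rule C1_I(2)[OF 1 2])
qed

lemma
  shows C1_const: "C1 (\<lambda>x::'n::finite pt. c)" and partial_const: "partial i (\<lambda>x::'n pt. c) = (\<lambda>x. 0)"
proof -
  have 1: "((\<lambda>x::'n pt. c) has_derivative (\<lambda>h. \<Sum>i\<in>UNIV. h $ i * (\<lambda>_ _. 0) i x)) (at x)" for x by simp
  show "C1 (\<lambda>x::'n pt. c)" by (rule C1_I(1)[OF 1]) simp
  show "partial i (\<lambda>x::'n pt. c) = (\<lambda>x. 0)" using C1_I(2)[OF 1] by simp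
qed

lemma partial_cmult: "C1 p \<Longrightarrow> partial i (\<lambda>x. c * p x) = (\<lambda>x. c * partial i p x)"
  using partial_mult[OF C1_const[of c], of p i] by (simp add: partial_const)

lemma C1_cmult: "C1 p \<Longrightarrow> C1 (\<lambda>x. c * p x)"
  using C1_mult[OF C1_const] by blast

lemma partial_diff: "C1 p \<Longrightarrow> C1 q \<Longrightarrow> partial i (\<lambda>x. p x - q x) = (\<lambda>x. partial i p x - partial i q x)"
  using partial_add[OF _ C1_cmult, of p q i "-1"] partial_cmult[of q i "-1"] by simp

lemma C1_sum: "(\<And>j. j \<in> J \<Longrightarrow> C1 (p j)) \<Longrightarrow> C1 (\<lambda>x. \<Sum>j\<in>J. p j x)"
  by (induction J rule: infinite_finite_induct) (auto intro: C1_const C1_add)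

lemma partial_sum:
  assumes "\<And>j. j \<in> J \<Longrightarrow> C1 (p j)"
  shows "partial i (\<lambda>x. \<Sum>j\<in>J. p j x) = (\<lambda>x. \<Sum>j\<in>J. partial i (p j) x)"
  using assms
proof (induction J rule: infinite_finite_induct)
  case (insert a J)
  then show ?case
    using partial_add[of "p a" "\<lambda>x. \<Sum>j\<in>J. p j x" i] by (simp add: C1_sum)
qed (simp_all add: partial_const)

lemma
  assumes "\<And>t. (f has_real_derivative f' t) (at t)" "continuous_on UNIV f'"
  shows C1_compose_affine: "C1 (\<lambda>x::'n::finite pt. f (g \<bullet> x + c))"
    and partial_compose_affine: "partial i (\<lambda>x::'n pt. f (g \<bullet> x + c)) = (\<lambda>x. g $ i * f' (g \<bullet> x + c))"
proof -
  have 1: "((\<lambda>x. f (g \<bullet> x + c)) has_derivative (\<lambda>h. \<Sum>i\<in>UNIV. h $ i * (g $ i * f' (g \<bullet> x + c)))) (at x)" for x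
  proof -
    have "((\<lambda>x. f (g \<bullet> x + c)) has_derivative (\<lambda>h. f' (g \<bullet> x + c) * (g \<bullet> h))) (at x)"
    proof (rule has_derivative_compose[OF _ assms(1)[unfolded has_field_derivative_def]])
      show "((\<lambda>x. g \<bullet> x + c) has_derivative (\<lambda>h. g \<bullet> h)) (at x)"
        by (auto intro!: derivative_eq_intros)
    qed
    then show ?thesis
      by (rule has_derivative_eq_rhs)
        (simp add: inner_vec_def sum_distrib_left sum_distrib_right mult_ac)
  qed
  have 2: "continuous_on UNIV (\<lambda>x. g $ i * f' (g \<bullet> x + c))" for i
    by (intro continuous_intros continuous_on_compose2[OF assms(2)]) auto
  show "C1 (\<lambda>x::'n::finite pt. f (g \<bullet> x + c))" by (rule C1_I(1)[OF 1 2])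
  show "partial i (\<lambda>x::'n pt. f (g \<bullet> x + c)) = (\<lambda>x. g $ i * f' (g \<bullet> x + c))" by (rule C1_I(2)[OF 1 2])
qed

lemma C1_affine: "C1 (\<lambda>x. g \<bullet> x + c)"
  by (rule C1_poly_fun[OF poly_fun_affine])

lemma partial_affine: "partial i (\<lambda>x::'n::finite pt. g \<bullet> x + c) = (\<lambda>x. g $ i)"
  using partial_compose_affine[of "\<lambda>t. t" "\<lambda>_. 1" i g c] by (auto intro!: derivative_eq_intros)

lemma C1_prod: "finite J \<Longrightarrow> (\<And>j. j \<in> J \<Longrightarrow> C1 (p j)) \<Longrightarrow> C1 (\<lambda>x. \<Prod>j\<in>J. p j x)"
  by (induction J rule: finite_induct) (auto intro: C1_const C1_mult)

lemma partial_prod: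
  assumes "finite J" "\<And>j. j \<in> J \<Longrightarrow> C1 (p j)"
  shows "partial i (\<lambda>x. \<Prod>j\<in>J. p j x) = (\<lambda>x. \<Sum>j\<in>J. partial i (p j) x * (\<Prod>k\<in>J-{j}. p k x))"
proof -
  show "partial i (\<lambda>x. \<Prod>j\<in>J. p j x) = (\<lambda>x. \<Sum>j\<in>J. partial i (p j) x * (\<Prod>k\<in>J-{j}. p k x))"
    using assms
  proof (induction J)
    case (insert a J)
    have C: "C1 (\<lambda>x. \<Prod>j\<in>J. p j x)" using insert.hyps(1) insert.prems by (auto intro: C1_prod)
    have "(\<Prod>k\<in>insert a J - {j}. p k x) = p a x * (\<Prod>k\<in>J-{j}. p k x)" if "j \<in> J" for j x
    proof -
      have "insert a J - {j} = insert a (J - {j})" using that insert.hyps by auto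
      then show ?thesis using insert.hyps by simp
    qed
    moreover have "insert a J - {a} = J" using insert.hyps by auto
    ultimately show ?case
      using insert partial_mult[of "p a" "\<lambda>x. \<Prod>j\<in>J. p j x" i] C
      by (auto simp: sum_distrib_left mult_ac fun_eq_iff intro!: sum.cong)
  qed (simp add: partial_const)
qed

section \<open>Integrals of derivatives of functions with bounded support\<close>

lemma integral_translate_diff:
  fixes h :: "'a::euclidean_space \<Rightarrow> real"
  assumes "integrable lborel h"
  shows "integrable lborel (\<lambda>x. h (x + e) - h x)" "(LINT x|lborel. h (x + e) - h x) = 0"
proof -
  have *: "integrable lborel (\<lambda>x. h (x + e))"
    using assms integrable_distr_eq[of "(+) e" lborel borel h]
    by (simp add: lborel_distr_plus add.commute borel_measurable_integrable)
  show "integrable lborel (\<lambda>x. h (x + e) - h x)" using * assms by simp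
  have "(LINT x|lborel. h (x + e)) = (LINT x|lborel. h x)"
    using assms integral_distr[of "(+) e" lborel borel h]
    by (simp add: lborel_distr_plus add.commute borel_measurable_integrable)
  then show "(LINT x|lborel. h (x + e) - h x) = 0" using * assms by simp
qed

text \<open>Translation invariance makes every difference quotient integrate to 0. The Lipschitz
  bound and the bounded support dominate the quotients, so their limit integrates to 0 as
  well.\<close>

lemma integral_directional_derivative:
  fixes h h' :: "'a::euclidean_space \<Rightarrow> real"
  assumes int: "integrable lborel h"
    and lip: "\<And>x t. \<bar>h (x + t *\<^sub>R e) - h x\<bar> \<le> L * \<bar>t\<bar>"
    and supp: "\<And>x. R < norm x \<Longrightarrow> h x = 0"
    and meas: "h' \<in> borel_measurable borel"
    and der: "AE x in lborel. ((\<lambda>t. h (x + t *\<^sub>R e)) has_real_derivative h' x) (at 0)"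
  shows "integrable lborel h'" "(LINT x|lborel. h' x) = 0"
proof -
  define t where "t m = inverse (real (Suc m))" for m
  define u where "u m x = (h (x + t m *\<^sub>R e) - h x) / t m" for m x
  have t: "0 < t m" "t m \<le> 1" for m by (auto simp: t_def field_simps)
  have t0: "t \<longlonglongrightarrow> 0" unfolding t_def by (rule LIMSEQ_inverse_real_of_nat)
  have u_int: "integrable lborel (u m)" "(LINT x|lborel. u m x) = 0" for m
    using integral_translate_diff[OF int, of "t m *\<^sub>R e"] unfolding u_def by auto
  \<comment> \<open>The increments \<open>t m\<close> are at most 1, so a point moves by at most
    \<open>norm e\<close>, and all quotients vanish outside the enlarged ball.\<close>
  define w where "w x = indicator (cball 0 (R + norm e)) x * \<bar>L\<bar>" for x :: 'a
  have w: "integrable lborel w" unfolding w_def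
    using borel_integrable_compact[of "cball 0 (R + norm e)" "\<lambda>_. \<bar>L\<bar>"] by simp
  have bound: "norm (u m x) \<le> w x" for m x
  proof (cases "x \<in> cball 0 (R + norm e)")
    case True
    have "\<bar>h (x + t m *\<^sub>R e) - h x\<bar> / t m \<le> L"
      using lip[of x "t m"] t[of m] by (simp add: divide_simps)
    then show ?thesis using True t[of m] by (simp add: w_def u_def)
  next
    case False
    then have n: "R + norm e < norm x" by simp
    have "norm (t m *\<^sub>R e) \<le> norm e" using t[of m] by (simp add: mult_left_le_one_le)
    then have "R < norm (x + t m *\<^sub>R e)" using n norm_diff_ineq[of x "t m *\<^sub>R e"] by linarith
    moreover have "R < norm x" using n norm_ge_zero[of e] by linarith
    ultimately show ?thesis using supp False by (simp add: w_def u_def)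
  qed
  have lim: "AE x in lborel. (\<lambda>m. u m x) \<longlonglongrightarrow> h' x"
    using der
  proof eventually_elim
    case (elim x)
    then have "((\<lambda>s. (h (x + s *\<^sub>R e) - h x) / s) \<longlongrightarrow> h' x) (at 0)"
      by (simp add: DERIV_def)
    moreover have "filterlim t (at 0) sequentially"
      using t0 t(1) by (auto simp: filterlim_at intro!: always_eventually) (metis less_irrefl)
    ultimately show ?case unfolding u_def by (rule filterlim_compose)
  qed
  note dc = integral_dominated_convergence[of h' lborel u w] integrable_dominated_convergence[of h' lborel u w]
  have m: "h' \<in> borel_measurable lborel" "\<And>m. u m \<in> borel_measurable lborel"
    using meas u_int(1) by auto
  show "integrable lborel h'" using dc(2)[OF m w lim] bound by auto
  have "(\<lambda>m. LINT x|lborel. u m x) \<longlonglongrightarrow> (LINT x|lborel. h' x)" using dc(1)[OF m w lim] bound by auto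
  then show "(LINT x|lborel. h' x) = 0" using u_int(2) LIMSEQ_unique[OF tendsto_const] by fastforce
qed

lemma C1_line_derivative:
  assumes "C1 p"
  shows "((\<lambda>t. p (x + t *\<^sub>R e)) has_real_derivative (\<Sum>i\<in>UNIV. e $ i * partial i p (x + t *\<^sub>R e))) (at t)"
proof -
  have "((\<lambda>t. p (x + t *\<^sub>R e)) has_derivative (\<lambda>h. \<Sum>i\<in>UNIV. (h *\<^sub>R e) $ i * partial i p (x + t *\<^sub>R e))) (at t)"
    by (rule has_derivative_compose[OF _ C1_has_derivative[OF assms]]) (auto intro!: derivative_eq_intros)
  then show ?thesis
    unfolding has_field_derivative_def by (rule has_derivative_eq_rhs) (auto simp: sum_distrib_left mult_ac)
qed

lemma integrable_compact_support:
  fixes p :: "'a::euclidean_space \<Rightarrow> real"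
  assumes "continuous_on UNIV p" "\<And>x. R < norm x \<Longrightarrow> p x = 0"
  shows "integrable lborel p"
proof -
  have "integrable lborel (\<lambda>x. indicator (cball 0 R) x *\<^sub>R p x)"
    by (rule borel_integrable_compact) (auto intro: continuous_on_subset[OF assms(1)])
  moreover have "(\<lambda>x. indicator (cball 0 R) x *\<^sub>R p x) = p"
    using assms(2) by (auto simp: indicator_def fun_eq_iff)
  ultimately show ?thesis by simp
qed

lemma integral_partial_zero:
  assumes C: "C1 p" and supp: "\<And>x. R < norm x \<Longrightarrow> p x = 0"
  shows "integrable lborel (partial i p)" "(LINT x|lborel. partial i p x) = 0"
proof -
  have dline: "((\<lambda>t. p (x + t *\<^sub>R axis i 1)) has_real_derivative partial i p (x + t *\<^sub>R axis i 1)) (at t)" for x t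
    using C1_line_derivative[OF C, of x "axis i 1" t] by (simp add: sum_axis)
  have supp': "partial i p x = 0" if "R < norm x" for x
  proof (rule DERIV_unique)
    show "((\<lambda>t. p (x + t *\<^sub>R axis i 1)) has_real_derivative partial i p x) (at 0)"
      using dline[of x 0] by simp
    have "open ((\<lambda>t. x + t *\<^sub>R axis i 1) -` {y. R < norm y})"
      by (intro open_vimage open_Collect_less continuous_intros)
    then have "\<forall>\<^sub>F t in nhds 0. t \<in> (\<lambda>t. x + t *\<^sub>R axis i 1) -` {y. R < norm y}"
      using that by (intro eventually_nhds_in_open) auto
    then have "\<forall>\<^sub>F t in nhds 0. p (x + t *\<^sub>R axis i 1) = 0"
      by eventually_elim (use supp in auto)
    then show "((\<lambda>t. p (x + t *\<^sub>R axis i 1)) has_real_derivative 0) (at 0)"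
      by (subst DERIV_cong_ev[OF refl _ refl, of _ "\<lambda>_. 0"]) auto
  qed
  have "bounded (partial i p ` cball 0 R)"
    by (intro compact_imp_bounded compact_continuous_image compact_cball
        continuous_on_subset[OF C1_partial_continuous[OF C]]) auto
  then obtain L where "\<forall>x\<in>cball 0 R. \<bar>partial i p x\<bar> \<le> L" unfolding bounded_iff by auto
  then have L: "\<bar>partial i p x\<bar> \<le> max L 0" for x
    using supp'[of x] by (cases "R < norm x") (auto simp: le_max_iff_disj)
  have lip: "\<bar>p (x + t *\<^sub>R axis i 1) - p x\<bar> \<le> max L 0 * \<bar>t\<bar>" for x t
    using field_differentiable_bound[of UNIV "\<lambda>t. p (x + t *\<^sub>R axis i 1)" "\<lambda>t. partial i p (x + t *\<^sub>R axis i 1)" "max L 0" t 0]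
      dline L by auto
  have der: "AE x in lborel. ((\<lambda>t. p (x + t *\<^sub>R axis i 1)) has_real_derivative partial i p x) (at 0)"
    using dline[of _ 0] by simp
  have m: "partial i p \<in> borel_measurable borel"
    by (intro borel_measurable_continuous_onI C1_partial_continuous C)
  note * = integral_directional_derivative[OF integrable_compact_support[OF C1_continuous[OF C] supp] lip supp m der]
  show "integrable lborel (partial i p)" "(LINT x|lborel. partial i p x) = 0"
    using * by blast+
qed


section \<open>Barycentric coordinates\<close>

definition simplex_verts :: "'n::finite pt set \<Rightarrow> bool" where
  "simplex_verts C \<longleftrightarrow> \<not> affine_dependent C \<and> card C = CARD('n) + 1"

text \<open>The condition makes the affine function \<open>bary C v\<close> equal 1 at
  \<open>v\<close> and 0 at the other points. For the vertices of an n-simplex it has exactly one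
  solution, the gradient of the barycentric coordinate.\<close>

definition bgrad :: "'n::finite pt set \<Rightarrow> 'n pt \<Rightarrow> 'n pt" where
  "bgrad C v = (SOME g. \<forall>w\<in>C - {v}. g \<bullet> (v - w) = 1)"

definition bary :: "'n::finite pt set \<Rightarrow> 'n pt \<Rightarrow> 'n pt \<Rightarrow> real" where
  "bary C v x = bgrad C v \<bullet> x + (1 - bgrad C v \<bullet> v)"

lemma simplex_verts_finite: "simplex_verts C \<Longrightarrow> finite C"
  by (metis card.infinite add_is_0 one_neq_zero simplex_verts_def)

text \<open>Affine independence keeps \<open>v\<close> out of the affine hull of the other points.
  Hence \<open>v - w0\<close> has a nonzero component \<open>z\<close> orthogonal to the directions
  of that hull, and \<open>z\<close> divided by its squared length has the required
  products.\<close>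

lemma bgrad_exists:
  fixes C :: "'n::finite pt set"
  assumes "\<not> affine_dependent C" "v \<in> C"
  shows "\<exists>g. \<forall>w\<in>C - {v}. g \<bullet> (v - w) = 1"
proof (cases "C - {v} = {}")
  case False
  then obtain w0 where w0: "w0 \<in> C - {v}" by blast
  define U where "U = (\<lambda>x. - w0 + x) ` (C - {v} - {w0})"
  have "v \<notin> affine hull (C - {v})" using assms unfolding affine_dependent_def by blast
  then have "v \<noteq> w0 + u" if "u \<in> span U" for u
    using affine_hull_span2[OF w0] that unfolding U_def by blast
  from this[of "v - w0"] have nU: "v - w0 \<notin> span U" by auto
  then obtain y z where yz: "y \<in> span U" "\<And>w. w \<in> span U \<Longrightarrow> orthogonal z w" "v - w0 = y + z"
    using orthogonal_subspace_decomp_exists[of U "v - w0"] by blast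
  then have z: "z \<noteq> 0" using nU by auto
  have "z \<bullet> (v - w) = z \<bullet> z" if w: "w \<in> C - {v}" for w
  proof -
    have "w - w0 \<in> span U"
    proof (cases "w = w0")
      case False
      then have "- w0 + w \<in> U" using w unfolding U_def by blast
      then show ?thesis using span_base by fastforce
    qed (simp add: span_zero)
    then have "z \<bullet> (w - w0) = 0" using yz(2) by (simp add: orthogonal_def)
    moreover have "z \<bullet> (v - w0) = z \<bullet> z"
      using yz(2)[OF yz(1)] by (simp add: yz(3) orthogonal_def inner_right_distrib)
    ultimately show ?thesis by (simp add: inner_diff_right)
  qed
  then have "\<forall>w\<in>C - {v}. (z /\<^sub>R (z \<bullet> z)) \<bullet> (v - w) = 1" using z by simp
  then show ?thesis by blast
qed auto

lemma bary_vertex: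
  assumes "\<not> affine_dependent C" "v \<in> C" "w \<in> C"
  shows "bary C v w = (if w = v then 1 else 0)"
proof -
  have "\<forall>w\<in>C - {v}. bgrad C v \<bullet> (v - w) = 1"
    unfolding bgrad_def by (rule someI_ex[OF bgrad_exists[OF assms(1,2)]])
  then have "w \<noteq> v \<Longrightarrow> bgrad C v \<bullet> (v - w) = 1" using assms(3) by blast
  then show ?thesis by (auto simp: bary_def inner_diff_right)
qed

lemma bary_poly: "bary C v \<in> poly_fun 1"
  unfolding bary_def[abs_def] by (rule poly_fun_affine)

lemma bary_C1: "C1 (bary C v)"
  by (rule C1_poly_fun[OF bary_poly])

lemma bary_continuous [continuous_intros]: "continuous_on S f \<Longrightarrow> continuous_on S (\<lambda>x. bary C v (f x))"
  unfolding bary_def by (intro continuous_intros)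

lemma partial_bary: "partial i (bary C v) = (\<lambda>x. bgrad C v $ i)"
  unfolding bary_def[abs_def] by (rule partial_affine)

lemma bary_add_scale: "bary C v (x + t *\<^sub>R e) = bary C v x + t * (bgrad C v \<bullet> e)"
  by (simp add: bary_def inner_right_distrib)

lemma bary_diff: "bary C v x - bary C v y = bgrad C v \<bullet> (x - y)"
  by (simp add: bary_def inner_diff_right)

lemma bary_combination:
  assumes "sum u A = 1" shows "bary C v (\<Sum>w\<in>A. u w *\<^sub>R w) = (\<Sum>w\<in>A. u w * bary C v w)"
proof -
  have "(\<Sum>w\<in>A. u w * bary C v w) = bgrad C v \<bullet> (\<Sum>w\<in>A. u w *\<^sub>R w) + sum u A * (1 - bgrad C v \<bullet> v)"
    by (simp add: bary_def distrib_left sum.distrib inner_sum_right flip: sum_distrib_right)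
  then show ?thesis using assms by (simp add: bary_def)
qed

lemma affine_hull_simplex_verts:
  assumes "simplex_verts (C :: 'n::finite pt set)" shows "affine hull C = UNIV"
proof -
  have "aff_dim C = DIM('n pt)"
    using assms aff_dim_affine_independent[of C] by (simp add: simplex_verts_def)
  then show ?thesis using aff_dim_eq_full[of C] by simp
qed

lemma
  assumes C: "simplex_verts C"
  shows sum_bary: "(\<Sum>v\<in>C. bary C v x) = 1"
    and bary_decomp: "(\<Sum>v\<in>C. bary C v x *\<^sub>R v) = x"
proof -
  have fin: "finite C" and ind: "\<not> affine_dependent C" using C simplex_verts_finite by (auto simp: simplex_verts_def)
  have "x \<in> affine hull C" using affine_hull_simplex_verts[OF C] by simp
  then obtain u where u: "sum u C = 1" "(\<Sum>v\<in>C. u v *\<^sub>R v) = x"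
    using affine_hull_finite[OF fin] by auto
  have b: "bary C v x = u v" if v: "v \<in> C" for v
  proof -
    have "bary C v x = (\<Sum>w\<in>C. u w * bary C v w)" using bary_combination[OF u(1)] u(2) by simp
    also have "\<dots> = (\<Sum>w\<in>C. if w = v then u v else 0)"
      by (rule sum.cong) (auto simp: bary_vertex[OF ind v])
    finally show ?thesis using fin v by simp
  qed
  then show "(\<Sum>v\<in>C. bary C v x) = 1" "(\<Sum>v\<in>C. bary C v x *\<^sub>R v) = x" using u by simp_all
qed

text \<open>Affine coordinates with respect to independent points are unique, so membership in a
  face is a matter of signs and zeros. All later arguments see faces only in this form.\<close>

lemma convex_hull_bary:
  assumes C: "simplex_verts C" and K: "K \<subseteq> C"
  shows "x \<in> convex hull K \<longleftrightarrow> (\<forall>v\<in>C. 0 \<le> bary C v x) \<and> (\<forall>v\<in>C - K. bary C v x = 0)"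
proof -
  have fin: "finite C" and ind: "\<not> affine_dependent C" using C simplex_verts_finite by (auto simp: simplex_verts_def)
  have finK: "finite K" using K fin finite_subset by blast
  show ?thesis
  proof
    assume "x \<in> convex hull K"
    then obtain u where u: "\<forall>v\<in>K. 0 \<le> u v" "sum u K = 1" "(\<Sum>v\<in>K. u v *\<^sub>R v) = x"
      using convex_hull_finite[OF finK] by auto
    have "bary C v x = (if v \<in> K then u v else 0)" if v: "v \<in> C" for v
    proof -
      have "bary C v x = (\<Sum>w\<in>K. u w * bary C v w)" using bary_combination[OF u(2)] u(3) by simp
      also have "\<dots> = (\<Sum>w\<in>K. if w = v then u v else 0)"
        using K by (intro sum.cong) (auto simp: bary_vertex[OF ind v])
      finally show ?thesis using finK by simp
    qed
    then show "(\<forall>v\<in>C. 0 \<le> bary C v x) \<and> (\<forall>v\<in>C - K. bary C v x = 0)" using u(1) by auto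
  next
    assume *: "(\<forall>v\<in>C. 0 \<le> bary C v x) \<and> (\<forall>v\<in>C - K. bary C v x = 0)"
    have "(\<Sum>v\<in>K. bary C v x) = (\<Sum>v\<in>C. bary C v x)"
      using * K fin by (intro sum.mono_neutral_left) auto
    moreover have "(\<Sum>v\<in>K. bary C v x *\<^sub>R v) = (\<Sum>v\<in>C. bary C v x *\<^sub>R v)"
      using * K fin by (intro sum.mono_neutral_left) auto
    ultimately show "x \<in> convex hull K"
      using * K sum_bary[OF C] bary_decomp[OF C] unfolding convex_hull_finite[OF finK]
      by (intro CollectI exI[of _ "\<lambda>v. bary C v x"]) auto
  qed
qed

lemma interior_simplex_bary:
  assumes C: "simplex_verts C"
  shows "interior (convex hull C) = {x. \<forall>v\<in>C. 0 < bary C v x}"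
proof
  have fin: "finite C" and ind: "\<not> affine_dependent C" using C simplex_verts_finite by (auto simp: simplex_verts_def)
  have "open (\<Inter>v\<in>C. {x. 0 < bary C v x})"
    using fin by (intro open_INT ballI open_Collect_less continuous_intros) auto
  moreover have "{x. \<forall>v\<in>C. 0 < bary C v x} = (\<Inter>v\<in>C. {x. 0 < bary C v x})" by auto
  ultimately have "open {x. \<forall>v\<in>C. 0 < bary C v x}" by simp
  moreover have "{x. \<forall>v\<in>C. 0 < bary C v x} \<subseteq> convex hull C"
    using convex_hull_bary[OF C order_refl] by (auto intro: less_imp_le)
  ultimately show "{x. \<forall>v\<in>C. 0 < bary C v x} \<subseteq> interior (convex hull C)" by (rule interior_maximal[rotated])
  show "interior (convex hull C) \<subseteq> {x. \<forall>v\<in>C. 0 < bary C v x}"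
  proof
    fix x assume "x \<in> interior (convex hull C)"
    then obtain e where e: "e > 0" "ball x e \<subseteq> convex hull C" using mem_interior by blast
    have "0 < bary C v x" if v: "v \<in> C" for v
    proof -
      have g: "bgrad C v \<noteq> 0"
      proof
        assume "bgrad C v = 0"
        then have "bary C v y = 1" for y by (simp add: bary_def)
        moreover obtain w where "w \<in> C" "w \<noteq> v"
        proof -
          have "card C > 1" using C by (simp add: simplex_verts_def)
          then have "C \<noteq> {v}" by auto
          then show ?thesis using v that by blast
        qed
        ultimately show False using bary_vertex[OF ind v, of w] by simp
      qed
      \<comment> \<open>A step against the gradient of half the radius stays in the ball, hence in
        the simplex, and lowers the coordinate by a positive amount; so the coordinate was positive
        before.\<close>
      define t where "t = e / (2 * norm (bgrad C v))"
      have t: "t > 0" using e g by (simp add: t_def)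
      have "x + (-t) *\<^sub>R bgrad C v \<in> ball x e"
        using e g by (simp add: dist_norm t_def)
      then have "0 \<le> bary C v (x + (-t) *\<^sub>R bgrad C v)"
        using e convex_hull_bary[OF C order_refl] v by blast
      then have "t * (bgrad C v \<bullet> bgrad C v) \<le> bary C v x" unfolding bary_add_scale by simp
      moreover have "0 < t * (bgrad C v \<bullet> bgrad C v)" using t g by simp
      ultimately show ?thesis by linarith
    qed
    then show "x \<in> {x. \<forall>v\<in>C. 0 < bary C v x}" by blast
  qed
qed

lemma bary_nonneg: "simplex_verts C \<Longrightarrow> x \<in> convex hull C \<Longrightarrow> v \<in> C \<Longrightarrow> 0 \<le> bary C v x"
  using convex_hull_bary[of C C x] by blast

lemma simplex_n_iff: "int CARD('n) simplex T \<longleftrightarrow> (\<exists>C. simplex_verts C \<and> T = convex hull (C :: 'n::finite pt set))"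
  by (auto simp: simplex_def simplex_verts_def)

text \<open>A mesh is a set of point sets without vertex lists, so the vertices are recovered from a
  simplex as its extreme points.\<close>

definition verts :: "'n::finite pt set \<Rightarrow> 'n pt set" where
  "verts T = {v. v extreme_point_of T}"

lemma verts_hull: "\<not> affine_dependent C \<Longrightarrow> verts (convex hull C) = C"
  by (simp add: verts_def extreme_point_of_convex_hull_affine_independent)

lemma simplex_verts_verts:
  fixes T :: "'n::finite pt set"
  assumes "int CARD('n) simplex T" shows "simplex_verts (verts T)" "convex hull (verts T) = T"
proof -
  obtain C where C: "simplex_verts C" "T = convex hull C" using assms unfolding simplex_n_iff by blast
  then have "verts T = C" using verts_hull[of C] by (simp add: simplex_verts_def)
  then show "simplex_verts (verts T)" "convex hull (verts T) = T" using C by auto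
qed

lemma simplex_boundary_null:
  fixes C :: "'n::finite pt set"
  assumes "simplex_verts C" shows "AE x in lborel. x \<in> convex hull C \<longrightarrow> x \<in> interior (convex hull C)"
proof -
  have "negligible (frontier (convex hull C))" by (intro negligible_convex_frontier convex_convex_hull)
  then have "frontier (convex hull C) \<in> null_sets lebesgue" by (simp add: negligible_iff_null_sets)
  moreover have "frontier (convex hull C) \<in> sets borel" by simp
  ultimately have "frontier (convex hull C) \<in> null_sets lborel"
    using null_sets_completion_iff[of "frontier (convex hull C)" lborel] by simp
  then have "AE x in lborel. x \<notin> frontier (convex hull C)" by (rule AE_not_in)
  then show ?thesis
  proof eventually_elim
    case (elim x)
    then show ?case using closure_subset[of "convex hull C"] unfolding frontier_def by blast
  qed
qed


section \<open>Alternating forms\<close>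

definition del :: "nat \<Rightarrow> 'a list \<Rightarrow> 'a list" where
  "del i vs = take i vs @ drop (Suc i) vs"

lemma length_del [simp]: "i < length vs \<Longrightarrow> length (del i vs) = length vs - 1"
  by (simp add: del_def)

lemma nth_del: "i < length vs \<Longrightarrow> j < length vs - 1 \<Longrightarrow> del i vs ! j = (if j < i then vs ! j else vs ! Suc j)"
  by (auto simp: del_def nth_append min_def)

lemma del_Suc_Cons [simp]: "del (Suc i) (v # vs) = v # del i vs"
  and del_0_Cons [simp]: "del 0 (v # vs) = vs"
  by (auto simp: del_def)

lemma map_del: "map f (del i vs) = del i (map f vs)"
  by (simp add: del_def take_map drop_map)

lemma AltI:
  assumes "\<And>vs. length vs \<noteq> j \<Longrightarrow> \<alpha> vs = 0"
    and "\<And>vs i. length vs = j \<Longrightarrow> i < j \<Longrightarrow> linear (\<lambda>v. \<alpha> (vs[i := v]))"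
    and "\<And>vs a b. length vs = j \<Longrightarrow> a < b \<Longrightarrow> b < j \<Longrightarrow> vs ! a = vs ! b \<Longrightarrow> \<alpha> vs = 0"
  shows "\<alpha> \<in> Alt j"
proof -
  have "\<alpha> vs = 0" if "length vs = j" "a < j" "b < j" "a \<noteq> b" "vs ! a = vs ! b" for vs a b
    using assms(3)[of vs a b] assms(3)[of vs b a] that by (cases "a < b") auto
  then show ?thesis unfolding Alt_def using assms(1,2) by blast
qed

lemma Alt_length: "\<alpha> \<in> Alt j \<Longrightarrow> length vs \<noteq> j \<Longrightarrow> \<alpha> vs = 0"
  and Alt_linear: "\<alpha> \<in> Alt j \<Longrightarrow> length vs = j \<Longrightarrow> i < j \<Longrightarrow> linear (\<lambda>v. \<alpha> (vs[i := v]))"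
  and Alt_eq: "\<alpha> \<in> Alt j \<Longrightarrow> length vs = j \<Longrightarrow> i < j \<Longrightarrow> i' < j \<Longrightarrow> i \<noteq> i' \<Longrightarrow> vs ! i = vs ! i' \<Longrightarrow> \<alpha> vs = 0"
  unfolding Alt_def by blast+

lemma Alt_not_distinct: "\<alpha> \<in> Alt j \<Longrightarrow> \<not> distinct vs \<Longrightarrow> \<alpha> vs = 0"
  unfolding distinct_conv_nth by (metis Alt_eq Alt_length)

lemma Alt_eq_lt: "length vs = j \<Longrightarrow> a < b \<Longrightarrow> b < j \<Longrightarrow> vs ! a = vs ! b \<Longrightarrow> \<alpha> \<in> Alt j \<Longrightarrow> \<alpha> vs = 0"
  using Alt_eq[of \<alpha> j vs a b] by simp

lemma Alt_zero: "(\<lambda>vs. 0) \<in> Alt j"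
  by (rule AltI) (auto intro: linear_zero)

lemma Alt_add: "\<alpha> \<in> Alt j \<Longrightarrow> \<beta> \<in> Alt j \<Longrightarrow> (\<lambda>vs. \<alpha> vs + \<beta> vs) \<in> Alt j"
  by (rule AltI) (auto intro!: linear_compose_add Alt_linear simp: Alt_length Alt_eq_lt)

lemma Alt_scale: "\<alpha> \<in> Alt j \<Longrightarrow> (\<lambda>vs. c * \<alpha> vs) \<in> Alt j"
proof (rule AltI)
  fix vs :: "'a pt list" and i assume "\<alpha> \<in> Alt j" "length vs = j" "i < j"
  then have "linear (\<lambda>v. c *\<^sub>R \<alpha> (vs[i := v]))" by (intro linear_compose_scale_right Alt_linear)
  then show "linear (\<lambda>v. c * \<alpha> (vs[i := v]))" by simp
qed (auto simp: Alt_length Alt_eq_lt)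

lemma Alt_diff: "\<alpha> \<in> Alt j \<Longrightarrow> \<beta> \<in> Alt j \<Longrightarrow> (\<lambda>vs. \<alpha> vs - \<beta> vs) \<in> Alt j"
  using Alt_add[OF _ Alt_scale, of \<alpha> j \<beta> "-1"] by simp

lemma Alt_sum: "(\<And>s. s \<in> S \<Longrightarrow> \<alpha> s \<in> Alt j) \<Longrightarrow> (\<lambda>vs. \<Sum>s\<in>S. \<alpha> s vs) \<in> Alt j"
  by (induction S rule: infinite_finite_induct) (auto intro: Alt_zero Alt_add)

text \<open>Polarisation: expand the form with the sum of the two vectors placed in both
  slots.\<close>

lemma Alt_swap:
  assumes \<alpha>: "\<alpha> \<in> Alt j" and len: "length vs = j" and i: "i < j" "i' < j" "i \<noteq> i'"
  shows "\<alpha> (vs[i := vs ! i', i' := vs ! i]) = - \<alpha> vs"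
proof -
  define f where "f a b = \<alpha> (vs[i := a, i' := b])" for a b
  have z: "f a a = 0" for a unfolding f_def using assms by (intro Alt_eq[OF \<alpha>, of _ i i']) auto
  have 1: "linear (\<lambda>b. f a b)" for a unfolding f_def using assms by (intro Alt_linear[OF \<alpha>]) auto
  have "linear (\<lambda>a. \<alpha> ((vs[i' := b])[i := a]))" for b using assms by (intro Alt_linear[OF \<alpha>]) auto
  then have 2: "linear (\<lambda>a. f a b)" for b unfolding f_def using i by (simp add: list_update_swap)
  have "f (vs ! i + vs ! i') (vs ! i + vs ! i')
      = f (vs ! i) (vs ! i) + f (vs ! i) (vs ! i') + f (vs ! i') (vs ! i) + f (vs ! i') (vs ! i')"
    by (simp add: linear_add[OF 1] linear_add[OF 2])
  then have "f (vs ! i') (vs ! i) = - f (vs ! i) (vs ! i')" by (simp add: z)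
  moreover have "vs[i := vs ! i, i' := vs ! i'] = vs" by simp
  ultimately show ?thesis by (simp add: f_def)
qed

lemma Alt_permute:
  assumes \<alpha>: "\<alpha> \<in> Alt j" and p: "p permutes {..<j}" and len: "length vs = j"
  shows "\<alpha> (permute_list p vs) = of_int (sign p) * \<alpha> vs"
proof -
  have "\<forall>vs. length vs = j \<longrightarrow> \<alpha> (permute_list p vs) = of_int (sign p) * \<alpha> vs"
    using p finite_lessThan
  proof (induction rule: permutes_induct)
    case id
    then show ?case by (simp add: sign_id)
  next
    case (swap a b p)
    show ?case
    proof (intro allI impI)
      fix vs :: "'a pt list" assume len: "length vs = j"
      have tr: "Transposition.transpose a b permutes {..<length vs}"
        using swap.hyps len by (intro permutes_swap_id) auto
      have "permute_list (Transposition.transpose a b) vs = vs[a := vs ! b, b := vs ! a]"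
        using swap.hyps len
        by (intro nth_equalityI) (auto simp: permute_list_def Transposition.transpose_def nth_list_update)
      then have "\<alpha> (permute_list (Transposition.transpose a b) vs) = of_int (sign (Transposition.transpose a b)) * \<alpha> vs"
        using Alt_swap[OF \<alpha> len, of a b] swap.hyps by (cases "a = b") (auto simp: sign_swap_id)
      moreover have "permute_list (Transposition.transpose a b \<circ> p) vs
          = permute_list p (permute_list (Transposition.transpose a b) vs)"
        using swap.hyps len by (intro permute_list_compose) auto
      moreover have "sign (Transposition.transpose a b \<circ> p) = sign (Transposition.transpose a b) * sign p"
        using swap.hyps by (intro sign_compose permutation_swap_id permutes_imp_permutation[OF finite_lessThan])
      ultimately show "\<alpha> (permute_list (Transposition.transpose a b \<circ> p) vs)
          = of_int (sign (Transposition.transpose a b \<circ> p)) * \<alpha> vs"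
        using swap.IH len by (simp add: mult.commute)
    qed
  qed
  then show ?thesis using len by blast
qed

abbreviation subfam :: "('n::{finite,linorder} \<Rightarrow> 'n pt) \<Rightarrow> 'n set \<Rightarrow> 'n pt list" where
  "subfam z \<sigma> \<equiv> map z (sorted_list_of_set \<sigma>)"

text \<open>Increasing tuples suffice: repeated vectors give 0, reordering costs a sign, and
  linearity then frees the slots one after another from the spanning family.\<close>

lemma Alt_determined:
  fixes z :: "'n::{finite,linorder} \<Rightarrow> 'n pt"
  assumes \<alpha>: "\<alpha> \<in> Alt k" and span: "span (range z) = UNIV"
    and zero: "\<And>\<sigma>. card \<sigma> = k \<Longrightarrow> \<alpha> (subfam z \<sigma>) = 0"
  shows "\<alpha> vs = 0"
proof -
  have 1: "\<alpha> (map z L) = 0" if "length L = k" for L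
  proof (cases "distinct L")
    case False
    then have "\<not> distinct (map z L)" by (simp add: distinct_map)
    then show ?thesis using Alt_not_distinct[OF \<alpha>] by blast
  next
    case True
    have "mset (sorted_list_of_set (set L)) = mset L"
      using True by (intro set_eq_iff_mset_eq_distinct[THEN iffD1]) auto
    then obtain p where p: "p permutes {..<length (sorted_list_of_set (set L))}"
      "permute_list p (sorted_list_of_set (set L)) = L"
      using mset_eq_permutation by metis
    have c: "card (set L) = k" using True that distinct_card by force
    have "map z L = permute_list p (subfam z (set L))"
      using p by (metis permute_list_map)
    then have "\<alpha> (map z L) = of_int (sign p) * \<alpha> (subfam z (set L))"
      using Alt_permute[OF \<alpha>, of p "subfam z (set L)"] p(1) c by simp
    then show ?thesis using zero[OF c] by simp
  qed
  \<comment> \<open>The first \<open>m\<close> slots may hold arbitrary vectors, the remaining ones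
    still hold members of the family.\<close>
  have 2: "\<forall>vs. length vs = k \<and> (\<forall>i. m \<le> i \<and> i < k \<longrightarrow> vs ! i \<in> range z) \<longrightarrow> \<alpha> vs = 0" if "m \<le> k" for m
    using that
  proof (induction m)
    case 0
    show ?case
    proof (intro allI impI, elim conjE)
      fix vs assume len: "length vs = k" and "\<forall>i. 0 \<le> i \<and> i < k \<longrightarrow> vs ! i \<in> range z"
      then have "set vs \<subseteq> range z" by (auto simp: in_set_conv_nth)
      then obtain L where "vs = map z L" by (metis ex_map_conv image_iff subset_eq)
      then show "\<alpha> vs = 0" using 1 len by auto
    qed
  next
    case (Suc m)
    show ?case
    proof (intro allI impI, elim conjE)
      fix vs assume len: "length vs = k" and r: "\<forall>i. Suc m \<le> i \<and> i < k \<longrightarrow> vs ! i \<in> range z"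
      have lin: "linear (\<lambda>v. \<alpha> (vs[m := v]))" using Alt_linear[OF \<alpha> len] Suc.prems by simp
      have "\<alpha> (vs[m := v]) = 0" if "v \<in> range z" for v
      proof -
        have "\<forall>i. m \<le> i \<and> i < k \<longrightarrow> vs[m := v] ! i \<in> range z"
          using r that len by (auto simp: nth_list_update)
        then show ?thesis using Suc len by simp
      qed
      then have "\<alpha> (vs[m := vs ! m]) = 0"
        using linear_eq_0_on_span[OF lin, of "range z" "vs ! m"] span by blast
      then show "\<alpha> vs = 0" by simp
    qed
  qed
  show ?thesis using 2[of k] Alt_length[OF \<alpha>] by (cases "length vs = k") auto
qed

lemma span_axis: "span (range (\<lambda>i. axis i (1::real) :: 'n::finite pt)) = UNIV"
proof -
  have "range (\<lambda>i. axis i (1::real) :: 'n pt) = Basis" by (auto simp: Basis_vec_def)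
  then show ?thesis by simp
qed

lemma Alt_eqI:
  fixes \<alpha> :: "'n::{finite,linorder} form"
  assumes "\<alpha> \<in> Alt k" "\<beta> \<in> Alt k" "span (range z) = UNIV"
    and "\<And>\<sigma>. card \<sigma> = k \<Longrightarrow> \<alpha> (subfam z \<sigma>) = \<beta> (subfam z \<sigma>)"
  shows "\<alpha> = \<beta>"
proof
  fix vs show "\<alpha> vs = \<beta> vs"
    using Alt_determined[OF Alt_diff[OF assms(1,2)] assms(3)] assms(4) by auto
qed

text \<open>The determinant of the inner products of \<open>ys\<close> with \<open>vs\<close>, that
  is, the wedge product of the 1-forms represented by \<open>ys\<close>. Written with vectors on
  both sides it is symmetric in its two lists.\<close>

definition gram :: "'n::finite pt list \<Rightarrow> 'n pt list \<Rightarrow> real" where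
  "gram ys vs = (if length vs = length ys then
     (\<Sum>p | p permutes {..<length ys}. of_int (sign p) * (\<Prod>a<length ys. (ys ! a) \<bullet> (vs ! p a))) else 0)"

lemma wedge_set_dy_of: "wedge_set (dy_of z) \<sigma> = gram (subfam z \<sigma>)"
  by (auto simp: wedge_set_def wedge_def gram_def dy_of_def fun_eq_iff)

lemma gram_sym: "gram ys vs = gram vs ys"
proof (cases "length vs = length ys")
  case True
  let ?S = "{..<length ys}"
  have "(\<Sum>p | p permutes ?S. of_int (sign p) * (\<Prod>a<length ys. (ys ! a) \<bullet> (vs ! p a)))
      = (\<Sum>p | p permutes ?S. of_int (sign (inv p)) * (\<Prod>a<length ys. (ys ! a) \<bullet> (vs ! inv p a)))"
    by (rule sum_permutations_inverse)
  also have "\<dots> = (\<Sum>p | p permutes ?S. of_int (sign p) * (\<Prod>a<length ys. (vs ! a) \<bullet> (ys ! p a)))"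
  proof (rule sum.cong[OF refl])
    fix p assume "p \<in> {p. p permutes ?S}"
    then have p: "p permutes ?S" by simp
    have "(\<Prod>a<length ys. (ys ! a) \<bullet> (vs ! inv p a)) = (\<Prod>a<length ys. (ys ! p a) \<bullet> (vs ! inv p (p a)))"
      using prod.permute[OF p, of "\<lambda>a. (ys ! a) \<bullet> (vs ! inv p a)"] by (simp add: o_def)
    also have "\<dots> = (\<Prod>a<length ys. (vs ! a) \<bullet> (ys ! p a))"
      using permutes_inverses[OF p] by (simp add: inner_commute)
    finally show "of_int (sign (inv p)) * (\<Prod>a<length ys. (ys ! a) \<bullet> (vs ! inv p a))
        = of_int (sign p) * (\<Prod>a<length ys. (vs ! a) \<bullet> (ys ! p a))"
      using sign_inverse[OF permutes_imp_permutation[OF _ p]] by simp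
  qed
  finally show ?thesis using True by (simp add: gram_def)
qed (auto simp: gram_def)

lemma gram_Alt: "gram ys \<in> Alt (length ys)"
proof (rule AltI)
  let ?S = "{..<length ys}"
  fix vs :: "'a pt list" and i assume len: "length vs = length ys" and i: "i < length ys"
  have "linear (\<lambda>v. of_int (sign p) * (\<Prod>a<length ys. (ys ! a) \<bullet> (vs[i := v] ! p a)))" if p: "p permutes ?S" for p
  proof -
    \<comment> \<open>Slot \<open>i\<close> enters the product for \<open>p\<close> only through the
      row that \<open>p\<close> sends to \<open>i\<close>.\<close>
    let ?b = "inv p i"
    have b: "?b < length ys" "p ?b = i" using p i permutes_in_image[OF permutes_inv[OF p], of i] permutes_inverses[OF p] by auto
    have ne: "p a \<noteq> i" if "a \<noteq> ?b" for a using that permutes_inverses[OF p] by metis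
    have "(\<Prod>a<length ys. (ys ! a) \<bullet> (vs[i := v] ! p a))
        = ((ys ! ?b) \<bullet> v) * (\<Prod>a\<in>{..<length ys} - {?b}. (ys ! a) \<bullet> (vs ! p a))" for v
    proof -
      have "(\<Prod>a<length ys. (ys ! a) \<bullet> (vs[i := v] ! p a))
        = ((ys ! ?b) \<bullet> (vs[i := v] ! p ?b)) * (\<Prod>a\<in>{..<length ys} - {?b}. (ys ! a) \<bullet> (vs[i := v] ! p a))"
        using b by (intro prod.remove) auto
      also have "(\<Prod>a\<in>{..<length ys} - {?b}. (ys ! a) \<bullet> (vs[i := v] ! p a))
        = (\<Prod>a\<in>{..<length ys} - {?b}. (ys ! a) \<bullet> (vs ! p a))"
        using ne by (intro prod.cong) (metis DiffD2 insertI1 nth_list_update_neq)+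
      finally show ?thesis using b len i by simp
    qed
    then show ?thesis
      by (auto intro!: linearI simp: inner_right_distrib algebra_simps)
  qed
  then have "linear (\<lambda>v. \<Sum>p | p permutes ?S. of_int (sign p) * (\<Prod>a<length ys. (ys ! a) \<bullet> (vs[i := v] ! p a)))"
    by (intro linear_compose_sum) auto
  then show "linear (\<lambda>v. gram ys (vs[i := v]))" using len by (simp add: gram_def)
next
  let ?S = "{..<length ys}"
  fix vs :: "'a pt list" and a b assume len: "length vs = length ys" and ab: "a < b" "b < length ys" "vs ! a = vs ! b"
  \<comment> \<open>Composing with the transposition of the two equal arguments keeps every product
    and reverses every sign, so the sum is its own negative.\<close>
  define t where "t = Transposition.transpose a b"
  have t: "t permutes ?S" unfolding t_def using ab by (intro permutes_swap_id) auto
  have vt: "vs ! t c = vs ! c" for c using ab by (auto simp: t_def Transposition.transpose_def)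
  have "(\<Sum>p | p permutes ?S. of_int (sign p) * (\<Prod>a<length ys. (ys ! a) \<bullet> (vs ! p a)))
      = (\<Sum>p | p permutes ?S. of_int (sign (t \<circ> p)) * (\<Prod>a<length ys. (ys ! a) \<bullet> (vs ! (t \<circ> p) a)))"
    by (rule setum_permutations_compose_left[OF t])
  also have "\<dots> = (\<Sum>p | p permutes ?S. - (of_int (sign p) * (\<Prod>a<length ys. (ys ! a) \<bullet> (vs ! p a))))"
  proof (rule sum.cong[OF refl])
    fix p assume "p \<in> {p. p permutes ?S}"
    then have "sign (t \<circ> p) = sign t * sign p"
      using t by (intro sign_compose) (auto intro: permutes_imp_permutation)
    then have "sign (t \<circ> p) = - sign p" using ab by (simp add: t_def sign_swap_id)
    then show "of_int (sign (t \<circ> p)) * (\<Prod>a<length ys. (ys ! a) \<bullet> (vs ! (t \<circ> p) a)) = - (of_int (sign p) * (\<Prod>a<length ys. (ys ! a) \<bullet> (vs ! p a)))"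
      by (simp add: vt)
  qed
  finally show "gram ys vs = 0" using len by (simp add: gram_def sum_negf)
qed (simp add: gram_def)

text \<open>A nonzero product in the determinant forces the two increasing lists to be
  rearrangements of each other. They are then equal, and the permutation is the identity.\<close>

lemma gram_dual:
  fixes z b :: "'n::{finite,linorder} \<Rightarrow> 'n pt"
  assumes dual: "\<And>i j. z i \<bullet> b j = (if i = j then 1 else 0)" and card: "card \<sigma> = card \<rho>"
  shows "gram (subfam z \<sigma>) (subfam b \<rho>) = (if \<sigma> = \<rho> then 1 else 0)"
proof -
  let ?s = "sorted_list_of_set \<sigma>" and ?r = "sorted_list_of_set \<rho>"
  let ?S = "{..<card \<sigma>}"
  have len: "length ?s = card \<sigma>" "length ?r = card \<sigma>" using card by auto
  have tm: "(\<Prod>a<card \<sigma>. (subfam z \<sigma> ! a) \<bullet> (subfam b \<rho> ! p a)) = (if \<sigma> = \<rho> \<and> p = id then 1 else 0)"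
    if p: "p permutes ?S" for p
  proof -
    have pa: "p a < card \<sigma>" if "a < card \<sigma>" for a using permutes_in_image[OF p, of a] that by auto
    have eq: "(subfam z \<sigma> ! a) \<bullet> (subfam b \<rho> ! p a) = (if ?s ! a = ?r ! p a then 1 else 0)" if "a < card \<sigma>" for a
      using that pa len by (simp add: dual)
    show ?thesis
    proof (cases "\<forall>a<card \<sigma>. ?s ! a = ?r ! p a")
      case True
      then have "?s = permute_list p ?r" using len pa by (intro nth_equalityI) (auto simp: permute_list_def)
      then have "set ?s = set ?r" using p len by (metis set_permute_list)
      then have sr: "\<sigma> = \<rho>" by simp
      have "p a = a" for a
      proof (cases "a < card \<sigma>")
        case a: True
        then have "?r ! a = ?r ! p a" using True sr by auto
        then show ?thesis using a pa[OF a] len sr by (simp add: nth_eq_iff_index_eq)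
      next
        case False
        then show ?thesis using p by (simp add: permutes_def)
      qed
      then have "p = id" by auto
      then show ?thesis using sr eq by simp
    next
      case False
      then obtain a where a: "a < card \<sigma>" "?s ! a \<noteq> ?r ! p a" by blast
      then have "(\<Prod>a<card \<sigma>. (subfam z \<sigma> ! a) \<bullet> (subfam b \<rho> ! p a)) = 0"
        using eq by (intro prod_zero) auto
      moreover have "\<not> (\<sigma> = \<rho> \<and> p = id)" using a by auto
      ultimately show ?thesis by (simp only: if_False)
    qed
  qed
  have "gram (subfam z \<sigma>) (subfam b \<rho>) = (\<Sum>p | p permutes ?S. of_int (sign p) * (if \<sigma> = \<rho> \<and> p = id then 1 else 0))"
    unfolding gram_def using len tm by (auto simp del: nth_map intro!: sum.cong)
  also have "\<dots> = (\<Sum>p | p permutes ?S. if p = id then (if \<sigma> = \<rho> then 1 else 0) else 0)"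
    by (intro sum.cong) (auto simp: sign_id)
  also have "\<dots> = (if \<sigma> = \<rho> then 1 else 0)"
    by (subst sum.delta) (auto simp: finite_permutations permutes_id)
  finally show ?thesis .
qed

lemma axis_dual: "axis i (1::real) \<bullet> axis j 1 = (if i = j then 1 else 0)"
  by (simp add: inner_axis_axis)

lemma std_vecs_subfam: "std_vecs \<sigma> = subfam (\<lambda>i. axis i 1) \<sigma>"
  by (simp add: std_vecs_def)

lemma Alt_expand:
  fixes \<alpha> :: "'n::{finite,linorder} form"
  assumes \<alpha>: "\<alpha> \<in> Alt k"
  shows "\<alpha> vs = (\<Sum>\<rho> | card \<rho> = k. \<alpha> (std_vecs \<rho>) * gram (std_vecs \<rho>) vs)"
proof -
  have "gram (std_vecs \<rho>) \<in> Alt k" if "card \<rho> = k" for \<rho> :: "'n set"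
    using gram_Alt[of "std_vecs \<rho>"] that by (simp add: std_vecs_def)
  then have "(\<lambda>vs. \<Sum>\<rho> | card \<rho> = k. \<alpha> (std_vecs \<rho>) * gram (std_vecs \<rho>) vs) \<in> Alt k"
    by (intro Alt_sum Alt_scale) auto
  then have "\<alpha> = (\<lambda>vs. \<Sum>\<rho> | card \<rho> = k. \<alpha> (std_vecs \<rho>) * gram (std_vecs \<rho>) vs)"
  proof (rule Alt_eqI[OF \<alpha> _ span_axis])
    fix \<sigma> :: "'n set" assume \<sigma>: "card \<sigma> = k"
    have "(\<Sum>\<rho> | card \<rho> = k. \<alpha> (std_vecs \<rho>) * gram (std_vecs \<rho>) (std_vecs \<sigma>))
        = (\<Sum>\<rho> | card \<rho> = k. if \<rho> = \<sigma> then \<alpha> (std_vecs \<sigma>) else 0)"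
      unfolding std_vecs_subfam by (rule sum.cong) (use \<sigma> in \<open>auto simp: gram_dual[OF axis_dual]\<close>)
    then show "\<alpha> (subfam (\<lambda>i. axis i 1) \<sigma>) = (\<Sum>\<rho> | card \<rho> = k. \<alpha> (std_vecs \<rho>) * gram (std_vecs \<rho>) (subfam (\<lambda>i. axis i 1) \<sigma>))"
      using \<sigma> by (simp add: std_vecs_subfam sum.delta)
  qed
  then show ?thesis by (rule fun_cong)
qed

text \<open>The reproducing property: pairing with a wedge of 1-forms is evaluation at the vectors
  that represent them. Moments against dual basis forms become values at the dual vectors.\<close>

lemma form_inner_gram:
  assumes "\<alpha> \<in> Alt k" "length ys = k"
  shows "form_inner k \<alpha> (gram ys) = \<alpha> ys"
  unfolding form_inner_def using Alt_expand[OF assms(1), of ys] by (simp add: gram_sym[of ys])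

section \<open>Interior product, wedge with a functional, volume form\<close>

definition ip :: "'n pt \<Rightarrow> 'n form \<Rightarrow> 'n form" where
  "ip e \<alpha> = (\<lambda>vs. \<alpha> (e # vs))"

lemma ip_Alt: assumes "\<alpha> \<in> Alt (Suc j)" shows "ip e \<alpha> \<in> Alt j"
proof (rule AltI)
  fix vs :: "'a pt list" and i assume "length vs = j" "i < j"
  then show "linear (\<lambda>v. ip e \<alpha> (vs[i := v]))"
    using Alt_linear[OF assms, of "e # vs" "Suc i"] by (simp add: ip_def)
next
  fix vs :: "'a pt list" and a b assume "length vs = j" "a < b" "b < j" "vs ! a = vs ! b"
  then show "ip e \<alpha> vs = 0"
    using Alt_eq[OF assms, of "e # vs" "Suc a" "Suc b"] by (simp add: ip_def)
qed (use Alt_length[OF assms] in \<open>auto simp: ip_def\<close>)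

lemma Alt_front:
  assumes \<alpha>: "\<alpha> \<in> Alt j"
  shows "length vs = j \<Longrightarrow> i < j \<Longrightarrow> \<alpha> (vs ! i # del i vs) = (-1) ^ i * \<alpha> vs"
proof (induction i arbitrary: vs)
  case 0
  then have "vs ! 0 # del 0 vs = vs" by (cases vs) auto
  then show ?case by simp
next
  case (Suc i)
  define vs' where "vs' = vs[i := vs ! Suc i, Suc i := vs ! i]"
  have len: "length vs' = j" using Suc.prems by (simp add: vs'_def)
  have "\<alpha> vs' = - \<alpha> vs" unfolding vs'_def using Suc.prems by (intro Alt_swap[OF \<alpha>]) auto
  moreover have "vs' ! i = vs ! Suc i" using Suc.prems by (simp add: vs'_def)
  moreover have "del i vs' = del (Suc i) vs"
    using Suc.prems len
    by (intro nth_equalityI) (auto simp: nth_del vs'_def nth_list_update less_Suc_eq)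
  ultimately show ?case using Suc.IH[OF len] Suc.prems by simp
qed

text \<open>The wedge product of the linear functional \<open>u\<close> with the
  \<open>j\<close>-form \<beta>, expanded along the argument that \<open>u\<close> takes.\<close>

definition uw :: "nat \<Rightarrow> ('n pt \<Rightarrow> real) \<Rightarrow> 'n form \<Rightarrow> 'n form" where
  "uw j u \<beta> = (\<lambda>vs. if length vs = Suc j then \<Sum>i<Suc j. (-1) ^ i * (u (vs ! i) * \<beta> (del i vs)) else 0)"

lemma uw_Alt:
  assumes u: "linear u" and \<beta>: "\<beta> \<in> Alt j"
  shows "uw j u \<beta> \<in> Alt (Suc j)"
proof (rule AltI)
  fix vs :: "'a pt list" and m assume len: "length vs = Suc j" and m: "m < Suc j"
  have "linear (\<lambda>v. (-1) ^ i * (u (vs[m := v] ! i) * \<beta> (del i (vs[m := v]))))" if i: "i < Suc j" for i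
  proof (cases "i = m")
    case True
    have "del i (vs[m := v]) = del i vs" for v
      using True len m by (intro nth_equalityI) (auto simp: nth_del)
    then show ?thesis using True len m u
      by (auto intro!: linearI simp: linear_add linear_scale algebra_simps)
  next
    case False
    define m' where "m' = (if m < i then m else m - 1)"
    have m': "m' < j" using False m i by (auto simp: m'_def)
    have "del i (vs[m := v]) = (del i vs)[m' := v]" for v
      using False len m i by (intro nth_equalityI) (auto simp: nth_del nth_list_update m'_def)
    moreover have l: "linear (\<lambda>v. \<beta> ((del i vs)[m' := v]))" using len i m' by (intro Alt_linear[OF \<beta>]) auto
    ultimately show ?thesis using False
      by (auto intro!: linearI simp: linear_add[OF l] linear_scale[OF l] algebra_simps)
  qed
  then have "linear (\<lambda>v. \<Sum>i<Suc j. (-1) ^ i * (u (vs[m := v] ! i) * \<beta> (del i (vs[m := v]))))"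
    by (intro linear_compose_sum) auto
  then show "linear (\<lambda>v. uw j u \<beta> (vs[m := v]))" using len by (simp add: uw_def)
next
  fix vs :: "'a pt list" and a b assume len: "length vs = Suc j" and ab: "a < b" "b < Suc j" "vs ! a = vs ! b"
  let ?F = "\<lambda>i. (-1) ^ i * (u (vs ! i) * \<beta> (del i vs))"
  have 0: "?F i = 0" if "i < Suc j" "i \<noteq> a" "i \<noteq> b" for i
  proof -
    define a' where "a' = (if a < i then a else a - 1)"
    define b' where "b' = (if b < i then b else b - 1)"
    have "\<beta> (del i vs) = 0"
      using that ab len by (intro Alt_eq[OF \<beta>, of _ a' b']) (auto simp: a'_def b'_def nth_del)
    then show ?thesis by simp
  qed
  \<comment> \<open>When neither of the equal arguments is deleted, \<beta> receives both and
    vanishes. The other two terms cancel: moving the remaining copy to the front compares the two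
    deletions, with a sign opposite to that of the expansion.\<close>
  have "(\<Sum>i<Suc j. ?F i) = (\<Sum>i\<in>{a, b}. ?F i)"
    using ab 0 by (intro sum.mono_neutral_right) auto
  also have "\<dots> = ?F a + ?F b" using ab by simp
  also have "\<dots> = 0"
  proof -
    obtain c where c: "b = Suc c" using ab by (cases b) auto
    have "\<beta> (del a vs ! c # del c (del a vs)) = (-1) ^ c * \<beta> (del a vs)"
      using ab len c by (intro Alt_front[OF \<beta>]) auto
    moreover have "\<beta> (del b vs ! a # del a (del b vs)) = (-1) ^ a * \<beta> (del b vs)"
      using ab len c by (intro Alt_front[OF \<beta>]) auto
    moreover have "del a vs ! c = del b vs ! a" using ab len c by (simp add: nth_del)
    moreover have "del c (del a vs) = del a (del b vs)"
      using ab len c by (intro nth_equalityI) (auto simp: nth_del)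
    ultimately have "(-1) ^ c * \<beta> (del a vs) = (-1) ^ a * \<beta> (del b vs)" by simp
    then have "(-1) ^ a * ((-1) ^ c * \<beta> (del a vs)) * (-1) ^ c = (-1) ^ a * ((-1) ^ a * \<beta> (del b vs)) * (-1) ^ c" by simp
    moreover have "(-1::real) ^ c * (-1) ^ c = 1" "(-1::real) ^ a * (-1) ^ a = 1"
      by (simp_all flip: power_mult_distrib)
    ultimately have "(-1) ^ a * \<beta> (del a vs) = (-1) ^ c * \<beta> (del b vs)" by (simp add: algebra_simps)
    then have "(-1) ^ a * (u (vs ! b) * \<beta> (del a vs)) = (-1) ^ c * (u (vs ! b) * \<beta> (del b vs))"
      by (simp add: mult.left_commute)
    then show ?thesis using ab c by simp
  qed
  finally show "uw j u \<beta> vs = 0" using len by (simp add: uw_def)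
qed (simp add: uw_def)

definition vol :: "'n::{finite,linorder} form" where
  "vol = gram (std_vecs UNIV)"

lemma std_vecs_length [simp]: "length (std_vecs \<sigma>) = card (\<sigma> :: 'n::{finite,linorder} set)"
  by (simp add: std_vecs_def)

lemma vol_Alt: "(vol :: 'n::{finite,linorder} form) \<in> Alt CARD('n)"
  using gram_Alt[of "std_vecs (UNIV :: 'n set)"] by (simp add: vol_def)

lemma vol_std: "vol (std_vecs UNIV) = 1"
  using gram_dual[OF axis_dual, of UNIV UNIV] by (simp add: vol_def std_vecs_subfam)

lemma card_eq_UNIV: "card (\<sigma> :: 'n::finite set) = CARD('n) \<longleftrightarrow> \<sigma> = UNIV"
  by (metis card_subset_eq finite_class.finite_UNIV subset_UNIV)

lemma Alt_top:
  fixes \<gamma> :: "'n::{finite,linorder} form"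
  assumes "\<gamma> \<in> Alt CARD('n)" shows "\<gamma> vs = \<gamma> (std_vecs UNIV) * vol vs"
proof -
  have "{\<rho> :: 'n set. card \<rho> = CARD('n)} = {UNIV}" using card_eq_UNIV by auto
  then show ?thesis using Alt_expand[OF assms, of vs] by (simp add: vol_def)
qed

lemma Alt_above:
  fixes \<gamma> :: "'n::{finite,linorder} form"
  assumes "\<gamma> \<in> Alt (Suc CARD('n))" shows "\<gamma> vs = 0"
proof (rule Alt_determined[OF assms span_axis])
  fix \<sigma> :: "'n set" assume "card \<sigma> = Suc CARD('n)"
  moreover have "card \<sigma> \<le> CARD('n)" by (rule card_mono) auto
  ultimately show "\<gamma> (subfam (\<lambda>i. axis i 1) \<sigma>) = 0" by simp
qed

lemma vol_subfam_nonzero: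
  fixes z :: "'n::{finite,linorder} \<Rightarrow> 'n pt"
  assumes "span (range z) = UNIV" shows "vol (subfam z UNIV) \<noteq> 0"
proof
  assume z: "vol (subfam z UNIV) = 0"
  have "vol (std_vecs (UNIV :: 'n set)) = 0"
  proof (rule Alt_determined[OF vol_Alt assms])
    fix \<sigma> :: "'n set" assume "card \<sigma> = CARD('n)"
    then have "\<sigma> = UNIV" by (rule card_eq_UNIV[THEN iffD1])
    then show "vol (subfam z \<sigma>) = 0" using z by simp
  qed
  then show False by (simp add: vol_std)
qed

text \<open>Cramer's rule: the form \<open>u \<and> vol\<close> of degree \<open>n + 1\<close> vanishes.\<close>

lemma cramer_vol:
  fixes vs :: "'n::{finite,linorder} pt list"
  assumes u: "linear u" and len: "length vs = CARD('n)"
  shows "(\<Sum>i<CARD('n). (-1) ^ i * (u (vs ! i) * vol (c # del i vs))) = u c * vol vs"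
proof -
  have "uw CARD('n) u vol (c # vs) = 0"
    by (rule Alt_above[OF uw_Alt[OF u vol_Alt]])
  then show ?thesis using len
    by (simp add: uw_def sum.lessThan_Suc_shift sum_negf del: sum.lessThan_Suc)
qed

text \<open>The test tensor of rank one. Seen through the vector of the second factor
  (\<open>proxy\<close>, below), it is the form \<open>ip e \<alpha>\<close> with the constant
  vector \<open>e\<close> attached.\<close>

definition zeta :: "'n::{finite,linorder} pt \<Rightarrow> 'n form \<Rightarrow> 'n tform" where
  "zeta e \<alpha> = tensor (ip e \<alpha>) (ip e vol)"

lemma tensor_AltT: "\<alpha> \<in> Alt k \<Longrightarrow> \<beta> \<in> Alt m \<Longrightarrow> tensor \<alpha> \<beta> \<in> AltT k m"
  using Alt_scale[of \<alpha> k "\<beta> vs" for vs] Alt_scale[of \<beta> m]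
  by (auto simp: AltT_def tensor_def mult.commute)

text \<open>Cramer's rule evaluates the constraint map at this tensor to
  \<open>\<alpha> (e # e # ws)\<close> times the volume form, and \<alpha> is alternating.\<close>

lemma zeta_XX:
  fixes \<alpha> :: "'n::{finite,linorder} form"
  assumes \<alpha>: "\<alpha> \<in> Alt (Suc k)" and k: "1 \<le> k"
  shows "zeta e \<alpha> \<in> XX k"
proof -
  have "(vol :: 'n form) \<in> Alt (Suc (CARD('n) - 1))" using vol_Alt[where 'n = 'n] by simp
  then have v: "ip e vol \<in> Alt (CARD('n) - 1)" by (rule ip_Alt)
  have A: "zeta e \<alpha> \<in> AltT k (CARD('n) - 1)"
    unfolding zeta_def by (intro tensor_AltT ip_Alt \<alpha> v)
  have "s_map (zeta e \<alpha>) ws vs = 0" for ws vs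
  proof (cases "length vs = CARD('n)")
    case True
    show ?thesis
    proof (cases "Suc (length ws) = k")
      case len: True
      have "linear (\<lambda>x. \<alpha> ((e # 0 # ws)[1 := x]))"
        using len by (intro Alt_linear[OF \<alpha>]) auto
      then have u: "linear (\<lambda>x. ip e \<alpha> (x # ws))" by (simp add: ip_def)
      have "s_map (zeta e \<alpha>) ws vs = (\<Sum>i<CARD('n). (-1) ^ i * (ip e \<alpha> (vs ! i # ws) * vol (e # del i vs)))"
        using True by (simp add: s_map_def zeta_def tensor_def del_def ip_def[of _ vol])
      also have "\<dots> = ip e \<alpha> (e # ws) * vol vs" by (rule cramer_vol[OF u True])
      also have "ip e \<alpha> (e # ws) = 0" unfolding ip_def using Alt_not_distinct[OF \<alpha>] by simp
      finally show ?thesis by simp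
    next
      case False
      then have "\<alpha> (e # x # ws) = 0" for x using Alt_length[OF \<alpha>] by simp
      then show ?thesis by (simp add: s_map_def zeta_def tensor_def ip_def)
    qed
  next
    case False
    have "ip e vol (take i vs @ drop (Suc i) vs) = 0" if "i < length vs" for i
    proof (rule Alt_length[OF v])
      have "0 < CARD('n)" by simp
      with False that show "length (take i vs @ drop (Suc i) vs) \<noteq> CARD('n) - 1" by (simp del: zero_less_card_finite)
    qed
    then show ?thesis by (simp add: s_map_def zeta_def tensor_def)
  qed
  then show ?thesis using A by (auto simp: XX_def fun_eq_iff)
qed

section \<open>Positions in the ordered index type\<close>

lemma sorted_UNIV_pos: "(sorted_list_of_set UNIV :: 'n::{finite,linorder} list) ! pos i = i"
  and pos_less: "pos (i :: 'n) < CARD('n)"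
proof -
  let ?L = "sorted_list_of_set UNIV :: 'n list"
  have "i \<in> set ?L" by simp
  then obtain m where m: "m < length ?L" "?L ! m = i" unfolding in_set_conv_nth by blast
  have "{j. j < i} = (\<lambda>a. ?L ! a) ` {..<m}"
  proof (intro equalityI subsetI)
    fix j assume j: "j \<in> {j. j < i}"
    have "j \<in> set ?L" by simp
    then obtain a where a: "a < length ?L" "?L ! a = j" unfolding in_set_conv_nth by blast
    have "a < m"
    proof (rule ccontr)
      assume "\<not> a < m"
      then have "?L ! m \<le> ?L ! a" using a by (intro sorted_nth_mono) auto
      then show False using j a m by simp
    qed
    then show "j \<in> (\<lambda>a. ?L ! a) ` {..<m}" using a by auto
  next
    fix j assume "j \<in> (\<lambda>a. ?L ! a) ` {..<m}"
    then obtain a where a: "a < m" "j = ?L ! a" by auto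
    then have "?L ! a \<le> ?L ! m" "?L ! a \<noteq> ?L ! m"
      using m by (auto intro!: sorted_nth_mono simp: nth_eq_iff_index_eq)
    then show "j \<in> {j. j < i}" using a m by auto
  qed
  moreover have "inj_on (\<lambda>a. ?L ! a) {..<m}" using m by (auto intro!: inj_onI simp: nth_eq_iff_index_eq)
  ultimately have "pos i = m" by (simp add: pos_def card_image)
  then show "?L ! pos i = i" "pos i < CARD('n)" using m by auto
qed

lemma sorted_minus: "sorted_list_of_set (- {i :: 'n::{finite,linorder}}) = del (pos i) (sorted_list_of_set UNIV)"
proof (rule sorted_distinct_set_unique)
  let ?L = "sorted_list_of_set UNIV :: 'n list"
  show "sorted (del (pos i) ?L)"
    unfolding sorted_iff_nth_mono
  proof (intro allI impI)
    fix a c assume "a \<le> c" "c < length (del (pos i) ?L)"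
    then show "del (pos i) ?L ! a \<le> del (pos i) ?L ! c"
      using pos_less[of i] by (auto simp: nth_del intro!: sorted_nth_mono)
  qed
  have d: "distinct (take (pos i) ?L @ ?L ! pos i # drop (Suc (pos i)) ?L)"
    using pos_less[of i] by (simp flip: id_take_nth_drop)
  then show "distinct (del (pos i) ?L)" unfolding del_def by auto
  have "set (take (pos i) ?L @ ?L ! pos i # drop (Suc (pos i)) ?L) = UNIV"
    using pos_less[of i] by (simp flip: id_take_nth_drop)
  then show "set (sorted_list_of_set (- {i})) = set (del (pos i) ?L)"
    using d unfolding del_def sorted_UNIV_pos by auto
qed auto

lemma sum_over_sorted:
  "(\<Sum>a<CARD('n). F a ((sorted_list_of_set UNIV :: 'n::{finite,linorder} list) ! a)) = (\<Sum>i\<in>UNIV. F (pos i) i)"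
proof -
  have "(\<Sum>i\<in>UNIV. F (pos i) i) = (\<Sum>a<CARD('n). F a ((sorted_list_of_set UNIV :: 'n list) ! a))"
  proof (rule sum.reindex_bij_witness[of _ "\<lambda>a. sorted_list_of_set UNIV ! a" pos])
    fix a assume "a \<in> {..<CARD('n)}"
    then have a: "a < length (sorted_list_of_set UNIV :: 'n list)" by simp
    have "(sorted_list_of_set UNIV :: 'n list) ! pos (sorted_list_of_set UNIV ! a :: 'n) = sorted_list_of_set UNIV ! a"
      by (rule sorted_UNIV_pos)
    then show "pos (sorted_list_of_set UNIV ! a :: 'n) = a"
      using a pos_less[of "sorted_list_of_set UNIV ! a :: 'n"] by (subst (asm) nth_eq_iff_index_eq) auto
  qed (auto simp: sorted_UNIV_pos pos_less)
  then show ?thesis by simp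
qed

text \<open>Converts the expansion of a form over list positions into a sum over indices, with the
  sign (-1)^\<open>pos i\<close> of the Hodge star in place of the sign of the position.\<close>

lemma sum_over_subfam:
  fixes z :: "'n::{finite,linorder} \<Rightarrow> 'n pt"
  shows "(\<Sum>a<CARD('n). F a (subfam z UNIV ! a) (del a (subfam z UNIV))) = (\<Sum>i\<in>UNIV. F (pos i) (z i) (subfam z (- {i})))"
proof -
  have "(\<Sum>a<CARD('n). F a (subfam z UNIV ! a) (del a (subfam z UNIV)))
      = (\<Sum>a<CARD('n). F a (z ((sorted_list_of_set UNIV) ! a)) (del a (subfam z UNIV)))"
    by (rule sum.cong) auto
  also have "\<dots> = (\<Sum>i\<in>UNIV. F (pos i) (z i) (del (pos i) (subfam z UNIV)))"
    by (rule sum_over_sorted[of "\<lambda>a i. F a (z i) (del a (subfam z UNIV))"])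
  finally show ?thesis by (simp add: sorted_minus map_del)
qed

text \<open>The vector whose contraction with the volume form is the (n - 1)-form \<beta>. Through
  it the divergence in the statement becomes the ordinary divergence of vector fields, one for each
  value of the first group of arguments, and normal components become inner products with normal
  vectors.\<close>

definition proxy :: "'n::{finite,linorder} form \<Rightarrow> 'n pt" where
  "proxy \<beta> = (\<chi> i. (-1) ^ pos i * \<beta> (std_vecs (- {i})))"

lemma coef_proxy: "coef \<omega> \<sigma> i = proxy (\<omega> (std_vecs \<sigma>)) $ i"
  by (simp add: coef_def proxy_def)

lemma proxy_ip_vol:
  fixes e :: "'n::{finite,linorder} pt"
  shows "proxy (ip e vol) = e"
proof -
  have "proxy (ip e vol) $ i = e $ i" for i
  proof -
    have "(\<Sum>a<CARD('n). (-1) ^ a * ((std_vecs (UNIV :: 'n set) ! a) $ i * vol (e # del a (std_vecs (UNIV :: 'n set))))) = e $ i * vol (std_vecs (UNIV :: 'n set))"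
      by (rule cramer_vol[of "\<lambda>x. x $ i"]) (auto intro: bounded_linear.linear[OF bounded_linear_vec_nth])
    moreover have "(\<Sum>a<CARD('n). (-1) ^ a * ((std_vecs (UNIV :: 'n set) ! a) $ i * vol (e # del a (std_vecs (UNIV :: 'n set)))))
       = (\<Sum>j\<in>UNIV. (-1) ^ pos j * (axis j 1 $ i * vol (e # std_vecs (- {j}))))"
      unfolding std_vecs_subfam by (rule sum_over_subfam[of "\<lambda>a v L. (-1) ^ a * (v $ i * vol (e # L))"])
    moreover have "\<dots> = (\<Sum>j\<in>UNIV. if j = i then (-1) ^ pos i * vol (e # std_vecs (- {i})) else 0)"
      by (rule sum.cong) (auto simp: axis_def)
    ultimately show ?thesis by (simp add: vol_std proxy_def ip_def)
  qed
  then show ?thesis by (simp add: vec_eq_iff)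
qed

text \<open>The n-form obtained by wedging the functional of \<open>b i\<close> with \<beta> is
  evaluated twice. On the basis \<open>z\<close> only the term of index \<open>i\<close> survives;
  on the standard basis the terms add up to \<open>proxy \<beta> \<bullet> b i\<close>. The two
  values differ by the determinant of \<open>z\<close>.\<close>

lemma proxy_dual:
  fixes z b :: "'n::{finite,linorder} \<Rightarrow> 'n pt"
  assumes \<beta>: "\<beta> \<in> Alt (CARD('n) - 1)" and dual: "\<And>i j. z i \<bullet> b j = (if i = j then 1 else 0)"
  shows "(-1) ^ pos i * \<beta> (subfam z (- {i})) = vol (subfam z UNIV) * (proxy \<beta> \<bullet> b i)"
proof -
  let ?u = "\<lambda>x. x \<bullet> b i"
  have n: "Suc (CARD('n) - 1) = CARD('n)" by simp
  have u: "linear ?u" by (rule bounded_linear.linear[OF bounded_linear_inner_left])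
  define \<gamma> where "\<gamma> = uw (CARD('n) - 1) ?u \<beta>"
  have "\<gamma> \<in> Alt CARD('n)" using uw_Alt[OF u \<beta>] n unfolding \<gamma>_def by simp
  then have top: "\<gamma> (subfam z UNIV) = \<gamma> (std_vecs UNIV) * vol (subfam z UNIV)" by (rule Alt_top)
  have eq: "\<gamma> (subfam y UNIV) = (\<Sum>j\<in>UNIV. (-1) ^ pos j * ((y j \<bullet> b i) * \<beta> (subfam y (- {j}))))" for y
    using sum_over_subfam[of "\<lambda>a v L. (-1) ^ a * ((v \<bullet> b i) * \<beta> L)" y] by (simp add: \<gamma>_def uw_def n)
  have "\<gamma> (subfam z UNIV) = (\<Sum>j\<in>UNIV. if j = i then (-1) ^ pos i * \<beta> (subfam z (- {i})) else 0)"
    unfolding eq by (rule sum.cong) (auto simp: dual)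
  then have 1: "\<gamma> (subfam z UNIV) = (-1) ^ pos i * \<beta> (subfam z (- {i}))" by simp
  have 2: "\<gamma> (std_vecs UNIV) = proxy \<beta> \<bullet> b i"
    unfolding std_vecs_subfam eq inner_axis' by (simp add: proxy_def inner_vec_def std_vecs_subfam mult_ac)
  show ?thesis using top unfolding 1 2 by simp
qed

section \<open>Dual bases and the forms in the moments\<close>

lemma dual_family_exists:
  fixes b :: "'n::finite \<Rightarrow> 'n pt"
  assumes "inj b" "independent (range b)"
  obtains z where "\<And>i j. z i \<bullet> b j = (if i = j then 1 else 0)"
proof -
  have "\<exists>z. \<forall>j. z \<bullet> b j = (if i = j then 1 else 0)" for i
  proof -
    obtain f :: "'n pt \<Rightarrow> real" where f: "linear f" "\<forall>x\<in>range b. f x = (if x = b i then 1 else 0)"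
      using linear_independent_extend[OF assms(2), of "\<lambda>x. if x = b i then 1 else 0"] by blast
    have "(adjoint f 1) \<bullet> b j = f (b j)" for j
      using adjoint_works[OF f(1), of "b j" 1] by (simp add: inner_commute)
    then show ?thesis using f(2) assms(1) by (intro exI[of _ "adjoint f 1"]) (auto simp: inj_eq)
  qed
  then show ?thesis using that by metis
qed

lemma family_span_UNIV:
  fixes b :: "'n::finite \<Rightarrow> 'n pt"
  assumes "inj b" "independent (range b)" shows "span (range b) = UNIV"
proof -
  have "card (range b) = DIM('n pt)" using assms(1) by (simp add: card_image)
  then show ?thesis using card_ge_dim_independent[OF _ assms(2), of UNIV] by auto
qed

lemma dual_expand:
  fixes b :: "'n::finite \<Rightarrow> 'n pt"
  assumes dual: "\<And>i j. z i \<bullet> b j = (if i = j then 1 else 0)" and span: "span (range b) = UNIV"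
  shows "v = (\<Sum>i\<in>UNIV. (v \<bullet> b i) *\<^sub>R z i)"
proof -
  define d where "d = v - (\<Sum>i\<in>UNIV. (v \<bullet> b i) *\<^sub>R z i)"
  have lin: "linear (\<lambda>x. d \<bullet> x)" by (rule bounded_linear.linear[OF bounded_linear_inner_right])
  have "d \<bullet> b j = 0" for j
  proof -
    have "(\<Sum>i\<in>UNIV. (v \<bullet> b i) *\<^sub>R z i) \<bullet> b j = (\<Sum>i\<in>UNIV. if i = j then v \<bullet> b j else 0)"
      unfolding inner_sum_left by (rule sum.cong) (auto simp: dual)
    then show ?thesis by (simp add: d_def inner_diff_left)
  qed
  then have "d \<bullet> d = 0" using linear_eq_0_on_span[OF lin, of "range b" d] span by auto
  then show ?thesis by (simp add: d_def)
qed

lemma dual_span: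
  fixes b :: "'n::finite \<Rightarrow> 'n pt"
  assumes dual: "\<And>i j. z i \<bullet> b j = (if i = j then 1 else 0)" and span: "span (range b) = UNIV"
  shows "span (range z) = UNIV"
proof -
  have "(\<Sum>i\<in>UNIV. (v \<bullet> b i) *\<^sub>R z i) \<in> span (range z)" for v
    by (intro span_sum span_scale span_base) auto
  then show ?thesis using dual_expand[OF dual span] by fastforce
qed

lemma dy_of_Alt: "dy_of c i \<in> Alt 1"
proof (rule AltI)
  fix vs :: "'a pt list" and m :: nat assume "length vs = 1" "m < 1"
  then have "dy_of c i (vs[m := v]) = c i \<bullet> v" for v by (cases vs) (auto simp: dy_of_def)
  then show "linear (\<lambda>v. dy_of c i (vs[m := v]))"
    by (simp add: bounded_linear.linear[OF bounded_linear_inner_right])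
qed (auto simp: dy_of_def)

lemma form_inner_dy_of:
  fixes \<alpha> :: "'n::{finite,linorder} form"
  assumes "\<alpha> \<in> Alt 1" shows "form_inner 1 \<alpha> (dy_of b j) = \<alpha> [b j]"
proof -
  have "{p. p permutes {..<Suc 0}} = {id}" by (auto simp: lessThan_Suc fun_eq_iff)
  then have "dy_of b j = gram [b j]"
    by (auto simp: dy_of_def gram_def fun_eq_iff length_Suc_conv sign_id)
  then show ?thesis using form_inner_gram[OF assms, of "[b j]"] by simp
qed

text \<open>A 1-form is fixed by its values on the basis \<open>b\<close>, and pairing with
  \<open>dy_of b j\<close> reads off exactly these values. So the description has one solution, the
  functionals of the dual vectors.\<close>

lemma dual_basis_eq:
  fixes b z :: "'n::{finite,linorder} \<Rightarrow> 'n pt"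
  assumes dual: "\<And>i j. z i \<bullet> b j = (if i = j then 1 else 0)" and span: "span (range b) = UNIV"
  shows "dual_basis (dy_of b) = dy_of z"
  unfolding dual_basis_def
proof (rule the_equality)
  show "(\<forall>i. dy_of z i \<in> Alt 1) \<and> (\<forall>i j. form_inner 1 (dy_of z i) (dy_of b j) = (if i = j then 1 else 0))"
    by (intro conjI allI dy_of_Alt) (simp only: form_inner_dy_of[OF dy_of_Alt], simp add: dy_of_def dual)
  fix dz assume dz: "(\<forall>i. dz i \<in> Alt 1) \<and> (\<forall>i j. form_inner 1 (dz i) (dy_of b j) = (if i = j then 1 else 0))"
  show "dz = dy_of z"
  proof
    fix i
    have "dz i [b j] = (if i = j then 1 else 0)" for j using dz form_inner_dy_of[of "dz i" b j] by auto
    moreover have "dy_of z i [b j] = (if i = j then 1 else 0)" for j using dual by (simp add: dy_of_def)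
    moreover have "\<exists>j. \<sigma> = {j}" if "card \<sigma> = 1" for \<sigma> :: "'n set" using that card_1_singletonE by blast
    ultimately show "dz i = dy_of z i"
      using dz by (intro Alt_eqI[OF _ dy_of_Alt span]) (fastforce)+
  qed
qed

text \<open>The bridge from degrees of freedom to normal components: up to the determinant of
  \<open>z\<close>, a moment against the dual basis element of (\<sigma>, i) sees the component of
  the proxy along \<open>b i\<close>, and \<open>b i\<close> is a normal vector when the index is
  normal.\<close>

lemma tform_inner_dual:
  fixes b z :: "'n::{finite,linorder} \<Rightarrow> 'n pt"
  assumes \<omega>: "\<omega> \<in> AltT k (CARD('n) - 1)" and \<sigma>: "card \<sigma> = k"
    and dual: "\<And>i j. z i \<bullet> b j = (if i = j then 1 else 0)"
  shows "tform_inner k (CARD('n) - 1) \<omega> (tensor (wedge_set (dy_of z) \<sigma>) (star (dy_of z) i))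
    = vol (subfam z UNIV) * (proxy (\<omega> (subfam z \<sigma>)) \<bullet> b i)"
proof -
  have A: "(\<lambda>ws. \<omega> ws vs) \<in> Alt k" "\<omega> ws \<in> Alt (CARD('n) - 1)" for ws vs using \<omega> by (auto simp: AltT_def)
  have c: "length (subfam z (- {i})) = CARD('n) - 1" by (simp add: Compl_eq_Diff_UNIV)
  have "tform_inner k (CARD('n) - 1) \<omega> (tensor (wedge_set (dy_of z) \<sigma>) (star (dy_of z) i))
    = (\<Sum>\<rho> | card \<rho> = CARD('n) - 1. (-1) ^ pos i * gram (subfam z (- {i})) (std_vecs \<rho>) *
        form_inner k (\<lambda>ws. \<omega> ws (std_vecs \<rho>)) (gram (subfam z \<sigma>)))"
    unfolding tform_inner_def form_inner_def tensor_def star_def wedge_set_dy_of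
    by (subst sum.swap) (simp add: sum_distrib_left mult_ac)
  also have "\<dots> = (-1) ^ pos i * form_inner (CARD('n) - 1) (\<omega> (subfam z \<sigma>)) (gram (subfam z (- {i})))"
    using form_inner_gram[OF A(1), of "subfam z \<sigma>"] \<sigma>
    by (simp add: form_inner_def sum_distrib_left mult_ac)
  also have "\<dots> = (-1) ^ pos i * \<omega> (subfam z \<sigma>) (subfam z (- {i}))"
    using form_inner_gram[OF A(2) c] by simp
  also have "\<dots> = vol (subfam z UNIV) * (proxy (\<omega> (subfam z \<sigma>)) \<bullet> b i)"
    by (rule proxy_dual[OF A(2) dual])
  finally show ?thesis .
qed

text \<open>The constraint sequence of \<open>\<tau>\<close>, read off from \<open>s \<omega> = 0\<close> at the vectors of a basis.\<close>

lemma XX_constraint: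
  fixes b z :: "'n::{finite,linorder} \<Rightarrow> 'n pt"
  assumes \<omega>: "\<omega> \<in> XX k" and dual: "\<And>i j. z i \<bullet> b j = (if i = j then 1 else 0)"
    and span: "span (range b) = UNIV"
  shows "(\<Sum>i\<in>UNIV. proxy (\<omega> (z i # ws)) \<bullet> b i) = 0"
proof -
  have A: "\<omega> ws \<in> Alt (CARD('n) - 1)" for ws using \<omega> by (auto simp: AltT_def XX_def)
  have "s_map \<omega> ws (subfam z UNIV) = 0" using \<omega> by (simp add: XX_def)
  moreover have "s_map \<omega> ws (subfam z UNIV)
      = (\<Sum>a<CARD('n). (-1) ^ a * \<omega> (subfam z UNIV ! a # ws) (del a (subfam z UNIV)))"
    by (simp add: s_map_def del_def)
  moreover have "\<dots> = (\<Sum>i\<in>UNIV. (-1) ^ pos i * \<omega> (z i # ws) (subfam z (- {i})))"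
    by (rule sum_over_subfam[of "\<lambda>a v L. (-1) ^ a * \<omega> (v # ws) L"])
  moreover have "\<dots> = (\<Sum>i\<in>UNIV. vol (subfam z UNIV) * (proxy (\<omega> (z i # ws)) \<bullet> b i))"
    by (intro sum.cong refl proxy_dual A dual)
  ultimately have "vol (subfam z UNIV) * (\<Sum>i\<in>UNIV. proxy (\<omega> (z i # ws)) \<bullet> b i) = 0"
    by (simp add: sum_distrib_left)
  then show ?thesis using vol_subfam_nonzero[OF dual_span[OF dual span]] by simp
qed


section \<open>The divergence theorem on a mesh\<close>

text \<open>
  The library states the change of variables for linear maps only for well-ordered index types;
  \<open>'a wo\<close> is a copy of \<open>'a\<close> in that class.
\<close>

typedef 'a wo = "UNIV :: 'a set" morphisms un_wo mk_wo by simp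

setup_lifting type_definition_wo

instance wo :: (finite) finite
proof
  have "(UNIV :: 'a wo set) = mk_wo ` UNIV" by (metis UNIV_eq_I rangeI un_wo_inverse)
  then show "finite (UNIV :: 'a wo set)" by (metis finite finite_imageI)
qed

instantiation wo :: (linorder) linorder
begin
lift_definition less_eq_wo :: "'a wo \<Rightarrow> 'a wo \<Rightarrow> bool" is "(\<le>)" .
lift_definition less_wo :: "'a wo \<Rightarrow> 'a wo \<Rightarrow> bool" is "(<)" .
instance by standard (transfer; auto)+
end

instance wo :: ("{finite,linorder}") wellorder
proof
  fix P :: "'a wo \<Rightarrow> bool" and a :: "'a wo"
  assume *: "\<And>x. (\<And>y. y < x \<Longrightarrow> P y) \<Longrightarrow> P x"
  have "card {z. z < x} < card {z. z < y}" if "x < y" for x y :: "'a wo"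
    using that by (intro psubset_card_mono) (auto intro: less_trans)
  then have wf: "wf {(x, y :: 'a wo). x < y}"
    by (intro wf_subset[OF wf_measure[of "\<lambda>x. card {z. z < x}"]]) auto
  show "P a"
  proof (rule wf_induct_rule[OF wf, of P a])
    fix x assume "\<And>y. (y, x) \<in> {(x, y). x < y} \<Longrightarrow> P y"
    then have "\<And>y. y < x \<Longrightarrow> P y" by simp
    then show "P x" by (rule *)
  qed
qed

definition to_wo :: "'n::finite pt \<Rightarrow> 'n wo pt" where "to_wo x = (\<chi> i. x $ un_wo i)"
definition of_wo :: "'n::finite wo pt \<Rightarrow> 'n pt" where "of_wo x = (\<chi> i. x $ mk_wo i)"

lemma wo_inv [simp]: "to_wo (of_wo x) = x" "of_wo (to_wo y) = y"
  by (simp_all add: to_wo_def of_wo_def vec_eq_iff un_wo_inverse mk_wo_inverse)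

lemma bij_un_wo: "bij (un_wo :: 'n wo \<Rightarrow> 'n)"
  by (rule bij_betw_byWitness[of _ mk_wo]) (auto simp: un_wo_inverse mk_wo_inverse)

lemma linear_of_wo: "linear of_wo" and linear_to_wo: "linear to_wo"
  by (auto intro!: linearI simp: of_wo_def to_wo_def vec_eq_iff)

lemma of_wo_inner: "g \<bullet> of_wo x = to_wo g \<bullet> (x :: 'n::finite wo pt)"
proof -
  have "(\<Sum>i\<in>UNIV. g $ i * x $ mk_wo i) = (\<Sum>i\<in>UNIV. g $ un_wo i * x $ mk_wo (un_wo i))"
    by (rule sum.reindex_bij_betw[symmetric, OF bij_un_wo])
  then show ?thesis by (simp add: inner_vec_def of_wo_def to_wo_def un_wo_inverse)
qed

lemma of_wo_measurable: "of_wo \<in> borel_measurable borel"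
  by (rule borel_measurable_continuous_onI[OF linear_continuous_on[OF linear_conv_bounded_linear[THEN iffD1, OF linear_of_wo]]])

lemma prod_Basis_cart: "(\<Prod>b\<in>Basis. x \<bullet> b) = (\<Prod>i\<in>UNIV. (x :: 'n::finite pt) $ i)"
proof -
  have B: "(Basis :: ('n pt) set) = range (\<lambda>i. axis i 1)" by (auto simp: Basis_vec_def)
  show ?thesis unfolding B by (subst prod.reindex) (auto simp: inj_on_def axis_eq_axis inner_axis)
qed

lemma distr_of_wo: "distr lborel borel (of_wo :: 'n::finite wo pt \<Rightarrow> 'n pt) = lborel"
proof (rule lborel_eqI[symmetric])
  fix l u :: "'n pt"
  assume lu: "\<And>b. b \<in> Basis \<Longrightarrow> l \<bullet> b \<le> u \<bullet> b"
  have le: "l $ i \<le> u $ i" for i using lu[of "axis i 1"] by (simp add: inner_axis axis_in_Basis_iff)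
  have "of_wo -` box l u = box (to_wo l) (to_wo u)"
  proof (intro set_eqI iffI)
    fix x assume "x \<in> of_wo -` box l u"
    then have "\<And>i. l $ i < x $ mk_wo i \<and> x $ mk_wo i < u $ i" by (auto simp: mem_box_cart of_wo_def)
    from this[of "un_wo j" for j] show "x \<in> box (to_wo l) (to_wo u)"
      by (auto simp: mem_box_cart to_wo_def un_wo_inverse)
  next
    fix x assume "x \<in> box (to_wo l) (to_wo u)"
    then have "\<And>i. l $ un_wo i < x $ i \<and> x $ i < u $ un_wo i" by (auto simp: mem_box_cart to_wo_def)
    from this[of "mk_wo j" for j] show "x \<in> of_wo -` box l u"
      by (auto simp: mem_box_cart of_wo_def mk_wo_inverse)
  qed
  then have "emeasure (distr lborel borel of_wo) (box l u) = emeasure lborel (box (to_wo l) (to_wo u))"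
    using emeasure_distr[of of_wo "lborel :: 'n wo pt measure" "borel :: 'n pt measure" "box l u"] of_wo_measurable
    by simp
  also have "\<dots> = ennreal (\<Prod>b\<in>Basis. (to_wo u - to_wo l) \<bullet> b)"
  proof (rule emeasure_lborel_box)
    fix b :: "'n wo pt" assume "b \<in> Basis"
    then obtain i where "b = axis i 1" by (auto simp: Basis_vec_def)
    then show "to_wo l \<bullet> b \<le> to_wo u \<bullet> b" using le by (simp add: inner_axis to_wo_def)
  qed
  also have "(\<Prod>b\<in>Basis. (to_wo u - to_wo l) \<bullet> b) = (\<Prod>i\<in>UNIV. (u - l) $ un_wo i)"
    by (simp add: prod_Basis_cart to_wo_def)
  also have "\<dots> = (\<Prod>i\<in>UNIV. (u - l) $ i)"
    by (rule prod.reindex_bij_betw[OF bij_un_wo])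
  also have "\<dots> = (\<Prod>b\<in>Basis. (u - l) \<bullet> b)" by (simp add: prod_Basis_cart)
  finally show "emeasure (distr lborel borel of_wo) (box l u) = ennreal (\<Prod>b\<in>Basis. (u - l) \<bullet> b)" .
qed simp

text \<open>Rotating \<open>g\<close> onto a coordinate axis conjugates the map to one that differs
  from the identity in a single column, and the determinant is the diagonal entry of that
  column.\<close>

lemma det_rank_one_update:
  fixes g u :: "'m::finite pt"
  shows "det (matrix (\<lambda>x. x + (g \<bullet> x) *\<^sub>R u)) = 1 + g \<bullet> u"
proof -
  obtain k :: 'm where True by simp
  let ?A = "\<lambda>x. x + (g \<bullet> x) *\<^sub>R u"
  have "norm g = norm (norm g *\<^sub>R axis k (1::real))" by simp
  then obtain f :: "'m pt \<Rightarrow> 'm pt" where f: "orthogonal_transformation f" "f g = norm g *\<^sub>R axis k 1"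
    by (rule orthogonal_transformation_exists)
  have lf: "linear f" using f(1) orthogonal_transformation_linear by blast
  have lA: "linear ?A" by (auto intro!: linearI simp: inner_right_distrib algebra_simps)
  define B where "B y = y + ((norm g *\<^sub>R axis k 1) \<bullet> y) *\<^sub>R f u" for y
  have lB: "linear B" unfolding B_def by (auto intro!: linearI simp: inner_right_distrib algebra_simps)
  have "f (?A x) = B (f x)" for x
  proof -
    have "(norm g *\<^sub>R axis k 1) \<bullet> f x = g \<bullet> x"
      using f unfolding orthogonal_transformation_def by (simp flip: f(2))
    then show ?thesis by (simp add: B_def linear_add[OF lf] linear_scale[OF lf])
  qed
  then have "f \<circ> ?A = B \<circ> f" by auto
  then have "matrix f ** matrix ?A = matrix B ** matrix f"
    using matrix_compose[OF lA lf] matrix_compose[OF lf lB] by simp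
  then have "det (matrix f) * det (matrix ?A) = det (matrix B) * det (matrix f)"
    by (metis det_mul)
  moreover have "det (matrix f) \<noteq> 0"
    using f(1) lf det_nz_iff_inj orthogonal_transformation_inj by blast
  ultimately have "det (matrix ?A) = det (matrix B)" by simp
  also have "matrix B = (\<chi> i j. if j = k then (mat 1 *v (axis k 1 + norm g *\<^sub>R f u)) $ i else (mat 1 :: ((real, 'm) vec, 'm) vec) $ i $ j)"
  proof -
    have "B (axis j 1) = axis j 1 + (if j = k then norm g else 0) *\<^sub>R f u" for j
      by (simp add: B_def inner_axis_axis)
    then show ?thesis
      by (simp add: vec_eq_iff matrix_def mat_def axis_def matrix_vector_mul_lid[unfolded mat_def])
  qed
  also have "det \<dots> = (axis k 1 + norm g *\<^sub>R f u) $ k * det (mat 1 :: ((real, 'm) vec, 'm) vec)"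
    by (rule cramer_lemma)
  also have "\<dots> = 1 + norm g * (f u $ k)" by simp
  also have "norm g * (f u $ k) = f g \<bullet> f u" by (simp add: f(2) inner_axis')
  also have "\<dots> = g \<bullet> u" using f(1) by (simp add: orthogonal_transformation_def)
  finally show ?thesis .
qed

lemma integral_rank_one_update_wo:
  fixes p :: "'m::{finite,wellorder} pt \<Rightarrow> real"
  assumes cont: "continuous_on UNIV p" and supp: "\<And>x. R < norm x \<Longrightarrow> p x = 0" and ne: "1 + g \<bullet> u \<noteq> 0"
  shows "(LINT x|lborel. p x) = \<bar>1 + g \<bullet> u\<bar> * (LINT x|lborel. p (x + (g \<bullet> x) *\<^sub>R u))"
proof -
  let ?A = "\<lambda>x. x + (g \<bullet> x) *\<^sub>R u"
  have lA: "linear ?A" by (auto intro!: linearI simp: inner_right_distrib algebra_simps)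
  have inj: "inj ?A" using det_nz_iff_inj[OF lA] ne det_rank_one_update[of g u] by simp
  have surj: "range ?A = UNIV" using linear_injective_imp_surjective[OF lA inj] by simp
  have ip: "integrable lborel p" by (rule integrable_compact_support[OF cont supp])
  have abs: "p absolutely_integrable_on UNIV"
    using ip by (simp add: set_integrable_def integrable_completion borel_measurable_continuous_onI[OF cont])
  have meas: "p \<in> borel_measurable borel" by (rule borel_measurable_continuous_onI[OF cont])
  have "bounded_linear ?A" using lA linear_conv_bounded_linear by blast
  then have cA: "continuous_on UNIV ?A" by (rule linear_continuous_on)
  obtain B where B: "B > 0" "\<And>x. B * norm x \<le> norm (?A x)"
    using linear_inj_bounded_below_pos[OF lA inj] by blast
  have "p (?A x) = 0" if "R / B < norm x" for x
    using that B(1) B(2)[of x] by (intro supp) (simp add: field_simps)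
  then have ipA: "integrable lborel (\<lambda>x. p (?A x))"
    by (intro integrable_compact_support[of _ "R / B"] continuous_on_compose2[OF cont cA]) auto
  \<comment> \<open>The change of variables is for vector-valued functions, so \<open>p\<close> is
    wrapped as a vector of length 1.\<close>
  define F :: "'m pt \<Rightarrow> real ^ 1" where "F x = vec (p x)" for x
  have "F absolutely_integrable_on range ?A"
    using abs surj by (simp add: absolutely_integrable_on_1_iff F_def)
  then have "integral (range ?A) F = \<bar>det (matrix ?A)\<bar> *\<^sub>R integral UNIV (F \<circ> ?A)"
    by (intro integral_change_of_variables_linear[OF lA]) simp
  then have "integral UNIV p = \<bar>1 + g \<bullet> u\<bar> * integral UNIV (\<lambda>x. p (?A x))"
    by (simp add: surj det_rank_one_update integral_on_1_eq F_def o_def vec_eq_iff)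
  then show ?thesis using integral_lborel[OF ip] integral_lborel[OF ipA] by simp
qed

lemma integral_of_wo:
  fixes p :: "'n::finite pt \<Rightarrow> real"
  assumes "p \<in> borel_measurable borel"
  shows "(LINT x|lborel. p (of_wo x)) = (LINT x|lborel. p x)"
proof -
  have "of_wo \<in> lborel \<rightarrow>\<^sub>M (borel :: 'n pt measure)" using of_wo_measurable by simp
  from integral_distr[OF this assms] show ?thesis by (simp add: distr_of_wo)
qed

lemma integral_rank_one_update:
  fixes p :: "'n::{finite,linorder} pt \<Rightarrow> real"
  assumes cont: "continuous_on UNIV p" and supp: "\<And>x. R < norm x \<Longrightarrow> p x = 0" and ne: "1 + g \<bullet> u \<noteq> 0"
  shows "(LINT x|lborel. p x) = \<bar>1 + g \<bullet> u\<bar> * (LINT x|lborel. p (x + (g \<bullet> x) *\<^sub>R u))"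
proof -
  have c: "continuous_on UNIV of_wo"
    by (rule linear_continuous_on[OF linear_conv_bounded_linear[THEN iffD1, OF linear_of_wo]])
  have n: "norm (of_wo x :: 'n pt) = norm x" for x
    using of_wo_inner[of "of_wo x" x] by (simp add: norm_eq_sqrt_inner)
  have i: "g \<bullet> u = to_wo g \<bullet> to_wo u" using of_wo_inner[of g "to_wo u"] by simp
  have m: "p \<in> borel_measurable borel" by (rule borel_measurable_continuous_onI[OF cont])
  have "continuous_on UNIV (\<lambda>x. p (x + (g \<bullet> x) *\<^sub>R u))"
    by (intro continuous_on_compose2[OF cont] continuous_intros) auto
  then have mA: "(\<lambda>x. p (x + (g \<bullet> x) *\<^sub>R u)) \<in> borel_measurable borel" by (rule borel_measurable_continuous_onI)
  have e: "of_wo (x + (to_wo g \<bullet> x) *\<^sub>R to_wo u) = of_wo x + (g \<bullet> of_wo x) *\<^sub>R u" for x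
    by (simp add: linear_add[OF linear_of_wo] linear_scale[OF linear_of_wo] of_wo_inner)
  have "(LINT x|lborel. p (of_wo x)) = \<bar>1 + to_wo g \<bullet> to_wo u\<bar> *
      (LINT x|lborel. p (of_wo (x + (to_wo g \<bullet> x) *\<^sub>R to_wo u)))"
    using ne i n supp
    by (intro integral_rank_one_update_wo[of "\<lambda>x. p (of_wo x)" R] continuous_on_compose2[OF cont c]) auto
  also have "(LINT x|lborel. p (of_wo (x + (to_wo g \<bullet> x) *\<^sub>R to_wo u))) = (LINT x|lborel. p (x + (g \<bullet> x) *\<^sub>R u))"
    unfolding e by (rule integral_of_wo[OF mA])
  finally show ?thesis using i integral_of_wo[OF m] by simp
qed

section \<open>Cutoffs of a simplex and their boundary layers\<close>

definition cutoff :: "'n::finite pt set \<Rightarrow> nat \<Rightarrow> 'n pt \<Rightarrow> real" where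
  "cutoff C m x = (\<Prod>v\<in>C. bump (real m * bary C v x))"

text \<open>The coefficient of \<open>bgrad C v\<close> in the gradient of the cutoff. The cutoffs
  increase to the indicator of the open simplex, and this coefficient then lives close to the facet
  opposite \<open>v\<close>.\<close>

definition layer :: "'n::finite pt set \<Rightarrow> 'n pt \<Rightarrow> nat \<Rightarrow> 'n pt \<Rightarrow> real" where
  "layer C v m x = real m * bump' (real m * bary C v x) * (\<Prod>w\<in>C - {v}. bump (real m * bary C w x))"

lemma
  shows C1_bump_bary: "C1 (\<lambda>x. bump (real m * bary C v x))"
    and partial_bump_bary: "partial i (\<lambda>x. bump (real m * bary C v x)) = (\<lambda>x. real m * bgrad C v $ i * bump' (real m * bary C v x))"
proof -
  have eq: "(\<lambda>x. f (real m * bary C v x)) = (\<lambda>x. f ((real m *\<^sub>R bgrad C v) \<bullet> x + real m * (1 - bgrad C v \<bullet> v)))" for f :: "real \<Rightarrow> real"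
    by (simp add: bary_def distrib_left)
  have c: "continuous_on UNIV bump'" using bump'_continuous[OF continuous_on_id] by simp
  show "C1 (\<lambda>x. bump (real m * bary C v x))"
    unfolding eq by (rule C1_compose_affine[OF bump_DERIV c])
  show "partial i (\<lambda>x. bump (real m * bary C v x)) = (\<lambda>x. real m * bgrad C v $ i * bump' (real m * bary C v x))"
    unfolding eq partial_compose_affine[OF bump_DERIV c] by (simp add: bary_def distrib_left)
qed

lemma C1_cutoff: "finite C \<Longrightarrow> C1 (cutoff C m)"
  unfolding cutoff_def[abs_def] by (intro C1_prod C1_bump_bary)

lemma partial_cutoff:
  assumes "finite C" shows "partial i (cutoff C m) x = (\<Sum>v\<in>C. bgrad C v $ i * layer C v m x)"
  unfolding cutoff_def[abs_def] partial_prod[OF assms C1_bump_bary] partial_bump_bary layer_def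
  by (simp add: mult_ac)

lemma layer_continuous: "continuous_on UNIV (layer C v m)"
  unfolding layer_def[abs_def] by (intro continuous_intros)

lemma
  assumes C: "simplex_verts C" and x: "x \<notin> interior (convex hull C)"
  shows cutoff_outside: "cutoff C m x = 0" and layer_outside: "v \<in> C \<Longrightarrow> layer C v m x = 0"
proof -
  obtain w where w: "w \<in> C" "bary C w x \<le> 0" using x unfolding interior_simplex_bary[OF C] by force
  have z: "real m * bary C w x \<le> 0" using w(2) by (simp add: mult_nonneg_nonpos)
  have fin: "finite C" by (rule simplex_verts_finite[OF C])
  show "cutoff C m x = 0" unfolding cutoff_def
    using w z bump_0 fin by (intro prod_zero) auto
  assume "v \<in> C"
  show "layer C v m x = 0"
  proof (cases "w = v")
    case True then show ?thesis using bump'_0[OF z] by (simp add: layer_def)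
  next
    case False
    then have "(\<Prod>w\<in>C - {v}. bump (real m * bary C w x)) = 0"
      using w z bump_0 fin by (intro prod_zero) auto
    then show ?thesis by (simp add: layer_def)
  qed
qed

lemma simplex_compact: "simplex_verts C \<Longrightarrow> compact (convex hull C)"
  by (simp add: finite_imp_compact_convex_hull simplex_verts_finite)

lemma simplex_norm_bound:
  assumes "simplex_verts C" obtains R where "\<And>x. R < norm x \<Longrightarrow> x \<notin> convex hull C"
  using compact_imp_bounded[OF simplex_compact[OF assms]] unfolding bounded_iff
  by (meson not_less)

lemma
  assumes C: "simplex_verts C" and f: "continuous_on UNIV f"
  shows integrable_cutoff: "integrable lborel (\<lambda>x. cutoff C m x * f x)"
    and integrable_layer: "v \<in> C \<Longrightarrow> integrable lborel (\<lambda>x. layer C v m x * f x)"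
proof -
  obtain R where R: "\<And>x. R < norm x \<Longrightarrow> x \<notin> convex hull C" using simplex_norm_bound[OF C] by blast
  have R': "x \<notin> interior (convex hull C)" if "R < norm x" for x using R[OF that] interior_subset by blast
  show "integrable lborel (\<lambda>x. cutoff C m x * f x)"
    using cutoff_outside[OF C R'] C1_continuous[OF C1_cutoff[OF simplex_verts_finite[OF C]]]
    by (intro integrable_compact_support[of _ R] continuous_intros f) auto
  assume "v \<in> C"
  then show "integrable lborel (\<lambda>x. layer C v m x * f x)"
    using layer_outside[OF C R']
    by (intro integrable_compact_support[of _ R] continuous_intros layer_continuous f) auto
qed

text \<open>Integration by parts with a cutoff that vanishes outside the simplex. No boundary
  integral arises; the facets enter only through volume integrals over the layers, so no surface
  measure is needed.\<close>

lemma cutoff_divergence: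
  assumes C: "simplex_verts C" and G: "\<And>i. C1 (G i)"
  shows "(LINT x|lborel. cutoff C m x * (\<Sum>i\<in>UNIV. partial i (G i) x))
    = - (\<Sum>v\<in>C. LINT x|lborel. layer C v m x * (\<Sum>i\<in>UNIV. bgrad C v $ i * G i x))"
proof -
  have fin: "finite C" by (rule simplex_verts_finite[OF C])
  obtain R where R: "\<And>x. R < norm x \<Longrightarrow> x \<notin> convex hull C" using simplex_norm_bound[OF C] by blast
  have R': "cutoff C m x = 0" if "R < norm x" for x
    using cutoff_outside[OF C] R[OF that] interior_subset by blast
  have p: "partial i (\<lambda>x. cutoff C m x * G i x) x
      = cutoff C m x * partial i (G i) x + (\<Sum>v\<in>C. layer C v m x * (bgrad C v $ i * G i x))" for i x
    unfolding partial_mult[OF C1_cutoff[OF fin] G] partial_cutoff[OF fin]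
    by (simp add: sum_distrib_right sum_distrib_left mult_ac)
  have z: "(LINT x|lborel. partial i (\<lambda>x. cutoff C m x * G i x) x) = 0" for i
    using R' by (intro integral_partial_zero[where R = R] C1_mult C1_cutoff fin G) auto
  have "0 = (\<Sum>i\<in>UNIV. LINT x|lborel. cutoff C m x * partial i (G i) x + (\<Sum>v\<in>C. layer C v m x * (bgrad C v $ i * G i x)))"
    using z unfolding p by simp
  also have "\<dots> = (\<Sum>i\<in>UNIV. (LINT x|lborel. cutoff C m x * partial i (G i) x) + (\<Sum>v\<in>C. LINT x|lborel. layer C v m x * (bgrad C v $ i * G i x)))"
  proof (rule sum.cong[OF refl])
    fix i
    have I1: "integrable lborel (\<lambda>x. cutoff C m x * partial i (G i) x)"
      by (intro integrable_cutoff C C1_partial_continuous[OF G])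
    have I2: "integrable lborel (\<lambda>x. layer C v m x * (bgrad C v $ i * G i x))" if "v \<in> C" for v
      by (intro integrable_layer C continuous_intros C1_continuous[OF G] that)
    show "(LINT x|lborel. cutoff C m x * partial i (G i) x + (\<Sum>v\<in>C. layer C v m x * (bgrad C v $ i * G i x)))
      = (LINT x|lborel. cutoff C m x * partial i (G i) x) + (\<Sum>v\<in>C. LINT x|lborel. layer C v m x * (bgrad C v $ i * G i x))"
      using I1 I2 by simp
  qed
  also have "\<dots> = (LINT x|lborel. cutoff C m x * (\<Sum>i\<in>UNIV. partial i (G i) x))
     + (\<Sum>v\<in>C. LINT x|lborel. layer C v m x * (\<Sum>i\<in>UNIV. bgrad C v $ i * G i x))"
  proof -
    have "(LINT x|lborel. cutoff C m x * (\<Sum>i\<in>UNIV. partial i (G i) x)) = (\<Sum>i\<in>UNIV. LINT x|lborel. cutoff C m x * partial i (G i) x)"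
      unfolding sum_distrib_left
      by (rule Bochner_Integration.integral_sum) (auto intro!: integrable_cutoff C C1_partial_continuous[OF G])
    moreover have "(LINT x|lborel. layer C v m x * (\<Sum>i\<in>UNIV. bgrad C v $ i * G i x)) = (\<Sum>i\<in>UNIV. LINT x|lborel. layer C v m x * (bgrad C v $ i * G i x))" if "v \<in> C" for v
      unfolding sum_distrib_left
      by (rule Bochner_Integration.integral_sum) (intro integrable_layer C that continuous_intros C1_continuous[OF G])
    ultimately show ?thesis by (simp add: sum.distrib sum.swap[of _ C])
  qed
  finally show ?thesis by linarith
qed

lemma cutoff_limit:
  assumes C: "simplex_verts C" and D: "continuous_on UNIV D"
  shows "(\<lambda>m. LINT x|lborel. cutoff C m x * D x) \<longlonglongrightarrow> (LINT x|lborel. indicator (convex hull C) x * D x)"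
proof (rule integral_dominated_convergence)
  let ?T = "convex hull C"
  have fin: "finite C" by (rule simplex_verts_finite[OF C])
  have "integrable lborel (\<lambda>x. indicator ?T x *\<^sub>R \<bar>D x\<bar>)"
    by (rule borel_integrable_compact[OF simplex_compact[OF C]]) (intro continuous_intros continuous_on_subset[OF D] subset_UNIV)
  then show "integrable lborel (\<lambda>x. indicator ?T x * \<bar>D x\<bar>)" by simp
  have Dm: "D \<in> borel_measurable borel" by (rule borel_measurable_continuous_onI[OF D])
  have "?T \<in> sets borel" using simplex_compact[OF C] borel_compact by blast
  then show "(\<lambda>x. indicator ?T x * D x) \<in> borel_measurable lborel" using Dm by simp
  show "(\<lambda>x. cutoff C m x * D x) \<in> borel_measurable lborel" for m
    using integrable_cutoff[OF C D] by auto
  show "AE x in lborel. norm (cutoff C m x * D x) \<le> indicator ?T x * \<bar>D x\<bar>" for m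
  proof (rule AE_I2)
    fix x
    have "0 \<le> cutoff C m x" "cutoff C m x \<le> 1"
      unfolding cutoff_def by (auto intro: prod_nonneg prod_le_1 bump_nonneg bump_le_1)
    moreover have "cutoff C m x = 0" if "x \<notin> ?T" using cutoff_outside[OF C] that interior_subset by blast
    ultimately show "norm (cutoff C m x * D x) \<le> indicator ?T x * \<bar>D x\<bar>"
      by (cases "x \<in> ?T") (auto simp: abs_mult mult_left_le_one_le)
  qed
  show "AE x in lborel. (\<lambda>m. cutoff C m x * D x) \<longlonglongrightarrow> indicator ?T x * D x"
    using simplex_boundary_null[OF C]
  proof eventually_elim
    case (elim x)
    show ?case
    proof (cases "x \<in> ?T")
      case True
      then have "\<forall>v\<in>C. 0 < bary C v x" using elim interior_simplex_bary[OF C] by auto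
      then have "(\<lambda>m. cutoff C m x) \<longlonglongrightarrow> (\<Prod>v\<in>C. 1)"
        unfolding cutoff_def by (intro tendsto_prod bump_tendsto) auto
      then have "(\<lambda>m. cutoff C m x * D x) \<longlonglongrightarrow> 1 * D x" by (intro tendsto_intros) simp
      then show ?thesis using True by simp
    next
      case False
      then have "cutoff C m x = 0" for m using cutoff_outside[OF C] interior_subset by blast
      then show ?thesis using False by simp
    qed
  qed
qed

text \<open>The decay of \<open>f\<close> towards the facet compensates the factor m of the layer:
  with s = m * \<open>bary C v x\<close> the integrand is at most \<bar>L\<bar> s
  \<open>bump'\<close> s, which is bounded and tends to 0 at every interior point.\<close>

lemma layer_limit:
  assumes C: "simplex_verts C" and v: "v \<in> C" and f: "continuous_on UNIV f"
    and bound: "\<And>x. x \<in> convex hull C \<Longrightarrow> \<bar>f x\<bar> \<le> L * bary C v x"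
  shows "(\<lambda>m. LINT x|lborel. layer C v m x * f x) \<longlonglongrightarrow> 0"
proof -
  let ?T = "convex hull C"
  have fin: "finite C" by (rule simplex_verts_finite[OF C])
  have est: "\<bar>layer C v m x * f x\<bar> \<le> \<bar>L\<bar> * ((real m * bary C v x) * bump' (real m * bary C v x))" if x: "x \<in> ?T" for m x
  proof -
    have b: "0 \<le> bary C v x" using bary_nonneg[OF C x v] .
    have P: "0 \<le> (\<Prod>w\<in>C - {v}. bump (real m * bary C w x))" "(\<Prod>w\<in>C - {v}. bump (real m * bary C w x)) \<le> 1"
      by (auto intro: prod_nonneg prod_le_1 bump_nonneg bump_le_1)
    have "\<bar>layer C v m x\<bar> \<le> real m * bump' (real m * bary C v x)"
      unfolding layer_def using P bump'_nonneg[of "real m * bary C v x"]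
      by (simp add: abs_mult mult_left_le)
    moreover have "\<bar>f x\<bar> \<le> \<bar>L\<bar> * bary C v x"
      using bound[OF x] b by (meson abs_ge_self mult_right_mono order_trans)
    ultimately have "\<bar>layer C v m x\<bar> * \<bar>f x\<bar> \<le> (real m * bump' (real m * bary C v x)) * (\<bar>L\<bar> * bary C v x)"
      using bump'_nonneg by (intro mult_mono) auto
    then show ?thesis by (simp add: abs_mult mult_ac)
  qed
  have "(\<lambda>m. LINT x|lborel. layer C v m x * f x) \<longlonglongrightarrow> (LINT x|(lborel :: 'a pt measure). 0)"
  proof (rule integral_dominated_convergence)
    have "integrable lborel (\<lambda>x. indicator ?T x *\<^sub>R \<bar>L\<bar>)"
      by (rule borel_integrable_compact[OF simplex_compact[OF C]]) simp
    then show "integrable lborel (\<lambda>x. indicator ?T x * \<bar>L\<bar>)" by simp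
    show "(\<lambda>x. layer C v m x * f x) \<in> borel_measurable lborel" for m
      using integrable_layer[OF C f v] by auto
    show "AE x in lborel. norm (layer C v m x * f x) \<le> indicator ?T x * \<bar>L\<bar>" for m
    proof (rule AE_I2)
      fix x
      have "layer C v m x = 0" if "x \<notin> ?T" using layer_outside[OF C _ v] that interior_subset by blast
      moreover have "\<bar>L\<bar> * ((real m * bary C v x) * bump' (real m * bary C v x)) \<le> \<bar>L\<bar>"
        using bump'_bound[of "real m * bary C v x"] by (intro mult_left_le) auto
      ultimately show "norm (layer C v m x * f x) \<le> indicator ?T x * \<bar>L\<bar>"
        using est[of x m] by (cases "x \<in> ?T") auto
    qed
    show "AE x in lborel. (\<lambda>m. layer C v m x * f x) \<longlonglongrightarrow> 0"
      using simplex_boundary_null[OF C]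
    proof eventually_elim
      case (elim x)
      show ?case
      proof (cases "x \<in> ?T")
        case True
        then have "0 < bary C v x" using elim interior_simplex_bary[OF C] v by auto
        then have lim: "(\<lambda>m. \<bar>L\<bar> * ((real m * bary C v x) * bump' (real m * bary C v x))) \<longlonglongrightarrow> 0"
          by (rule tendsto_mult_right_zero[OF bump'_tendsto])
        show ?thesis
          by (rule Lim_null_comparison[OF always_eventually lim]) (intro allI, unfold real_norm_def, rule est[OF True])
      next
        case False
        then have "layer C v m x = 0" for m using layer_outside[OF C _ v] interior_subset by blast
        then show ?thesis by simp
      qed
    qed
  qed simp
  then show ?thesis by simp
qed

lemma C1_lipschitz:
  assumes p: "C1 p" and S: "compact S" "convex S"
  obtains L where "0 \<le> L" "\<And>x y. x \<in> S \<Longrightarrow> y \<in> S \<Longrightarrow> \<bar>p x - p y\<bar> \<le> L * norm (x - y)"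
proof -
  have "continuous_on S (\<lambda>x. \<Sum>i\<in>UNIV. \<bar>partial i p x\<bar>)"
    by (intro continuous_intros continuous_on_subset[OF C1_partial_continuous[OF p]] subset_UNIV)
  then have "bounded ((\<lambda>x. \<Sum>i\<in>UNIV. \<bar>partial i p x\<bar>) ` S)"
    by (intro compact_imp_bounded compact_continuous_image S)
  then obtain B where B: "\<And>x. x \<in> S \<Longrightarrow> (\<Sum>i\<in>UNIV. \<bar>partial i p x\<bar>) \<le> B"
    unfolding bounded_iff by force
  have "\<bar>p x - p y\<bar> \<le> max B 0 * norm (x - y)" if "x \<in> S" "y \<in> S" for x y
  proof -
    have "norm (p x - p y) \<le> max B 0 * norm (x - y)"
    proof (rule differentiable_bound[OF S(2) has_derivative_at_withinI[OF C1_has_derivative[OF p]]])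
      fix x assume x: "x \<in> S"
      show "onorm (\<lambda>h. \<Sum>i\<in>UNIV. h $ i * partial i p x) \<le> max B 0"
      proof (rule onorm_le)
        fix h :: "'a pt"
        have "\<bar>\<Sum>i\<in>UNIV. h $ i * partial i p x\<bar> \<le> (\<Sum>i\<in>UNIV. norm h * \<bar>partial i p x\<bar>)"
          by (intro order_trans[OF sum_abs] sum_mono) (simp add: abs_mult mult_right_mono component_le_norm_cart)
        also have "\<dots> \<le> norm h * max B 0"
          using B[OF x] by (simp add: mult_left_mono le_max_iff_disj flip: sum_distrib_left)
        finally show "norm (\<Sum>i\<in>UNIV. h $ i * partial i p x) \<le> max B 0 * norm h" by (simp add: mult.commute)
      qed
    qed (use that in auto)
    then show ?thesis by simp
  qed
  then show ?thesis using that[of "max B 0"] by simp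
qed

text \<open>Both sides are affine in \<open>y\<close>, vanish at the vertices of the shared facet
  and agree at \<open>v'\<close>.\<close>

lemma bary_opposite:
  assumes C: "simplex_verts C" "v \<in> C" and C': "simplex_verts C'" "v' \<in> C'" and K: "C - {v} = C' - {v'}"
  shows "bary C v y = bary C v v' * bary C' v' y"
proof -
  have fin: "finite C'" by (rule simplex_verts_finite[OF C'(1)])
  have ind: "\<not> affine_dependent C" using C by (simp add: simplex_verts_def)
  have "bary C v y = bary C v (\<Sum>w\<in>C'. bary C' w y *\<^sub>R w)" by (simp add: bary_decomp[OF C'(1)])
  also have "\<dots> = (\<Sum>w\<in>C'. bary C' w y * bary C v w)" by (rule bary_combination[OF sum_bary[OF C'(1)]])
  also have "\<dots> = (\<Sum>w\<in>C'. if w = v' then bary C' v' y * bary C v v' else 0)"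
  proof (rule sum.cong[OF refl])
    fix w assume w: "w \<in> C'"
    show "bary C' w y * bary C v w = (if w = v' then bary C' v' y * bary C v v' else 0)"
    proof (cases "w = v'")
      case False
      then have "w \<in> C - {v}" unfolding K using w by blast
      then show ?thesis using bary_vertex[OF ind C(2), of w] False by simp
    qed simp
  qed
  finally show ?thesis using fin C'(2) by simp
qed

lemma bgrad_opposite:
  assumes C: "simplex_verts C" "v \<in> C" and C': "simplex_verts C'" "v' \<in> C'" and K: "C - {v} = C' - {v'}"
  shows "bgrad C v = bary C v v' *\<^sub>R bgrad C' v'"
proof -
  have "bgrad C v \<bullet> y = (bary C v v' *\<^sub>R bgrad C' v') \<bullet> y" for y
    using bary_opposite[OF assms, of y] bary_opposite[OF assms, of 0] bary_diff[of C v y 0] bary_diff[of C' v' y 0]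
    by (simp add: algebra_simps)
  then show ?thesis by (metis vector_eq_rdot)
qed

text \<open>The affine map \<open>A\<close> that fixes the shared facet and sends \<open>v\<close>
  to \<open>v'\<close> carries one layer onto the other. Its linear part has determinant
  \<open>bary C v v'\<close>, which is also the ratio of the two gradients. Because this number is
  negative, the two contributions combine into one layer integral of the difference of the normal
  components, and that difference is small near the facet.\<close>

lemma layer_pair:
  fixes C :: "'n::{finite,linorder} pt set"
  assumes C: "simplex_verts C" "v \<in> C" and C': "simplex_verts C'" "v' \<in> C'" and K: "C - {v} = C' - {v'}"
    and opp: "bary C v v' < 0" and G: "\<And>i. C1 (G i)" "\<And>i. C1 (G' i)"
    and match: "\<And>x. x \<in> convex hull (C - {v}) \<Longrightarrow> (\<Sum>i\<in>UNIV. bgrad C v $ i * (G i x - G' i x)) = 0"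
  shows "(\<lambda>m. (LINT x|lborel. layer C v m x * (\<Sum>i\<in>UNIV. bgrad C v $ i * G i x)) +
     (LINT x|lborel. layer C' v' m x * (\<Sum>i\<in>UNIV. bgrad C' v' $ i * G' i x))) \<longlonglongrightarrow> 0"
proof -
  have fin: "finite C" "finite C'" and ind: "\<not> affine_dependent C" "\<not> affine_dependent C'"
    using C C' simplex_verts_finite by (auto simp: simplex_verts_def)
  have CK: "C = insert v (C - {v})" using C by blast
  have CK': "C' = insert v' (C - {v})" unfolding K using C' by blast
  have "C - {v} \<noteq> {}"
  proof
    assume "C - {v} = {}"
    then have "C = {v}" using C(2) by blast
    then show False using C(1) by (simp add: simplex_verts_def)
  qed
  then obtain w0 where w0: "w0 \<in> C - {v}" by blast
  define g where "g = bgrad C v"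
  define u where "u = v' - v"
  define c where "c = 1 - g \<bullet> v"
  define A where "A x = x + bary C v x *\<^sub>R u" for x
  have A_eq: "A x = (x + (g \<bullet> x) *\<^sub>R u) + c *\<^sub>R u" for x
    by (simp add: A_def bary_def g_def c_def scaleR_add_left)
  have \<kappa>: "1 + g \<bullet> u = bary C v v'"
    using bary_diff[of C v v' v] bary_vertex[OF ind(1) C(2) C(2)] by (simp add: g_def u_def)
  \<comment> \<open>The barycentric coordinates of \<open>A x\<close> in the second simplex: the
    weight of \<open>v\<close> is handed over to \<open>v'\<close>.\<close>
  define \<mu> where "\<mu> x y = (if y = v' then bary C v x else bary C y x)" for x y
  have \<mu>K: "\<mu> x y = bary C y x" if "y \<in> C - {v}" for x y using that unfolding K by (auto simp: \<mu>_def)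
  have v'K: "v' \<notin> C - {v}" unfolding K by blast
  have finK: "finite (C - {v})" using fin by simp
  have sum\<mu>: "sum (\<mu> x) C' = 1" for x
  proof -
    have "sum (\<mu> x) C' = \<mu> x v' + sum (\<mu> x) (C - {v})" using v'K finK by (subst CK') simp
    also have "\<dots> = bary C v x + (\<Sum>y\<in>C - {v}. bary C y x)" using \<mu>K by (simp add: \<mu>_def)
    also have "\<dots> = (\<Sum>y\<in>C. bary C y x)" using fin C(2) by (simp add: sum.remove)
    finally show ?thesis by (simp add: sum_bary[OF C(1)])
  qed
  have A_comb: "A x = (\<Sum>y\<in>C'. \<mu> x y *\<^sub>R y)" for x
  proof -
    have "x = bary C v x *\<^sub>R v + (\<Sum>y\<in>C - {v}. bary C y x *\<^sub>R y)"
      using bary_decomp[OF C(1), of x] fin C(2) by (simp add: sum.remove)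
    then have "A x = bary C v x *\<^sub>R v' + (\<Sum>y\<in>C - {v}. bary C y x *\<^sub>R y)"
      unfolding A_def u_def by (simp add: algebra_simps)
    also have "\<dots> = \<mu> x v' *\<^sub>R v' + (\<Sum>y\<in>C - {v}. \<mu> x y *\<^sub>R y)" using \<mu>K by (simp add: \<mu>_def)
    also have "\<dots> = (\<Sum>y\<in>C'. \<mu> x y *\<^sub>R y)" using v'K finK by (subst CK') simp
    finally show ?thesis .
  qed
  have A_bary: "bary C' y (A x) = \<mu> x y" if y: "y \<in> C'" for x y
  proof -
    have "bary C' y (A x) = (\<Sum>w\<in>C'. \<mu> x w * bary C' y w)" unfolding A_comb by (rule bary_combination[OF sum\<mu>])
    also have "\<dots> = (\<Sum>w\<in>C'. if w = y then \<mu> x y else 0)"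
      by (rule sum.cong) (auto simp: bary_vertex[OF ind(2) y])
    finally show ?thesis using fin y by simp
  qed
  have layerA: "layer C' v' m (A x) = layer C v m x" for m x
  proof -
    have "bary C' w (A x) = bary C w x" if "w \<in> C - {v}" for w
      using A_bary[of w x] \<mu>K[OF that] that unfolding K by simp
    then show ?thesis
      using A_bary[OF C'(2), of x] unfolding layer_def K[symmetric] by (simp add: \<mu>_def)
  qed
  define n' where "n' x = (\<Sum>i\<in>UNIV. bgrad C' v' $ i * G' i x)" for x
  define f where "f x = (\<Sum>i\<in>UNIV. g $ i * (G i x - G' i (A x)))" for x
  have cA: "continuous_on UNIV A" unfolding A_def by (intro continuous_intros)
  have cn': "continuous_on UNIV n'" unfolding n'_def by (intro continuous_intros C1_continuous[OF G(1)] C1_continuous[OF G(2)])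
  have cf: "continuous_on UNIV f"
    unfolding f_def by (intro continuous_intros C1_continuous[OF G(1)] C1_continuous[OF G(2)] continuous_on_compose2[OF C1_continuous[OF G(2)] cA]) auto
  \<comment> \<open>\<open>A\<close> is a rank-one update followed by a translation, and the
    translation leaves the integral unchanged. The minus sign is the absolute value of the negative
    determinant.\<close>
  have change: "(LINT x|lborel. layer C' v' m x * n' x) = - bary C v v' * (LINT x|lborel. layer C v m x * n' (A x))" for m
  proof -
    define p where "p y = layer C' v' m y * n' y" for y
    obtain R where R: "\<And>x. R < norm x \<Longrightarrow> x \<notin> convex hull C'" using simplex_norm_bound[OF C'(1)] by blast
    have R': "p x = 0" if "R < norm x" for x
      unfolding p_def using layer_outside[OF C'(1) _ C'(2)] R[OF that] interior_subset by auto
    have cp: "continuous_on UNIV p" unfolding p_def by (intro continuous_intros layer_continuous cn')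
    have cp2: "continuous_on UNIV (\<lambda>y. p (y + c *\<^sub>R u))"
      by (intro continuous_on_compose2[OF cp] continuous_intros) auto
    have "p (x + c *\<^sub>R u) = 0" if "R + norm (c *\<^sub>R u) < norm x" for x
      using that norm_diff_ineq[of x "c *\<^sub>R u"] by (intro R') linarith
    then have "(LINT y|lborel. p (y + c *\<^sub>R u)) = \<bar>1 + g \<bullet> u\<bar> * (LINT x|lborel. p ((x + (g \<bullet> x) *\<^sub>R u) + c *\<^sub>R u))"
      using opp \<kappa> by (intro integral_rank_one_update[OF cp2]) auto
    moreover have "(LINT y|lborel. p (y + c *\<^sub>R u)) = (LINT y|lborel. p y)"
    proof -
      have "integrable lborel p" by (rule integrable_compact_support[OF cp R'])
      then show ?thesis using integral_translate_diff[of p "c *\<^sub>R u"]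
          integrable_compact_support[OF cp2, of "R + norm (c *\<^sub>R u)"] \<open>\<And>x. R + norm (c *\<^sub>R u) < norm x \<Longrightarrow> p (x + c *\<^sub>R u) = 0\<close> by simp
    qed
    ultimately show ?thesis using opp unfolding A_eq[symmetric] \<kappa> by (simp add: p_def layerA)
  qed
  have gk: "g = bary C v v' *\<^sub>R bgrad C' v'" unfolding g_def by (rule bgrad_opposite[OF C C' K])
  have sum_eq: "(LINT x|lborel. layer C v m x * (\<Sum>i\<in>UNIV. bgrad C v $ i * G i x)) +
     (LINT x|lborel. layer C' v' m x * (\<Sum>i\<in>UNIV. bgrad C' v' $ i * G' i x)) = (LINT x|lborel. layer C v m x * f x)" for m
  proof -
    have fe: "f x = (\<Sum>i\<in>UNIV. bgrad C v $ i * G i x) - bary C v v' * n' (A x)" for x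
      unfolding f_def n'_def g_def[symmetric]
      by (subst (2) gk) (simp add: gk right_diff_distrib sum_subtractf sum_distrib_left mult_ac)
    have i: "integrable lborel (\<lambda>x. layer C v m x * (\<Sum>i\<in>UNIV. bgrad C v $ i * G i x))"
      "integrable lborel (\<lambda>x. layer C v m x * n' (A x))"
      by (intro integrable_layer C continuous_intros C1_continuous[OF G(1)] C1_continuous[OF G(2)] continuous_on_compose2[OF cn' cA]; simp)+
    have "(LINT x|lborel. layer C v m x * f x) = (LINT x|lborel. layer C v m x * (\<Sum>i\<in>UNIV. bgrad C v $ i * G i x) - bary C v v' * (layer C v m x * n' (A x)))"
      unfolding fe by (simp add: right_diff_distrib mult_ac)
    also have "\<dots> = (LINT x|lborel. layer C v m x * (\<Sum>i\<in>UNIV. bgrad C v $ i * G i x)) - bary C v v' * (LINT x|lborel. layer C v m x * n' (A x))"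
      using i by simp
    finally show ?thesis using change[of m] unfolding n'_def by simp
  qed
  have "\<exists>L. 0 \<le> L \<and> (\<forall>x\<in>convex hull C. \<forall>y\<in>convex hull C. \<bar>G i x - G i y\<bar> \<le> L * norm (x - y))" for i
    by (rule C1_lipschitz[OF G(1)[of i] simplex_compact[OF C(1)] convex_convex_hull]) blast
  then obtain L where "\<forall>i. 0 \<le> L i \<and> (\<forall>x\<in>convex hull C. \<forall>y\<in>convex hull C. \<bar>G i x - G i y\<bar> \<le> L i * norm (x - y))"
    by metis
  then have L: "\<And>i x y. x \<in> convex hull C \<Longrightarrow> y \<in> convex hull C \<Longrightarrow> \<bar>G i x - G i y\<bar> \<le> L i * norm (x - y)" by blast
  have "\<exists>L. 0 \<le> L \<and> (\<forall>x\<in>convex hull C'. \<forall>y\<in>convex hull C'. \<bar>G' i x - G' i y\<bar> \<le> L * norm (x - y))" for i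
    by (rule C1_lipschitz[OF G(2)[of i] simplex_compact[OF C'(1)] convex_convex_hull]) blast
  then obtain L' where "\<forall>i. 0 \<le> L' i \<and> (\<forall>x\<in>convex hull C'. \<forall>y\<in>convex hull C'. \<bar>G' i x - G' i y\<bar> \<le> L' i * norm (x - y))"
    by metis
  then have L': "\<And>i x y. x \<in> convex hull C' \<Longrightarrow> y \<in> convex hull C' \<Longrightarrow> \<bar>G' i x - G' i y\<bar> \<le> L' i * norm (x - y)" by blast
  \<comment> \<open>The difference is estimated by going from \<open>x\<close> to the facet inside
    the first simplex and from there to \<open>A x\<close> inside the second. Both displacements are
    \<open>bary C v x\<close> times a fixed vector.\<close>
  define M where "M = (\<Sum>i\<in>UNIV. \<bar>g $ i\<bar> * (L i * norm (v - w0) + L' i * norm (w0 - v')))"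
  have "\<bar>f x\<bar> \<le> M * bary C v x" if x: "x \<in> convex hull C" for x
  proof -
    \<comment> \<open>Shifting the weight of \<open>v\<close> onto the facet vertex
      \<open>w0\<close> gives a point of the shared facet, where the normal components
      match.\<close>
    define \<pi> where "\<pi> = x - bary C v x *\<^sub>R (v - w0)"
    have b: "0 \<le> bary C v x" by (rule bary_nonneg[OF C(1) x C(2)])
    have bp: "bary C y \<pi> = bary C y x - bary C v x * (bary C y v - bary C y w0)" for y
      using bary_add_scale[of C y x "- bary C v x" "v - w0"] by (simp add: \<pi>_def bary_diff)
    have "0 \<le> bary C y \<pi>" if y: "y \<in> C" for y
      using bary_nonneg[OF C(1) x y] b w0 C(2) unfolding bp by (auto simp: bary_vertex[OF ind(1) y])
    moreover have "bary C v \<pi> = 0" using w0 C(2) unfolding bp by (auto simp: bary_vertex[OF ind(1)])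
    ultimately have \<pi>: "\<pi> \<in> convex hull (C - {v})" using C(2) by (subst convex_hull_bary[OF C(1)]) auto
    have "convex hull (C - {v}) \<subseteq> convex hull C" "convex hull (C' - {v'}) \<subseteq> convex hull C'"
      by (rule hull_mono, blast)+
    then have \<pi>C: "\<pi> \<in> convex hull C" "\<pi> \<in> convex hull C'"
      using \<pi> unfolding K[symmetric] by (simp_all only: subset_iff)
    have Ax: "A x \<in> convex hull C'"
    proof -
      have "0 \<le> bary C' y (A x)" if y: "y \<in> C'" for y
      proof (cases "y = v'")
        case True then show ?thesis using A_bary[OF y] b by (simp add: \<mu>_def)
      next
        case False
        then have "y \<in> C - {v}" using y unfolding K by blast
        then show ?thesis using A_bary[OF y] \<mu>K bary_nonneg[OF C(1) x] by simp
      qed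
      then show ?thesis by (subst convex_hull_bary[OF C'(1)]) auto
    qed
    have "\<bar>g $ i * (G i x - G' i (A x)) - g $ i * (G i \<pi> - G' i \<pi>)\<bar>
        \<le> \<bar>g $ i\<bar> * (L i * norm (v - w0) + L' i * norm (w0 - v')) * bary C v x" for i
    proof -
      have "x - \<pi> = bary C v x *\<^sub>R (v - w0)" by (simp add: \<pi>_def)
      then have 1: "\<bar>G i x - G i \<pi>\<bar> \<le> L i * (bary C v x * norm (v - w0))"
        using L[OF x \<pi>C(1), of i] b by simp
      have "\<pi> - A x = bary C v x *\<^sub>R (w0 - v')" by (simp add: \<pi>_def A_def u_def algebra_simps)
      then have 2: "\<bar>G' i \<pi> - G' i (A x)\<bar> \<le> L' i * (bary C v x * norm (w0 - v'))"
        using L'[OF \<pi>C(2) Ax, of i] b by simp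
      have "\<bar>(G i x - G i \<pi>) + (G' i \<pi> - G' i (A x))\<bar> \<le> L i * (bary C v x * norm (v - w0)) + L' i * (bary C v x * norm (w0 - v'))"
        using 1 2 by linarith
      then have le: "\<bar>g $ i\<bar> * \<bar>(G i x - G i \<pi>) + (G' i \<pi> - G' i (A x))\<bar> \<le> \<bar>g $ i\<bar> * (L i * (bary C v x * norm (v - w0)) + L' i * (bary C v x * norm (w0 - v')))"
        by (rule mult_left_mono) simp
      have "g $ i * (G i x - G' i (A x)) - g $ i * (G i \<pi> - G' i \<pi>) = g $ i * ((G i x - G i \<pi>) + (G' i \<pi> - G' i (A x)))"
        by (simp add: algebra_simps)
      then have "\<bar>g $ i * (G i x - G' i (A x)) - g $ i * (G i \<pi> - G' i \<pi>)\<bar> = \<bar>g $ i\<bar> * \<bar>(G i x - G i \<pi>) + (G' i \<pi> - G' i (A x))\<bar>"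
        by (simp only: abs_mult)
      also note le
      also have "\<bar>g $ i\<bar> * (L i * (bary C v x * norm (v - w0)) + L' i * (bary C v x * norm (w0 - v')))
          = \<bar>g $ i\<bar> * (L i * norm (v - w0) + L' i * norm (w0 - v')) * bary C v x" by (simp add: algebra_simps)
      finally show ?thesis .
    qed
    then have "\<bar>\<Sum>i\<in>UNIV. g $ i * (G i x - G' i (A x)) - g $ i * (G i \<pi> - G' i \<pi>)\<bar>
      \<le> (\<Sum>i\<in>UNIV. \<bar>g $ i\<bar> * (L i * norm (v - w0) + L' i * norm (w0 - v')) * bary C v x)"
      by (intro order_trans[OF sum_abs] sum_mono)
    moreover have "(\<Sum>i\<in>UNIV. g $ i * (G i x - G' i (A x)) - g $ i * (G i \<pi> - G' i \<pi>)) = f x"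
      using match[OF \<pi>] by (simp add: f_def sum_subtractf g_def)
    ultimately show ?thesis by (simp add: M_def sum_distrib_right)
  qed
  then show ?thesis unfolding sum_eq by (rule layer_limit[OF C cf])
qed

section \<open>Meshes and adjacent simplices\<close>

definition simplicial_mesh :: "'n::finite pt set set \<Rightarrow> bool" where
  "simplicial_mesh \<T> \<longleftrightarrow> triangulation \<T> \<and> (\<forall>T\<in>\<T>. int CARD('n) simplex T)"

text \<open>Without the covering condition of \<open>conforming_mesh\<close>, parts of a mesh are
  meshes. Single simplices, the simplices around a facet and the simplices with nonzero residual are
  used in this way.\<close>

lemma mesh_subset: "simplicial_mesh \<T> \<Longrightarrow> \<S> \<subseteq> \<T> \<Longrightarrow> simplicial_mesh \<S>"
  unfolding simplicial_mesh_def triangulation_def by (blast intro: finite_subset)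

lemma mesh_finite: "simplicial_mesh \<T> \<Longrightarrow> finite \<T>"
  by (simp add: simplicial_mesh_def triangulation_def)

lemma mesh_inter_face: "simplicial_mesh \<T> \<Longrightarrow> T \<in> \<T> \<Longrightarrow> T' \<in> \<T> \<Longrightarrow> T \<inter> T' face_of T"
  by (simp add: simplicial_mesh_def triangulation_def)

lemma
  assumes "simplicial_mesh \<T>" "T \<in> \<T>"
  shows mesh_verts: "simplex_verts (verts T)" and mesh_hull: "convex hull (verts T) = T"
  using simplex_verts_verts[of T] assms by (auto simp: simplicial_mesh_def)

lemma face_verts:
  assumes m: "simplicial_mesh \<T>" "T \<in> \<T>" and f: "f face_of T"
  shows "verts f \<subseteq> verts T" "convex hull (verts f) = f" "f = T \<inter> {x. \<forall>v\<in>verts T - verts f. bary (verts T) v x = 0}"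
    and "int l simplex f \<Longrightarrow> card (verts f) = Suc l"
proof -
  let ?C = "verts T"
  have C: "simplex_verts ?C" "convex hull ?C = T" using mesh_verts[OF m] mesh_hull[OF m] by auto
  have ind: "\<not> affine_dependent ?C" using C by (simp add: simplex_verts_def)
  obtain K where K: "K \<subseteq> ?C" "f = convex hull K"
    using f C face_of_convex_hull_affine_independent[OF ind, of f] by auto
  have "\<not> affine_dependent K" using affine_independent_subset[OF ind K(1)] .
  then have vf: "verts f = K" using verts_hull K by simp
  show "verts f \<subseteq> ?C" "convex hull (verts f) = f" using K vf by auto
  show "f = T \<inter> {x. \<forall>v\<in>verts T - verts f. bary (verts T) v x = 0}"
    unfolding vf using convex_hull_bary[OF C(1) K(1)] convex_hull_bary[OF C(1) order_refl]
    unfolding C(2) K(2)[symmetric] by auto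
  show "card (verts f) = Suc l" if sim: "int l simplex f"
  proof -
    obtain D where D: "\<not> affine_dependent D" "int (card D) = int l + 1" "f = convex hull D"
      using sim unfolding simplex_def by blast
    then have "verts f = D" using verts_hull by simp
    then show ?thesis using D(2) by simp
  qed
qed

lemma bary_face_vertex:
  assumes "simplex_verts C" "K \<subseteq> C" "v \<in> C" "v \<in> convex hull K" shows "v \<in> K"
  using convex_hull_bary[OF assms(1,2), of v] bary_vertex[of C v v] assms by (force simp: simplex_verts_def)

text \<open>The pair (\<open>T\<close>, \<open>v\<close>) encodes the facet of \<open>T\<close>
  opposite \<open>v\<close>; the pair (\<open>T'\<close>, \<open>v'\<close>) is the same facet seen
  from the other simplex.\<close>

definition adjacent :: "'n::finite pt set \<Rightarrow> 'n pt \<Rightarrow> 'n pt set \<Rightarrow> 'n pt \<Rightarrow> bool" where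
  "adjacent T v T' v' \<longleftrightarrow> T' \<noteq> T \<and> v' \<in> verts T' \<and> verts T - {v} = verts T' - {v'}"

text \<open>Suppose \<open>v'\<close> were not strictly beyond the facet. Then a point close to the
  centre \<open>y\<close> of the facet, displaced towards \<open>v'\<close>, would lie in both
  simplices, although conformity lets them meet only in the facet.\<close>

lemma adjacent_opposite:
  assumes m: "simplicial_mesh \<T>" "T \<in> \<T>" "T' \<in> \<T>" and v: "v \<in> verts T" and adj: "adjacent T v T' v'"
  shows "bary (verts T) v v' < 0"
proof (rule ccontr)
  let ?C = "verts T" and ?C' = "verts T'"
  let ?K = "?C - {v}"
  assume "\<not> bary ?C v v' < 0"
  then have nn: "0 \<le> bary ?C v v'" by simp
  have C: "simplex_verts ?C" "convex hull ?C = T" and C': "simplex_verts ?C'" "convex hull ?C' = T'"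
    using mesh_verts[OF m(1,2)] mesh_hull[OF m(1,2)] mesh_verts[OF m(1,3)] mesh_hull[OF m(1,3)] by auto
  have ind: "\<not> affine_dependent ?C" "\<not> affine_dependent ?C'" using C C' by (auto simp: simplex_verts_def)
  have v': "v' \<in> ?C'" and K: "?K = ?C' - {v'}" and ne: "T' \<noteq> T" using adj by (auto simp: adjacent_def)
  have finK: "finite ?K" using simplex_verts_finite[OF C(1)] by simp
  have cK: "card ?K = CARD('a)" using C(1) v simplex_verts_finite[OF C(1)] by (simp add: simplex_verts_def)
  have KT: "?K \<subseteq> T \<inter> T'"
  proof -
    have "?K \<subseteq> ?C" "?K \<subseteq> ?C'" unfolding K by auto (use K in blast)
    then show ?thesis using hull_subset[of ?C convex] hull_subset[of ?C' convex] C(2) C'(2) by blast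
  qed
  have F: "T \<inter> T' face_of T" "T \<inter> T' face_of T'"
    using mesh_inter_face[OF m(1,2,3)] mesh_inter_face[OF m(1,3,2)] by (auto simp: Int_commute)
  note f1 = face_verts[OF m(1,2) F(1)] and f2 = face_verts[OF m(1,3) F(2)]
  have KJ: "?K \<subseteq> verts (T \<inter> T')"
  proof
    fix w assume w: "w \<in> ?K"
    then have "w \<in> convex hull (verts (T \<inter> T'))" using KT f1(2) by blast
    then show "w \<in> verts (T \<inter> T')" using bary_face_vertex[OF C(1) f1(1)] w by blast
  qed
  have vJ: "v \<notin> verts (T \<inter> T')"
  proof
    assume "v \<in> verts (T \<inter> T')"
    then have "?C \<subseteq> verts (T \<inter> T')" using KJ by blast
    then have "?C \<subseteq> ?C'" using f2(1) by blast
    moreover have "card ?C = card ?C'" using C C' by (simp add: simplex_verts_def)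
    ultimately have "?C = ?C'" using card_subset_eq simplex_verts_finite[OF C'(1)] by blast
    then show False using C(2) C'(2) ne by metis
  qed
  have J: "T \<inter> T' = convex hull ?K"
  proof -
    have "verts (T \<inter> T') = ?K" using KJ vJ f1(1) by blast
    then show ?thesis using f1(2) by simp
  qed
  define y where "y = (\<Sum>w\<in>?K. (1 / real CARD('a)) *\<^sub>R w)"
  have s1: "(\<Sum>w\<in>?K. 1 / real CARD('a)) = 1" using cK by simp
  have by1: "bary ?C u y = (if u = v then 0 else 1 / real CARD('a))" if u: "u \<in> ?C" for u
  proof -
    have "bary ?C u y = (\<Sum>w\<in>?K. 1 / real CARD('a) * bary ?C u w)"
      unfolding y_def by (rule bary_combination[OF s1])
    also have "\<dots> = (\<Sum>w\<in>?K. if w = u then 1 / real CARD('a) else 0)"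
      by (rule sum.cong) (auto simp: bary_vertex[OF ind(1) u])
    finally show ?thesis using finK u by auto
  qed
  have yT: "y \<in> T \<inter> T'" unfolding J by (subst convex_hull_bary[OF C(1)]) (use by1 in auto)
  define M where "M = (\<Sum>u\<in>?C. \<bar>bary ?C u v'\<bar>)"
  \<comment> \<open>The coordinates of the centre are 1/n. Along the displacement they drop by at
    most t (1 + M), which this choice keeps below 1/n.\<close>
  define t where "t = 1 / (1 + real CARD('a) * (1 + M))"
  have M: "0 \<le> M" "\<And>u. u \<in> ?C \<Longrightarrow> \<bar>bary ?C u v'\<bar> \<le> M"
    unfolding M_def using simplex_verts_finite[OF C(1)] by (auto intro!: sum_nonneg member_le_sum)
  have t: "0 < t" "t < 1" "real CARD('a) * (t * (1 + M)) \<le> 1"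
    using M(1) by (auto simp: t_def divide_simps add_pos_nonneg)
  define z where "z = y + t *\<^sub>R (v' - y)"
  have v'T: "v' \<in> T'" using v' hull_subset[of ?C' convex] C'(2) by blast
  have zT': "z \<in> T'"
  proof -
    have "z = (1 - t) *\<^sub>R y + t *\<^sub>R v'" by (simp add: z_def algebra_simps)
    then show ?thesis using yT v'T t convexD_alt[of T' y v' t] convex_convex_hull[of ?C'] C'(2) by auto
  qed
  have bz: "bary D u z = (1 - t) * bary D u y + t * bary D u v'" for D u
    unfolding z_def bary_add_scale bary_diff[symmetric] by (simp add: algebra_simps)
  have "0 \<le> bary ?C u z" if u: "u \<in> ?C" for u
  proof (cases "u = v")
    case True
    then show ?thesis using nn t by1[OF v] unfolding bz by simp
  next
    case False
    have "t * (1 + M) \<le> 1 / real CARD('a)" using t(3) by (simp add: field_simps)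
    moreover have "t * (1 / real CARD('a)) \<le> t * 1" using t(1) by (intro mult_left_mono) auto
    moreover have "- (t * M) \<le> t * bary ?C u v'"
    proof -
      have "t * (- M) \<le> t * bary ?C u v'" using M(2)[OF u] t(1) by (intro mult_left_mono) auto
      then show ?thesis by simp
    qed
    moreover have "(1 - t) * (1 / real CARD('a)) = 1 / real CARD('a) - t * (1 / real CARD('a))"
      "t * (1 + M) = t + t * M" by (simp_all only: left_diff_distrib distrib_left mult_1_left mult_1_right)
    ultimately have "0 \<le> (1 - t) * (1 / real CARD('a)) + t * bary ?C u v'" by linarith
    then show ?thesis unfolding bz using by1[OF u] False by simp
  qed
  then have "z \<in> T" using convex_hull_bary[OF C(1) order_refl, of z] C(2) by auto
  then have "z \<in> convex hull ?K" using zT' J by blast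
  then have "z \<in> convex hull (?C' - {v'})" using K by simp
  then have "bary ?C' v' z = 0" using convex_hull_bary[OF C'(1), of "?C' - {v'}" z] v' by blast
  moreover have "y \<in> convex hull (?C' - {v'})" using yT J K by simp
  then have "bary ?C' v' y = 0" using convex_hull_bary[OF C'(1), of "?C' - {v'}" y] v' by blast
  ultimately show False unfolding bz using bary_vertex[OF ind(2) v' v'] t by simp
qed

lemma adjacent_sym: "v \<in> verts T \<Longrightarrow> adjacent T v T' v' \<Longrightarrow> adjacent T' v' T v"
  by (auto simp: adjacent_def)

text \<open>A facet has only two sides. Two different neighbours would be adjacent to each other as
  well, and the coordinate of the second opposite vertex, a product of two negative factors, would
  have to be negative.\<close>

lemma adjacent_unique:
  assumes m: "simplicial_mesh \<T>" "T \<in> \<T>" "T1 \<in> \<T>" "T2 \<in> \<T>" and v: "v \<in> verts T"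
    and a1: "adjacent T v T1 v1" and a2: "adjacent T v T2 v2"
  shows "T1 = T2" "v1 = v2"
proof -
  have C: "simplex_verts (verts T)" "simplex_verts (verts T1)" using mesh_verts m by auto
  have v1: "v1 \<in> verts T1" and K1: "verts T - {v} = verts T1 - {v1}" using a1 by (auto simp: adjacent_def)
  have v2: "v2 \<in> verts T2" and K2: "verts T - {v} = verts T2 - {v2}" using a2 by (auto simp: adjacent_def)
  show T: "T1 = T2"
  proof (rule ccontr)
    assume "T1 \<noteq> T2"
    then have "adjacent T1 v1 T2 v2" using v2 K1 K2 by (simp add: adjacent_def)
    then have "bary (verts T1) v1 v2 < 0" using adjacent_opposite[OF m(1,3,4) v1] by blast
    moreover have "bary (verts T) v v2 = bary (verts T) v v1 * bary (verts T1) v1 v2"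
      by (rule bary_opposite[OF C(1) v C(2) v1 K1])
    moreover have "bary (verts T) v v2 < 0" "bary (verts T) v v1 < 0"
      using adjacent_opposite[OF m(1,2) m(4) v a2] adjacent_opposite[OF m(1,2) m(3) v a1] by auto
    ultimately show False by (simp add: mult_less_0_iff)
  qed
  show "v1 = v2"
  proof (rule ccontr)
    assume "v1 \<noteq> v2"
    then have "v1 \<in> verts T2 - {v2}" using v1 T by blast
    then have "v1 \<in> verts T1 - {v1}" unfolding K2[symmetric] K1 .
    then show False by blast
  qed
qed

text \<open>The integrals of the divergences are limits of minus the sum of all layer terms. An
  involution on the facets exchanges the two copies of an interior facet and fixes a facet without
  neighbour, so twice that sum splits into expressions that each tend to 0.\<close>

theorem mesh_divergence_zero:
  fixes \<S> :: "'n::{finite,linorder} pt set set"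
  assumes m: "simplicial_mesh \<S>" and G: "\<And>T i. T \<in> \<S> \<Longrightarrow> C1 (G T i)"
    and inner: "\<And>T T' v v' x. T \<in> \<S> \<Longrightarrow> T' \<in> \<S> \<Longrightarrow> v \<in> verts T \<Longrightarrow> adjacent T v T' v' \<Longrightarrow>
      x \<in> convex hull (verts T - {v}) \<Longrightarrow> (\<Sum>i\<in>UNIV. bgrad (verts T) v $ i * (G T i x - G T' i x)) = 0"
    and outer: "\<And>T v x. T \<in> \<S> \<Longrightarrow> v \<in> verts T \<Longrightarrow> (\<And>T' v'. T' \<in> \<S> \<Longrightarrow> \<not> adjacent T v T' v') \<Longrightarrow>
      x \<in> convex hull (verts T - {v}) \<Longrightarrow> (\<Sum>i\<in>UNIV. bgrad (verts T) v $ i * G T i x) = 0"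
  shows "(\<Sum>T\<in>\<S>. LINT x|lborel. indicator T x * (\<Sum>i\<in>UNIV. partial i (G T i) x)) = 0"
proof -
  define I where "I = (SIGMA T:\<S>. verts T)"
  define a where "a m p = (case p of (T, v) \<Rightarrow>
    LINT x|lborel. layer (verts T) v m x * (\<Sum>i\<in>UNIV. bgrad (verts T) v $ i * G T i x))" for m p
  define nb where "nb p q \<longleftrightarrow> adjacent (fst p) (snd p) (fst q) (snd q)" for p q :: "'n pt set \<times> 'n pt"
  \<comment> \<open>A facet without neighbour is its own partner; its layer term is then counted
    twice, and tends to 0 by the outer condition alone.\<close>
  define \<sigma> where "\<sigma> p = (if \<exists>q\<in>I. nb p q then SOME q. q \<in> I \<and> nb p q else p)" for p
  have C: "simplex_verts (verts T)" "convex hull (verts T) = T" if "T \<in> \<S>" for T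
    using mesh_verts[OF m that] mesh_hull[OF m that] by auto
  have fin: "finite I" unfolding I_def using mesh_finite[OF m] simplex_verts_finite[OF C(1)] by auto
  have sym: "nb q p" if "p \<in> I" "nb p q" for p q using that adjacent_sym by (auto simp: nb_def I_def)
  have uniq: "q = q'" if "p \<in> I" "q \<in> I" "q' \<in> I" "nb p q" "nb p q'" for p q q'
  proof -
    obtain T v T1 v1 T2 v2 where e: "p = (T, v)" "q = (T1, v1)" "q' = (T2, v2)" by (metis surj_pair)
    have "T \<in> \<S>" "T1 \<in> \<S>" "T2 \<in> \<S>" "v \<in> verts T" "adjacent T v T1 v1" "adjacent T v T2 v2"
      using that e by (auto simp: nb_def I_def)
    from adjacent_unique[OF m this] show ?thesis by (simp add: e)
  qed
  have \<sigma>1: "\<sigma> p = q" if "p \<in> I" "q \<in> I" "nb p q" for p q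
  proof -
    have "(SOME q. q \<in> I \<and> nb p q) = q" using that uniq by (intro some_equality) blast+
    then show ?thesis using that by (auto simp: \<sigma>_def)
  qed
  have \<sigma>2: "\<sigma> p = p" if "\<not> (\<exists>q\<in>I. nb p q)" for p using that unfolding \<sigma>_def by (simp only: if_False)
  have \<sigma>I: "\<sigma> p \<in> I" if "p \<in> I" for p
  proof (cases "\<exists>q\<in>I. nb p q")
    case True
    then obtain q where "q \<in> I" "nb p q" by blast
    then show ?thesis using \<sigma>1[OF that] by simp
  qed (simp add: \<sigma>2 that)
  have \<sigma>\<sigma>: "\<sigma> (\<sigma> p) = p" if "p \<in> I" for p
  proof (cases "\<exists>q\<in>I. nb p q")
    case True
    then obtain q where q: "q \<in> I" "nb p q" by blast
    then show ?thesis using \<sigma>1[OF that q] \<sigma>1[OF q(1) that sym[OF that q(2)]] by simp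
  next
    case False then show ?thesis using \<sigma>2 by simp
  qed
  have bij: "bij_betw \<sigma> I I"
    by (rule bij_betw_byWitness[of _ \<sigma>]) (use \<sigma>\<sigma> \<sigma>I in auto)
  have lim: "(\<lambda>m. a m p + a m (\<sigma> p)) \<longlonglongrightarrow> 0" if p: "p \<in> I" for p
  proof -
    obtain T v where Tv: "p = (T, v)" "T \<in> \<S>" "v \<in> verts T" using p by (auto simp: I_def)
    have ind: "\<not> affine_dependent (verts T)" using C(1)[OF Tv(2)] by (simp add: simplex_verts_def)
    show ?thesis
    proof (cases "\<exists>q\<in>I. nb p q")
      case True
      then obtain T' v' where T': "T' \<in> \<S>" "v' \<in> verts T'" "nb p (T', v')" by (auto simp: I_def)
      then have adj: "adjacent T v T' v'" using Tv by (simp add: nb_def)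
      have "\<sigma> p = (T', v')" using \<sigma>1[OF p _ T'(3)] T' by (simp add: I_def)
      moreover have "verts T - {v} = verts T' - {v'}" using adj by (simp add: adjacent_def)
      ultimately show ?thesis
        using layer_pair[OF C(1)[OF Tv(2)] Tv(3) C(1)[OF T'(1)] T'(2) _ adjacent_opposite[OF m Tv(2) T'(1) Tv(3) adj]
            G[OF Tv(2)] G[OF T'(1)] inner[OF Tv(2) T'(1) Tv(3) adj]]
        by (simp add: a_def Tv(1))
    next
      case False
      have no: "\<not> adjacent T v T' v'" if "T' \<in> \<S>" for T' v'
      proof
        assume "adjacent T v T' v'"
        moreover from this have "(T', v') \<in> I" using that by (auto simp: I_def adjacent_def)
        ultimately show False using False Tv by (auto simp: nb_def)
      qed
      define f where "f x = (\<Sum>i\<in>UNIV. bgrad (verts T) v $ i * G T i x)" for x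
      have cf: "continuous_on UNIV f" unfolding f_def by (intro continuous_intros C1_continuous[OF G[OF Tv(2)]])
      have Cf: "C1 f" unfolding f_def by (intro C1_sum C1_cmult G Tv)
      have "verts T - {v} \<noteq> {}"
      proof
        assume "verts T - {v} = {}"
        then have "verts T = {v}" using Tv by blast
        then show False using C(1)[OF Tv(2)] by (simp add: simplex_verts_def)
      qed
      then obtain w0 where w0: "w0 \<in> verts T - {v}" by blast
      obtain L where L: "0 \<le> L" "\<And>x y. x \<in> T \<Longrightarrow> y \<in> T \<Longrightarrow> \<bar>f x - f y\<bar> \<le> L * norm (x - y)"
        using C1_lipschitz[OF Cf simplex_compact[OF C(1)[OF Tv(2)]] convex_convex_hull] C(2)[OF Tv(2)] by metis
      have "\<bar>f x\<bar> \<le> (L * norm (v - w0)) * bary (verts T) v x" if x: "x \<in> convex hull (verts T)" for x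
      proof -
        define \<pi> where "\<pi> = x - bary (verts T) v x *\<^sub>R (v - w0)"
        have b: "0 \<le> bary (verts T) v x" by (rule bary_nonneg[OF C(1)[OF Tv(2)] x Tv(3)])
        have bp: "bary (verts T) y \<pi> = bary (verts T) y x - bary (verts T) v x * (bary (verts T) y v - bary (verts T) y w0)" for y
          using bary_add_scale[of "verts T" y x "- bary (verts T) v x" "v - w0"] by (simp add: \<pi>_def bary_diff)
        have "0 \<le> bary (verts T) y \<pi>" if y: "y \<in> verts T" for y
          using bary_nonneg[OF C(1)[OF Tv(2)] x y] b w0 Tv(3) unfolding bp by (auto simp: bary_vertex[OF ind y])
        moreover have "bary (verts T) v \<pi> = 0" using w0 Tv(3) unfolding bp by (auto simp: bary_vertex[OF ind])
        ultimately have \<pi>: "\<pi> \<in> convex hull (verts T - {v})"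
          using Tv(3) by (subst convex_hull_bary[OF C(1)[OF Tv(2)]]) auto
        have "convex hull (verts T - {v}) \<subseteq> convex hull (verts T)" by (rule hull_mono) blast
        then have "\<pi> \<in> T" "x \<in> T" using \<pi> x C(2)[OF Tv(2)] by auto
        moreover have "f \<pi> = 0" unfolding f_def by (rule outer[OF Tv(2,3) no \<pi>])
        ultimately have "\<bar>f x\<bar> \<le> L * norm (x - \<pi>)" using L(2)[of x \<pi>] by simp
        then show ?thesis using b by (simp add: \<pi>_def mult_ac)
      qed
      from layer_limit[OF C(1)[OF Tv(2)] Tv(3) cf this]
      have "(\<lambda>m. a m p) \<longlonglongrightarrow> 0" by (simp add: a_def Tv(1) f_def)
      from tendsto_add[OF this this] show ?thesis using \<sigma>2[OF False] by simp
    qed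
  qed
  have "(\<lambda>m. \<Sum>p\<in>I. a m p + a m (\<sigma> p)) \<longlonglongrightarrow> (\<Sum>p\<in>I. 0)" by (rule tendsto_sum[OF lim])
  moreover have "(\<Sum>p\<in>I. a m p + a m (\<sigma> p)) = 2 * (\<Sum>p\<in>I. a m p)" for m
    using sum.reindex_bij_betw[OF bij, of "a m"] by (simp add: sum.distrib)
  ultimately have "(\<lambda>m. 2 * (\<Sum>p\<in>I. a m p)) \<longlonglongrightarrow> 0" by simp
  from tendsto_mult[OF tendsto_const[of "- (1/2)"] this]
  have lim0: "(\<lambda>m. - (\<Sum>p\<in>I. a m p)) \<longlonglongrightarrow> 0" by simp
  have "(\<Sum>T\<in>\<S>. LINT x|lborel. cutoff (verts T) m x * (\<Sum>i\<in>UNIV. partial i (G T i) x)) = - (\<Sum>p\<in>I. a m p)" for m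
  proof -
    have "(\<Sum>p\<in>I. a m p) = (\<Sum>T\<in>\<S>. \<Sum>v\<in>verts T. a m (T, v))"
      unfolding I_def by (subst sum.Sigma) (use mesh_finite[OF m] simplex_verts_finite[OF C(1)] in auto)
    then show ?thesis using cutoff_divergence[OF C(1) G] by (simp add: a_def sum_negf)
  qed
  then have "(\<lambda>m. \<Sum>T\<in>\<S>. LINT x|lborel. cutoff (verts T) m x * (\<Sum>i\<in>UNIV. partial i (G T i) x)) \<longlonglongrightarrow> 0"
    using lim0 by simp
  moreover have "(\<lambda>m. \<Sum>T\<in>\<S>. LINT x|lborel. cutoff (verts T) m x * (\<Sum>i\<in>UNIV. partial i (G T i) x))
    \<longlonglongrightarrow> (\<Sum>T\<in>\<S>. LINT x|lborel. indicator T x * (\<Sum>i\<in>UNIV. partial i (G T i) x))"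
  proof (rule tendsto_sum)
    fix T assume T: "T \<in> \<S>"
    have "continuous_on UNIV (\<lambda>x. \<Sum>i\<in>UNIV. partial i (G T i) x)"
      by (intro continuous_intros C1_partial_continuous[OF G[OF T]])
    from cutoff_limit[OF C(1)[OF T] this]
    show "(\<lambda>m. LINT x|lborel. cutoff (verts T) m x * (\<Sum>i\<in>UNIV. partial i (G T i) x))
      \<longlonglongrightarrow> (LINT x|lborel. indicator T x * (\<Sum>i\<in>UNIV. partial i (G T i) x))" by (simp add: C(2)[OF T])
  qed
  ultimately show ?thesis by (rule LIMSEQ_unique[symmetric])
qed


section \<open>Degrees of freedom and normal traces\<close>

lemma tangent_space_subspace: "subspace (tangent_space f)"
  by (simp add: tangent_space_def)

lemma tangent_space_mono: "f \<subseteq> f' \<Longrightarrow> tangent_space f \<subseteq> tangent_space f'"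
  unfolding tangent_space_def by (intro span_mono) blast

section \<open>Integration over a face\<close>

lemma orthonormal_finite: "orthonormal B \<Longrightarrow> finite B"
  unfolding orthonormal_def
  by (intro independent_imp_finite pairwise_orthogonal_independent) auto

lemma face_measure_cases:
  fixes f :: "'n::finite pt set"
  assumes "f \<noteq> {}"
  obtains B a where "orthonormal B" "span B = tangent_space f" "a \<in> f"
    "face_measure f = distr (PiM B (\<lambda>_. lborel)) borel (\<lambda>t. a + (\<Sum>b\<in>B. t b *\<^sub>R b))"
proof -
  define B where "B = (SOME B. orthonormal B \<and> span B = tangent_space f)"
  define a where "a = (SOME a. a \<in> f)"
  obtain B0 where "pairwise orthogonal B0" "\<And>x. x \<in> B0 \<Longrightarrow> norm x = 1" "span B0 = tangent_space f"
    using orthonormal_basis_subspace[OF tangent_space_subspace] by metis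
  then have "\<exists>B. orthonormal B \<and> span B = tangent_space f" by (auto simp: orthonormal_def)
  then have B: "orthonormal B \<and> span B = tangent_space f" unfolding B_def by (rule someI_ex)
  have a: "a \<in> f" unfolding a_def using assms by (simp add: some_in_eq)
  show ?thesis
    by (rule that[of B a]) (use B a in \<open>simp_all add: face_measure_def Let_def flip: B_def a_def\<close>)
qed

lemma orthonormal_inner_sum:
  assumes B: "orthonormal B" and c: "c \<in> B"
  shows "(\<Sum>b\<in>B. t b *\<^sub>R b) \<bullet> c = t c"
proof -
  have "(\<Sum>b\<in>B. t b *\<^sub>R b) \<bullet> c = (\<Sum>b\<in>B. if b = c then t c else 0)"
    unfolding inner_sum_left
  proof (rule sum.cong[OF refl])
    fix b assume b: "b \<in> B"
    show "(t b *\<^sub>R b) \<bullet> c = (if b = c then t c else 0)"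
      using B b c by (auto simp: orthonormal_def pairwise_def orthogonal_def dot_square_norm)
  qed
  then show ?thesis using orthonormal_finite[OF B] c by simp
qed

lemma orthonormal_expand:
  assumes B: "orthonormal B" and v: "v \<in> span B"
  shows "(\<Sum>b\<in>B. (v \<bullet> b) *\<^sub>R b) = v"
proof -
  obtain u where u: "v = (\<Sum>b\<in>B. u b *\<^sub>R b)"
    using v span_finite[OF orthonormal_finite[OF B]] by auto
  then have "v \<bullet> b = u b" if "b \<in> B" for b using orthonormal_inner_sum[OF B that] by simp
  then show ?thesis using u by simp
qed

lemma affine_hull_add_tangent:
  assumes "p \<in> affine hull f" "v \<in> tangent_space f" shows "p + v \<in> affine hull f"
proof -
  have "\<forall>p\<in>affine hull f. p + v \<in> affine hull f"
    using assms(2) unfolding tangent_space_def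
  proof (induction rule: span_induct)
    case base
    show ?case
    proof (rule subspaceI)
      fix c u assume *: "u \<in> {v. \<forall>p\<in>affine hull f. p + v \<in> affine hull f}"
      show "c *\<^sub>R u \<in> {v. \<forall>p\<in>affine hull f. p + v \<in> affine hull f}"
      proof (intro CollectI ballI)
        fix p assume p: "p \<in> affine hull f"
        then have "p + u \<in> affine hull f" using * by blast
        from mem_affine_3_minus[OF affine_affine_hull p this p, of c]
        show "p + c *\<^sub>R u \<in> affine hull f" by simp
      qed
    qed (auto simp: add.assoc[symmetric])
  next
    case (step w)
    then obtain x y where xy: "w = x - y" "x \<in> f" "y \<in> f" by blast
    show ?case
    proof
      fix p assume p: "p \<in> affine hull f"
      from mem_affine_3_minus[OF affine_affine_hull p hull_inc[OF xy(2)] hull_inc[OF xy(3)], of 1]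
      show "p + w \<in> affine hull f" by (simp add: xy(1))
    qed
  qed
  then show ?thesis using assms(1) by blast
qed

lemma sum_components_measurable:
  fixes B :: "'a::euclidean_space set"
  shows "(\<lambda>t. a + (\<Sum>b\<in>B. t b *\<^sub>R b)) \<in> PiM B (\<lambda>_. lborel) \<rightarrow>\<^sub>M borel"
  by (intro borel_measurable_add borel_measurable_const borel_measurable_sum borel_measurable_scaleR
      measurable_component_singleton[of _ B "\<lambda>_. lborel :: real measure", simplified])

text \<open>In the isometric parametrisation a compact face lies in a cube, so its measure is
  finite, and a continuous function is bounded on it.\<close>

lemma face_integrable:
  fixes f :: "'n::finite pt set"
  assumes f: "compact f" and h: "continuous_on UNIV h"
  shows "set_integrable (face_measure f) f (h :: 'n pt \<Rightarrow> real)"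
proof (cases "f = {}")
  case False
  then obtain B a where B: "orthonormal B" "span B = tangent_space f" and a: "a \<in> f"
    and fm: "face_measure f = distr (PiM B (\<lambda>_. lborel)) borel (\<lambda>t. a + (\<Sum>b\<in>B. t b *\<^sub>R b))"
    by (rule face_measure_cases)
  define \<phi> where "\<phi> t = a + (\<Sum>b\<in>B. t b *\<^sub>R b)" for t
  interpret finite_product_sigma_finite "\<lambda>_. lborel :: real measure" B
    using orthonormal_finite[OF B(1)] by unfold_locales
  have \<phi>: "\<phi> \<in> PiM B (\<lambda>_. lborel) \<rightarrow>\<^sub>M borel" unfolding \<phi>_def by (rule sum_components_measurable)
  obtain R where R: "\<And>x. x \<in> f \<Longrightarrow> norm x \<le> R" using compact_imp_bounded[OF f] unfolding bounded_iff by blast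
  define M where "M = R + norm a"
  have sub: "\<phi> -` f \<inter> space (PiM B (\<lambda>_. lborel)) \<subseteq> (\<Pi>\<^sub>E b\<in>B. {-M..M})"
  proof
    fix t assume t: "t \<in> \<phi> -` f \<inter> space (PiM B (\<lambda>_. lborel))"
    have "\<bar>t b\<bar> \<le> M" if b: "b \<in> B" for b
    proof -
      have "t b = (\<phi> t - a) \<bullet> b" using orthonormal_inner_sum[OF B(1) b, of t] by (simp add: \<phi>_def)
      also have "\<bar>\<dots>\<bar> \<le> norm (\<phi> t - a) * norm b" by (rule Cauchy_Schwarz_ineq2)
      also have "\<dots> \<le> M" using B(1) b R[of "\<phi> t"] t norm_triangle_ineq4[of "\<phi> t" a] by (simp add: orthonormal_def M_def)
      finally show ?thesis .
    qed
    then have "- M \<le> t b \<and> t b \<le> M" if "b \<in> B" for b using that by (simp add: abs_le_iff minus_le_iff)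
    then show "t \<in> (\<Pi>\<^sub>E b\<in>B. {-M..M})" using t by (auto simp: space_PiM PiE_iff)
  qed
  have "emeasure (face_measure f) f = emeasure (PiM B (\<lambda>_. lborel)) (\<phi> -` f \<inter> space (PiM B (\<lambda>_. lborel)))"
    unfolding fm \<phi>_def[symmetric] using emeasure_distr[OF \<phi>, of f] borel_compact[OF f] by simp
  also have "\<dots> \<le> emeasure (PiM B (\<lambda>_. lborel)) (\<Pi>\<^sub>E b\<in>B. {-M..M})"
    by (intro emeasure_mono sub sets_PiM_I_finite finite_index) auto
  also have "\<dots> = (\<Prod>b\<in>B. emeasure lborel {-M..M})"
    by (rule measure_times) auto
  also have "\<dots> < \<infinity>"
    by (simp add: emeasure_lborel_Icc_eq power_eq_top_ennreal less_top[symmetric])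
  finally have fin: "emeasure (face_measure f) f < \<infinity>" .
  have "bounded (h ` f)"
    by (intro compact_imp_bounded compact_continuous_image f continuous_on_subset[OF h]) auto
  then obtain D where D: "\<And>x. x \<in> f \<Longrightarrow> norm (h x) \<le> D" unfolding bounded_iff by auto
  have sets: "sets (face_measure f) = sets borel" unfolding fm by simp
  show ?thesis unfolding set_integrable_def
  proof (rule integrableI_bounded_set_indicator[OF _ _ fin])
    show "f \<in> sets (face_measure f)" using sets borel_compact[OF f] by simp
    show "h \<in> borel_measurable (face_measure f)"
      using borel_measurable_continuous_onI[OF h] measurable_cong_sets[OF sets refl] by blast
    show "AE x\<in>f in face_measure f. norm (h x) \<le> D" using D by auto
  qed
qed (simp add: set_integrable_def)

text \<open>A positive value at a relative interior point would persist on the image of a small open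
  cube of parameters that is mapped into \<open>f\<close>, and such a cube has positive
  measure.\<close>

lemma face_integral_zero:
  fixes f :: "'n::finite pt set"
  assumes f: "compact f" "convex f" and h: "continuous_on UNIV h" "\<And>x. x \<in> f \<Longrightarrow> 0 \<le> h x"
    and zero: "set_lebesgue_integral (face_measure f) f h = (0::real)" and x0: "x0 \<in> rel_interior f"
  shows "h x0 = 0"
proof (rule ccontr)
  assume "h x0 \<noteq> 0"
  have x0f: "x0 \<in> f" using x0 rel_interior_subset by blast
  then have "f \<noteq> {}" by blast
  have pos: "0 < h x0" using x0f h(2) \<open>h x0 \<noteq> 0\<close> by force
  obtain B a where B: "orthonormal B" "span B = tangent_space f" and a: "a \<in> f"
    and fm: "face_measure f = distr (PiM B (\<lambda>_. lborel)) borel (\<lambda>t. a + (\<Sum>b\<in>B. t b *\<^sub>R b))"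
    by (rule face_measure_cases[OF \<open>f \<noteq> {}\<close>])
  define \<phi> where "\<phi> t = a + (\<Sum>b\<in>B. t b *\<^sub>R b)" for t
  interpret finite_product_sigma_finite "\<lambda>_. lborel :: real measure" B
    using orthonormal_finite[OF B(1)] by unfold_locales
  have \<phi>: "\<phi> \<in> PiM B (\<lambda>_. lborel) \<rightarrow>\<^sub>M borel" unfolding \<phi>_def by (rule sum_components_measurable)
  have "AE x in face_measure f. indicator f x *\<^sub>R h x = 0"
    using zero face_integrable[OF f(1) h(1)] h(2) unfolding set_lebesgue_integral_def set_integrable_def
    by (subst integral_nonneg_eq_0_iff_AE[symmetric]) (auto simp: indicator_def)
  then have AE: "AE t in PiM B (\<lambda>_. lborel). indicator f (\<phi> t) *\<^sub>R h (\<phi> t) = 0"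
    unfolding fm \<phi>_def[symmetric] by (rule AE_distrD[OF \<phi>])
  obtain e1 where e1: "e1 > 0" "ball x0 e1 \<inter> affine hull f \<subseteq> f" using x0 mem_rel_interior_ball by blast
  have "open {x. 0 < h x}" by (intro open_Collect_less continuous_intros h)
  then obtain e2 where e2: "e2 > 0" "ball x0 e2 \<subseteq> {x. 0 < h x}" using pos open_contains_ball by blast
  \<comment> \<open>A deviation below \<delta> in each parameter moves the point by at most
    \<open>card B\<close> times \<delta>. The added 1 makes this strictly smaller than both radii,
    also when \<open>B\<close> is empty.\<close>
  define \<delta> where "\<delta> = min e1 e2 / (1 + real (card B))"
  have \<delta>: "\<delta> > 0" using e1 e2 by (simp add: \<delta>_def)
  define Q where "Q = (\<Pi>\<^sub>E b\<in>B. {(x0 - a) \<bullet> b - \<delta> <..< (x0 - a) \<bullet> b + \<delta>})"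
  have "x0 - a \<in> span B" unfolding B(2) tangent_space_def using x0f a by (intro span_base) blast
  then have x0eq: "x0 = a + (\<Sum>b\<in>B. ((x0 - a) \<bullet> b) *\<^sub>R b)" using orthonormal_expand[OF B(1)] by simp
  have inQ: "\<not> indicator f (\<phi> t) *\<^sub>R h (\<phi> t) = 0" if t: "t \<in> Q" for t
  proof -
    have "\<phi> t - x0 = (\<Sum>b\<in>B. (t b - (x0 - a) \<bullet> b) *\<^sub>R b)"
      by (subst x0eq) (simp add: \<phi>_def sum_subtractf scaleR_diff_left)
    then have "norm (\<phi> t - x0) \<le> (\<Sum>b\<in>B. norm ((t b - (x0 - a) \<bullet> b) *\<^sub>R b))" by (simp only: norm_sum)
    also have "\<dots> \<le> (\<Sum>b\<in>B. \<delta>)"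
    proof (rule sum_mono)
      fix b assume b: "b \<in> B"
      then have "\<bar>t b - (x0 - a) \<bullet> b\<bar> \<le> \<delta>" using t unfolding Q_def by (auto dest!: PiE_mem[OF _ b])
      then show "norm ((t b - (x0 - a) \<bullet> b) *\<^sub>R b) \<le> \<delta>" using B(1) b by (simp add: orthonormal_def)
    qed
    also have "\<dots> < min e1 e2"
    proof -
      have "(1 + real (card B)) * \<delta> = min e1 e2" unfolding \<delta>_def by simp
      then have "\<delta> + real (card B) * \<delta> = min e1 e2" by (simp only: distrib_right mult_1_left)
      then show ?thesis unfolding sum_constant using \<delta> by linarith
    qed
    finally have n: "norm (\<phi> t - x0) < min e1 e2" .
    have "(\<Sum>b\<in>B. t b *\<^sub>R b) \<in> tangent_space f" unfolding B(2)[symmetric] by (intro span_sum span_scale span_base)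
    then have "\<phi> t \<in> affine hull f" unfolding \<phi>_def using a by (intro affine_hull_add_tangent hull_inc)
    then have "\<phi> t \<in> f" using e1 n by (auto simp: dist_norm norm_minus_commute)
    moreover have "0 < h (\<phi> t)" using e2 n by (auto simp: dist_norm norm_minus_commute)
    ultimately show ?thesis by simp
  qed
  have Qs: "Q \<in> sets (PiM B (\<lambda>_. lborel))" unfolding Q_def by (intro sets_PiM_I_finite finite_index) auto
  have "AE t in PiM B (\<lambda>_. lborel). t \<notin> Q" using AE by eventually_elim (use inQ in blast)
  then have "emeasure (PiM B (\<lambda>_. lborel)) Q = 0"
    using Qs sets.sets_into_space[OF Qs] by (subst (asm) AE_iff_measurable[OF Qs]) auto
  moreover have "emeasure (PiM B (\<lambda>_. lborel)) Q = (\<Prod>b\<in>B. emeasure lborel {(x0 - a) \<bullet> b - \<delta> <..< (x0 - a) \<bullet> b + \<delta>})"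
    unfolding Q_def by (rule measure_times) auto
  moreover have "\<dots> = (\<Prod>b\<in>B. ennreal (2 * \<delta>))" using \<delta> by (simp add: algebra_simps)
  ultimately show False using \<delta> finite_index by (simp add: prod_ennreal)
qed

text \<open>The spans of the tangential and of the normal vectors are orthogonal and their
  dimensions add up to n, so together the vectors form a basis. A vector normal to the face then has
  no tangential part.\<close>

lemma
  fixes b :: "'n::{finite,linorder} \<Rightarrow> 'n pt"
  assumes tn: "tn_basis l f b"
  shows tn_inj: "inj b" and tn_independent: "independent (range b)"
    and tn_normal_span: "(\<And>w. w \<in> tangent_space f \<Longrightarrow> n \<bullet> w = 0) \<Longrightarrow> n \<in> span (b ` {i. l \<le> pos i})"
proof -
  let ?I = "{i :: 'n. pos i < l}" and ?J = "{i :: 'n. l \<le> pos i}"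
  let ?S = "span (b ` ?I)" and ?N = "span (b ` ?J)"
  have st: "?S \<subseteq> tangent_space f"
    using tn by (intro span_minimal tangent_space_subspace) (auto simp: tn_basis_def)
  have no: "m \<bullet> w = 0" if "m \<in> ?N" "w \<in> tangent_space f" for m w
    using that(1)
  proof (induction rule: span_induct)
    case base
    show ?case by (rule subspaceI) (auto simp: inner_left_distrib)
  next
    case (step x) then show ?case using tn that(2) by (auto simp: tn_basis_def)
  qed
  have int0: "?S \<inter> ?N = {0}"
  proof (intro equalityI subsetI)
    fix x assume "x \<in> ?S \<inter> ?N"
    then have "x \<bullet> x = 0" using no st by blast
    then show "x \<in> {0}" by simp
  qed (auto simp: span_zero)
  have U: "range b = b ` ?I \<union> b ` ?J" by (auto simp: image_iff) (metis not_le)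
  have "dim {x + y |x y. x \<in> ?S \<and> y \<in> ?N} + dim (?S \<inter> ?N) = dim ?S + dim ?N"
    by (intro dim_sums_Int) auto
  moreover have "{x + y |x y. x \<in> ?S \<and> y \<in> ?N} = span (range b)" unfolding U span_Un by blast
  moreover have "dim ?S = card ?I" "dim ?N = card ?J"
    using tn by (simp_all add: tn_basis_def dim_eq_card_independent card_image)
  moreover have "card ?I + card ?J = CARD('n)"
    by (subst card_Un_disjoint[symmetric]) (auto intro!: arg_cong[where f = card])
  ultimately have dim: "dim (span (range b)) = CARD('n)" using int0 by simp
  then have spanU: "span (range b) = UNIV" using dim_eq_full[of "range b"] by simp
  have "CARD('n) \<le> card (range b)" using dim dim_le_card'[of "range b"] by simp
  then have c: "card (range b) = CARD('n)" using card_image_le[of UNIV b] by simp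
  then show "inj b" by (simp add: eq_card_imp_inj_on)
  show "independent (range b)" using c spanU by (intro card_le_dim_spanning[of _ UNIV]) auto
  show "n \<in> ?N" if n: "\<And>w. w \<in> tangent_space f \<Longrightarrow> n \<bullet> w = 0"
  proof -
    have "n \<in> span (b ` ?I \<union> b ` ?J)" using spanU U by auto
    then obtain t m where tm: "n = t + m" "t \<in> ?S" "m \<in> ?N" unfolding span_Un by blast
    have "t \<bullet> t = n \<bullet> t - m \<bullet> t" by (simp add: tm(1) inner_left_distrib)
    also have "\<dots> = 0" using n no tm st by auto
    finally show ?thesis using tm by simp
  qed
qed

text \<open>The factors are split off one vertex at a time. After division by the product over
  \<open>J\<close>, the quotient still vanishes on the facet opposite the next vertex
  \<open>v\<close>: \<open>J\<close> does not contain \<open>v\<close>, so the product is positive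
  inside that facet, and continuity reaches its boundary.\<close>

lemma poly_divides_bary:
  assumes C: "simplex_verts C" and K: "K \<subseteq> C" "2 \<le> card K" and g: "g \<in> poly_fun r"
    and zero: "\<And>v x. v \<in> K \<Longrightarrow> x \<in> convex hull (K - {v}) \<Longrightarrow> g x = 0"
    and J: "J \<subseteq> K" "card J \<le> r"
  shows "\<exists>q\<in>poly_fun (r - card J). \<forall>x\<in>convex hull K. g x = (\<Prod>v\<in>J. bary C v x) * q x"
proof -
  have fin: "finite C" "finite K" "finite J" using simplex_verts_finite[OF C] K J by (auto intro: finite_subset)
  have ind: "\<not> affine_dependent C" using C by (simp add: simplex_verts_def)
  show ?thesis using fin(3) J
  proof (induction J)
    case empty
    then show ?case using g by (intro bexI[of _ g]) auto
  next
    case (insert v J)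
    then obtain q where q: "q \<in> poly_fun (r - card J)" "\<And>x. x \<in> convex hull K \<Longrightarrow> g x = (\<Prod>v\<in>J. bary C v x) * q x"
      by auto
    have v: "v \<in> K" "v \<in> C" using insert K by auto
    define L where "L = K - {v}"
    have L: "L \<noteq> {}" "finite L" "L \<subseteq> C" "L \<subseteq> K" using K v fin unfolding L_def
      by (auto dest: card_mono[rotated, of _ "{v}"])
    have LK: "convex hull L \<subseteq> convex hull K" using L(4) by (rule hull_mono)
    obtain w where w: "w \<in> L" using L(1) by blast
    define c where "c = (\<Sum>u\<in>L. (1 / real (card L)) *\<^sub>R u)"
    have s1: "(\<Sum>u\<in>L. 1 / real (card L)) = 1" using L by simp
    have cL: "c \<in> convex hull L" unfolding c_def convex_hull_finite[OF L(2)]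
      using s1 by (intro CollectI exI[of _ "\<lambda>u. 1 / real (card L)"]) auto
    have bc: "0 < bary C u c" if u: "u \<in> L" for u
    proof -
      have "bary C u c = (\<Sum>w\<in>L. 1 / real (card L) * bary C u w)" unfolding c_def by (rule bary_combination[OF s1])
      also have "\<dots> = (\<Sum>w\<in>L. if w = u then 1 / real (card L) else 0)"
      proof (rule sum.cong[OF refl])
        fix w assume "w \<in> L"
        then have "u \<in> C" "w \<in> C" using u L(3) by blast+
        then show "1 / real (card L) * bary C u w = (if w = u then 1 / real (card L) else 0)"
          by (simp add: bary_vertex[OF ind])
      qed
      finally show ?thesis using L u by (simp add: card_gt_0_iff)
    qed
    have q0: "q x = 0" if x: "x \<in> convex hull L" for x
    proof -
      \<comment> \<open>For 0 < \<open>t\<close> \<le> 1 the point has positive coordinates at all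
        vertices of \<open>L\<close>, so there the zero of \<open>g\<close> is a zero of
        \<open>q\<close>. The limit at 0 from the right is the value at \<open>x\<close>.\<close>
      define h where "h t = q (x + t *\<^sub>R (c - x))" for t
      have h0: "h t = 0" if t: "0 < t" "t \<le> 1" for t
      proof -
        define y where "y = x + t *\<^sub>R (c - x)"
        have "y = (1 - t) *\<^sub>R x + t *\<^sub>R c" by (simp add: y_def algebra_simps)
        then have yL: "y \<in> convex hull L" using x cL t convexD_alt[OF convex_convex_hull x cL, of t] by simp
        have "0 < bary C u y" if u: "u \<in> L" for u
        proof -
          have "bary C u y = (1 - t) * bary C u x + t * bary C u c"
            unfolding y_def bary_add_scale bary_diff[symmetric] by (simp add: algebra_simps)
          moreover have "0 \<le> bary C u x" using x convex_hull_bary[OF C L(3)] u L by blast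
          ultimately show ?thesis using t bc[OF u] by (simp add: add_nonneg_pos)
        qed
        moreover have "J \<subseteq> L" using insert by (auto simp: L_def)
        ultimately have "0 < (\<Prod>u\<in>J. bary C u y)" by (intro prod_pos) auto
        moreover have "g y = 0" using zero[OF v(1)] yL unfolding L_def by blast
        ultimately have "q y = 0" using q(2)[of y] yL LK by auto
        then show ?thesis by (simp add: h_def y_def)
      qed
      have "continuous_on UNIV h" unfolding h_def
        by (intro continuous_on_compose2[OF poly_fun_continuous_on[OF q(1)]] continuous_intros) auto
      then have "(h \<longlongrightarrow> h 0) (at_right 0)"
        by (metis UNIV_I continuous_on_def tendsto_within_subset subset_UNIV)
      moreover have "\<forall>\<^sub>F t in at_right 0. h t = 0"
        unfolding eventually_at_right_field by (intro exI[of _ 1]) (use h0 in auto)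
      then have "(h \<longlongrightarrow> 0) (at_right 0)" by (rule tendsto_eventually)
      ultimately have "h 0 = 0" by (intro tendsto_unique[of "at_right (0::real)" h]) auto
      then show ?thesis by (simp add: h_def)
    qed
    obtain q' where q': "q' \<in> poly_fun (r - card J - 1)"
      "\<And>x. q x = q (x - bary C v x *\<^sub>R (v - w)) + bary C v x * q' x"
      using poly_fun_division[OF q(1), of "bgrad C v" "1 - bgrad C v \<bullet> v" "v - w"] unfolding bary_def by metis
    show ?case
    proof (intro bexI[of _ q'] ballI)
      show "q' \<in> poly_fun (r - card (insert v J))" using q'(1) insert by simp
      fix x assume x: "x \<in> convex hull K"
      define \<pi> where "\<pi> = x - bary C v x *\<^sub>R (v - w)"
      have bx: "\<forall>u\<in>C. 0 \<le> bary C u x" "\<forall>u\<in>C - K. bary C u x = 0"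
        using x convex_hull_bary[OF C K(1)] by auto
      have bp: "bary C u \<pi> = bary C u x - bary C v x * (bary C u v - bary C u w)" for u
        using bary_add_scale[of C u x "- bary C v x" "v - w"] by (simp add: \<pi>_def bary_diff)
      have wC: "w \<in> C" "w \<noteq> v" using w L by (auto simp: L_def)
      have "0 \<le> bary C u \<pi>" if u: "u \<in> C" for u
      proof -
        have "0 \<le> bary C u x" "0 \<le> bary C v x" using bx(1) u v(2) by auto
        then show ?thesis using v(2) wC unfolding bp by (auto simp: bary_vertex[OF ind u])
      qed
      moreover have "bary C u \<pi> = 0" if u: "u \<in> C - L" for u
        using bx u v(2) wC w unfolding bp by (auto simp: bary_vertex[OF ind] L_def)
      ultimately have "\<pi> \<in> convex hull L" using convex_hull_bary[OF C L(3)] by blast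
      then have "q x = bary C v x * q' x" using q'(2)[of x] q0 by (simp add: \<pi>_def)
      then show "g x = (\<Prod>v\<in>insert v J. bary C v x) * q' x"
        using q(2)[OF x] insert.hyps by simp
    qed
  qed
qed

section \<open>Free indices and normal traces\<close>

lemma front_subfam:
  fixes z :: "'n::{finite,linorder} \<Rightarrow> 'n pt"
  assumes i: "i \<notin> \<tau>"
  obtains m where "\<And>\<alpha>. \<alpha> \<in> Alt (card (insert i \<tau>)) \<Longrightarrow> \<alpha> (z i # subfam z \<tau>) = (-1) ^ m * \<alpha> (subfam z (insert i \<tau>))"
proof -
  let ?L = "sorted_list_of_set (insert i \<tau>)"
  have "i \<in> set ?L" by (subst set_sorted_list_of_set) auto
  then obtain xs ys where L: "?L = xs @ i # ys" "i \<notin> set xs" using split_list_first by metis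
  have "sorted_list_of_set \<tau> = remove1 i ?L"
    using i sorted_list_of_set.sorted_key_list_of_set_remove[of "insert i \<tau>" i] by simp
  then have \<tau>: "sorted_list_of_set \<tau> = xs @ ys" using L by (simp add: remove1_append)
  have "\<alpha> (z i # subfam z \<tau>) = (-1) ^ length xs * \<alpha> (subfam z (insert i \<tau>))" if \<alpha>: "\<alpha> \<in> Alt (card (insert i \<tau>))" for \<alpha>
  proof -
    have len: "length (subfam z (insert i \<tau>)) = card (insert i \<tau>)" using i by simp
    have "length xs < length ?L" using L by simp
    then have lt: "length xs < card (insert i \<tau>)" using i by simp
    have "subfam z (insert i \<tau>) ! length xs = z i" "del (length xs) (subfam z (insert i \<tau>)) = subfam z \<tau>"
      unfolding L \<tau> by (simp_all add: nth_append del_def)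
    then show ?thesis using Alt_front[OF \<alpha> len lt] by simp
  qed
  then show ?thesis using that by blast
qed

lemma pair_index_eq:
  assumes "- \<tau> \<noteq> {}"
  shows "pair_index \<tau> = (insert (Min (- \<tau>)) \<tau>, Min (- \<tau>))"
  using sorted_list_of_set_nonempty[of "- \<tau>"] assms by (simp add: pair_index_def constraint_seq_def)

text \<open>Such an index heads the constraint sequence of some \<tau>, and all other members of the
  sequence are free because their second entry is not the least index outside \<tau>. Since
  \<open>i\<close> is that least index, they come after it and are normal whenever \<open>i\<close>
  is.\<close>

lemma nonfree_index:
  fixes \<sigma> :: "'n::{finite,linorder} set"
  assumes k: "1 \<le> k" "k \<le> CARD('n) - 1" and \<sigma>: "card \<sigma> = k" and nf: "\<not> free_index k (\<sigma>, i)"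
  obtains \<tau> where "card \<tau> = k - 1" "i \<notin> \<tau>" "\<sigma> = insert i \<tau>" "\<And>j. j \<notin> \<tau> \<Longrightarrow> i \<le> j"
    "\<And>j. j \<notin> \<tau> \<Longrightarrow> j \<noteq> i \<Longrightarrow> free_index k (insert j \<tau>, j)"
proof -
  have ne: "- \<tau> \<noteq> {}" if "card \<tau> = k - 1" for \<tau> :: "'n set"
  proof
    assume "- \<tau> = {}"
    then have "\<tau> = UNIV" by auto
    then have "CARD('n) = k - 1" using that by simp
    then show False using k by linarith
  qed
  obtain \<tau> where \<tau>: "card \<tau> = k - 1" "(\<sigma>, i) = pair_index \<tau>" using nf \<sigma> by (auto simp: free_index_def)
  then have e: "\<sigma> = insert (Min (- \<tau>)) \<tau>" "i = Min (- \<tau>)" using pair_index_eq[OF ne] by auto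
  have i: "i \<notin> \<tau>" using Min_in[of "- \<tau>"] ne[OF \<tau>(1)] e(2) by auto
  have min: "i \<le> j" if "j \<notin> \<tau>" for j using e(2) that by simp
  show ?thesis
  proof (rule that[OF \<tau>(1) i _ min])
    show "\<sigma> = insert i \<tau>" using e by simp
    fix j assume j: "j \<notin> \<tau>" "j \<noteq> i"
    have "(insert j \<tau>, j) \<noteq> pair_index \<tau>'" if \<tau>': "card \<tau>' = k - 1" for \<tau>'
    proof
      assume "(insert j \<tau>, j) = pair_index \<tau>'"
      then have j': "insert j \<tau> = insert j \<tau>'" "j = Min (- \<tau>')" using pair_index_eq[OF ne[OF \<tau>']] by auto
      then have "j \<notin> \<tau>'" using Min_in[of "- \<tau>'"] ne[OF \<tau>'] by auto
      then have "\<tau> = \<tau>'" using j'(1) j(1) by (metis Diff_insert_absorb)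
      then show False using j'(2) e(2) j(2) by simp
    qed
    moreover have "card (insert j \<tau>) = k" using j(1) \<tau>(1) k(1) by simp
    ultimately show "free_index k (insert j \<tau>, j)" by (simp add: free_index_def)
  qed
qed

lemma pos_mono: "(i :: 'n::{finite,linorder}) \<le> j \<Longrightarrow> pos i \<le> pos j"
  unfolding pos_def by (intro card_mono) auto

lemma proxy_inner: "proxy \<beta> \<bullet> n = (\<Sum>i\<in>UNIV. ((-1) ^ pos i * n $ i) * \<beta> (std_vecs (- {i})))"
  by (simp add: proxy_def inner_vec_def mult_ac)

lemma proxy_Alt:
  assumes "\<omega> \<in> AltT k m" shows "(\<lambda>ws. proxy (\<omega> ws) \<bullet> n) \<in> Alt k"
  unfolding proxy_inner by (intro Alt_sum Alt_scale) (use assms in \<open>simp add: AltT_def\<close>)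

lemma proxy_poly:
  assumes "\<delta> \<in> poly_tform r E" shows "(\<lambda>x. proxy (\<delta> x ws) \<bullet> n) \<in> poly_fun r"
  unfolding proxy_inner by (intro poly_fun_sum poly_fun_cmult) (use assms in \<open>simp add: poly_tform_def\<close>)

lemma tform_inner_scale: "tform_inner k m \<omega> (\<lambda>ws vs. c * \<theta> ws vs) = c * tform_inner k m \<omega> \<theta>"
  by (simp add: tform_inner_def sum_distrib_left mult_ac)

lemma dof_space_single:
  assumes q: "q \<in> poly_fun (r - (l + 1))" and free: "free_index k (\<sigma>, i)" and i: "i \<in> normal_indices l"
  shows "(\<lambda>x ws vs. q x * tensor (wedge_set (dual_basis (dy_of b)) \<sigma>) (star (dual_basis (dy_of b)) i) ws vs)
    \<in> dof_space k r l b"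
proof -
  define t where "t = (\<lambda>(\<sigma>, i). tensor (wedge_set (dual_basis (dy_of b)) \<sigma>) (star (dual_basis (dy_of b)) i))"
  define p where "p \<sigma>' i' = (if \<sigma>' = \<sigma> \<and> i' = i then q else (\<lambda>_. 0))" for \<sigma>' i'
  let ?A = "{(\<sigma>', i'). free_index k (\<sigma>', i') \<and> i' \<in> normal_indices l}"
  have A: "(\<sigma>, i) \<in> ?A" using free i by simp
  have "(\<Sum>(\<sigma>', i')\<in>?A. p \<sigma>' i' x * t (\<sigma>', i') ws vs) = q x * t (\<sigma>, i) ws vs" for x ws vs
  proof -
    have "(\<Sum>(\<sigma>', i')\<in>?A. p \<sigma>' i' x * t (\<sigma>', i') ws vs) = (\<Sum>s\<in>?A. if s = (\<sigma>, i) then q x * t (\<sigma>, i) ws vs else 0)"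
      by (rule sum.cong) (auto simp: p_def split: if_splits)
    then show ?thesis using A by (simp add: sum.delta)
  qed
  moreover have "p \<sigma>' i' \<in> poly_fun (r - (l + 1))" for \<sigma>' i'
    using q by (simp add: p_def poly_fun_const)
  ultimately show ?thesis unfolding dof_space_def Let_def
    by (intro CollectI exI[of _ p]) (auto simp: t_def fun_eq_iff)
qed

text \<open>
  The degrees of freedom on the subsimplices of a face determine the normal components on it.  The
  induction is on the dimension: on a subsimplex the free components vanish on the boundary, hence
  are divisible by the bubble function, and the remaining factor is annihilated by the moments.  The
  components that are not free follow from the constraints.
\<close>

lemma normal_trace_zero:
  fixes \<delta> :: "'n::{finite,linorder} pt \<Rightarrow> 'n tform"
  assumes C: "simplex_verts C" and K0: "K0 \<subseteq> C" and k: "1 \<le> k" "k \<le> CARD('n) - 1"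
    and \<delta>: "\<delta> \<in> poly_tform r (XX k)" and r: "CARD('n) \<le> r"
    and tn: "\<And>K. K \<subseteq> K0 \<Longrightarrow> K \<noteq> {} \<Longrightarrow> card K \<le> CARD('n) \<Longrightarrow> tn_basis (card K - 1) (convex hull K) (b (convex hull K))"
    and vert: "\<And>v. v \<in> K0 \<Longrightarrow> \<delta> v = (\<lambda>ws vs. 0)"
    and mom: "\<And>K \<eta>. K \<subseteq> K0 \<Longrightarrow> 2 \<le> card K \<Longrightarrow> card K \<le> CARD('n) \<Longrightarrow>
      \<eta> \<in> dof_space k r (card K - 1) (b (convex hull K)) \<Longrightarrow> face_inner k (convex hull K) \<delta> \<eta> = 0"
    and K: "K \<subseteq> K0" "K \<noteq> {}" "card K \<le> CARD('n)" and x: "x \<in> convex hull K"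
    and n: "\<And>w. w \<in> tangent_space (convex hull K) \<Longrightarrow> n \<bullet> w = 0"
  shows "proxy (\<delta> x ws) \<bullet> n = 0"
proof -
  have finK: "finite K" if "K \<subseteq> K0" for K using that K0 simplex_verts_finite[OF C] by (meson finite_subset)
  have \<delta>X: "\<delta> x \<in> XX k" for x using \<delta> by (simp add: poly_tform_def)
  then have \<delta>A: "\<delta> x \<in> AltT k (CARD('n) - 1)" for x by (simp add: XX_def)
  have "\<forall>K x n ws. card K = Suc l \<longrightarrow> K \<subseteq> K0 \<longrightarrow> card K \<le> CARD('n) \<longrightarrow> x \<in> convex hull K \<longrightarrow>
      (\<forall>w\<in>tangent_space (convex hull K). n \<bullet> w = 0) \<longrightarrow> proxy (\<delta> x ws) \<bullet> n = 0" for l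
  proof (induction l)
    case 0
    show ?case
    proof (intro allI impI)
      fix K x n ws assume "card K = Suc 0" "K \<subseteq> K0" "x \<in> convex hull K"
      then have "x \<in> K0" by (auto simp: card_1_singleton_iff)
      then show "proxy (\<delta> x ws) \<bullet> n = 0" using vert by (simp add: proxy_inner)
    qed
  next
    case (Suc l)
    show ?case
    proof (intro allI impI)
      fix K x n ws
      assume cK: "card K = Suc (Suc l)" and K: "K \<subseteq> K0" and le: "card K \<le> CARD('n)" and x: "x \<in> convex hull K"
        and n: "\<forall>w\<in>tangent_space (convex hull K). n \<bullet> w = 0"
      let ?f = "convex hull K"
      define c where "c = b ?f"
      have KC: "K \<subseteq> C" using K K0 by blast
      have ne: "K \<noteq> {}" using cK by auto
      have tnc: "tn_basis (Suc l) ?f c" using tn[OF K ne le] cK by (simp add: c_def)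
      have inj: "inj c" and ind: "independent (range c)" using tn_inj[OF tnc] tn_independent[OF tnc] by auto
      have span: "span (range c) = UNIV" by (rule family_span_UNIV[OF inj ind])
      obtain z where dual: "\<And>i j. z i \<bullet> c j = (if i = j then 1 else 0)"
        using dual_family_exists[OF inj ind] by blast
      have db: "dual_basis (dy_of c) = dy_of z" by (rule dual_basis_eq[OF dual span])
      have spanz: "span (range z) = UNIV" by (rule dual_span[OF dual span])
      define V where "V = vol (subfam z UNIV)"
      have V: "V \<noteq> 0" unfolding V_def by (rule vol_subfam_nonzero[OF spanz])
      have cn: "c i \<bullet> w = 0" if "i \<in> normal_indices (Suc l)" "w \<in> tangent_space ?f" for i w
        using tnc that by (simp add: tn_basis_def normal_indices_def)
      have f: "compact ?f" "convex ?f" "closed ?f"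
        using finK[OF K] by (auto intro!: compact_imp_closed finite_imp_compact_convex_hull)
      have free0: "proxy (\<delta> y (subfam z \<sigma>)) \<bullet> c i = 0"
        if fr: "free_index k (\<sigma>, i)" and i: "i \<in> normal_indices (Suc l)" and y: "y \<in> ?f" for \<sigma> i y
      proof -
        have c\<sigma>: "card \<sigma> = k" using fr by (simp add: free_index_def)
        define g where "g x = proxy (\<delta> x (subfam z \<sigma>)) \<bullet> c i" for x
        have g: "g \<in> poly_fun r" unfolding g_def by (rule proxy_poly[OF \<delta>])
        have g0: "g x = 0" if v: "v \<in> K" and x: "x \<in> convex hull (K - {v})" for v x
        proof -
          have "card (K - {v}) = Suc l" using v finK[OF K] cK by simp
          moreover have "convex hull (K - {v}) \<subseteq> ?f" by (rule hull_mono) blast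
          then have "\<forall>w\<in>tangent_space (convex hull (K - {v})). c i \<bullet> w = 0"
            using cn[OF i] tangent_space_mono by blast
          ultimately show ?thesis unfolding g_def using Suc.IH x K le cK by (metis Diff_subset Suc_leD subset_trans)
        qed
        \<comment> \<open>One linear factor is split off for each vertex of \<open>K\<close>. The
          face has dimension \<open>card K - 1\<close>, so the degree of the cofactor is precisely
          the one allowed in the moments.\<close>
        obtain q where q: "q \<in> poly_fun (r - card K)" "\<And>x. x \<in> ?f \<Longrightarrow> g x = (\<Prod>v\<in>K. bary C v x) * q x"
        proof -
          have "\<exists>q\<in>poly_fun (r - card K). \<forall>x\<in>?f. g x = (\<Prod>v\<in>K. bary C v x) * q x"
            by (rule poly_divides_bary[OF C KC _ g]) (use g0 cK le r in auto)
          then show thesis using that by blast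
        qed
        \<comment> \<open>The cofactor itself serves as test polynomial. The integrand becomes a
          constant times the bubble times \<open>q\<close> squared, and on the face bubble and
          square are nonnegative.\<close>
        define h where "h x = (\<Prod>v\<in>K. bary C v x) * (q x)\<^sup>2" for x
        have hc: "continuous_on UNIV h"
          unfolding h_def by (intro continuous_intros poly_fun_continuous_on[OF q(1)])
        have bp: "0 \<le> (\<Prod>v\<in>K. bary C v x)" if "x \<in> ?f" for x
          using that convex_hull_bary[OF C KC] KC by (intro prod_nonneg) blast
        have "face_inner k ?f \<delta> (\<lambda>x ws vs. q x * tensor (wedge_set (dual_basis (dy_of c)) \<sigma>) (star (dual_basis (dy_of c)) i) ws vs) = 0"
        proof (rule mom[OF K _ le])
          show "(\<lambda>x ws vs. q x * tensor (wedge_set (dual_basis (dy_of c)) \<sigma>) (star (dual_basis (dy_of c)) i) ws vs)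
              \<in> dof_space k r (card K - 1) (b ?f)"
            unfolding c_def[symmetric] by (rule dof_space_single[OF _ fr]) (use q(1) i cK in auto)
        qed (use cK in simp)
        moreover have "tform_inner k (CARD('n) - 1) (\<delta> x) (\<lambda>ws vs. q x * tensor (wedge_set (dual_basis (dy_of c)) \<sigma>) (star (dual_basis (dy_of c)) i) ws vs)
            = V * (q x * g x)" for x
          unfolding db tform_inner_scale tform_inner_dual[OF \<delta>A c\<sigma> dual] g_def V_def by simp
        ultimately have "set_lebesgue_integral (face_measure ?f) ?f (\<lambda>x. V * (q x * g x)) = 0"
          by (simp add: face_inner_def)
        moreover have "indicator ?f x *\<^sub>R (V * (q x * g x)) = V * (indicator ?f x *\<^sub>R h x)" for x
          using q(2)[of x] by (simp add: indicator_def h_def power2_eq_square)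
        ultimately have "V * set_lebesgue_integral (face_measure ?f) ?f h = 0"
          unfolding set_lebesgue_integral_def by (simp only: integral_mult_right_zero)
        then have "set_lebesgue_integral (face_measure ?f) ?f h = 0" using V by simp
        then have h0: "h x = 0" if "x \<in> rel_interior ?f" for x
          using face_integral_zero[OF f(1,2) hc _ _ that] bp by (simp add: h_def)
        have gr: "g x = 0" if "x \<in> rel_interior ?f" for x
        proof -
          have "x \<in> ?f" using that rel_interior_subset by blast
          then have "(g x)\<^sup>2 = (\<Prod>v\<in>K. bary C v x) * h x" using q(2) by (simp add: h_def power2_eq_square mult_ac)
          then show ?thesis using h0[OF that] by simp
        qed
        \<comment> \<open>The vanishing integral gives zeros in the relative interior only;
          continuity extends them to the whole face.\<close>
        have "y \<in> closure (rel_interior ?f)" using y f by (simp add: convex_closure_rel_interior)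
        then have "g y = 0"
          using continuous_constant_on_closure[OF poly_fun_continuous_on[OF g] gr] by blast
        then show ?thesis by (simp add: g_def)
      qed
      have all0: "proxy (\<delta> x (subfam z \<sigma>)) \<bullet> c i = 0" if c\<sigma>: "card \<sigma> = k" and i: "i \<in> normal_indices (Suc l)" for \<sigma> i
      proof (cases "free_index k (\<sigma>, i)")
        case True then show ?thesis using free0 i x by blast
      next
        case False
        then obtain \<tau> where \<tau>: "card \<tau> = k - 1" "i \<notin> \<tau>" "\<sigma> = insert i \<tau>" "\<And>j. j \<notin> \<tau> \<Longrightarrow> i \<le> j"
            "\<And>j. j \<notin> \<tau> \<Longrightarrow> j \<noteq> i \<Longrightarrow> free_index k (insert j \<tau>, j)"
          using nonfree_index[OF k c\<sigma>] by metis
        have A: "(\<lambda>ws. proxy (\<delta> x ws) \<bullet> m) \<in> Alt k" for m by (rule proxy_Alt[OF \<delta>A])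
        \<comment> \<open>All other terms of the constraint drop out: those with \<open>j\<close> in
          \<tau> by a repeated argument, the rest because their index is free and \<open>j\<close>,
          lying after \<open>i\<close>, is still normal.\<close>
        have "proxy (\<delta> x (z j # subfam z \<tau>)) \<bullet> c j = 0" if j: "j \<noteq> i" for j
        proof (cases "j \<in> \<tau>")
          case True
          then have "\<not> distinct (z j # subfam z \<tau>)" by auto
          then show ?thesis using Alt_not_distinct[OF A] by blast
        next
          case False
          have cj: "card (insert j \<tau>) = k" using False \<tau>(1) k by simp
          obtain m where m: "\<And>\<alpha>. \<alpha> \<in> Alt (card (insert j \<tau>)) \<Longrightarrow> \<alpha> (z j # subfam z \<tau>) = (-1) ^ m * \<alpha> (subfam z (insert j \<tau>))"
            using front_subfam[OF False] by blast
          have "proxy (\<delta> x (z j # subfam z \<tau>)) \<bullet> c j = (-1) ^ m * (proxy (\<delta> x (subfam z (insert j \<tau>))) \<bullet> c j)"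
            by (rule m[unfolded cj, OF A[of "c j"]])
          moreover have "j \<in> normal_indices (Suc l)"
            using i pos_mono[OF \<tau>(4)[OF False]] by (simp add: normal_indices_def)
          ultimately show ?thesis using free0[OF \<tau>(5)[OF False j] _ x] by (simp only: mult_zero_right)
        qed
        then have "(\<Sum>j\<in>UNIV. proxy (\<delta> x (z j # subfam z \<tau>)) \<bullet> c j) = (\<Sum>j\<in>{i}. proxy (\<delta> x (z j # subfam z \<tau>)) \<bullet> c j)"
          by (intro sum.mono_neutral_right) auto
        then have "proxy (\<delta> x (z i # subfam z \<tau>)) \<bullet> c i = 0"
          using XX_constraint[OF \<delta>X dual span, of x "subfam z \<tau>"] by simp
        moreover obtain m where m: "\<And>\<alpha>. \<alpha> \<in> Alt (card (insert i \<tau>)) \<Longrightarrow> \<alpha> (z i # subfam z \<tau>) = (-1) ^ m * \<alpha> (subfam z (insert i \<tau>))"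
          using front_subfam[OF \<tau>(2)] by blast
        have "proxy (\<delta> x (z i # subfam z \<tau>)) \<bullet> c i = (-1) ^ m * (proxy (\<delta> x (subfam z \<sigma>)) \<bullet> c i)"
          by (rule m[folded \<tau>(3), unfolded c\<sigma>, OF A[of "c i"]])
        ultimately show ?thesis by simp
      qed
      have zero: "proxy (\<delta> x ws) \<bullet> c i = 0" if i: "i \<in> normal_indices (Suc l)" for i ws
        using Alt_determined[OF proxy_Alt[OF \<delta>A] spanz] all0[OF _ i] by blast
      have "n \<in> span (c ` {i. Suc l \<le> pos i})" using tn_normal_span[OF tnc] n by blast
      then show "proxy (\<delta> x ws) \<bullet> n = 0"
      proof (induction rule: span_induct)
        case base
        show ?case by (rule subspaceI) (auto simp: inner_right_distrib)
      next
        case (step m)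
        then show ?case using zero by (auto simp: normal_indices_def)
      qed
    qed
  qed
  moreover obtain l where "card K = Suc l" using K finK[OF K(1)] by (metis card_0_eq not0_implies_Suc)
  ultimately show ?thesis using K x n by blast
qed

lemma mesh_face_trans:
  assumes m: "simplicial_mesh \<T>" "T \<in> \<T>" "T' \<in> \<T>" and f: "f face_of T'" "f \<subseteq> T"
  shows "f face_of T"
proof -
  have "f \<subseteq> T'" using f(1) by (rule face_of_imp_subset)
  then have "f face_of (T \<inter> T')" using f by (intro face_of_subset[OF f(1)]) auto
  then show ?thesis using mesh_inter_face[OF m] face_of_trans by blast
qed

lemma subsimplex_hull:
  assumes m: "simplicial_mesh \<T>" "T \<in> \<T>" and K: "K \<subseteq> verts T" "K \<noteq> {}"
  shows "convex hull K \<in> subsimplices (card K - 1) \<T>" "convex hull K \<subseteq> T"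
proof -
  have C: "simplex_verts (verts T)" "convex hull (verts T) = T" using mesh_verts[OF m] mesh_hull[OF m] by auto
  then have ind: "\<not> affine_dependent (verts T)" by (simp add: simplex_verts_def)
  have "finite K" using K(1) simplex_verts_finite[OF C(1)] finite_subset by blast
  then have "int (card K) = int (card K - 1) + 1" using K(2) by (simp add: of_nat_diff Suc_leI card_gt_0_iff)
  then have "int (card K - 1) simplex (convex hull K)"
    using affine_independent_subset[OF ind K(1)] by (intro simplex_convex_hull conjI)
  moreover have face: "(convex hull K) face_of T"
    using face_of_convex_hull_affine_independent[OF ind, of "convex hull K"] K(1) C(2) by auto
  ultimately show "convex hull K \<in> subsimplices (card K - 1) \<T>" using m(2) by (auto simp: subsimplices_def)
  show "convex hull K \<subseteq> T" using face by (rule face_of_imp_subset)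
qed

lemma subsimplex_verts:
  assumes m: "simplicial_mesh \<T>" "T \<in> \<T>" and f: "f \<in> subsimplices l \<T>" "f \<subseteq> T"
  shows "verts f \<subseteq> verts T" "convex hull (verts f) = f" "card (verts f) = Suc l" "f face_of T"
proof -
  obtain T' where T': "T' \<in> \<T>" "f face_of T'" and s: "int l simplex f" using f(1) by (auto simp: subsimplices_def)
  show face: "f face_of T" by (rule mesh_face_trans[OF m T' f(2)])
  from face_verts[OF m face] s
  show "verts f \<subseteq> verts T" "convex hull (verts f) = f" "card (verts f) = Suc l" by auto
qed

section \<open>Linear structure of the constrained tensors\<close>

lemma AltT_add: "\<omega> \<in> AltT k m \<Longrightarrow> \<eta> \<in> AltT k m \<Longrightarrow> (\<lambda>ws vs. \<omega> ws vs + \<eta> ws vs) \<in> AltT k m"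
  by (auto simp: AltT_def intro!: Alt_add)

lemma AltT_scale: "\<omega> \<in> AltT k m \<Longrightarrow> (\<lambda>ws vs. c * \<omega> ws vs) \<in> AltT k m"
  by (auto simp: AltT_def intro!: Alt_scale)

lemma s_map_add: "s_map (\<lambda>ws vs. \<omega> ws vs + \<eta> ws vs) = (\<lambda>ws vs. s_map \<omega> ws vs + s_map \<eta> ws vs)"
  by (simp add: s_map_def distrib_left sum.distrib fun_eq_iff)

lemma s_map_scale: "s_map (\<lambda>ws vs. c * \<omega> ws vs) = (\<lambda>ws vs. c * s_map \<omega> ws vs)"
  by (simp add: s_map_def sum_distrib_left mult_ac fun_eq_iff)

lemma XX_add: "\<omega> \<in> XX k \<Longrightarrow> \<eta> \<in> XX k \<Longrightarrow> (\<lambda>ws vs. \<omega> ws vs + \<eta> ws vs) \<in> XX k"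
  unfolding XX_def by (simp add: AltT_add s_map_add)

lemma XX_scale: "\<omega> \<in> XX k \<Longrightarrow> (\<lambda>ws vs. c * \<omega> ws vs) \<in> XX k"
  unfolding XX_def by (simp add: AltT_scale s_map_scale)

lemma XX_diff: "\<omega> \<in> XX k \<Longrightarrow> \<eta> \<in> XX k \<Longrightarrow> (\<lambda>ws vs. \<omega> ws vs - \<eta> ws vs) \<in> XX k"
  using XX_add[OF _ XX_scale, of \<omega> k \<eta> "-1"] by simp

lemma XX_zero: "(\<lambda>ws vs. 0) \<in> XX k"
  by (auto simp: XX_def AltT_def Alt_zero s_map_def fun_eq_iff)

lemma proxy_add: "proxy (\<lambda>vs. \<alpha> vs + \<beta> vs) = proxy \<alpha> + proxy \<beta>"
  and proxy_diff: "proxy (\<lambda>vs. \<alpha> vs - \<beta> vs) = proxy \<alpha> - proxy \<beta>"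
  and proxy_scale: "proxy (\<lambda>vs. c * \<alpha> vs) = c *\<^sub>R proxy \<alpha>"
  and proxy_zero: "proxy (\<lambda>vs. 0) = 0"
  by (simp_all add: proxy_def vec_eq_iff algebra_simps)

lemma proxy_eq_zero:
  fixes \<beta> :: "'n::{finite,linorder} form"
  assumes \<beta>: "\<beta> \<in> Alt (CARD('n) - 1)" and z: "proxy \<beta> = 0" shows "\<beta> vs = 0"
proof (rule Alt_determined[OF \<beta> span_axis])
  fix \<sigma> :: "'n set" assume c: "card \<sigma> = CARD('n) - 1"
  have "card (\<sigma> \<union> - \<sigma>) = card \<sigma> + card (- \<sigma>)" by (intro card_Un_disjoint) auto
  then have "CARD('n) = card \<sigma> + card (- \<sigma>)" by simp
  then have "card (- \<sigma>) = 1" using c zero_less_card_finite[where 'a = 'n] by arith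
  then obtain i where "- \<sigma> = {i}" by (rule card_1_singletonE)
  then have \<sigma>: "\<sigma> = - {i}" by blast
  have "proxy \<beta> $ i = 0" using z by simp
  then show "\<beta> (subfam (\<lambda>i. axis i 1) \<sigma>) = 0" by (simp add: proxy_def std_vecs_subfam \<sigma>)
qed

section \<open>Single-valued degrees of freedom and continuity of normal components\<close>

definition dof_family ::
    "nat \<Rightarrow> nat \<Rightarrow> 'n::{finite,linorder} pt set set \<Rightarrow> ('n pt set \<Rightarrow> 'n \<Rightarrow> 'n pt) \<Rightarrow>
      ('n pt set \<Rightarrow> 'n pt \<Rightarrow> 'n tform) \<Rightarrow> bool" where
  "dof_family k r \<T> b P \<longleftrightarrow> (\<forall>T\<in>\<T>. P T \<in> poly_tform r (XX k)) \<and>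
     (\<forall>v. {v} \<in> subsimplices 0 \<T> \<longrightarrow>
        (\<forall>T\<in>\<T>. \<forall>T'\<in>\<T>. v \<in> T \<and> v \<in> T' \<longrightarrow> P T v = P T' v)) \<and>
     (\<forall>l \<in> {1..CARD('n) - 1}. \<forall>f \<in> subsimplices l \<T>. \<forall>\<eta> \<in> dof_space k r l (b f).
        \<forall>T\<in>\<T>. \<forall>T'\<in>\<T>. f \<subseteq> T \<and> f \<subseteq> T' \<longrightarrow> face_inner k f (P T) \<eta> = face_inner k f (P T') \<eta>)"

lemmas dof_family_poly = conjunct1[OF dof_family_def[THEN iffD1]]
  and dof_family_vertex = conjunct1[OF conjunct2[OF dof_family_def[THEN iffD1]]]
  and dof_family_face = conjunct2[OF conjunct2[OF dof_family_def[THEN iffD1]]]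

lemma V_h_iff:
  "\<omega> \<in> V_h k r \<Omega> \<T> b \<longleftrightarrow> \<omega> \<in> L2_tform \<Omega> (XX k) \<and>
     (\<exists>P. dof_family k r \<T> b P \<and> (\<forall>T\<in>\<T>. AE x in lebesgue. x \<in> \<Omega> \<inter> T \<longrightarrow> \<omega> x = P T x))"
  unfolding V_h_def dof_family_def by (simp only: mem_Collect_eq ball_conj_distrib conj_ac)

lemma dof_space_poly:
  assumes "\<eta> \<in> dof_space k r l c" shows "(\<lambda>x. \<eta> x ws vs) \<in> poly_fun (r - (l + 1))"
proof -
  obtain p where "\<And>\<sigma> i. p \<sigma> i \<in> poly_fun (r - (l + 1))"
    "\<eta> = (\<lambda>x ws vs. \<Sum>(\<sigma>, i) | free_index k (\<sigma>, i) \<and> i \<in> normal_indices l.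
         p \<sigma> i x * tensor (wedge_set (dual_basis (dy_of c)) \<sigma>) (star (dual_basis (dy_of c)) i) ws vs)"
    using assms unfolding dof_space_def Let_def by blast
  then show ?thesis by (auto intro!: poly_fun_sum poly_fun_multc simp: case_prod_beta)
qed

lemma face_inner_diff:
  fixes P :: "'n::{finite,linorder} pt \<Rightarrow> 'n tform"
  assumes "compact f" "P \<in> poly_tform r E" "Q \<in> poly_tform r E" and \<eta>: "\<And>ws vs. (\<lambda>x. \<eta> x ws vs) \<in> poly_fun s"
  shows "face_inner k f (\<lambda>x ws vs. P x ws vs - Q x ws vs) \<eta> = face_inner k f P \<eta> - face_inner k f Q \<eta>"
proof -
  have c: "continuous_on UNIV (\<lambda>x. tform_inner k (CARD('n) - 1) (R x) (\<eta> x))" if "R \<in> poly_tform r E" for R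
    unfolding tform_inner_def
    using that by (intro continuous_intros poly_fun_continuous_on[OF \<eta>] poly_fun_continuous_on[of _ r])
      (simp add: poly_tform_def)
  have "tform_inner k (CARD('n) - 1) (\<lambda>ws vs. P x ws vs - Q x ws vs) (\<eta> x)
      = tform_inner k (CARD('n) - 1) (P x) (\<eta> x) - tform_inner k (CARD('n) - 1) (Q x) (\<eta> x)" for x
    by (simp add: tform_inner_def left_diff_distrib sum_subtractf)
  then show ?thesis
    using set_integral_diff(2)[OF face_integrable[OF assms(1) c[OF assms(2)]] face_integrable[OF assms(1) c[OF assms(3)]]]
    by (simp add: face_inner_def)
qed

lemma bgrad_normal:
  assumes C: "simplex_verts C" and v: "v \<in> C" and w: "w \<in> tangent_space (convex hull (C - {v}))"
  shows "bgrad C v \<bullet> w = 0"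
  using w unfolding tangent_space_def
proof (induction rule: span_induct)
  case base
  show ?case by (rule subspaceI) (auto simp: inner_right_distrib)
next
  case (step w)
  then obtain x y where "w = x - y" "x \<in> convex hull (C - {v})" "y \<in> convex hull (C - {v})" by blast
  then show ?case using convex_hull_bary[OF C, of "C - {v}"] v bary_diff[of C v x y] by auto
qed

text \<open>The difference of the two polynomials has zero vertex values and zero moments on every
  subsimplex of the shared facet, so \<open>normal_trace_zero\<close> applies to it, with
  \<open>bgrad\<close> as a normal of the facet.\<close>

lemma dof_family_normal_continuous:
  fixes \<T> :: "'n::{finite,linorder} pt set set"
  assumes m: "simplicial_mesh \<T>" and k: "1 \<le> k" "k \<le> CARD('n) - 1" and r: "CARD('n) \<le> r"
    and tn: "\<And>l f. l \<le> CARD('n) - 1 \<Longrightarrow> f \<in> subsimplices l \<T> \<Longrightarrow> tn_basis l f (b f)"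
    and P: "dof_family k r \<T> b P"
    and T: "T \<in> \<T>" "T' \<in> \<T>" and v: "v \<in> verts T" and adj: "adjacent T v T' v'"
    and x: "x \<in> convex hull (verts T - {v})"
  shows "proxy (P T x ws) \<bullet> bgrad (verts T) v = proxy (P T' x ws) \<bullet> bgrad (verts T) v"
proof -
  define \<delta> where "\<delta> x = (\<lambda>ws vs. P T x ws vs - P T' x ws vs)" for x
  let ?K0 = "verts T - {v}"
  have C: "simplex_verts (verts T)" using mesh_verts[OF m T(1)] .
  have K0T': "?K0 \<subseteq> verts T'" using adj by (auto simp: adjacent_def)
  have PT: "P T \<in> poly_tform r (XX k)" "P T' \<in> poly_tform r (XX k)" using P T by (auto simp: dof_family_def)
  have \<delta>: "\<delta> \<in> poly_tform r (XX k)"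
    using PT by (auto simp: poly_tform_def \<delta>_def intro!: XX_diff poly_fun_diff)
  have fin: "finite ?K0" using simplex_verts_finite[OF C] by simp
  have cK0: "card ?K0 = CARD('n)" using C v simplex_verts_finite[OF C] by (simp add: simplex_verts_def)
  have K0ne: "?K0 \<noteq> {}" using cK0 by (metis card.empty zero_less_card_finite less_irrefl)
  have "proxy (\<delta> x ws) \<bullet> bgrad (verts T) v = 0"
  proof (rule normal_trace_zero[OF C _ k \<delta> r, of ?K0 b ?K0])
    fix K assume K: "K \<subseteq> ?K0" "K \<noteq> {}" "card K \<le> CARD('n)"
    show "tn_basis (card K - 1) (convex hull K) (b (convex hull K))"
      using K subsimplex_hull(1)[OF m T(1), of K] by (intro tn) auto
  next
    fix u assume u: "u \<in> ?K0"
    have "{u} \<in> subsimplices 0 \<T>" "u \<in> T" using subsimplex_hull[OF m T(1), of "{u}"] u by auto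
    moreover have "u \<in> T'" using subsimplex_hull(2)[OF m T(2), of "{u}"] u K0T' by auto
    ultimately have "P T u = P T' u" using dof_family_vertex[OF P] T by blast
    then show "\<delta> u = (\<lambda>ws vs. 0)" by (simp add: \<delta>_def)
  next
    fix K \<eta> assume K: "K \<subseteq> ?K0" "2 \<le> card K" "card K \<le> CARD('n)"
      and \<eta>: "\<eta> \<in> dof_space k r (card K - 1) (b (convex hull K))"
    have ne: "K \<noteq> {}" using K(2) by auto
    have f: "convex hull K \<in> subsimplices (card K - 1) \<T>" "convex hull K \<subseteq> T" "convex hull K \<subseteq> T'"
      using subsimplex_hull[OF m T(1) _ ne] subsimplex_hull(2)[OF m T(2) _ ne] K(1) K0T' by blast+
    have l: "card K - 1 \<in> {1..CARD('n) - 1}" using K(2,3) by auto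
    have "face_inner k (convex hull K) (P T) \<eta> = face_inner k (convex hull K) (P T') \<eta>"
      using dof_family_face[OF P] l f \<eta> T by blast
    moreover have "compact (convex hull K)"
      using K(1) fin by (meson finite_imp_compact_convex_hull finite_subset)
    ultimately show "face_inner k (convex hull K) \<delta> \<eta> = 0"
      unfolding \<delta>_def using face_inner_diff[OF _ PT dof_space_poly[OF \<eta>]] by simp
  qed (use bgrad_normal[OF C v] x cK0 K0ne in auto)
  then show ?thesis by (simp add: \<delta>_def proxy_diff inner_diff_left)
qed

text \<open>The bound on \<open>card K\<close> restricts to subsimplices of dimension below n. For a
  single vertex every vector is normal, so there the condition demands equal vertex values.\<close>

definition normal_family :: "nat \<Rightarrow> nat \<Rightarrow> 'n::{finite,linorder} pt set set \<Rightarrow>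
      ('n pt set \<Rightarrow> 'n pt \<Rightarrow> 'n tform) \<Rightarrow> bool" where
  "normal_family k r \<T> P \<longleftrightarrow> (\<forall>T\<in>\<T>. P T \<in> poly_tform r (XX k)) \<and>
     (\<forall>T\<in>\<T>. \<forall>T'\<in>\<T>. \<forall>K ws n. \<forall>x\<in>convex hull K. K \<subseteq> verts T \<and> K \<subseteq> verts T' \<and> K \<noteq> {} \<and> card K \<le> CARD('n) \<and>
        (\<forall>w\<in>tangent_space (convex hull K). n \<bullet> w = 0) \<longrightarrow> proxy (P T x ws) \<bullet> n = proxy (P T' x ws) \<bullet> n)"

text \<open>The test functions are built from elements with normal second index only, and each of
  them pairs with a component along the basis vector of that index.\<close>

lemma tform_inner_dof_space:
  fixes c :: "'n::{finite,linorder} \<Rightarrow> 'n pt"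
  assumes \<eta>: "\<eta> \<in> dof_space k r l c" and inj: "inj c" "independent (range c)"
    and \<omega>: "\<omega> \<in> AltT k (CARD('n) - 1)" "\<omega>' \<in> AltT k (CARD('n) - 1)"
    and eq: "\<And>i ws. i \<in> normal_indices l \<Longrightarrow> proxy (\<omega> ws) \<bullet> c i = proxy (\<omega>' ws) \<bullet> c i"
  shows "tform_inner k (CARD('n) - 1) \<omega> (\<eta> x) = tform_inner k (CARD('n) - 1) \<omega>' (\<eta> x)"
proof -
  have span: "span (range c) = UNIV" by (rule family_span_UNIV[OF inj])
  obtain z where dual: "\<And>i j. z i \<bullet> c j = (if i = j then 1 else 0)"
    using dual_family_exists[OF inj] by blast
  have db: "dual_basis (dy_of c) = dy_of z" by (rule dual_basis_eq[OF dual span])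
  let ?A = "{(\<sigma>, i). free_index k (\<sigma>, i) \<and> i \<in> normal_indices l}"
  obtain p where p: "\<eta> = (\<lambda>x ws vs. \<Sum>(\<sigma>, i)\<in>?A. p \<sigma> i x * tensor (wedge_set (dy_of z) \<sigma>) (star (dy_of z) i) ws vs)"
    using \<eta> unfolding dof_space_def Let_def db by blast
  have expand: "tform_inner k (CARD('n) - 1) \<omega> (\<eta> x) = (\<Sum>(\<sigma>, i)\<in>?A. p \<sigma> i x * (vol (subfam z UNIV) * (proxy (\<omega> (subfam z \<sigma>)) \<bullet> c i)))"
    if \<omega>: "\<omega> \<in> AltT k (CARD('n) - 1)" for \<omega>
  proof -
    have "tform_inner k (CARD('n) - 1) \<omega> (\<eta> x)
        = (\<Sum>s\<in>?A. case s of (\<sigma>, i) \<Rightarrow> p \<sigma> i x * tform_inner k (CARD('n) - 1) \<omega> (tensor (wedge_set (dy_of z) \<sigma>) (star (dy_of z) i)))"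
    proof -
      have "tform_inner k (CARD('n) - 1) \<omega> (\<lambda>ws vs. \<Sum>s\<in>A. q s * t s ws vs) = (\<Sum>s\<in>A. q s * tform_inner k (CARD('n) - 1) \<omega> (t s))"
        for A :: "('n set \<times> 'n) set" and q t
        unfolding tform_inner_def sum_distrib_left sum.swap[of _ _ A]
        by (simp add: sum_distrib_left mult_ac)
      from this[of "\<lambda>(\<sigma>, i). p \<sigma> i x" "\<lambda>(\<sigma>, i). tensor (wedge_set (dy_of z) \<sigma>) (star (dy_of z) i)" ?A]
      show ?thesis unfolding p by (simp add: case_prod_beta)
    qed
    also have "\<dots> = (\<Sum>(\<sigma>, i)\<in>?A. p \<sigma> i x * (vol (subfam z UNIV) * (proxy (\<omega> (subfam z \<sigma>)) \<bullet> c i)))"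
      using tform_inner_dual[OF \<omega> _ dual] by (intro sum.cong) (auto simp: free_index_def)
    finally show ?thesis .
  qed
  show ?thesis unfolding expand[OF \<omega>(1)] expand[OF \<omega>(2)] using eq by (intro sum.cong) auto
qed

lemma normal_family_dof_family:
  fixes \<T> :: "'n::{finite,linorder} pt set set"
  assumes m: "simplicial_mesh \<T>"
    and tn: "\<And>l f. l \<le> CARD('n) - 1 \<Longrightarrow> f \<in> subsimplices l \<T> \<Longrightarrow> tn_basis l f (b f)"
    and P: "normal_family k r \<T> P"
  shows "dof_family k r \<T> b P"
proof -
  have PX: "P T x \<in> AltT k (CARD('n) - 1)" if "T \<in> \<T>" for T x
    using P that by (auto simp: normal_family_def poly_tform_def XX_def)
  have eq: "proxy (P T x ws) \<bullet> n = proxy (P T' x ws) \<bullet> n"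
    if "T \<in> \<T>" "T' \<in> \<T>" "f \<in> subsimplices l \<T>" "l \<le> CARD('n) - 1" "f \<subseteq> T" "f \<subseteq> T'" "x \<in> f" "\<forall>w\<in>tangent_space f. n \<bullet> w = 0"
    for T T' f l x n ws
  proof -
    note 1 = subsimplex_verts[OF m that(1,3,5)] and 2 = subsimplex_verts[OF m that(2,3,6)]
    have "0 < CARD('n)" by simp
    then have "card (verts f) \<le> CARD('n)" "verts f \<noteq> {}" using 1(3) that(4) by (linarith, auto)
    then show ?thesis using P that(1,2,7,8) 1(1,2) 2(1) unfolding normal_family_def by metis
  qed
  have V: "P T v = P T' v" if v: "{v} \<in> subsimplices 0 \<T>" "T \<in> \<T>" "T' \<in> \<T>" "v \<in> T" "v \<in> T'" for v T T'
  proof -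
    have ts: "tangent_space {v} = {0}" by (simp add: tangent_space_def)
    have "proxy (P T v ws) \<bullet> n = proxy (P T' v ws) \<bullet> n" for ws n
      using eq[OF v(2,3,1)] v(4,5) ts by auto
    then have e: "proxy (P T v ws) = proxy (P T' v ws)" for ws by (metis vector_eq_rdot)
    have "P T v ws vs - P T' v ws vs = 0" for ws vs
    proof (rule proxy_eq_zero[of "\<lambda>vs. P T v ws vs - P T' v ws vs"])
      show "(\<lambda>vs. P T v ws vs - P T' v ws vs) \<in> Alt (CARD('n) - 1)"
        using PX[OF v(2)] PX[OF v(3)] by (intro Alt_diff) (auto simp: AltT_def)
      show "proxy (\<lambda>vs. P T v ws vs - P T' v ws vs) = 0" using e by (simp add: proxy_diff)
    qed
    then show ?thesis by (simp add: fun_eq_iff)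
  qed
  have F: "face_inner k f (P T) \<eta> = face_inner k f (P T') \<eta>"
    if l: "l \<in> {1..CARD('n) - 1}" and f: "f \<in> subsimplices l \<T>" and \<eta>: "\<eta> \<in> dof_space k r l (b f)"
      and T: "T \<in> \<T>" "T' \<in> \<T>" "f \<subseteq> T" "f \<subseteq> T'" for l f \<eta> T T'
  proof -
    have t: "tn_basis l f (b f)" using l f by (intro tn) auto
    have "tform_inner k (CARD('n) - 1) (P T x) (\<eta> x) = tform_inner k (CARD('n) - 1) (P T' x) (\<eta> x)" if x: "x \<in> f" for x
    proof (rule tform_inner_dof_space[OF \<eta> tn_inj[OF t] tn_independent[OF t] PX[OF T(1)] PX[OF T(2)]])
      fix i :: 'n and ws assume "i \<in> normal_indices l"
      then have "\<forall>w\<in>tangent_space f. b f i \<bullet> w = 0" using t by (simp add: tn_basis_def normal_indices_def)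
      then show "proxy (P T x ws) \<bullet> b f i = proxy (P T' x ws) \<bullet> b f i"
        using eq[OF T(1,2) f _ T(3,4) x] l by simp
    qed
    then have "indicator f x *\<^sub>R tform_inner k (CARD('n) - 1) (P T x) (\<eta> x) = indicator f x *\<^sub>R tform_inner k (CARD('n) - 1) (P T' x) (\<eta> x)" for x
      by (simp add: indicator_def)
    then show ?thesis by (simp only: face_inner_def set_lebesgue_integral_def)
  qed
  have "\<forall>T\<in>\<T>. P T \<in> poly_tform r (XX k)" using P unfolding normal_family_def by (rule conjunct1)
  then show ?thesis
    unfolding dof_family_def
  proof (intro conjI allI impI ballI)
    fix v T T' assume "{v} \<in> subsimplices 0 \<T>" "T \<in> \<T>" "T' \<in> \<T>" "v \<in> T \<and> v \<in> T'"
    then show "P T v = P T' v" using V by blast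
  next
    fix l f \<eta> T T' assume "l \<in> {1..CARD('n) - 1}" "f \<in> subsimplices l \<T>" "\<eta> \<in> dof_space k r l (b f)"
      "T \<in> \<T>" "T' \<in> \<T>" "f \<subseteq> T \<and> f \<subseteq> T'"
    then show "face_inner k f (P T) \<eta> = face_inner k f (P T') \<eta>" using F by blast
  qed blast
qed


section \<open>The weak divergence of a piecewise polynomial\<close>

lemma mesh_interior_disjoint:
  assumes m: "simplicial_mesh \<T>" "T \<in> \<T>" "T' \<in> \<T>" and ne: "T \<noteq> T'"
  shows "interior T \<inter> interior T' = {}"
proof (cases "T \<inter> T' = T")
  case True
  have "T \<inter> T' face_of T'" using mesh_inter_face[OF m(1,3,2)] by (simp add: Int_commute)
  then have "T \<inter> interior T' = {}" using face_of_disjoint_interior[of T T'] True ne by simp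
  then show ?thesis using interior_subset by blast
next
  case False
  then have "(T \<inter> T') \<inter> interior T = {}" using face_of_disjoint_interior[OF mesh_inter_face[OF m]] by blast
  then show ?thesis using interior_subset by blast
qed

lemma mesh_compact: "simplicial_mesh \<T> \<Longrightarrow> T \<in> \<T> \<Longrightarrow> compact T"
  using simplex_compact[OF mesh_verts] mesh_hull by metis

text \<open>If the open set met the facet, it would contain a point \<open>y\<close> in the relative
  interior of the facet and a point \<open>p\<close> just beyond it. Some simplex contains both. Its
  intersection with \<open>T\<close> is a face that contains \<open>y\<close>, hence the whole
  facet, so this simplex would be a neighbour.\<close>

lemma boundary_facet_outside:
  fixes \<T> :: "'n::{finite,linorder} pt set set"
  assumes m: "simplicial_mesh \<T>" "T \<in> \<T>" and v: "v \<in> verts T"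
    and no: "\<And>T' v'. T' \<in> \<T> \<Longrightarrow> \<not> adjacent T v T' v'"
    and \<Omega>: "open \<Omega>" "\<Omega> \<subseteq> \<Union>\<T>" and x: "x \<in> convex hull (verts T - {v})"
  shows "x \<notin> \<Omega>"
proof
  assume x\<Omega>: "x \<in> \<Omega>"
  let ?C = "verts T" and ?K = "verts T - {v}"
  have C: "simplex_verts ?C" "convex hull ?C = T" using mesh_verts[OF m] mesh_hull[OF m] by auto
  have ind: "\<not> affine_dependent ?C" using C by (simp add: simplex_verts_def)
  have finC: "finite ?C" using simplex_verts_finite[OF C(1)] .
  have cK: "card ?K = CARD('n)" using C(1) v finC by (simp add: simplex_verts_def)
  define c where "c = (\<Sum>w\<in>?K. (1 / real CARD('n)) *\<^sub>R w)"
  have s1: "(\<Sum>w\<in>?K. 1 / real CARD('n)) = 1" using cK by simp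
  have bc: "bary ?C u c = (if u = v then 0 else 1 / real CARD('n))" if u: "u \<in> ?C" for u
  proof -
    have "bary ?C u c = (\<Sum>w\<in>?K. 1 / real CARD('n) * bary ?C u w)"
      unfolding c_def by (rule bary_combination[OF s1])
    also have "\<dots> = (\<Sum>w\<in>?K. if w = u then 1 / real CARD('n) else 0)"
      by (rule sum.cong) (auto simp: bary_vertex[OF ind u])
    finally show ?thesis using finC u by auto
  qed
  have bx: "\<forall>u\<in>?C. 0 \<le> bary ?C u x" "bary ?C v x = 0" using x convex_hull_bary[OF C(1), of ?K x] v by auto
  obtain e where e: "e > 0" "ball x e \<subseteq> \<Omega>" using \<Omega>(1) x\<Omega> open_contains_ball by blast
  define t where "t = min 1 (e / (2 * (1 + norm (c - x))))"
  have t: "0 < t" "t \<le> 1" "t * norm (c - x) < e"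
  proof -
    show "0 < t" "t \<le> 1" using e(1) by (auto simp: t_def add_pos_nonneg)
    have "t * norm (c - x) \<le> e / (2 * (1 + norm (c - x))) * norm (c - x)" by (intro mult_right_mono) (auto simp: t_def)
    also have "\<dots> < e" using e(1) by (simp add: field_simps add_pos_nonneg)
    finally show "t * norm (c - x) < e" .
  qed
  \<comment> \<open>A short move towards the centre of the facet makes the coordinates of all its
    vertices positive without leaving \<Omega>.\<close>
  define y where "y = x + t *\<^sub>R (c - x)"
  have y\<Omega>: "y \<in> \<Omega>" using e(2) t by (auto simp: y_def dist_norm)
  have byy: "bary ?C u y = (1 - t) * bary ?C u x + t * bary ?C u c" for u
    unfolding y_def bary_add_scale bary_diff[symmetric] by (simp add: algebra_simps)
  have by0: "bary ?C v y = 0" using bx bc[OF v] byy by simp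
  have byp: "0 < bary ?C u y" if u: "u \<in> ?K" for u
    using bx(1) u t bc[of u] unfolding byy by (simp add: add_nonneg_pos)
  \<comment> \<open>Outside this closed set every simplex of the mesh contains \<open>y\<close>; so
    a covering simplex of a nearby point also passes through \<open>y\<close>.\<close>
  define W where "W = \<Union>{T'\<in>\<T>. y \<notin> T'}"
  have "closed W" unfolding W_def using mesh_finite[OF m(1)] mesh_compact[OF m(1)]
    by (intro closed_Union) (auto intro: compact_imp_closed)
  then have "open (\<Omega> - W)" using \<Omega>(1) by auto
  moreover have "y \<in> \<Omega> - W" using y\<Omega> by (auto simp: W_def)
  ultimately obtain d where d: "d > 0" "ball y d \<subseteq> \<Omega> - W" using open_contains_ball by blast
  define s where "s = d / (2 * (1 + norm (v - y)))"
  have s: "0 < s" "s * norm (v - y) < d" using d(1) by (auto simp: s_def field_simps add_pos_nonneg)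
  define p where "p = y + (- s) *\<^sub>R (v - y)"
  have "dist y p = s * norm (v - y)" using s(1) by (simp add: p_def dist_norm)
  then have "p \<in> ball y d" using s(2) by simp
  then have "p \<in> \<Omega> - W" using d(2) by blast
  then obtain T' where T': "T' \<in> \<T>" "p \<in> T'" "y \<in> T'" using \<Omega>(2) by (auto simp: W_def)
  have "bary ?C v p = - s"
    unfolding p_def bary_add_scale bary_diff[symmetric] using by0 bary_vertex[OF ind v v] by simp
  then have "p \<notin> T" using s(1) convex_hull_bary[OF C(1) order_refl, of p] C(2) v by auto
  then have ne: "T' \<noteq> T" using T'(2) by blast
  have F: "T \<inter> T' face_of T" "T \<inter> T' face_of T'"
    using mesh_inter_face[OF m(1,2) T'(1)] mesh_inter_face[OF m(1) T'(1) m(2)] by (auto simp: Int_commute)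
  note f1 = face_verts[OF m F(1)] and f2 = face_verts[OF m(1) T'(1) F(2)]
  have C': "simplex_verts (verts T')" "convex hull (verts T') = T'" using mesh_verts[OF m(1) T'(1)] mesh_hull[OF m(1) T'(1)] by auto
  have yT: "y \<in> T"
    using convex_hull_bary[OF C(1) order_refl, of y] by0 byp C(2) by (metis DiffI less_imp_le order_refl singletonD Diff_cancel empty_iff)
  have KJ: "?K \<subseteq> verts (T \<inter> T')"
  proof
    fix u assume u: "u \<in> ?K"
    have "y \<in> convex hull (verts (T \<inter> T'))" using yT T'(3) f1(2) by simp
    then have "\<forall>w\<in>?C - verts (T \<inter> T'). bary ?C w y = 0" using convex_hull_bary[OF C(1) f1(1)] by blast
    then show "u \<in> verts (T \<inter> T')" using byp[OF u] u by force
  qed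
  then have KT': "?K \<subseteq> verts T'" using f2(1) by blast
  have fin': "finite (verts T')" using simplex_verts_finite[OF C'(1)] .
  have "card (verts T' - ?K) = 1" using card_Diff_subset[OF _ KT'] finC cK C'(1) by (simp add: simplex_verts_def)
  then obtain v' where v': "verts T' - ?K = {v'}" by (rule card_1_singletonE)
  then have "v' \<in> verts T'" "verts T - {v} = verts T' - {v'}" using KT' by blast+
  then have "adjacent T v T' v'" using ne by (simp add: adjacent_def)
  then show False using no[OF T'(1)] by blast
qed

lemma mesh_AE_interior:
  assumes m: "simplicial_mesh \<T>"
  shows "AE x in lborel. \<forall>T\<in>\<T>. x \<in> T \<longrightarrow> x \<in> interior T"
  using mesh_finite[OF m] simplex_boundary_null[OF mesh_verts[OF m]] mesh_hull[OF m]
  by (subst AE_finite_all) auto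

lemma AE_lebesgue_lborel: "AE x in lborel. Q x \<Longrightarrow> AE x in lebesgue. Q x"
  by (rule AE_completion)

lemma lebesgue_borel_integral:
  fixes f :: "'a::euclidean_space \<Rightarrow> real"
  assumes "f \<in> borel_measurable borel"
  shows "integral\<^sup>L lebesgue f = integral\<^sup>L lborel f" "f \<in> borel_measurable lebesgue"
  using assms by (auto intro!: integral_completion measurable_completion)

lemma mesh_indicator_sum:
  assumes m: "simplicial_mesh \<T>" and T: "T \<in> \<T>" and x: "x \<in> interior T"
  shows "(\<Sum>T\<in>\<T>. indicator (interior T) x * h T) = (h T :: real)"
proof -
  have "(\<Sum>T\<in>\<T>. indicator (interior T) x * h T) = (\<Sum>T'\<in>\<T>. if T' = T then h T else 0)"
    using mesh_interior_disjoint[OF m T] x by (intro sum.cong) (auto simp: indicator_def)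
  then show ?thesis using mesh_finite[OF m] T by simp
qed

lemma glue_integral:
  fixes \<T> :: "'n::{finite,linorder} pt set set"
  assumes m: "simplicial_mesh \<T>" and \<Omega>: "open \<Omega>" "\<Omega> \<subseteq> \<Union>\<T>"
    and hm: "set_borel_measurable lebesgue \<Omega> h"
    and hT: "\<And>T. T \<in> \<T> \<Longrightarrow> continuous_on UNIV (hT T)"
    and eq: "\<And>T. T \<in> \<T> \<Longrightarrow> AE x in lebesgue. x \<in> \<Omega> \<inter> T \<longrightarrow> h x = hT T x"
  shows "set_lebesgue_integral lebesgue \<Omega> h = (\<Sum>T\<in>\<T>. LINT x|lborel. indicator T x * (indicator \<Omega> x * hT T x :: real))"
proof -
  have fin: "finite \<T>" using mesh_finite[OF m] .
  have hb: "hT T \<in> borel_measurable borel" if "T \<in> \<T>" for T by (rule borel_measurable_continuous_onI[OF hT[OF that]])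
  have Tb: "T \<in> sets borel" if "T \<in> \<T>" for T using mesh_compact[OF m that] borel_compact by blast
  have \<Omega>b: "\<Omega> \<in> sets borel" using \<Omega>(1) by simp
  \<comment> \<open>The interiors are disjoint and the boundaries form a null set, so the sum picks
    out one polynomial almost everywhere. It is Borel measurable, which allows passing from
    \<open>lebesgue\<close> to \<open>lborel\<close>.\<close>
  define F where "F x = (\<Sum>T\<in>\<T>. indicator (interior T) x * (indicator \<Omega> x * hT T x))" for x
  have Fb: "F \<in> borel_measurable borel" unfolding F_def using hb \<Omega>b by (intro borel_measurable_sum borel_measurable_times borel_measurable_indicator) auto
  have "AE x in lebesgue. \<forall>T\<in>\<T>. x \<in> \<Omega> \<inter> T \<longrightarrow> h x = hT T x" using fin eq by (subst AE_finite_all) auto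
  then have "AE x in lebesgue. indicator \<Omega> x *\<^sub>R h x = F x"
    using AE_lebesgue_lborel[OF mesh_AE_interior[OF m]]
  proof eventually_elim
    case (elim x)
    show ?case
    proof (cases "x \<in> \<Omega>")
      case True
      then obtain T where T: "T \<in> \<T>" "x \<in> T" using \<Omega>(2) by blast
      then have "x \<in> interior T" using elim by blast
      then have "F x = indicator \<Omega> x * hT T x" unfolding F_def by (rule mesh_indicator_sum[OF m T(1)])
      then show ?thesis using elim T True by simp
    qed (simp add: F_def)
  qed
  then have "set_lebesgue_integral lebesgue \<Omega> h = integral\<^sup>L lebesgue F"
    unfolding set_lebesgue_integral_def
    using hm lebesgue_borel_integral(2)[OF Fb] by (intro integral_cong_AE) (auto simp: set_borel_measurable_def)
  also have "\<dots> = integral\<^sup>L lborel F" by (rule lebesgue_borel_integral(1)[OF Fb])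
  also have "\<dots> = (\<Sum>T\<in>\<T>. LINT x|lborel. indicator (interior T) x * (indicator \<Omega> x * hT T x))"
    unfolding F_def
  proof (rule Bochner_Integration.integral_sum)
    fix T assume T: "T \<in> \<T>"
    have "integrable lborel (\<lambda>x. indicator T x *\<^sub>R hT T x)"
      by (rule borel_integrable_compact[OF mesh_compact[OF m T] continuous_on_subset[OF hT[OF T]]]) simp
    then show "integrable lborel (\<lambda>x. indicator (interior T) x * (indicator \<Omega> x * hT T x))"
    proof (rule Bochner_Integration.integrable_bound)
      show "(\<lambda>x. indicator (interior T) x * (indicator \<Omega> x * hT T x)) \<in> borel_measurable lborel"
        using hb[OF T] \<Omega>b by simp
      show "AE x in lborel. norm (indicator (interior T) x * (indicator \<Omega> x * hT T x)) \<le> norm (indicator T x *\<^sub>R hT T x)"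
        using interior_subset[of T] by (auto simp: indicator_def)
    qed
  qed
  also have "\<dots> = (\<Sum>T\<in>\<T>. LINT x|lborel. indicator T x * (indicator \<Omega> x * hT T x))"
  proof (rule sum.cong[OF refl])
    fix T assume T: "T \<in> \<T>"
    have "AE x in lborel. indicator (interior T) x * (indicator \<Omega> x * hT T x) = indicator T x * (indicator \<Omega> x * hT T x)"
      using mesh_AE_interior[OF m]
    proof eventually_elim
      case (elim x)
      then show ?case using T interior_subset[of T] by (auto simp: indicator_def)
    qed
    then show "(LINT x|lborel. indicator (interior T) x * (indicator \<Omega> x * hT T x)) = (LINT x|lborel. indicator T x * (indicator \<Omega> x * hT T x))"
      using hb[OF T] \<Omega>b Tb[OF T] by (intro integral_cong_AE) auto
  qed
  finally show ?thesis .
qed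

text \<open>The elementwise divergence. It is taken for arbitrary arguments \<open>ws\<close> and
  not only for basis vectors, so that the result is again a form.\<close>

definition divf :: "('n::{finite,linorder} pt \<Rightarrow> 'n tform) \<Rightarrow> 'n pt \<Rightarrow> 'n form" where
  "divf P x = (\<lambda>ws. \<Sum>i\<in>UNIV. partial i (\<lambda>x. proxy (P x ws) $ i) x)"

lemma proxy_nth_poly: "P \<in> poly_tform r E \<Longrightarrow> (\<lambda>x. proxy (P x ws) $ i) \<in> poly_fun r"
  unfolding proxy_def by (simp add: poly_tform_def poly_fun_cmult)

lemma divf_poly: "P \<in> poly_tform r E \<Longrightarrow> (\<lambda>x. divf P x ws) \<in> poly_fun (r - 1)"
  unfolding divf_def by (intro poly_fun_sum poly_fun_partial proxy_nth_poly)

lemma proxy_nth_Alt: "\<omega> \<in> AltT k m \<Longrightarrow> (\<lambda>ws. proxy (\<omega> ws) $ i) \<in> Alt k"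
  unfolding proxy_def by (simp add: AltT_def Alt_scale)

lemma divf_Alt:
  assumes P: "P \<in> poly_tform r E" and E: "E \<subseteq> AltT k m"
  shows "divf P x \<in> Alt k"
proof -
  have A: "(\<lambda>ws. proxy (P y ws) $ i) \<in> Alt k" for y i
    using P E by (intro proxy_nth_Alt[of _ k m]) (auto simp: poly_tform_def)
  have C: "C1 (\<lambda>x. proxy (P x ws) $ i)" for ws i by (rule C1_poly_fun[OF proxy_nth_poly[OF P]])
  have "(\<lambda>ws. partial i (\<lambda>x. proxy (P x ws) $ i) x) \<in> Alt k" for i
  proof (rule AltI)
    fix vs :: "'a pt list" assume "length vs \<noteq> k"
    then have "(\<lambda>x. proxy (P x vs) $ i) = (\<lambda>x. 0)" using Alt_length[OF A] by auto
    then show "partial i (\<lambda>x. proxy (P x vs) $ i) x = 0" by (simp add: partial_const)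
  next
    fix vs :: "'a pt list" and a b assume "length vs = k" "a < b" "b < k" "vs ! a = vs ! b"
    then have "(\<lambda>x. proxy (P x vs) $ i) = (\<lambda>x. 0)" using Alt_eq_lt[OF _ _ _ _ A] by auto
    then show "partial i (\<lambda>x. proxy (P x vs) $ i) x = 0" by (simp add: partial_const)
  next
    fix vs :: "'a pt list" and j assume j: "length vs = k" "j < k"
    note lin = Alt_linear[OF A j]
    show "linear (\<lambda>v. partial i (\<lambda>x. proxy (P x (vs[j := v])) $ i) x)"
    proof (rule linearI)
      fix v w
      have "(\<lambda>x. proxy (P x (vs[j := v + w])) $ i) = (\<lambda>x. proxy (P x (vs[j := v])) $ i + proxy (P x (vs[j := w])) $ i)"
        using linear_add[OF lin] by auto
      then show "partial i (\<lambda>x. proxy (P x (vs[j := v + w])) $ i) x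
          = partial i (\<lambda>x. proxy (P x (vs[j := v])) $ i) x + partial i (\<lambda>x. proxy (P x (vs[j := w])) $ i) x"
        using partial_add[OF C C] by simp
      fix c
      have "(\<lambda>x. proxy (P x (vs[j := c *\<^sub>R v])) $ i) = (\<lambda>x. c * proxy (P x (vs[j := v])) $ i)"
        using linear_scale[OF lin] by auto
      then show "partial i (\<lambda>x. proxy (P x (vs[j := c *\<^sub>R v])) $ i) x = c *\<^sub>R partial i (\<lambda>x. proxy (P x (vs[j := v])) $ i) x"
        using partial_cmult[OF C] by simp
    qed
  qed
  then show ?thesis unfolding divf_def by (intro Alt_sum)
qed

lemma test_fun_C1:
  assumes "\<phi> \<in> test_fun \<Omega>"
  shows "C1 \<phi>" "x \<notin> \<Omega> \<Longrightarrow> \<phi> x = 0" "x \<notin> \<Omega> \<Longrightarrow> partial i \<phi> x = 0"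
    "compact (closure {x. \<phi> x \<noteq> 0})" "closure {x. \<phi> x \<noteq> 0} \<subseteq> \<Omega>"
proof -
  have s: "smooth \<phi>" and c: "compact (closure {x. \<phi> x \<noteq> 0})" "closure {x. \<phi> x \<noteq> 0} \<subseteq> \<Omega>"
    using assms by (auto simp: test_fun_def)
  show "compact (closure {x. \<phi> x \<noteq> 0})" "closure {x. \<phi> x \<noteq> 0} \<subseteq> \<Omega>" using c by auto
  have d0: "\<phi> differentiable (at x)" for x using s[unfolded smooth_def, rule_format, of "[]" x] by simp
  have d1: "partial i \<phi> differentiable (at x)" for x i using s[unfolded smooth_def, rule_format, of "[i]" x] by simp
  have "(\<phi> has_derivative (\<lambda>h. \<Sum>i\<in>UNIV. h $ i * partial i \<phi> x)) (at x)" for x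
  proof -
    have D: "(\<phi> has_derivative frechet_derivative \<phi> (at x)) (at x)" using d0 frechet_derivative_works by blast
    then have lin: "linear (frechet_derivative \<phi> (at x))" using has_derivative_linear by blast
    have "frechet_derivative \<phi> (at x) h = (\<Sum>i\<in>UNIV. h $ i * partial i \<phi> x)" for h
    proof -
      have "frechet_derivative \<phi> (at x) (\<Sum>i\<in>UNIV. h $ i *\<^sub>R axis i 1) = (\<Sum>i\<in>UNIV. h $ i * partial i \<phi> x)"
        by (simp add: linear_sum[OF lin] linear_scale[OF lin] partial_def)
      moreover have "(\<Sum>i\<in>UNIV. h $ i *\<^sub>R axis i 1) = h"
        using basis_expansion[of h] by (simp add: scalar_mult_eq_scaleR)
      ultimately show ?thesis by simp
    qed
    then have "frechet_derivative \<phi> (at x) = (\<lambda>h. \<Sum>i\<in>UNIV. h $ i * partial i \<phi> x)" by blast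
    then show ?thesis using D by simp
  qed
  moreover have "continuous_on UNIV (partial i \<phi>)" for i
    by (intro continuous_at_imp_continuous_on ballI differentiable_imp_continuous_within d1)
  ultimately show "C1 \<phi>" by (simp add: C1_def)
  show "\<phi> x = 0" if "x \<notin> \<Omega>" using that c(2) closure_subset[of "{x. \<phi> x \<noteq> 0}"] by blast
  show "partial i \<phi> x = 0" if x: "x \<notin> \<Omega>"
  proof -
    have o: "open (- closure {x. \<phi> x \<noteq> 0})" "x \<in> - closure {x. \<phi> x \<noteq> 0}" using x c(2) by auto
    have z: "\<phi> y = 0" if "y \<in> - closure {x. \<phi> x \<noteq> 0}" for y
      using that closure_subset[of "{x. \<phi> x \<noteq> 0}"] by blast
    have "((\<lambda>x. 0) has_derivative (\<lambda>h. \<Sum>i\<in>UNIV. h $ i * partial i \<phi> x)) (at x)"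
      by (rule has_derivative_transform_within_open[OF C1_has_derivative[OF \<open>C1 \<phi>\<close>] o]) (rule z)
    then have "(\<lambda>h. \<Sum>i\<in>UNIV. h $ i * partial i \<phi> x) = (\<lambda>h. 0)"
      by (rule has_derivative_unique) (rule has_derivative_const)
    from fun_cong[OF this, of "axis i 1"] show ?thesis unfolding sum_axis .
  qed
qed

text \<open>The divergence theorem on the mesh is applied to the polynomials multiplied by the test
  function. Across interior facets the normal components agree; facets without neighbour lie outside
  \<Omega>, where the test function vanishes.\<close>

lemma mesh_weak_divergence:
  fixes \<T> :: "'n::{finite,linorder} pt set set"
  assumes m: "simplicial_mesh \<T>" and \<Omega>: "open \<Omega>" "\<Omega> \<subseteq> \<Union>\<T>"
    and P: "\<And>T. T \<in> \<T> \<Longrightarrow> P T \<in> poly_tform r E"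
    and normal: "\<And>T T' v v' x ws. T \<in> \<T> \<Longrightarrow> T' \<in> \<T> \<Longrightarrow> v \<in> verts T \<Longrightarrow> adjacent T v T' v' \<Longrightarrow>
      x \<in> convex hull (verts T - {v}) \<Longrightarrow> proxy (P T x ws) \<bullet> bgrad (verts T) v = proxy (P T' x ws) \<bullet> bgrad (verts T) v"
    and \<omega>: "\<omega> \<in> L2_tform \<Omega> E" "\<And>T. T \<in> \<T> \<Longrightarrow> AE x in lebesgue. x \<in> \<Omega> \<inter> T \<longrightarrow> \<omega> x = P T x"
    and q: "q \<in> L2_form \<Omega> E'" "\<And>T. T \<in> \<T> \<Longrightarrow> AE x in lebesgue. x \<in> \<Omega> \<inter> T \<longrightarrow> q x = divf (P T) x"
  shows "is_div k \<Omega> \<omega> q"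
  unfolding is_div_def
proof (intro allI impI ballI)
  fix \<sigma> :: "'n set" and \<phi> assume \<phi>: "\<phi> \<in> test_fun \<Omega>"
  note \<phi>1 = test_fun_C1[OF \<phi>]
  let ?s = "std_vecs \<sigma>"
  have \<phi>b: "\<phi> \<in> borel_measurable lebesgue" "partial i \<phi> \<in> borel_measurable lebesgue" for i
    using borel_measurable_continuous_onI[OF C1_continuous[OF \<phi>1(1)]] borel_measurable_continuous_onI[OF C1_partial_continuous[OF \<phi>1(1)]]
    by (auto intro: lebesgue_borel_integral(2))
  have Pc: "C1 (\<lambda>x. proxy (P T x ?s) $ i)" if "T \<in> \<T>" for T i by (rule C1_poly_fun[OF proxy_nth_poly[OF P[OF that]]])
  have set_mult: "set_borel_measurable lebesgue \<Omega> (\<lambda>x. f x * g x)"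
    if "set_borel_measurable lebesgue \<Omega> f" "g \<in> borel_measurable lebesgue" for f g :: "'n pt \<Rightarrow> real"
    using that borel_measurable_times[of "\<lambda>x. indicator \<Omega> x *\<^sub>R f x" lebesgue g] by (simp add: set_borel_measurable_def mult.assoc)
  have set_sum: "set_borel_measurable lebesgue \<Omega> (\<lambda>x. \<Sum>i\<in>UNIV. f i x)"
    if "\<And>i. set_borel_measurable lebesgue \<Omega> (f i)" for f :: "'n \<Rightarrow> 'n pt \<Rightarrow> real"
    using that unfolding set_borel_measurable_def scaleR_sum_right by (intro borel_measurable_sum)
  have "set_lebesgue_integral lebesgue \<Omega> (\<lambda>x. q x ?s * \<phi> x)
      = (\<Sum>T\<in>\<T>. LINT x|lborel. indicator T x * (indicator \<Omega> x * (divf (P T) x ?s * \<phi> x)))"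
  proof (rule glue_integral[OF m \<Omega>])
    show "set_borel_measurable lebesgue \<Omega> (\<lambda>x. q x ?s * \<phi> x)"
      using q(1) \<phi>b by (intro set_mult) (auto simp: L2_form_def L2_def)
    fix T assume T: "T \<in> \<T>"
    show "continuous_on UNIV (\<lambda>x. divf (P T) x ?s * \<phi> x)"
      by (intro continuous_intros C1_continuous[OF \<phi>1(1)] poly_fun_continuous_on[OF divf_poly[OF P[OF T]]])
    show "AE x in lebesgue. x \<in> \<Omega> \<inter> T \<longrightarrow> q x ?s * \<phi> x = divf (P T) x ?s * \<phi> x"
      using q(2)[OF T] by eventually_elim auto
  qed
  also have "\<dots> = (\<Sum>T\<in>\<T>. LINT x|lborel. indicator T x * (divf (P T) x ?s * \<phi> x))"
  proof -
    have "indicator \<Omega> x * (c * \<phi> x) = c * \<phi> x" for c x using \<phi>1(2)[of x] by (cases "x \<in> \<Omega>") simp_all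
    then show ?thesis by (simp only:)
  qed
  finally have L: "set_lebesgue_integral lebesgue \<Omega> (\<lambda>x. q x ?s * \<phi> x) = (\<Sum>T\<in>\<T>. LINT x|lborel. indicator T x * (divf (P T) x ?s * \<phi> x))" .
  have "set_lebesgue_integral lebesgue \<Omega> (\<lambda>x. \<Sum>i\<in>UNIV. coef (\<omega> x) \<sigma> i * partial i \<phi> x)
      = (\<Sum>T\<in>\<T>. LINT x|lborel. indicator T x * (indicator \<Omega> x * (\<Sum>i\<in>UNIV. proxy (P T x ?s) $ i * partial i \<phi> x)))"
  proof (rule glue_integral[OF m \<Omega>])
    have "set_borel_measurable lebesgue \<Omega> (\<lambda>x. \<omega> x ws vs)" for ws vs using \<omega>(1) by (auto simp: L2_tform_def L2_def)
    then have "set_borel_measurable lebesgue \<Omega> (\<lambda>x. \<omega> x ?s (std_vecs (- {i})) * ((-1) ^ pos i * partial i \<phi> x))" for i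
      using \<phi>b by (intro set_mult) auto
    then show "set_borel_measurable lebesgue \<Omega> (\<lambda>x. \<Sum>i\<in>UNIV. coef (\<omega> x) \<sigma> i * partial i \<phi> x)"
      by (intro set_sum) (simp add: coef_def mult_ac)
    fix T assume T: "T \<in> \<T>"
    show "continuous_on UNIV (\<lambda>x. \<Sum>i\<in>UNIV. proxy (P T x ?s) $ i * partial i \<phi> x)"
      by (intro continuous_on_sum continuous_on_mult C1_continuous[OF Pc[OF T]] C1_partial_continuous[OF \<phi>1(1)])
    show "AE x in lebesgue. x \<in> \<Omega> \<inter> T \<longrightarrow> (\<Sum>i\<in>UNIV. coef (\<omega> x) \<sigma> i * partial i \<phi> x) = (\<Sum>i\<in>UNIV. proxy (P T x ?s) $ i * partial i \<phi> x)"
      using \<omega>(2)[OF T] by eventually_elim (auto simp: coef_proxy)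
  qed
  also have "\<dots> = (\<Sum>T\<in>\<T>. LINT x|lborel. indicator T x * (\<Sum>i\<in>UNIV. proxy (P T x ?s) $ i * partial i \<phi> x))"
  proof -
    have "indicator \<Omega> x * (\<Sum>i\<in>UNIV. c i * partial i \<phi> x) = (\<Sum>i\<in>UNIV. c i * partial i \<phi> x)" for c x
      using \<phi>1(3)[of x] by (cases "x \<in> \<Omega>") simp_all
    then show ?thesis by (simp only:)
  qed
  finally have R: "set_lebesgue_integral lebesgue \<Omega> (\<lambda>x. \<Sum>i\<in>UNIV. coef (\<omega> x) \<sigma> i * partial i \<phi> x)
    = (\<Sum>T\<in>\<T>. LINT x|lborel. indicator T x * (\<Sum>i\<in>UNIV. proxy (P T x ?s) $ i * partial i \<phi> x))" .
  have "(\<Sum>T\<in>\<T>. LINT x|lborel. indicator T x * (\<Sum>i\<in>UNIV. partial i (\<lambda>x. proxy (P T x ?s) $ i * \<phi> x) x)) = 0"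
  proof (rule mesh_divergence_zero[OF m])
    show "C1 (\<lambda>x. proxy (P T x ?s) $ i * \<phi> x)" if "T \<in> \<T>" for T i by (intro C1_mult Pc that \<phi>1(1))
  next
    fix T T' v v' x assume "T \<in> \<T>" "T' \<in> \<T>" "v \<in> verts T" "adjacent T v T' v'" "x \<in> convex hull (verts T - {v})"
    from normal[OF this, of ?s]
    have "(\<Sum>i\<in>UNIV. bgrad (verts T) v $ i * (proxy (P T x ?s) $ i - proxy (P T' x ?s) $ i)) = 0"
      by (simp add: inner_vec_def right_diff_distrib sum_subtractf mult.commute)
    then have "(\<Sum>i\<in>UNIV. bgrad (verts T) v $ i * (proxy (P T x ?s) $ i - proxy (P T' x ?s) $ i)) * \<phi> x = 0" by simp
    then show "(\<Sum>i\<in>UNIV. bgrad (verts T) v $ i * (proxy (P T x ?s) $ i * \<phi> x - proxy (P T' x ?s) $ i * \<phi> x)) = 0"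
      unfolding sum_distrib_right by (simp only: mult.assoc left_diff_distrib)
  next
    fix T v x assume "T \<in> \<T>" "v \<in> verts T" "\<And>T' v'. T' \<in> \<T> \<Longrightarrow> \<not> adjacent T v T' v'" "x \<in> convex hull (verts T - {v})"
    then have "x \<notin> \<Omega>" using boundary_facet_outside[OF m _ _ _ \<Omega>] by blast
    then show "(\<Sum>i\<in>UNIV. bgrad (verts T) v $ i * (proxy (P T x ?s) $ i * \<phi> x)) = 0" using \<phi>1(2) by simp
  qed
  moreover have "(LINT x|lborel. indicator T x * (\<Sum>i\<in>UNIV. partial i (\<lambda>x. proxy (P T x ?s) $ i * \<phi> x) x))
    = (LINT x|lborel. indicator T x * (divf (P T) x ?s * \<phi> x)) + (LINT x|lborel. indicator T x * (\<Sum>i\<in>UNIV. proxy (P T x ?s) $ i * partial i \<phi> x))"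
    if T: "T \<in> \<T>" for T
  proof -
    have int: "integrable lborel (\<lambda>x. indicator T x * h x)" if "continuous_on UNIV h" for h :: "'n pt \<Rightarrow> real"
      using borel_integrable_compact[OF mesh_compact[OF m T] continuous_on_subset[OF that]] by simp
    have i1: "integrable lborel (\<lambda>x. indicator T x * (divf (P T) x ?s * \<phi> x))"
      by (intro int continuous_on_mult C1_continuous[OF \<phi>1(1)] poly_fun_continuous_on[OF divf_poly[OF P[OF T]]])
    have i2: "integrable lborel (\<lambda>x. indicator T x * (\<Sum>i\<in>UNIV. proxy (P T x ?s) $ i * partial i \<phi> x))"
      by (intro int continuous_on_sum continuous_on_mult C1_continuous[OF Pc[OF T]] C1_partial_continuous[OF \<phi>1(1)])
    have "(\<Sum>i\<in>UNIV. partial i (\<lambda>x. proxy (P T x ?s) $ i * \<phi> x) x) = divf (P T) x ?s * \<phi> x + (\<Sum>i\<in>UNIV. proxy (P T x ?s) $ i * partial i \<phi> x)" for x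
      unfolding divf_def partial_mult[OF Pc[OF T] \<phi>1(1)] by (simp add: sum.distrib sum_distrib_right)
    then show ?thesis using Bochner_Integration.integral_add[OF i1 i2] by (simp only: distrib_left)
  qed
  ultimately show "set_lebesgue_integral lebesgue \<Omega> (\<lambda>x. q x ?s * \<phi> x)
      = - set_lebesgue_integral lebesgue \<Omega> (\<lambda>x. \<Sum>i\<in>UNIV. coef (\<omega> x) \<sigma> i * partial i \<phi> x)"
    unfolding L R by (simp add: sum.distrib)
qed

section \<open>Smooth test functions and the fundamental lemma\<close>

inductive smooth_gen :: "('n::finite pt \<Rightarrow> real) \<Rightarrow> bool" where
  flat: "smooth_gen (\<lambda>x. flat p (c * x $ i + d))"
| const: "smooth_gen (\<lambda>x. c)"
| add: "smooth_gen f \<Longrightarrow> smooth_gen g \<Longrightarrow> smooth_gen (\<lambda>x. f x + g x)"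
| mult: "smooth_gen f \<Longrightarrow> smooth_gen g \<Longrightarrow> smooth_gen (\<lambda>x. f x * g x)"

text \<open>Closure of the class under partial derivatives reduces smoothness, which is a condition
  on all iterated partial derivatives, to differentiability of the members.\<close>

lemma smooth_gen_partial: "smooth_gen f \<Longrightarrow> C1 f \<and> (\<forall>i. smooth_gen (partial i f))"
proof (induction rule: smooth_gen.induct)
  case (flat p c i d)
  have eq: "(\<lambda>x. h (c * x $ i + d)) = (\<lambda>x. h ((c *\<^sub>R axis i 1) \<bullet> x + d))" for h :: "real \<Rightarrow> real"
    by (simp add: inner_axis')
  have "smooth_gen (\<lambda>x. (c *\<^sub>R axis i 1) $ j * flat (flat_deriv p) (c * x $ i + d))" for j
    by (intro smooth_gen.intros)
  then show ?case
    unfolding eq using C1_compose_affine[OF flat_DERIV flat_continuous, of p "c *\<^sub>R axis i 1" d]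
      partial_compose_affine[OF flat_DERIV flat_continuous, of _ p "c *\<^sub>R axis i 1" d]
    by (simp add: inner_axis')
next
  case (const c)
  then show ?case by (simp add: C1_const partial_const smooth_gen.const)
next
  case (add f g)
  then show ?case by (auto simp: C1_add partial_add intro: smooth_gen.add)
next
  case (mult f g)
  then show ?case by (auto simp: C1_mult partial_mult intro!: smooth_gen.add smooth_gen.mult)
qed

lemma smooth_gen_smooth: assumes "smooth_gen f" shows "smooth f"
proof -
  have "smooth_gen (foldr partial is f)" for "is"
    by (induction "is") (use assms smooth_gen_partial in auto)
  then have "C1 (foldr partial is f)" for "is" using smooth_gen_partial by blast
  then show ?thesis unfolding smooth_def using C1_has_derivative by (blast intro: differentiableI)
qed

lemma smooth_gen_prod: "finite J \<Longrightarrow> (\<And>j. j \<in> J \<Longrightarrow> smooth_gen (f j)) \<Longrightarrow> smooth_gen (\<lambda>x. \<Prod>j\<in>J. f j x)"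
  by (induction J rule: finite_induct) (auto intro: smooth_gen.intros)

definition box_bump :: "nat \<Rightarrow> 'n::finite pt \<Rightarrow> 'n pt \<Rightarrow> 'n pt \<Rightarrow> real" where
  "box_bump m a b x = (\<Prod>i\<in>UNIV. bump (real m * (x $ i - a $ i)) * bump (real m * (b $ i - x $ i)))"

lemma box_bump_smooth: "smooth_gen (box_bump m a b)"
proof -
  have "smooth_gen (\<lambda>x. flat 1 (real m * x $ i + - real m * a $ i) * flat 1 (- real m * x $ i + real m * b $ i))" for i
    by (intro smooth_gen.intros)
  moreover have "(\<lambda>x. flat 1 (real m * x $ i + - real m * a $ i) * flat 1 (- real m * x $ i + real m * b $ i))
    = (\<lambda>x. bump (real m * (x $ i - a $ i)) * bump (real m * (b $ i - x $ i)))" for i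
    by (simp add: bump_def algebra_simps)
  ultimately show ?thesis unfolding box_bump_def[abs_def] by (intro smooth_gen_prod) auto
qed

lemma box_bump_outside: "x \<notin> box a b \<Longrightarrow> box_bump m a b x = 0"
proof -
  assume "x \<notin> box a b"
  then obtain i where "x $ i \<le> a $ i \<or> b $ i \<le> x $ i" by (auto simp: mem_box_cart not_less)
  then have "bump (real m * (x $ i - a $ i)) * bump (real m * (b $ i - x $ i)) = 0"
    by (auto intro!: bump_0 mult_nonneg_nonpos)
  then show ?thesis unfolding box_bump_def by (intro prod_zero) auto
qed

lemma box_bump_bounds: "0 \<le> box_bump m a b x" "box_bump m a b x \<le> 1"
  unfolding box_bump_def by (auto intro!: prod_nonneg prod_le_1 mult_nonneg_nonneg bump_nonneg mult_le_one bump_le_1)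

lemma box_bump_test_fun:
  assumes "cbox a b \<subseteq> U" shows "box_bump m a b \<in> test_fun U"
proof -
  have "{x. box_bump m a b x \<noteq> 0} \<subseteq> cbox a b" using box_bump_outside box_subset_cbox by blast
  then have sub: "closure {x. box_bump m a b x \<noteq> 0} \<subseteq> cbox a b" by (rule closure_minimal) (rule closed_cbox)
  then have "compact (closure {x. box_bump m a b x \<noteq> 0})"
    using compact_Int_closed[OF compact_cbox closed_closure, of a b "{x. box_bump m a b x \<noteq> 0}"]
    by (simp add: inf_absorb2)
  then show ?thesis using sub assms smooth_gen_smooth[OF box_bump_smooth] by (auto simp: test_fun_def)
qed

lemma box_bump_tendsto: "(\<lambda>m. box_bump m a b x) \<longlonglongrightarrow> indicator (box a b) x"
proof (cases "x \<in> box a b")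
  case True
  then have "(\<lambda>m. \<Prod>i\<in>UNIV. bump (real m * (x $ i - a $ i)) * bump (real m * (b $ i - x $ i))) \<longlonglongrightarrow> (\<Prod>i\<in>(UNIV::'a set). 1 * 1)"
    by (intro tendsto_prod tendsto_mult bump_tendsto) (auto simp: mem_box_cart)
  then show ?thesis using True by (simp add: box_bump_def)
next
  case False
  then show ?thesis by (simp add: box_bump_outside)
qed

text \<open>The measures with the positive and the negative part of \<open>v\<close> as densities
  agree on boxes. Boxes are stable under intersection and generate the Borel sets, so the two
  densities coincide almost everywhere.\<close>

lemma AE_zero_from_boxes:
  fixes v :: "'a::euclidean_space \<Rightarrow> real"
  assumes int: "integrable lborel v" and zero: "\<And>a b. (LINT x|lborel. indicator (box a b) x * v x) = 0"
  shows "AE x in lborel. v x = 0"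
proof -
  have vb: "v \<in> borel_measurable borel" using int by auto
  define M where "M s = density lborel (\<lambda>x. ennreal (max 0 (s * v x)))" for s :: real
  have i: "integrable lborel (\<lambda>x. max 0 (s * v x))" for s :: real using int by (intro integrable_max) auto
  have ib: "integrable lborel (\<lambda>x. indicator A x * max 0 (s * v x))" if "A \<in> sets borel" for A and s :: real
    using integrable_mult_indicator[OF _ i[of s], of A] that by simp
  have em: "emeasure (M s) A = ennreal (LINT x|lborel. indicator A x * max 0 (s * v x))" if A: "A \<in> sets borel" for A s
  proof -
    have "emeasure (M s) A = (\<integral>\<^sup>+x. ennreal (indicator A x * max 0 (s * v x)) \<partial>lborel)"
      unfolding M_def using vb A by (subst emeasure_density) (auto intro!: nn_integral_cong simp: indicator_def)
    also have "\<dots> = ennreal (LINT x|lborel. indicator A x * max 0 (s * v x))"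
      by (rule nn_integral_eq_integral[OF ib[OF A]]) (simp add: indicator_def)
    finally show ?thesis .
  qed
  have "M 1 = M (-1)"
  proof (rule measure_eqI_generator_eq)
    let ?E = "range (\<lambda>(a, b). box a b :: 'a set)"
    show "Int_stable ?E" by (auto simp: Int_stable_def box_Int_box)
    show "?E \<subseteq> Pow UNIV" by simp
    show "sets (M 1) = sigma_sets UNIV ?E" "sets (M (-1)) = sigma_sets UNIV ?E"
      by (simp_all add: M_def borel_eq_box)
    let ?A = "\<lambda>n::nat. box (- (real n *\<^sub>R One)) (real n *\<^sub>R One) :: 'a set"
    show "range ?A \<subseteq> ?E" by auto
    show "(\<Union>i. ?A i) = UNIV" unfolding UN_box_eq_UNIV ..
    show "emeasure (M 1) (?A i) \<noteq> \<infinity>" for i by (simp add: em)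
    fix X assume "X \<in> ?E"
    then obtain a b where X: "X = box a b" by auto
    have "(LINT x|lborel. indicator X x * max 0 (1 * v x)) - (LINT x|lborel. indicator X x * max 0 (-1 * v x))
        = (LINT x|lborel. indicator X x * max 0 (1 * v x) - indicator X x * max 0 (-1 * v x))"
      using ib[of X 1] ib[of X "-1"] by (subst Bochner_Integration.integral_diff) (auto simp: X)
    also have "\<dots> = (LINT x|lborel. indicator X x * v x)"
      by (rule arg_cong[where f = "integral\<^sup>L lborel"]) (auto simp: fun_eq_iff indicator_def max_def)
    also have "\<dots> = 0" unfolding X by (rule zero)
    finally show "emeasure (M 1) X = emeasure (M (-1)) X" by (simp add: em X)
  qed
  then have "AE x in lborel. ennreal (max 0 (1 * v x)) = ennreal (max 0 (-1 * v x))"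
    unfolding M_def using vb by (intro sigma_finite_measure.density_unique[OF sigma_finite_lborel]) auto
  then show ?thesis by eventually_elim (auto simp: max_def split: if_splits)
qed

text \<open>The bumps of a box converge to its indicator, so \<open>u\<close> has integral 0 over
  every open box whose closed box lies in \<open>U\<close>, and \<open>U\<close> is a countable
  union of closed boxes.\<close>

lemma fundamental_lemma:
  fixes u :: "'n::finite pt \<Rightarrow> real"
  assumes U: "open U" and int: "set_integrable lebesgue U u"
    and zero: "\<And>\<phi>. \<phi> \<in> test_fun U \<Longrightarrow> set_lebesgue_integral lebesgue U (\<lambda>x. u x * \<phi> x) = 0"
  shows "AE x in lebesgue. x \<in> U \<longrightarrow> u x = 0"
proof -
  define u' where "u' x = indicator U x * u x" for x
  have u'i: "integrable lebesgue u'" using int by (simp add: set_integrable_def u'_def[abs_def])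
  have box0: "(LINT x|lebesgue. indicator (box a b) x * u' x) = 0" if ab: "cbox a b \<subseteq> U" for a b
  proof -
    have "(\<lambda>m. LINT x|lebesgue. u' x * box_bump m a b x) \<longlonglongrightarrow> (LINT x|lebesgue. u' x * indicator (box a b) x)"
    proof (rule integral_dominated_convergence[where w = "\<lambda>x. \<bar>u' x\<bar>"])
      show "(\<lambda>x. u' x * indicator (box a b) x) \<in> borel_measurable lebesgue"
        using u'i lebesgue_borel_integral(2)[of "indicator (box a b)"] by (intro borel_measurable_times) auto
      show "(\<lambda>x. u' x * box_bump m a b x) \<in> borel_measurable lebesgue" for m
      proof -
        have "C1 (box_bump m a b)" using smooth_gen_partial[OF box_bump_smooth] by blast
        then have "box_bump m a b \<in> borel_measurable borel" by (intro borel_measurable_continuous_onI C1_continuous)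
        then show ?thesis using u'i lebesgue_borel_integral(2) by (intro borel_measurable_times) auto
      qed
      show "integrable lebesgue (\<lambda>x. \<bar>u' x\<bar>)" using u'i by (rule integrable_abs)
      show "AE x in lebesgue. (\<lambda>m. u' x * box_bump m a b x) \<longlonglongrightarrow> u' x * indicator (box a b) x"
        by (intro AE_I2 tendsto_mult tendsto_const box_bump_tendsto)
      show "AE x in lebesgue. norm (u' x * box_bump m a b x) \<le> \<bar>u' x\<bar>" for m
        using box_bump_bounds[of m a b] by (intro AE_I2) (simp add: abs_mult mult_left_le)
    qed
    moreover have "(LINT x|lebesgue. u' x * box_bump m a b x) = 0" for m
      using zero[OF box_bump_test_fun[OF ab, of m]] by (simp add: set_lebesgue_integral_def u'_def mult.assoc)
    ultimately have "(LINT x|lebesgue. u' x * indicator (box a b) x) = 0" using LIMSEQ_unique[OF tendsto_const] by fastforce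
    then show ?thesis by (simp add: mult.commute)
  qed
  have AEbox: "AE x in lebesgue. x \<in> cbox a b \<longrightarrow> u x = 0" if ab: "cbox a b \<subseteq> U" for a b
  proof -
    define w where "w x = indicator (box a b) x * u' x" for x
    have wi: "integrable lebesgue w"
      unfolding w_def using integrable_mult_indicator[OF _ u'i, of "box a b"] by simp
    \<comment> \<open>The function cut off to the box is only Lebesgue measurable, whereas
      \<open>AE_zero_from_boxes\<close> works with \<open>lborel\<close>; a Borel representative
      bridges this.\<close>
    obtain w' where w': "w' \<in> borel_measurable lborel" "AE x in lborel. w x = w' x"
      using completion_ex_borel_measurable_real[of w lborel] wi by auto
    have AEw: "AE x in lebesgue. w x = w' x" using w'(2) by (rule AE_completion)
    have w'i: "integrable lebesgue w'"
      using integrable_cong_AE[of w lebesgue w'] wi AEw w'(1) measurable_completion[OF w'(1)] by auto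
    then have w'il: "integrable lborel w'" using w'(1) by (simp add: integrable_completion)
    have "AE x in lborel. w' x = 0"
    proof (rule AE_zero_from_boxes[OF w'il])
      fix c d :: "'n pt"
      \<comment> \<open>An arbitrary box is intersected with the one inside \<open>U\<close>. The
        result is a box, and unless it is empty its closed box lies in \<open>cbox a b\<close> and
        so in \<open>U\<close>.\<close>
      obtain p q where pq: "box c d \<inter> box a b = box p q" unfolding box_Int_box by blast
      have "(LINT x|lebesgue. indicator (box p q) x * u' x) = 0"
      proof (cases "box p q = {}")
        case False
        then have "closure (box p q) = cbox p q" by (rule closure_box)
        moreover have "closure (box p q) \<subseteq> cbox a b"
          using pq box_subset_cbox[of a b] by (intro closure_minimal) auto
        ultimately show ?thesis using box0 ab by blast
      qed simp
      moreover have "(LINT x|lborel. indicator (box c d) x * w' x) = (LINT x|lebesgue. indicator (box c d) x * w' x)"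
        using w'(1) by (intro lebesgue_borel_integral(1)[symmetric]) auto
      moreover have "(LINT x|lebesgue. indicator (box c d) x * w' x) = (LINT x|lebesgue. indicator (box p q) x * u' x)"
      proof (rule integral_cong_AE)
        have m: "indicat_real (box c d) \<in> borel_measurable lebesgue" "indicat_real (box p q) \<in> borel_measurable lebesgue" for c d p q :: "'n pt"
          by (auto intro!: lebesgue_borel_integral(2))
        show "(\<lambda>x. indicator (box c d) x * w' x) \<in> borel_measurable lebesgue" using m w'i by (intro borel_measurable_times) auto
        show "(\<lambda>x. indicator (box p q) x * u' x) \<in> borel_measurable lebesgue" using m u'i by (intro borel_measurable_times) auto
        show "AE x in lebesgue. indicator (box c d) x * w' x = indicator (box p q) x * u' x"
          using AEw
        proof eventually_elim
          case (elim x)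
          have "indicator (box p q) x = (indicator (box c d) x * indicator (box a b) x :: real)"
            unfolding pq[symmetric] by (rule indicator_inter_arith)
          then show ?case using elim by (simp add: w_def mult.assoc)
        qed
      qed
      ultimately show "(LINT x|lborel. indicator (box c d) x * w' x) = 0" by simp
    qed
    then have 1: "AE x in lebesgue. w' x = 0" by (rule AE_completion)
    have "negligible (cbox a b - box a b)" by (rule negligible_frontier_interval)
    then have "AE x in lebesgue. x \<notin> cbox a b - box a b"
      by (intro AE_not_in) (simp add: negligible_iff_null_sets)
    with 1 AEw show ?thesis
    proof eventually_elim
      case (elim x)
      then show ?case using ab by (auto simp: w_def u'_def)
    qed
  qed
  obtain D where D: "countable D" "D \<subseteq> Pow U" "\<And>X. X \<in> D \<Longrightarrow> \<exists>a b. X = cbox a b" "\<Union>D = U"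
    using open_countable_Union_open_cbox[OF U] by metis
  have "AE x in lebesgue. \<forall>X\<in>D. x \<in> X \<longrightarrow> u x = 0"
  proof (rule AE_ball_countable'[OF _ D(1)])
    fix X assume X: "X \<in> D"
    then obtain a b where ab: "X = cbox a b" using D(3) by blast
    moreover have "X \<subseteq> U" using X D(2) by blast
    ultimately show "AE x in lebesgue. x \<in> X \<longrightarrow> u x = 0" using AEbox by simp
  qed
  then show ?thesis by eventually_elim (use D(4) in blast)
qed

lemma L2_integrable:
  assumes \<Omega>: "bounded \<Omega>" "open \<Omega>" and f: "f \<in> L2 \<Omega>" shows "set_integrable lebesgue \<Omega> f"
proof -
  have m: "set_borel_measurable lebesgue \<Omega> f" and i: "set_integrable lebesgue \<Omega> (\<lambda>x. (f x)\<^sup>2)"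
    using f by (auto simp: L2_def)
  have "\<Omega> \<in> lmeasurable" using \<Omega> by (simp add: lmeasurable_open)
  then have "integrable lebesgue (indicator \<Omega> :: _ \<Rightarrow> real)" by (simp only: lmeasurable_iff_integrable)
  then have "integrable lebesgue (\<lambda>x. indicator \<Omega> x + indicator \<Omega> x *\<^sub>R (f x)\<^sup>2)" using i by (simp add: set_integrable_def)
  then show ?thesis unfolding set_integrable_def
  proof (rule Bochner_Integration.integrable_bound)
    show "(\<lambda>x. indicator \<Omega> x *\<^sub>R f x) \<in> borel_measurable lebesgue" using m by (simp add: set_borel_measurable_def)
    have "\<bar>f x\<bar> \<le> 1 + (f x)\<^sup>2" for x
    proof -
      have "0 \<le> (\<bar>f x\<bar> - 1)\<^sup>2" by simp
      then have "2 * \<bar>f x\<bar> \<le> 1 + (f x)\<^sup>2" by (simp add: power2_diff)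
      then show ?thesis by simp
    qed
    then show "AE x in lebesgue. norm (indicator \<Omega> x *\<^sub>R f x) \<le> norm (indicator \<Omega> x + indicator \<Omega> x *\<^sub>R (f x)\<^sup>2)"
      by (intro AE_I2) (simp add: indicator_def)
  qed
qed

text \<open>Test functions supported in the interior of \<open>T\<close> see \<omega> only as a
  polynomial and produce no facet terms. Hence every weak divergence, and not only the one
  constructed by gluing, agrees with the elementwise divergence almost everywhere.\<close>

lemma weak_divergence_unique:
  fixes \<omega> :: "'n::{finite,linorder} pt \<Rightarrow> 'n tform"
  assumes \<Omega>: "open \<Omega>" "bounded \<Omega>" and T: "int CARD('n) simplex T"
    and P: "P \<in> poly_tform r (XX k)" and \<omega>: "\<omega> \<in> L2_tform \<Omega> E" "AE x in lebesgue. x \<in> \<Omega> \<inter> T \<longrightarrow> \<omega> x = P x"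
    and q: "q \<in> L2_form \<Omega> (Alt k)" and div: "is_div k \<Omega> \<omega> q"
  shows "AE x in lebesgue. x \<in> \<Omega> \<inter> T \<longrightarrow> q x = divf P x"
proof -
  define U where "U = \<Omega> \<inter> interior T"
  have U: "open U" "U \<subseteq> \<Omega>" "U \<subseteq> T" using \<Omega>(1) interior_subset by (auto simp: U_def)
  have C: "simplex_verts (verts T)" "convex hull (verts T) = T" using simplex_verts_verts[OF T] by auto
  have PX: "(XX k :: 'n tform set) \<subseteq> AltT k (CARD('n) - 1)" by (auto simp: XX_def)
  have comp: "AE x in lebesgue. x \<in> U \<longrightarrow> q x (std_vecs \<sigma>) - divf P x (std_vecs \<sigma>) = 0" if \<sigma>: "card \<sigma> = k" for \<sigma>
  proof (rule fundamental_lemma[OF U(1)])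
    let ?s = "std_vecs \<sigma>"
    have Us: "U \<in> sets lebesgue" using U(1) by simp
    have "set_integrable lebesgue \<Omega> (\<lambda>x. q x ?s)" using q by (intro L2_integrable \<Omega>) (auto simp: L2_form_def)
    then have qi: "set_integrable lebesgue U (\<lambda>x. q x ?s)" using Us U(2) by (rule set_integrable_subset)
    have dc: "continuous_on UNIV (\<lambda>x. divf P x ?s)" by (rule poly_fun_continuous_on[OF divf_poly[OF P]])
    have cT: "compact T" using simplex_compact[OF C(1)] C(2) by simp
    have Ti: "set_integrable lebesgue T h" if "continuous_on UNIV h" for h :: "'n pt \<Rightarrow> real"
    proof -
      have i: "integrable lborel (\<lambda>x. indicator T x *\<^sub>R h x)"
        by (rule borel_integrable_compact[OF cT continuous_on_subset[OF that]]) simp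
      then have "(\<lambda>x. indicator T x *\<^sub>R h x) \<in> borel_measurable lborel" by auto
      with i show ?thesis by (simp add: set_integrable_def integrable_completion)
    qed
    have di: "set_integrable lebesgue U (\<lambda>x. divf P x ?s)" by (rule set_integrable_subset[OF Ti[OF dc] Us U(3)])
    show "set_integrable lebesgue U (\<lambda>x. q x ?s - divf P x ?s)" using qi di by (rule set_integral_diff(1))
    fix \<phi> assume \<phi>: "\<phi> \<in> test_fun U"
    note \<phi>1 = test_fun_C1[OF \<phi>]
    have \<phi>\<Omega>: "\<phi> \<in> test_fun \<Omega>" using \<phi> U(2) by (auto simp: test_fun_def)
    have z: "indicator U x *\<^sub>R (c * \<phi> x) = indicator \<Omega> x *\<^sub>R (c * \<phi> x)" "indicator U x *\<^sub>R (c * \<phi> x) = c * \<phi> x"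
      "indicator \<Omega> x *\<^sub>R (\<Sum>i\<in>UNIV. d i * partial i \<phi> x) = (\<Sum>i\<in>UNIV. d i * partial i \<phi> x)" for c x and d :: "'n \<Rightarrow> real"
      using \<phi>1(2)[of x] \<phi>1(3)[of x] U(2) by (cases "x \<in> U"; auto simp: indicator_def)+
    have Cp: "C1 (\<lambda>x. proxy (P x ?s) $ i)" for i by (rule C1_poly_fun[OF proxy_nth_poly[OF P]])
    obtain R where R: "\<And>x. R < norm x \<Longrightarrow> \<phi> x = 0"
      using compact_imp_bounded[OF \<phi>1(4)] closure_subset[of "{x. \<phi> x \<noteq> 0}"] unfolding bounded_iff
      by (metis (mono_tags, lifting) mem_Collect_eq not_less subsetD)
    have R': "partial i \<phi> x = 0" if "x \<notin> U" for i x using \<phi>1(3)[OF that] .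
    have "partial i (\<lambda>x. proxy (P x ?s) $ i * \<phi> x) = (\<lambda>x. proxy (P x ?s) $ i * partial i \<phi> x + partial i (\<lambda>x. proxy (P x ?s) $ i) x * \<phi> x)" for i
      by (rule partial_mult[OF Cp \<phi>1(1)])
    moreover have ip: "integrable lborel (partial i (\<lambda>x. proxy (P x ?s) $ i * \<phi> x))" "(LINT x|lborel. partial i (\<lambda>x. proxy (P x ?s) $ i * \<phi> x) x) = 0" for i
      using integral_partial_zero[OF C1_mult[OF Cp[of i] \<phi>1(1)], of R] R by auto
    ultimately have ip: "integrable lborel (\<lambda>x. proxy (P x ?s) $ i * partial i \<phi> x + partial i (\<lambda>x. proxy (P x ?s) $ i) x * \<phi> x)"
      "(LINT x|lborel. proxy (P x ?s) $ i * partial i \<phi> x + partial i (\<lambda>x. proxy (P x ?s) $ i) x * \<phi> x) = 0" for i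
      by metis+
    have i1: "integrable lborel (\<lambda>x. divf P x ?s * \<phi> x)"
      using R by (intro integrable_compact_support[of _ R] continuous_on_mult dc C1_continuous[OF \<phi>1(1)]) auto
    have i2: "integrable lborel (\<lambda>x. \<Sum>i\<in>UNIV. proxy (P x ?s) $ i * partial i \<phi> x)"
    proof -
      obtain R2 where "\<And>x. x \<in> U \<Longrightarrow> norm x \<le> R2"
        using bounded_subset[OF \<Omega>(2) U(2)] unfolding bounded_iff by blast
      then show ?thesis using R'
        by (intro integrable_compact_support[of _ R2] continuous_on_sum continuous_on_mult C1_continuous[OF Cp] C1_partial_continuous[OF \<phi>1(1)])
          (auto simp: not_le intro!: sum.neutral, fastforce)
    qed
    have "(LINT x|lborel. (\<Sum>i\<in>UNIV. proxy (P x ?s) $ i * partial i \<phi> x) + divf P x ?s * \<phi> x)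
        = (LINT x|lborel. (\<Sum>i\<in>UNIV. proxy (P x ?s) $ i * partial i \<phi> x + partial i (\<lambda>x. proxy (P x ?s) $ i) x * \<phi> x))"
      by (simp add: divf_def sum.distrib sum_distrib_right)
    also have "\<dots> = 0" using ip by (subst Bochner_Integration.integral_sum) auto
    finally have byparts: "(LINT x|lborel. (\<Sum>i\<in>UNIV. proxy (P x ?s) $ i * partial i \<phi> x)) = - (LINT x|lborel. divf P x ?s * \<phi> x)"
      using i1 i2 by simp
    have "set_lebesgue_integral lebesgue \<Omega> (\<lambda>x. \<Sum>i\<in>UNIV. coef (\<omega> x) \<sigma> i * partial i \<phi> x)
      = (LINT x|lebesgue. (\<Sum>i\<in>UNIV. proxy (P x ?s) $ i * partial i \<phi> x))"
      unfolding set_lebesgue_integral_def z(3)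
    proof (rule integral_cong_AE)
      show m1: "(\<lambda>x. \<Sum>i\<in>UNIV. proxy (P x ?s) $ i * partial i \<phi> x) \<in> borel_measurable lebesgue"
        using i2 by (intro lebesgue_borel_integral(2)) auto
      have "(\<lambda>x. indicator \<Omega> x *\<^sub>R \<omega> x ws vs) \<in> borel_measurable lebesgue" for ws vs
        using \<omega>(1) by (auto simp: L2_tform_def L2_def set_borel_measurable_def)
      moreover have "partial i \<phi> \<in> borel_measurable lebesgue" for i
        by (intro lebesgue_borel_integral(2) borel_measurable_continuous_onI C1_partial_continuous[OF \<phi>1(1)])
      ultimately have "(\<lambda>x. \<Sum>i\<in>UNIV. (indicator \<Omega> x *\<^sub>R \<omega> x ?s (std_vecs (- {i}))) * ((-1) ^ pos i * partial i \<phi> x)) \<in> borel_measurable lebesgue"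
        by (intro borel_measurable_sum borel_measurable_times) auto
      moreover have "(\<Sum>i\<in>UNIV. (indicator \<Omega> x *\<^sub>R \<omega> x ?s (std_vecs (- {i}))) * ((-1) ^ pos i * partial i \<phi> x)) = (\<Sum>i\<in>UNIV. coef (\<omega> x) \<sigma> i * partial i \<phi> x)" for x
      proof (cases "x \<in> \<Omega>")
        case False
        then have "partial i \<phi> x = 0" for i using \<phi>1(3) U(2) by blast
        then show ?thesis by simp
      qed (simp add: coef_def mult_ac)
      ultimately show "(\<lambda>x. \<Sum>i\<in>UNIV. coef (\<omega> x) \<sigma> i * partial i \<phi> x) \<in> borel_measurable lebesgue" by simp
      show "AE x in lebesgue. (\<Sum>i\<in>UNIV. coef (\<omega> x) \<sigma> i * partial i \<phi> x) = (\<Sum>i\<in>UNIV. proxy (P x ?s) $ i * partial i \<phi> x)"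
        using \<omega>(2)
      proof eventually_elim
        case (elim x)
        then show ?case using R' U by (cases "x \<in> U") (auto simp: coef_proxy intro!: sum.cong)
      qed
    qed
    also have "\<dots> = (LINT x|lborel. (\<Sum>i\<in>UNIV. proxy (P x ?s) $ i * partial i \<phi> x))"
      using i2 by (intro lebesgue_borel_integral(1)) auto
    finally have "set_lebesgue_integral lebesgue \<Omega> (\<lambda>x. q x ?s * \<phi> x) = (LINT x|lborel. divf P x ?s * \<phi> x)"
      using div \<sigma> \<phi>\<Omega> byparts unfolding is_div_def by simp
    then have 1: "set_lebesgue_integral lebesgue U (\<lambda>x. q x ?s * \<phi> x) = (LINT x|lborel. divf P x ?s * \<phi> x)"
      unfolding set_lebesgue_integral_def z(1) .
    have 2: "set_lebesgue_integral lebesgue U (\<lambda>x. divf P x ?s * \<phi> x) = (LINT x|lborel. divf P x ?s * \<phi> x)"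
      unfolding set_lebesgue_integral_def z(2) using i1 by (intro lebesgue_borel_integral(1)) auto
    have \<phi>bd: "\<exists>B. \<forall>x. \<bar>\<phi> x\<bar> \<le> B"
    proof -
      have "bounded (\<phi> ` cball 0 R)" by (intro compact_imp_bounded compact_continuous_image C1_continuous[OF \<phi>1(1)] compact_cball)
      then obtain B where B: "\<forall>x\<in>cball 0 R. \<bar>\<phi> x\<bar> \<le> B" unfolding bounded_iff by auto
      have "\<bar>\<phi> x\<bar> \<le> max B 0" for x
        using bspec[OF B, of x] R[of x] by (cases "R < norm x") (auto simp: le_max_iff_disj)
      then show ?thesis by blast
    qed
    then obtain B where B: "\<And>x. \<bar>\<phi> x\<bar> \<le> B" by blast
    have mult: "set_integrable lebesgue U (\<lambda>x. h x * \<phi> x)" if "set_integrable lebesgue U h" for h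
    proof -
      have m1: "integrable lebesgue (\<lambda>x. B * (indicator U x *\<^sub>R h x))" using that by (simp add: set_integrable_def)
      have m2: "(\<lambda>x. indicator U x *\<^sub>R (h x * \<phi> x)) \<in> borel_measurable lebesgue"
      proof -
        have "(\<lambda>x. (indicator U x *\<^sub>R h x) * \<phi> x) \<in> borel_measurable lebesgue"
        proof (rule borel_measurable_times)
          show "(\<lambda>x. indicator U x *\<^sub>R h x) \<in> borel_measurable lebesgue" using that by (auto simp: set_integrable_def)
          show "\<phi> \<in> borel_measurable lebesgue"
            by (intro lebesgue_borel_integral(2) borel_measurable_continuous_onI C1_continuous[OF \<phi>1(1)])
        qed
        then show ?thesis by (simp add: mult.assoc)
      qed
      have m3: "norm (indicator U x *\<^sub>R (h x * \<phi> x)) \<le> norm (B * (indicator U x *\<^sub>R h x))" for x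
      proof -
        have "\<bar>h x\<bar> * \<bar>\<phi> x\<bar> \<le> \<bar>h x\<bar> * \<bar>B\<bar>" using B[of x] by (intro mult_left_mono) auto
        then show ?thesis by (cases "x \<in> U") (auto simp: abs_mult mult.commute)
      qed
      show ?thesis unfolding set_integrable_def
        by (rule Bochner_Integration.integrable_bound[OF m1 m2]) (intro AE_I2 m3)
    qed
    show "set_lebesgue_integral lebesgue U (\<lambda>x. (q x ?s - divf P x ?s) * \<phi> x) = 0"
      unfolding left_diff_distrib using set_integral_diff(2)[OF mult[OF qi] mult[OF di]] 1 2 by simp
  qed
  have "AE x in lebesgue. \<forall>\<sigma>\<in>{\<sigma>. card \<sigma> = k}. x \<in> U \<longrightarrow> q x (std_vecs \<sigma>) - divf P x (std_vecs \<sigma>) = 0"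
    using comp by (subst AE_finite_all) auto
  moreover have "AE x in lebesgue. x \<in> T \<longrightarrow> x \<in> interior T"
    using AE_lebesgue_lborel[OF simplex_boundary_null[OF C(1)]] C(2) by simp
  ultimately show ?thesis
  proof eventually_elim
    case (elim x)
    show ?case
    proof
      assume x: "x \<in> \<Omega> \<inter> T"
      then have xU: "x \<in> U" using elim by (auto simp: U_def)
      have "q x \<in> Alt k" using q x by (auto simp: L2_form_def)
      then show "q x = divf P x"
        using elim xU by (intro Alt_eqI[OF _ divf_Alt[OF P PX] span_axis]) (auto simp: std_vecs_subfam)
    qed
  qed
qed


section \<open>The orthogonal complement of the divergences\<close>

lemma poly_fun_line:
  assumes "p \<in> poly_fun r" obtains q :: "real poly" where "\<And>t. p (x + t *\<^sub>R u) = poly q t"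
proof -
  have "\<exists>q :: real poly. \<forall>t. p (x + t *\<^sub>R u) = poly q t" using assms
  proof (induction rule: poly_fun_induct)
    case (const r c) show ?case by (intro exI[of _ "[:c:]"]) simp
  next
    case (add r p q)
    then obtain p' q' where "\<forall>t. p (x + t *\<^sub>R u) = poly p' t" "\<forall>t. q (x + t *\<^sub>R u) = poly q' t" by blast
    then show ?case by (intro exI[of _ "p' + q'"]) simp
  next
    case (coord r p i)
    then obtain p' where "\<forall>t. p (x + t *\<^sub>R u) = poly p' t" by blast
    then show ?case by (intro exI[of _ "[:x $ i, u $ i:] * p'"]) (simp add: algebra_simps)
  qed
  then show ?thesis using that by blast
qed

text \<open>On the line from \<open>x0\<close> to \<open>y\<close> the polynomial in one variable
  has infinitely many zeros.\<close>

lemma poly_fun_zero_open: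
  assumes p: "p \<in> poly_fun r" and U: "open U" "x0 \<in> U" and z: "\<And>x. x \<in> U \<Longrightarrow> p x = 0"
  shows "p y = 0"
proof -
  obtain q where q: "\<And>t. p (x0 + t *\<^sub>R (y - x0)) = poly q t" using poly_fun_line[OF p] by blast
  obtain e where e: "e > 0" "ball x0 e \<subseteq> U" using U open_contains_ball by blast
  define d where "d = e / (1 + norm (y - x0))"
  have d: "d > 0" using e by (simp add: d_def add_pos_nonneg)
  have "poly q t = 0" if t: "t \<in> {0<..<d}" for t
  proof -
    have "t * norm (y - x0) \<le> d * norm (y - x0)" using t by (intro mult_right_mono) auto
    also have "\<dots> < e" using e by (simp add: d_def field_simps add_pos_nonneg)
    finally have "x0 + t *\<^sub>R (y - x0) \<in> ball x0 e" using t by (simp add: dist_norm)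
    then show ?thesis using q z e(2) by (metis subsetD)
  qed
  then have "{0<..<d} \<subseteq> {t. poly q t = 0}" by blast
  then have "infinite {t. poly q t = 0}" using infinite_Ioo[OF d] infinite_super by blast
  then have "q = 0" using poly_roots_finite by blast
  then show ?thesis using q[of 1] by simp
qed

lemma interior_simplex_nonempty:
  assumes "simplex_verts C" shows "interior (convex hull C) \<noteq> {}"
  using assms interior_convex_hull_eq_empty[of C] by (simp add: simplex_verts_def)

lemma weighted_integral_zero:
  fixes h :: "'n::finite pt \<Rightarrow> real"
  assumes C: "simplex_verts C" and h: "continuous_on UNIV h" "\<And>x. x \<in> convex hull C \<Longrightarrow> 0 \<le> h x"
    and zero: "(LINT x|lborel. indicator (convex hull C) x * h x) = 0" and x: "x \<in> interior (convex hull C)"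
  shows "h x = 0"
proof (rule ccontr)
  let ?T = "convex hull C" and ?U = "interior (convex hull C) \<inter> {y. 0 < h y}"
  assume ne: "h x \<noteq> 0"
  have "x \<in> ?T" using x interior_subset by (rule rev_subsetD)
  then have pos: "0 < h x" using h(2)[of x] ne by simp
  have i: "integrable lborel (\<lambda>x. indicator ?T x * h x)"
    using borel_integrable_compact[OF simplex_compact[OF C] continuous_on_subset[OF h(1) subset_UNIV]] by simp
  have nn: "0 \<le> indicator ?T x * h x" for x using h(2)[of x] by (cases "x \<in> ?T") auto
  have "AE x in lborel. indicator ?T x * h x = 0"
    using integral_nonneg_eq_0_iff_AE[OF i AE_I2] nn zero by blast
  then have ae: "AE y in lborel. y \<notin> ?U"
  proof eventually_elim
    case (elim y)
    show ?case
    proof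
      assume y: "y \<in> ?U"
      then have "y \<in> ?T" using interior_subset by blast
      then show False using elim y by simp
    qed
  qed
  have o: "open ?U" by (intro open_Int open_interior open_Collect_less continuous_intros h)
  then have "?U \<in> sets lborel" by simp
  with ae have "?U \<in> null_sets lborel" by (simp add: AE_iff_null_sets)
  then have "negligible ?U" by (simp add: negligible_iff_null_sets null_sets_completionI)
  then show False using open_not_negligible[OF o] x pos by blast
qed

text \<open>\<open>W\<close> is only known to lie in the span of finitely many \<open>b i\<close>,
  which may be dependent or lie outside \<open>W\<close>. Removing one of them leaves a subspace
  \<open>W'\<close> of codimension at most 1; the projection onto \<open>W'\<close> is then
  corrected along a vector \<open>v\<close> of \<open>W\<close> orthogonal to \<open>W'\<close>. The
  form is merely semidefinite, so \<open>v\<close> may have length 0.\<close>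

lemma orthogonal_projection:
  fixes ip :: "('a \<Rightarrow> real) \<Rightarrow> ('a \<Rightarrow> real) \<Rightarrow> real"
  assumes S: "\<And>f g c. f \<in> S \<Longrightarrow> g \<in> S \<Longrightarrow> (\<lambda>x. f x + c * g x) \<in> S"
    and lin: "\<And>f g h c. f \<in> S \<Longrightarrow> g \<in> S \<Longrightarrow> h \<in> S \<Longrightarrow> ip (\<lambda>x. f x + c * g x) h = ip f h + c * ip g h"
    and sym: "\<And>f g. ip f g = ip g f" and psd: "\<And>f. f \<in> S \<Longrightarrow> 0 \<le> ip f f"
    and fin: "finite I"
  shows "W \<subseteq> S \<Longrightarrow> (\<lambda>x. 0) \<in> W \<Longrightarrow> (\<And>f g c. f \<in> W \<Longrightarrow> g \<in> W \<Longrightarrow> (\<lambda>x. f x + c * g x) \<in> W) \<Longrightarrow>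
    (\<And>f. f \<in> W \<Longrightarrow> \<exists>c. f = (\<lambda>x. \<Sum>i\<in>I. c i * b i x)) \<Longrightarrow>
    p \<in> S \<Longrightarrow> \<exists>w\<in>W. \<forall>w'\<in>W. ip (\<lambda>x. p x + (-1) * w x) w' = 0"
  using fin
proof (induction I arbitrary: W p)
  case empty
  have "ip f (\<lambda>x. 0) = 0" if "f \<in> S" for f
    using lin[OF empty(5,5) that, of "-1"] sym[of f "\<lambda>x. 0"] by simp
  note zero = this
  have triv: "f = (\<lambda>x. 0)" if f: "f \<in> W" for f
  proof -
    obtain c where "f = (\<lambda>x. \<Sum>i\<in>{}. c i * b i x)" using empty(4)[OF f] by (elim exE)
    then show ?thesis by (simp only: sum.empty)
  qed
  have "(\<lambda>x. p x + (-1) * (\<lambda>x. 0) x) \<in> S" using S[OF empty(5) subsetD[OF empty(1,2)]] .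
  then have "ip (\<lambda>x. p x + (-1) * (\<lambda>x. 0) x) w' = 0" if "w' \<in> W" for w'
    unfolding triv[OF that] by (rule zero)
  then show ?case using empty(2) by (intro bexI[of _ "\<lambda>x. 0"] ballI)
next
  case (insert j I)
  note WS = insert.prems(1) and W0 = insert.prems(2) and Wc = insert.prems(3) and Wspan = insert.prems(4) and p = insert.prems(5)
  define W' where "W' = {f \<in> W. \<exists>c. f = (\<lambda>x. \<Sum>i\<in>I. c i * b i x)}"
  have W'I: "f \<in> W'" if "f \<in> W" "f = (\<lambda>x. \<Sum>i\<in>I. c i * b i x)" for f c
    unfolding W'_def using that by blast
  have W'S: "W' \<subseteq> S" "W' \<subseteq> W" using WS by (auto simp: W'_def)
  have W'0: "(\<lambda>x. 0) \<in> W'" using W0 by (rule W'I[of _ "\<lambda>_. 0"]) simp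
  have W'c: "(\<lambda>x. f x + c * g x) \<in> W'" if fg: "f \<in> W'" "g \<in> W'" for f g c
  proof -
    obtain cf cg where "f = (\<lambda>x. \<Sum>i\<in>I. cf i * b i x)" "g = (\<lambda>x. \<Sum>i\<in>I. cg i * b i x)" using fg unfolding W'_def by blast
    then have "(\<lambda>x. f x + c * g x) = (\<lambda>x. \<Sum>i\<in>I. (cf i + c * cg i) * b i x)"
      by (simp add: sum.distrib sum_distrib_left distrib_right mult.assoc)
    moreover have "(\<lambda>x. f x + c * g x) \<in> W" using fg W'S(2) by (intro Wc) blast+
    ultimately show ?thesis by (rule W'I[rotated])
  qed
  have IH: "\<exists>w\<in>W'. \<forall>w'\<in>W'. ip (\<lambda>x. p x + (-1) * w x) w' = 0" if "p \<in> S" for p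
    by (rule insert.IH[OF W'S(1) W'0 W'c _ that]) (simp_all only: W'_def mem_Collect_eq)
  show ?case
  proof (cases "W \<subseteq> W'")
    case True
    then show ?thesis using IH[OF p] W'S(2) by blast
  next
    case False
    then obtain w0 where w0: "w0 \<in> W" "w0 \<notin> W'" by blast
    obtain c0 where c0: "w0 = (\<lambda>x. \<Sum>i\<in>insert j I. c0 i * b i x)" using Wspan[OF w0(1)] by blast
    have c0j: "c0 j \<noteq> 0"
    proof
      assume "c0 j = 0"
      then have "w0 = (\<lambda>x. \<Sum>i\<in>I. c0 i * b i x)" using insert.hyps by (subst c0) simp
      then show False using W'I[OF w0(1)] w0(2) by (elim notE)
    qed
    have w0S: "w0 \<in> S" using w0 WS by blast
    obtain u where u: "u \<in> W'" "\<And>w'. w' \<in> W' \<Longrightarrow> ip (\<lambda>x. w0 x + (-1) * u x) w' = 0" using IH[OF w0S] by blast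
    define v where "v = (\<lambda>x. w0 x + (-1) * u x)"
    have vW: "v \<in> W" unfolding v_def using w0 u W'S by (intro Wc) auto
    then have vS: "v \<in> S" using WS by blast
    obtain y where y: "y \<in> W'" "\<And>w'. w' \<in> W' \<Longrightarrow> ip (\<lambda>x. p x + (-1) * y x) w' = 0" using IH[OF p] by blast
    define p' where "p' = (\<lambda>x. p x + (-1) * y x)"
    have yS: "y \<in> S" using y W'S by blast
    have p'S: "p' \<in> S" unfolding p'_def by (rule S[OF p yS])
    \<comment> \<open>If \<open>v\<close> has length 0 no correction is possible, and none is
      needed: \<open>cs\<close> shows that \<open>p'\<close> is then already orthogonal to
      \<open>v\<close>.\<close>
    define t where "t = (if ip v v = 0 then 0 else ip p' v / ip v v)"
    define w where "w = (\<lambda>x. y x + t * v x)"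
    have wW: "w \<in> W" unfolding w_def using y W'S vW by (intro Wc) auto
    have cs: "ip p' v = 0" if z: "ip v v = 0"
    proof (rule ccontr)
      assume ne: "ip p' v \<noteq> 0"
      \<comment> \<open>Chosen so that the square of \<open>p' + s v\<close>, which is linear in
        \<open>s\<close> when \<open>v\<close> has length 0, takes the value -1.\<close>
      define s where "s = - (ip p' p' + 1) / (2 * ip p' v)"
      have "0 \<le> ip (\<lambda>x. p' x + s * v x) (\<lambda>x. p' x + s * v x)" by (intro psd S p'S vS)
      also have "\<dots> = ip p' (\<lambda>x. p' x + s * v x) + s * ip v (\<lambda>x. p' x + s * v x)" by (intro lin p'S vS S)
      also have "\<dots> = ip p' p' + 2 * s * ip p' v"
        using sym[of p' "\<lambda>x. p' x + s * v x"] sym[of v "\<lambda>x. p' x + s * v x"] lin[OF p'S vS p'S, of s] lin[OF p'S vS vS, of s] z sym[of v p']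
        by simp
      also have "\<dots> = - 1" using ne by (simp add: s_def field_simps)
      finally show False by simp
    qed
    have eq: "(\<lambda>x. p x + (-1) * w x) = (\<lambda>x. p' x + (- t) * v x)" by (simp add: w_def p'_def algebra_simps)
    have v0: "ip (\<lambda>x. p' x + (- t) * v x) v = 0"
      using lin[OF p'S vS vS, of "- t"] cs by (simp add: t_def)
    have 0: "ip (\<lambda>x. p' x + (- t) * v x) w' = 0" if w': "w' \<in> W'" for w'
    proof -
      have "w' \<in> S" using w' W'S by blast
      then show ?thesis using lin[OF p'S vS, of w' "- t"] y(2)[OF w'] u(2)[OF w'] by (simp add: p'_def v_def)
    qed
    have "ip (\<lambda>x. p x + (-1) * w x) w'' = 0" if w'': "w'' \<in> W" for w''
    proof -
      obtain c where c: "w'' = (\<lambda>x. \<Sum>i\<in>insert j I. c i * b i x)" using Wspan[OF w''] by blast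
      define d where "d = c j / c0 j"
      \<comment> \<open>Subtracting this multiple of \<open>w0\<close> cancels the coefficient of
        \<open>b j\<close>, so the remainder belongs to \<open>W'\<close>.\<close>
      define r where "r = (\<lambda>x. w'' x + (- d) * w0 x)"
      have "r = (\<lambda>x. \<Sum>i\<in>I. (c i - d * c0 i) * b i x)"
        unfolding r_def c c0 using insert.hyps c0j
        by (simp add: d_def sum_subtractf left_diff_distrib sum_distrib_left sum_negf algebra_simps)
      moreover have "r \<in> W" unfolding r_def by (rule Wc[OF w'' w0(1)])
      ultimately have rW': "r \<in> W'" by (rule W'I[rotated])
      have rdu: "(\<lambda>x. r x + d * u x) \<in> W'" by (rule W'c[OF rW' u(1)])
      have w''eq: "w'' = (\<lambda>x. (r x + d * u x) + d * v x)" by (simp add: r_def v_def algebra_simps)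
      have qS: "(\<lambda>x. p' x + (- t) * v x) \<in> S" by (rule S[OF p'S vS])
      have "ip (\<lambda>x. p' x + (- t) * v x) w'' = ip w'' (\<lambda>x. p' x + (- t) * v x)" by (rule sym)
      also have "\<dots> = ip (\<lambda>x. r x + d * u x) (\<lambda>x. p' x + (- t) * v x) + d * ip v (\<lambda>x. p' x + (- t) * v x)"
        unfolding w''eq using rdu W'S(1) by (intro lin vS qS) auto
      also have "\<dots> = 0" using 0[OF rdu] v0 sym by simp
      finally show ?thesis unfolding eq .
    qed
    then show ?thesis using wW by blast
  qed
qed

section \<open>Test fields with a constant direction\<close>

definition dir :: "'n::finite pt \<Rightarrow> ('n pt \<Rightarrow> real) \<Rightarrow> 'n pt \<Rightarrow> real" where
  "dir e g x = (\<Sum>i\<in>UNIV. e $ i * partial i g x)"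

lemma dir_mult: "C1 f \<Longrightarrow> C1 g \<Longrightarrow> dir e (\<lambda>x. f x * g x) x = f x * dir e g x + dir e f x * g x"
  by (simp add: dir_def partial_mult distrib_left sum.distrib sum_distrib_left sum_distrib_right mult_ac)

lemma dir_poly: "p \<in> poly_fun r \<Longrightarrow> dir e p \<in> poly_fun (r - 1)"
  unfolding dir_def[abs_def] by (intro poly_fun_sum poly_fun_cmult poly_fun_partial)

lemma dir_bary: "dir e (bary C v) x = bgrad C v \<bullet> e"
  by (simp add: dir_def partial_bary inner_vec_def mult.commute)

lemma dir_prod:
  assumes "finite K" "\<And>w. w \<in> K \<Longrightarrow> C1 (f w)"
  shows "dir e (\<lambda>x. \<Prod>w\<in>K. f w x) x = (\<Sum>w\<in>K. dir e (f w) x * (\<Prod>u\<in>K - {w}. f u x))"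
proof -
  have "dir e (\<lambda>x. \<Prod>w\<in>K. f w x) x = (\<Sum>i\<in>UNIV. \<Sum>w\<in>K. e $ i * partial i (f w) x * (\<Prod>u\<in>K - {w}. f u x))"
    unfolding dir_def by (simp only: partial_prod[where p = f, OF assms] sum_distrib_left mult.assoc)
  also have "\<dots> = (\<Sum>w\<in>K. \<Sum>i\<in>UNIV. e $ i * partial i (f w) x * (\<Prod>u\<in>K - {w}. f u x))" by (rule sum.swap)
  finally show ?thesis by (simp add: dir_def sum_distrib_right)
qed

definition scal :: "('n::{finite,linorder} pt \<Rightarrow> real) \<Rightarrow> 'n pt \<Rightarrow> 'n form \<Rightarrow> 'n pt \<Rightarrow> 'n tform" where
  "scal g e \<alpha> x = (\<lambda>ws vs. g x * zeta e \<alpha> ws vs)"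

lemma proxy_zeta: "proxy (zeta e \<alpha> ws) = \<alpha> (e # ws) *\<^sub>R e"
proof -
  have "zeta e \<alpha> ws = (\<lambda>vs. \<alpha> (e # ws) * ip e vol vs)" by (simp add: zeta_def tensor_def ip_def)
  then show ?thesis by (simp add: proxy_scale proxy_ip_vol)
qed

lemma proxy_scal: "proxy (scal g e \<alpha> x ws) = (g x * \<alpha> (e # ws)) *\<^sub>R e"
  by (simp add: scal_def proxy_scale proxy_zeta)

lemma scal_poly:
  assumes "g \<in> poly_fun r" "\<alpha> \<in> Alt (Suc k)" "1 \<le> k"
  shows "scal g e \<alpha> \<in> poly_tform r (XX k)"
  unfolding poly_tform_def scal_def
  using XX_scale[OF zeta_XX[OF assms(2,3)]] poly_fun_multc[OF assms(1)] by blast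

text \<open>The proxy always points along \<open>e\<close>, so the divergence involves only the
  derivative of the scalar factor along \<open>e\<close>.\<close>

lemma divf_scal: "C1 g \<Longrightarrow> divf (scal g e \<alpha>) x ws = dir e g x * \<alpha> (e # ws)"
proof -
  assume g: "C1 g"
  have "(\<lambda>x. proxy (scal g e \<alpha> x ws) $ i) = (\<lambda>x. (\<alpha> (e # ws) * e $ i) * g x)" for i
    by (simp add: proxy_scal mult_ac)
  then have "partial i (\<lambda>x. proxy (scal g e \<alpha> x ws) $ i) x = (\<alpha> (e # ws) * e $ i) * partial i g x" for i
    by (simp only: partial_cmult[OF g])
  then have "divf (scal g e \<alpha>) x ws = (\<Sum>i\<in>UNIV. (\<alpha> (e # ws) * e $ i) * partial i g x)"
    unfolding divf_def by (simp only:)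
  then show ?thesis by (simp add: dir_def sum_distrib_left sum_distrib_right mult_ac)
qed

lemma form_inner_divf_scal:
  "C1 g \<Longrightarrow> form_inner k \<beta> (divf (scal g e \<alpha>) x) = dir e g x * form_inner k \<beta> (ip e \<alpha>)"
  by (simp add: form_inner_def divf_scal ip_def sum_distrib_left mult_ac)

text \<open>The divergence theorem for the field \<open>g T\<close> times the constant vector
  \<open>e\<close>; between neighbours it is then enough that the scalars agree.\<close>

lemma mesh_dir_zero:
  fixes \<S> :: "'n::{finite,linorder} pt set set"
  assumes m: "simplicial_mesh \<S>" and g: "\<And>T. T \<in> \<S> \<Longrightarrow> C1 (g T)"
    and inner: "\<And>T T' v v' x. T \<in> \<S> \<Longrightarrow> T' \<in> \<S> \<Longrightarrow> v \<in> verts T \<Longrightarrow> adjacent T v T' v' \<Longrightarrow>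
      x \<in> convex hull (verts T - {v}) \<Longrightarrow> g T x = g T' x"
    and outer: "\<And>T v x. T \<in> \<S> \<Longrightarrow> v \<in> verts T \<Longrightarrow> (\<And>T' v'. T' \<in> \<S> \<Longrightarrow> \<not> adjacent T v T' v') \<Longrightarrow>
      x \<in> convex hull (verts T - {v}) \<Longrightarrow> g T x * (bgrad (verts T) v \<bullet> e) = 0"
  shows "(\<Sum>T\<in>\<S>. LINT x|lborel. indicator T x * dir e (g T) x) = 0"
proof -
  have "(\<Sum>T\<in>\<S>. LINT x|lborel. indicator T x * (\<Sum>i\<in>UNIV. partial i (\<lambda>x. e $ i * g T x) x)) = 0"
  proof (rule mesh_divergence_zero[OF m])
    fix T v x assume "T \<in> \<S>" "v \<in> verts T" "\<And>T' v'. T' \<in> \<S> \<Longrightarrow> \<not> adjacent T v T' v'" "x \<in> convex hull (verts T - {v})"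
    from outer[OF this] show "(\<Sum>i\<in>UNIV. bgrad (verts T) v $ i * (e $ i * g T x)) = 0"
      by (simp add: inner_vec_def sum_distrib_left mult_ac)
  qed (use inner in \<open>simp_all add: C1_cmult g\<close>)
  moreover have "(\<Sum>i\<in>UNIV. partial i (\<lambda>x. e $ i * g T x) x) = dir e (g T) x" if "T \<in> \<S>" for T x
    using partial_cmult[OF g[OF that]] by (simp add: dir_def)
  ultimately show ?thesis by simp
qed

lemma single_mesh: "simplicial_mesh \<T> \<Longrightarrow> T \<in> \<T> \<Longrightarrow> simplicial_mesh {T}"
  by (rule mesh_subset) auto

lemma integrable_simplex:
  fixes h :: "'n::finite pt \<Rightarrow> real"
  assumes "simplicial_mesh \<T>" "T \<in> \<T>" "continuous_on UNIV h"
  shows "integrable lborel (\<lambda>x. indicator T x * h x)"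
proof -
  have "compact T" using simplex_compact[OF mesh_verts[OF assms(1,2)]] mesh_hull[OF assms(1,2)] by simp
  from borel_integrable_compact[OF this continuous_on_subset[OF assms(3)]] show ?thesis by simp
qed

lemma dir_continuous: "C1 g \<Longrightarrow> continuous_on UNIV (dir e g)"
  unfolding dir_def[abs_def] by (intro continuous_on_sum continuous_on_mult continuous_on_const C1_partial_continuous)

text \<open>On a subsimplex that misses one end point of the edge, the coordinate of that end point
  vanishes; if it contains both, the direction of the field is tangential. So all normal components
  are 0 and the field can be extended by 0.\<close>

lemma edge_test_normal_family:
  fixes \<T> :: "'n::{finite,linorder} pt set set"
  assumes m: "simplicial_mesh \<T>" and T: "T \<in> \<T>" and vw: "v \<in> verts T" "w \<in> verts T" "v \<noteq> w"
    and p: "p \<in> poly_fun (r - 2)" and r: "2 \<le> r" and \<alpha>: "\<alpha> \<in> Alt (Suc k)" and k: "1 \<le> k"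
  shows "normal_family k r \<T> (\<lambda>T'. if T' = T then scal (\<lambda>x. bary (verts T) v x * bary (verts T) w x * p x) (v - w) \<alpha> else (\<lambda>x ws vs. 0))"
    (is "normal_family k r \<T> ?P")
proof -
  have C: "simplex_verts (verts T)" using mesh_verts[OF m T] .
  have "(\<lambda>x. bary (verts T) v x * bary (verts T) w x * p x) \<in> poly_fun ((1 + 1) + (r - 2))"
    by (intro poly_fun_mult bary_poly p)
  moreover have "(1 + 1) + (r - 2) = r" using r by simp
  ultimately have g: "(\<lambda>x. bary (verts T) v x * bary (verts T) w x * p x) \<in> poly_fun r" by (simp only:)
  have "(\<lambda>x ws vs. 0) \<in> poly_tform r (XX k :: 'n tform set)" by (simp add: poly_tform_def XX_zero poly_fun_const)
  then have pol: "?P T' \<in> poly_tform r (XX k)" for T' using scal_poly[OF g \<alpha> k] by simp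
  have zero: "proxy (?P T' x ws) \<bullet> n = 0" if K: "K \<subseteq> verts T'" "x \<in> convex hull K" "\<forall>w\<in>tangent_space (convex hull K). n \<bullet> w = 0" for T' x ws n K
  proof (cases "T' = T")
    case True
    then have KT: "K \<subseteq> verts T" using K by simp
    have b: "bary (verts T) u x = 0" if "u \<in> verts T - K" for u using convex_hull_bary[OF C KT] K(2) that by blast
    have "bary (verts T) v x * bary (verts T) w x * (n \<bullet> (v - w)) = 0"
    proof (cases "v \<in> K \<and> w \<in> K")
      case True
      then have "v \<in> convex hull K" "w \<in> convex hull K" by (auto simp: hull_inc)
      then have "v - w \<in> tangent_space (convex hull K)" unfolding tangent_space_def by (intro span_base) blast
      then show ?thesis using K(3) by simp
    next
      case False
      then have "bary (verts T) v x = 0 \<or> bary (verts T) w x = 0" using b vw by blast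
      then show ?thesis by auto
    qed
    then show ?thesis using True by (auto simp: proxy_scal inner_commute)
  qed (simp add: proxy_zero)
  show ?thesis unfolding normal_family_def
  proof (intro conjI ballI allI impI)
    fix T1 T2 K :: "'n pt set" and ws n x assume "x \<in> convex hull K" and *: "K \<subseteq> verts T1 \<and> K \<subseteq> verts T2 \<and> K \<noteq> {} \<and> card K \<le> CARD('n) \<and> (\<forall>w\<in>tangent_space (convex hull K). n \<bullet> w = 0)"
    then show "proxy (?P T1 x ws) \<bullet> n = proxy (?P T2 x ws) \<bullet> n" using zero[of K T1 x n ws] zero[of K T2 x n ws] by simp
  qed (rule pol)
qed

lemma bary_agree:
  assumes C: "simplex_verts C" "simplex_verts C'" and K: "K \<subseteq> C" "K \<subseteq> C'" and x: "x \<in> convex hull K" and w: "w \<in> K"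
  shows "bary C w x = bary C' w x"
proof -
  have finK: "finite K" using K(1) simplex_verts_finite[OF C(1)] finite_subset by blast
  obtain u where u: "sum u K = 1" "(\<Sum>v\<in>K. u v *\<^sub>R v) = x" using x convex_hull_finite[OF finK] by auto
  have "bary D w x = u w" if D: "simplex_verts D" "K \<subseteq> D" for D
  proof -
    have ind: "\<not> affine_dependent D" using D by (simp add: simplex_verts_def)
    have "bary D w x = (\<Sum>v\<in>K. u v * bary D w v)" using bary_combination[OF u(1)] u(2) by simp
    also have "\<dots> = (\<Sum>v\<in>K. if v = w then u w else 0)"
    proof (rule sum.cong[OF refl])
      fix v assume "v \<in> K"
      then have "w \<in> D" "v \<in> D" using w D(2) by auto
      then show "u v * bary D w v = (if v = w then u w else 0)" by (simp add: bary_vertex[OF ind])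
    qed
    finally show ?thesis using finK w by simp
  qed
  then show ?thesis using C K by simp
qed

text \<open>The product of the coordinates vanishes on every subsimplex that does not contain
  \<open>K\<close>, and among those of dimension below n only \<open>K\<close> itself contains
  \<open>K\<close>. There the coordinates computed from the two sides agree, and \<open>e\<close>
  and \<alpha> are common to all simplices.\<close>

lemma facet_test_normal_family:
  fixes \<T> :: "'n::{finite,linorder} pt set set"
  assumes m: "simplicial_mesh \<T>" and K: "card K = CARD('n)"
    and p: "p \<in> poly_fun 1" and r: "CARD('n) + 1 \<le> r" and \<alpha>: "\<alpha> \<in> Alt (Suc k)" and k: "1 \<le> k"
  shows "normal_family k r \<T> (\<lambda>T. if K \<subseteq> verts T then scal (\<lambda>x. (\<Prod>w\<in>K. bary (verts T) w x) * p x) e \<alpha> else (\<lambda>x ws vs. 0))"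
    (is "normal_family k r \<T> ?P")
proof -
  have finK: "finite K" using K by (metis card.infinite zero_less_card_finite less_irrefl)
  have "(\<lambda>x. (\<Prod>w\<in>K. bary (verts T) w x) * p x) \<in> poly_fun (card K + 1)" for T
    by (intro poly_fun_mult poly_fun_prod bary_poly p finK)
  then have g: "(\<lambda>x. (\<Prod>w\<in>K. bary (verts T) w x) * p x) \<in> poly_fun r" for T
    by (rule poly_fun_mono) (use K r in simp)
  have "(\<lambda>x ws vs. 0) \<in> poly_tform r (XX k :: 'n tform set)" by (simp add: poly_tform_def XX_zero poly_fun_const)
  then have pol: "?P T \<in> poly_tform r (XX k)" for T using scal_poly[OF g \<alpha> k] by simp
  have zero: "proxy (?P T x ws) = 0" if T: "T \<in> \<T>" and K': "K' \<subseteq> verts T" "x \<in> convex hull K'" "\<not> K \<subseteq> K'" for T x ws K'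
  proof (cases "K \<subseteq> verts T")
    case True
    obtain w where w: "w \<in> K" "w \<notin> K'" using K'(3) by blast
    then have "bary (verts T) w x = 0" using convex_hull_bary[OF mesh_verts[OF m T] K'(1)] K'(2) True by blast
    then have "(\<Prod>w\<in>K. bary (verts T) w x) = 0" using w finK by (intro prod_zero) auto
    then show ?thesis by (simp add: proxy_scal proxy_zero)
  qed (simp add: proxy_zero)
  show ?thesis unfolding normal_family_def
  proof (intro conjI ballI allI impI)
    fix T1 T2 K' ws n x assume T: "T1 \<in> \<T>" "T2 \<in> \<T>" and x: "x \<in> convex hull K'"
      and *: "K' \<subseteq> verts T1 \<and> K' \<subseteq> verts T2 \<and> K' \<noteq> {} \<and> card K' \<le> CARD('n) \<and> (\<forall>w\<in>tangent_space (convex hull K'). n \<bullet> w = 0)"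
    show "proxy (?P T1 x ws) \<bullet> n = proxy (?P T2 x ws) \<bullet> n"
    proof (cases "K \<subseteq> K'")
      case True
      have "finite K'" using * simplex_verts_finite[OF mesh_verts[OF m T(1)]] finite_subset by blast
      then have KK: "K = K'" using True * K by (metis card_seteq)
      then have "K \<subseteq> verts T1" "K \<subseteq> verts T2" using * by auto
      moreover have "(\<Prod>w\<in>K. bary (verts T1) w x) = (\<Prod>w\<in>K. bary (verts T2) w x)"
        using bary_agree[OF mesh_verts[OF m T(1)] mesh_verts[OF m T(2)]] * x KK by (intro prod.cong) auto
      ultimately show ?thesis by (simp add: proxy_scal)
    next
      case False
      then show ?thesis using zero[OF T(1) _ x False] zero[OF T(2) _ x False] * by simp
    qed
  qed (rule pol)
qed

definition orthogonal_to_div ::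
    "nat \<Rightarrow> nat \<Rightarrow> 'n::{finite,linorder} pt set set \<Rightarrow> ('n pt set \<Rightarrow> 'n pt \<Rightarrow> 'n form) \<Rightarrow> bool" where
  "orthogonal_to_div k r \<T> R \<longleftrightarrow> (\<forall>P. normal_family k r \<T> P \<longrightarrow>
     (\<Sum>T\<in>\<T>. LINT x|lborel. indicator T x * form_inner k (R T x) (divf (P T) x)) = 0)"

lemma divf_zero: "divf (\<lambda>x ws vs. 0) x = (\<lambda>ws. 0)"
  by (simp add: divf_def proxy_zero partial_const)

lemma form_inner_zero: "form_inner k \<beta> (\<lambda>ws. 0) = 0"
  by (simp add: form_inner_def)

lemma form_inner_poly: "p \<in> poly_form r E \<Longrightarrow> (\<lambda>x. form_inner k (p x) \<beta>) \<in> poly_fun r"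
  unfolding form_inner_def poly_form_def by (intro poly_fun_sum poly_fun_multc) blast

text \<open>The derivative in question is itself used as the factor \<open>p\<close> of the test
  field. The field \<open>g \<rho> e\<close> has no normal component on the boundary of
  \<open>T\<close>, so the divergence theorem on \<open>T\<close> alone moves the derivative from
  \<open>g\<close> to \<rho>. What remains is the integral of \<open>p\<close> squared with a weight
  that is positive inside \<open>T\<close>.\<close>

lemma edge_derivative_zero:
  fixes \<T> :: "'n::{finite,linorder} pt set set"
  assumes m: "simplicial_mesh \<T>" and T: "T \<in> \<T>" and vw: "v \<in> verts T" "w \<in> verts T" "v \<noteq> w"
    and R: "R T \<in> poly_form (r - 1) E" and r: "2 \<le> r" and \<alpha>: "\<alpha> \<in> Alt (Suc k)" and k: "1 \<le> k"
    and orth: "orthogonal_to_div k r \<T> R"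
  shows "dir (v - w) (\<lambda>x. form_inner k (R T x) (ip (v - w) \<alpha>)) y = 0"
proof -
  define e where "e = v - w"
  define \<rho> where "\<rho> = (\<lambda>x. form_inner k (R T x) (ip e \<alpha>))"
  define p where "p = dir e \<rho>"
  define g where "g = (\<lambda>x. bary (verts T) v x * bary (verts T) w x * p x)"
  let ?P = "\<lambda>T'. if T' = T then scal g e \<alpha> else (\<lambda>x ws vs. 0)"
  have C: "simplex_verts (verts T)" and hull: "convex hull (verts T) = T" using mesh_verts[OF m T] mesh_hull[OF m T] .
  have ind: "\<not> affine_dependent (verts T)" using C by (simp add: simplex_verts_def)
  have \<rho>: "\<rho> \<in> poly_fun (r - 1)" unfolding \<rho>_def by (rule form_inner_poly[OF R])
  have p: "p \<in> poly_fun (r - 2)" using dir_poly[OF \<rho>, of e] r by (simp add: p_def diff_diff_eq numeral_2_eq_2)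
  note C1s = C1_poly_fun[OF \<rho>] C1_poly_fun[OF p]
  have g1: "C1 g" unfolding g_def by (intro C1_mult bary_C1 C1s)
  have "normal_family k r \<T> ?P" using edge_test_normal_family[OF m T vw p r \<alpha> k] by (simp only: g_def e_def)
  then have "(\<Sum>T'\<in>\<T>. LINT x|lborel. indicator T' x * form_inner k (R T' x) (divf (?P T') x)) = 0"
    using orth unfolding orthogonal_to_div_def by blast
  moreover have "(LINT x|lborel. indicator T' x * form_inner k (R T' x) (divf (?P T') x)) =
      (if T' = T then LINT x|lborel. indicator T x * (dir e g x * \<rho> x) else 0)" for T'
    by (simp add: divf_zero form_inner_zero form_inner_divf_scal[OF g1] \<rho>_def)
  ultimately have 1: "(LINT x|lborel. indicator T x * (dir e g x * \<rho> x)) = 0"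
    using T mesh_finite[OF m] by simp
  have g\<rho>: "C1 (\<lambda>x. g x * \<rho> x)" by (intro C1_mult g1 C1s)
  have "(\<Sum>T\<in>{T}. LINT x|lborel. indicator T x * dir e (\<lambda>x. g x * \<rho> x) x) = 0"
  proof (rule mesh_dir_zero[OF single_mesh[OF m T]])
    fix T' u x assume T': "T' \<in> {T}" and u: "u \<in> verts T'" and x: "x \<in> convex hull (verts T' - {u})"
    then have bu: "bary (verts T) u x = 0" using convex_hull_bary[OF C, of "verts T - {u}" x] by blast
    \<comment> \<open>On the facets opposite \<open>v\<close> and \<open>w\<close> a factor of
      \<open>g\<close> vanishes; every other facet contains the edge, and \<open>e\<close> is
      tangential to it.\<close>
    have "g x = 0 \<or> bgrad (verts T') u \<bullet> e = 0"
    proof (cases "u = v \<or> u = w")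
      case True then show ?thesis using bu by (auto simp: g_def)
    next
      case False
      then have "bary (verts T) u v - bary (verts T) u w = 0" using T' u vw False bary_vertex[OF ind] by auto
      then show ?thesis using T' by (simp add: bary_diff e_def)
    qed
    then show "g x * \<rho> x * (bgrad (verts T') u \<bullet> e) = 0" by auto
  qed (use g\<rho> in \<open>auto simp: adjacent_def\<close>)
  then have 2: "(LINT x|lborel. indicator T x * dir e (\<lambda>x. g x * \<rho> x) x) = 0" by simp
  have i: "integrable lborel (\<lambda>x. indicator T x * dir e (\<lambda>x. g x * \<rho> x) x)"
    "integrable lborel (\<lambda>x. indicator T x * (dir e g x * \<rho> x))"
    by (intro integrable_simplex[OF m T] dir_continuous[OF g\<rho>])
      (intro integrable_simplex[OF m T] continuous_on_mult dir_continuous[OF g1] C1_continuous C1s)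
  have "(LINT x|lborel. indicator T x * (g x * p x)) =
      (LINT x|lborel. indicator T x * dir e (\<lambda>x. g x * \<rho> x) x - indicator T x * (dir e g x * \<rho> x))"
    by (intro Bochner_Integration.integral_cong refl) (simp only: dir_mult[OF g1 C1s(1)] p_def distrib_left add_diff_cancel_right')
  also have "\<dots> = 0" using 1 2 by (simp add: Bochner_Integration.integral_diff[OF i])
  finally have z: "(LINT x|lborel. indicator (convex hull (verts T)) x * (g x * p x)) = 0" by (simp add: hull)
  have gp: "g x * p x = bary (verts T) v x * bary (verts T) w x * (p x)\<^sup>2" for x by (simp add: g_def power2_eq_square)
  have "p x = 0" if x: "x \<in> interior (convex hull (verts T))" for x
  proof -
    have "g x * p x = 0"
    proof (rule weighted_integral_zero[OF C _ _ z x])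
      show "continuous_on UNIV (\<lambda>x. g x * p x)" by (intro continuous_on_mult C1_continuous g1 C1s)
      show "0 \<le> g x * p x" if "x \<in> convex hull (verts T)" for x
        unfolding gp using bary_nonneg[OF C that] vw by (intro mult_nonneg_nonneg) auto
    qed
    moreover have "0 < bary (verts T) v x" "0 < bary (verts T) w x" using x vw interior_simplex_bary[OF C] by auto
    ultimately show ?thesis by (simp add: gp)
  qed
  moreover obtain x0 where "x0 \<in> interior (convex hull (verts T))" using interior_simplex_nonempty[OF C] by blast
  ultimately have "p y = 0" using poly_fun_zero_open[OF p open_interior] by blast
  then show ?thesis by (simp add: p_def \<rho>_def e_def)
qed

text \<open>Writing \<open>u v\<close> for \<open>v - v0\<close>, the conditions for the three edges
  between \<open>v\<close>, \<open>w\<close> and \<open>v0\<close> give B(u v, u w) + B(u w, u v) =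
  0, and these vectors span the space. So the symmetric part of \<open>B\<close> is zero.\<close>

lemma bilinear_edges_zero:
  fixes B :: "'n::finite pt \<Rightarrow> 'n pt \<Rightarrow> real"
  assumes C: "simplex_verts C" and B: "bilinear B" and edge: "\<And>v w. v \<in> C \<Longrightarrow> w \<in> C \<Longrightarrow> B (v - w) (v - w) = 0"
  shows "B t t = 0"
proof -
  have "C \<noteq> {}" using C by (auto simp: simplex_verts_def)
  then obtain v0 where v0: "v0 \<in> C" by blast
  \<comment> \<open>The differences of coordinates represent the vector \<open>t\<close> by the
    vertices. They sum to 0, so \<open>v0\<close> can be subtracted from every vertex.\<close>
  define c where "c v = bary C v t - bary C v 0" for v
  define u where "u v = v - v0" for v
  have "(\<Sum>v\<in>C. c v *\<^sub>R u v) = (\<Sum>v\<in>C. bary C v t *\<^sub>R v) - (\<Sum>v\<in>C. bary C v 0 *\<^sub>R v) - ((\<Sum>v\<in>C. bary C v t) - (\<Sum>v\<in>C. bary C v 0)) *\<^sub>R v0"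
    by (simp add: c_def u_def scaleR_diff_right scaleR_diff_left sum_subtractf scaleR_sum_left)
  then have t: "(\<Sum>v\<in>C. c v *\<^sub>R u v) = t" by (simp add: bary_decomp[OF C] sum_bary[OF C])
  have asym: "B (u v) (u w) + B (u w) (u v) = 0" if "v \<in> C" "w \<in> C" for v w
  proof -
    have "0 = B (u v - u w) (u v - u w)" using edge[OF that] by (simp add: u_def)
    also have "\<dots> = B (u v) (u v) - B (u v) (u w) - B (u w) (u v) + B (u w) (u w)"
      by (simp add: bilinear_lsub[OF B] bilinear_rsub[OF B])
    finally show ?thesis using edge[OF _ v0] that by (simp add: u_def)
  qed
  have fin: "finite C" using simplex_verts_finite[OF C] .
  have S: "B t t = (\<Sum>v\<in>C. \<Sum>w\<in>C. c v * c w * B (u v) (u w))"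
    unfolding t[symmetric] using B
    by (simp add: bilinear_sum[OF B] sum.cartesian_product bilinear_lmul[OF B] bilinear_rmul[OF B] mult_ac)
  also have "\<dots> = (\<Sum>v\<in>C. \<Sum>w\<in>C. c v * c w * B (u w) (u v))" by (subst sum.swap) (simp add: mult.commute)
  finally have "B t t + B t t = (\<Sum>v\<in>C. \<Sum>w\<in>C. c v * c w * (B (u v) (u w) + B (u w) (u v)))"
    using S by (simp add: distrib_left sum.distrib)
  also have "\<dots> = 0" by (intro sum.neutral ballI) (simp add: asym)
  finally show ?thesis by simp
qed

text \<open>The derivative along \<open>s\<close> of the pairing of \<open>p\<close> with the
  contraction of \<alpha> by \<open>t\<close>. The edge tests control the case that both directions
  are the same edge; keeping them apart gives a bilinear form to which polarisation applies.\<close>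

definition divform :: "nat \<Rightarrow> ('n::{finite,linorder} pt \<Rightarrow> 'n form) \<Rightarrow> 'n form \<Rightarrow> 'n pt \<Rightarrow> 'n pt \<Rightarrow> 'n pt \<Rightarrow> real" where
  "divform k p \<alpha> x t s = (\<Sum>\<sigma> | card \<sigma> = k. \<alpha> (t # std_vecs \<sigma>) * dir s (\<lambda>x. p x (std_vecs \<sigma>)) x)"

lemma dir_form_inner:
  assumes "p \<in> poly_form r E"
  shows "dir s (\<lambda>x. form_inner k (p x) (ip t \<alpha>)) x = divform k p \<alpha> x t s"
proof -
  have c: "C1 (\<lambda>x. p x ws)" for ws using assms by (auto simp: poly_form_def intro: C1_poly_fun)
  have "partial i (\<lambda>x. form_inner k (p x) (ip t \<alpha>)) x = (\<Sum>\<sigma> | card \<sigma> = k. \<alpha> (t # std_vecs \<sigma>) * partial i (\<lambda>x. p x (std_vecs \<sigma>)) x)" for i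
  proof -
    have "(\<lambda>x. form_inner k (p x) (ip t \<alpha>)) = (\<lambda>x. \<Sum>\<sigma> | card \<sigma> = k. \<alpha> (t # std_vecs \<sigma>) * p x (std_vecs \<sigma>))"
      by (simp add: form_inner_def ip_def mult.commute)
    moreover have "partial i (\<lambda>x. \<Sum>\<sigma> | card \<sigma> = k. \<alpha> (t # std_vecs \<sigma>) * p x (std_vecs \<sigma>)) =
        (\<lambda>x. \<Sum>\<sigma> | card \<sigma> = k. partial i (\<lambda>x. \<alpha> (t # std_vecs \<sigma>) * p x (std_vecs \<sigma>)) x)"
      by (rule partial_sum) (intro C1_cmult c)
    ultimately show ?thesis by (simp only: partial_cmult[OF c])
  qed
  then have "dir s (\<lambda>x. form_inner k (p x) (ip t \<alpha>)) x =
      (\<Sum>i\<in>UNIV. \<Sum>\<sigma> | card \<sigma> = k. s $ i * (\<alpha> (t # std_vecs \<sigma>) * partial i (\<lambda>x. p x (std_vecs \<sigma>)) x))"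
    by (simp only: dir_def sum_distrib_left)
  also have "\<dots> = (\<Sum>\<sigma> | card \<sigma> = k. \<Sum>i\<in>UNIV. s $ i * (\<alpha> (t # std_vecs \<sigma>) * partial i (\<lambda>x. p x (std_vecs \<sigma>)) x))"
    by (rule sum.swap)
  finally show ?thesis by (simp add: divform_def dir_def sum_distrib_left mult.left_commute)
qed

lemma divform_bilinear:
  fixes \<alpha> :: "'n::{finite,linorder} form"
  assumes \<alpha>: "\<alpha> \<in> Alt (Suc k)"
  shows "bilinear (divform k p \<alpha> x)"
proof -
  have l: "linear (\<lambda>t. \<alpha> (t # std_vecs \<sigma>))" if "card \<sigma> = k" for \<sigma> :: "'n set"
    using Alt_linear[OF \<alpha>, of "0 # std_vecs \<sigma>" 0] that by simp
  have "linear (\<lambda>t. divform k p \<alpha> x t s)" for s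
  proof (rule linearI)
    fix t t' c
    show "divform k p \<alpha> x (t + t') s = divform k p \<alpha> x t s + divform k p \<alpha> x t' s"
      unfolding divform_def sum.distrib[symmetric]
      by (intro sum.cong refl) (use linear_add[OF l] in \<open>simp add: distrib_right\<close>)
    show "divform k p \<alpha> x (c *\<^sub>R t) s = c *\<^sub>R divform k p \<alpha> x t s"
      unfolding divform_def real_scaleR_def sum_distrib_left
      by (intro sum.cong refl) (use linear_scale[OF l] in \<open>simp add: mult.assoc\<close>)
  qed
  moreover have "linear (\<lambda>s. divform k p \<alpha> x t s)" for t
    by (intro linearI) (simp_all add: divform_def dir_def distrib_left distrib_right sum.distrib sum_distrib_left mult_ac)
  ultimately show ?thesis by (simp add: bilinear_def)
qed

lemma divform_zero:
  fixes \<T> :: "'n::{finite,linorder} pt set set"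
  assumes m: "simplicial_mesh \<T>" and T: "T \<in> \<T>"
    and R: "R T \<in> poly_form (r - 1) E" and r: "2 \<le> r" and \<alpha>: "\<alpha> \<in> Alt (Suc k)" and k: "1 \<le> k"
    and orth: "orthogonal_to_div k r \<T> R"
  shows "divform k (R T) \<alpha> x t t = 0"
proof (rule bilinear_edges_zero[OF mesh_verts[OF m T] divform_bilinear[OF \<alpha>]])
  fix v w assume "v \<in> verts T" "w \<in> verts T"
  then show "divform k (R T) \<alpha> x (v - w) (v - w) = 0"
    using edge_derivative_zero[OF m T _ _ _ R r \<alpha> k orth, of v w x] bilinear_lzero[OF divform_bilinear[OF \<alpha>], of "R T" x]
    by (cases "v = w") (simp_all add: dir_form_inner[OF R])
qed

lemma gram_std_insert:
  fixes \<sigma> :: "'n::{finite,linorder} set"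
  assumes \<kappa>: "card \<kappa> = Suc (card \<sigma>)"
  shows "gram (std_vecs \<kappa>) (axis i 1 # std_vecs \<sigma>) \<noteq> 0 \<longleftrightarrow> i \<notin> \<sigma> \<and> \<kappa> = insert i \<sigma>"
proof (cases "i \<in> \<sigma>")
  case True
  have A: "gram (std_vecs \<kappa>) \<in> Alt (Suc (card \<sigma>))" using gram_Alt[of "std_vecs \<kappa>"] \<kappa> by simp
  have "\<not> distinct (axis i 1 # std_vecs \<sigma>)" using True by (auto simp: std_vecs_def)
  then show ?thesis using Alt_not_distinct[OF A] True by simp
next
  case False
  then have c: "card (insert i \<sigma>) = Suc (card \<sigma>)" by simp
  have A: "gram (std_vecs \<kappa>) \<in> Alt (card (insert i \<sigma>))" using gram_Alt[of "std_vecs \<kappa>"] \<kappa> c by simp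
  obtain m where "\<And>\<alpha> :: 'n form. \<alpha> \<in> Alt (card (insert i \<sigma>)) \<Longrightarrow> \<alpha> (axis i 1 # std_vecs \<sigma>) = (-1) ^ m * \<alpha> (std_vecs (insert i \<sigma>))"
    using front_subfam[OF False, where z = "\<lambda>i. axis i 1"] unfolding std_vecs_subfam by blast
  from this[OF A] have "gram (std_vecs \<kappa>) (axis i 1 # std_vecs \<sigma>) = (-1) ^ m * (if \<kappa> = insert i \<sigma> then 1 else 0)"
    using gram_dual[OF axis_dual, of \<kappa> "insert i \<sigma>"] \<kappa> c unfolding std_vecs_subfam by simp
  then show ?thesis using False by simp
qed

lemma dir_axis: "dir (axis j 1) f x = partial j f x"
  unfolding dir_def by (rule sum_axis)

lemma divform_gram:
  assumes \<kappa>: "card \<kappa> = Suc k"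
  shows "divform k p (gram (std_vecs \<kappa>)) x (axis i 1) s =
    (if i \<in> \<kappa> then gram (std_vecs \<kappa>) (axis i 1 # std_vecs (\<kappa> - {i})) * dir s (\<lambda>x. p x (std_vecs (\<kappa> - {i}))) x else 0)"
proof -
  have z: "gram (std_vecs \<kappa>) (axis i 1 # std_vecs \<sigma>) = 0" if "card \<sigma> = k" "\<sigma> \<noteq> \<kappa> - {i} \<or> i \<notin> \<kappa>" for \<sigma>
    using gram_std_insert[of \<kappa> \<sigma> i] that \<kappa> by auto
  show ?thesis
  proof (cases "i \<in> \<kappa>")
    case True
    then have "card (\<kappa> - {i}) = k" using \<kappa> by simp
    moreover have "divform k p (gram (std_vecs \<kappa>)) x (axis i 1) s =
        (\<Sum>\<sigma> | card \<sigma> = k. if \<sigma> = \<kappa> - {i} then gram (std_vecs \<kappa>) (axis i 1 # std_vecs \<sigma>) * dir s (\<lambda>x. p x (std_vecs \<sigma>)) x else 0)"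
      unfolding divform_def by (intro sum.cong refl) (simp add: z)
    ultimately show ?thesis using True by simp
  qed (simp add: divform_def z)
qed

lemma partial_commute:
  assumes "p \<in> poly_fun r" shows "partial i (partial j p) = partial j (partial i p)"
  using assms
proof (induction rule: poly_fun_induct)
  case (const r c) then show ?case by (simp add: partial_const)
next
  case (add r p q)
  note c = C1_poly_fun[OF add(1)] C1_poly_fun[OF add(2)] C1_poly_fun[OF poly_fun_partial[OF add(1)]] C1_poly_fun[OF poly_fun_partial[OF add(2)]]
  show ?case by (simp add: partial_add c add.IH)
next
  case (coord r p l)
  note c = C1_poly_fun[OF coord(1)] C1_poly_fun[OF poly_fun_partial[OF coord(1)]] C1_poly_fun[OF poly_fun_coord]
  have d: "partial i (\<lambda>x. x $ l) = (\<lambda>x. axis l 1 $ i)" for i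
  proof -
    have "(\<lambda>x. x $ l) = (\<lambda>x. axis l 1 \<bullet> x + 0)" by (simp add: inner_axis')
    then show ?thesis by (simp only: partial_affine)
  qed
  have "partial i (partial j (\<lambda>x. x $ l * p x)) = (\<lambda>x. (x $ l * partial i (partial j p) x + axis l 1 $ i * partial j p x) + axis l 1 $ j * partial i p x)" for i j
  proof -
    have "partial j (\<lambda>x. x $ l * p x) = (\<lambda>x. x $ l * partial j p x + axis l 1 $ j * p x)" using partial_mult[OF c(3,1)] by (simp add: d)
    moreover have "partial i (\<lambda>x. x $ l * partial j p x + axis l 1 $ j * p x) = (\<lambda>x. partial i (\<lambda>x. x $ l * partial j p x) x + partial i (\<lambda>x. axis l 1 $ j * p x) x)"
      by (intro partial_add C1_mult C1_cmult c)
    moreover have "partial i (\<lambda>x. x $ l * partial j p x) = (\<lambda>x. x $ l * partial i (partial j p) x + axis l 1 $ i * partial j p x)"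
      using partial_mult[OF c(3) c(2)] by (simp add: d)
    ultimately show ?thesis by (simp only: partial_cmult[OF c(1)])
  qed
  then show ?case by (simp add: coord.IH add_ac)
qed

lemma poly_fun_zero_partials:
  assumes p: "p \<in> poly_fun r" and z: "\<And>i x. partial i p x = 0"
  shows "p x = p 0"
proof -
  have "\<exists>c. \<forall>x\<in>UNIV. p x = c"
    using poly_fun_has_derivative[OF p] by (intro has_derivative_zero_constant) (auto simp: z)
  then show ?thesis by auto
qed

lemma poly_fun_zero_second_partials:
  assumes p: "p \<in> poly_fun r" and z: "\<And>i j x. partial i (partial j p) x = 0"
  shows "p \<in> poly_fun 1"
proof -
  define g where "g = (\<chi> j. partial j p 0)"
  have g: "partial j p = (\<lambda>x. g $ j)" for j
    using poly_fun_zero_partials[OF poly_fun_partial[OF p] z] by (auto simp: g_def)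
  have a: "(\<lambda>x. g \<bullet> x + 0) \<in> poly_fun (r + 1)" using poly_fun_affine by (rule poly_fun_mono) simp
  have p': "p \<in> poly_fun (r + 1)" using p by (rule poly_fun_mono) simp
  have "partial j (\<lambda>x. p x - (g \<bullet> x + 0)) = (\<lambda>x. 0)" for j
    using partial_diff[OF C1_poly_fun[OF p] C1_affine[of g 0], of j] by (simp only: partial_affine g diff_self)
  note * = poly_fun_zero_partials[OF poly_fun_diff[OF p' a] fun_cong[OF this]]
  have "p x = g \<bullet> x + p 0" for x using *[of x] by simp
  then have eq: "p = (\<lambda>x. g \<bullet> x + p 0)" by (rule ext)
  show ?thesis by (subst eq) (rule poly_fun_affine)
qed

text \<open>Choosing \<alpha> = dx_\<kappa> with \<open>k\<close> + 1 indices turns the vanishing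
  quadratic form into the relation \<open>D\<close>: up to the signs \<epsilon>, the
  \<open>j\<close>-th derivative of the component at \<kappa> without \<open>i\<close> is
  antisymmetric in \<open>i\<close> and \<open>j\<close>. This is an equation of Killing type, and
  as for Killing fields its solutions have no second derivatives.\<close>

lemma orthogonal_to_div_affine:
  fixes \<T> :: "'n::{finite,linorder} pt set set"
  assumes m: "simplicial_mesh \<T>" and T: "T \<in> \<T>"
    and R: "R T \<in> poly_form (r - 1) (Alt k)" and r: "2 \<le> r" and k: "1 \<le> k" "k < CARD('n)"
    and orth: "orthogonal_to_div k r \<T> R"
  shows "R T \<in> poly_form 1 (Alt k)"
proof -
  define \<rho> where "\<rho> \<sigma> x = R T x (std_vecs \<sigma>)" for \<sigma> x
  define \<epsilon> where "\<epsilon> \<kappa> i = gram (std_vecs \<kappa>) (axis i 1 # std_vecs (\<kappa> - {i}))" for \<kappa> :: "'n set" and i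
  have \<rho>: "\<rho> \<sigma> \<in> poly_fun (r - 1)" for \<sigma> using R by (auto simp: \<rho>_def[abs_def] poly_form_def)
  note c = C1_poly_fun[OF \<rho>] C1_poly_fun[OF poly_fun_partial[OF \<rho>]]
  have \<epsilon>: "\<epsilon> \<kappa> i \<noteq> 0" if "i \<in> \<kappa>" for \<kappa> i
  proof -
    have "card \<kappa> = Suc (card (\<kappa> - {i}))" using card_Suc_Diff1[OF finite that] by simp
    then show ?thesis using gram_std_insert[of \<kappa> "\<kappa> - {i}" i] that by (auto simp only: \<epsilon>_def insert_Diff_single insert_absorb)
  qed
  have D: "\<epsilon> \<kappa> i * partial j (\<rho> (\<kappa> - {i})) x = - (\<epsilon> \<kappa> j * partial i (\<rho> (\<kappa> - {j})) x)"
    if \<kappa>: "card \<kappa> = Suc k" "i \<in> \<kappa>" "j \<in> \<kappa>" for \<kappa> i j x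
  proof -
    have A: "gram (std_vecs \<kappa>) \<in> Alt (Suc k)" using gram_Alt[of "std_vecs \<kappa>"] \<kappa> by simp
    let ?B = "divform k (R T) (gram (std_vecs \<kappa>)) x"
    note B = divform_bilinear[OF A, of "R T" x] and z = divform_zero[OF m T R r A k(1) orth, of x]
    have "?B (axis i 1 + axis j 1) (axis i 1 + axis j 1) = ?B (axis i 1) (axis j 1) + ?B (axis j 1) (axis i 1)"
      by (simp only: bilinear_ladd[OF B] bilinear_radd[OF B]) (simp add: z)
    then show ?thesis using \<kappa> z by (simp add: divform_gram dir_axis \<rho>_def[abs_def] \<epsilon>_def)
  qed
  \<comment> \<open>The relation with both indices equal: a component does not depend on coordinates
    outside its index set.\<close>
  have out: "partial i (\<rho> \<sigma>) = (\<lambda>x. 0)" if \<sigma>: "card \<sigma> = k" "i \<notin> \<sigma>" for \<sigma> i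
  proof -
    have "\<epsilon> (insert i \<sigma>) i * partial i (\<rho> \<sigma>) x = 0" for x
      using D[of "insert i \<sigma>" i i x] \<sigma> by simp
    then show ?thesis using \<epsilon>[of i "insert i \<sigma>"] by (auto simp: fun_eq_iff)
  qed
  have D2: "\<epsilon> \<kappa> i * partial l (partial j (\<rho> (\<kappa> - {i}))) x = - (\<epsilon> \<kappa> j * partial l (partial i (\<rho> (\<kappa> - {j}))) x)"
    if \<kappa>: "card \<kappa> = Suc k" "i \<in> \<kappa>" "j \<in> \<kappa>" for \<kappa> i j l x
  proof -
    have "(\<lambda>x. \<epsilon> \<kappa> i * partial j (\<rho> (\<kappa> - {i})) x) = (\<lambda>x. (- \<epsilon> \<kappa> j) * partial i (\<rho> (\<kappa> - {j})) x)"
      using D[OF \<kappa>] by (simp add: fun_eq_iff)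
    then have "partial l (\<lambda>x. \<epsilon> \<kappa> i * partial j (\<rho> (\<kappa> - {i})) x) x = partial l (\<lambda>x. (- \<epsilon> \<kappa> j) * partial i (\<rho> (\<kappa> - {j})) x) x"
      by (simp only:)
    then have "\<epsilon> \<kappa> i * partial l (partial j (\<rho> (\<kappa> - {i}))) x = (- \<epsilon> \<kappa> j) * partial l (partial i (\<rho> (\<kappa> - {j}))) x"
      by (simp only: partial_cmult[OF c(2)])
    then show ?thesis by simp
  qed
  note sw = partial_commute[OF \<rho>]
  have second: "partial a (partial b (\<rho> \<sigma>)) x = 0" if \<sigma>: "card \<sigma> = k" for a b \<sigma> x
  proof (cases "a \<in> \<sigma> \<and> b \<in> \<sigma>")
    case False
    then consider "a \<notin> \<sigma>" | "b \<notin> \<sigma>" by blast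
    then show ?thesis
    proof cases
      case 1
      show ?thesis by (simp only: sw[of a b \<sigma>] out[OF \<sigma> 1] partial_const)
    next
      case 2
      show ?thesis by (simp only: out[OF \<sigma> 2] partial_const)
    qed
  next
    case True
    \<comment> \<open>Here \<open>k\<close> < n is used: an index \<open>j\<close> outside \<sigma>
      makes \<sigma> one of the sets \<kappa> without an element, and three indices of \<kappa> can
      be permuted.\<close>
    have "\<sigma> \<noteq> UNIV" using \<sigma> k(2) by auto
    then obtain j where j: "j \<notin> \<sigma>" by blast
    define \<kappa> where "\<kappa> = insert j \<sigma>"
    have \<kappa>: "card \<kappa> = Suc k" "j \<in> \<kappa>" "a \<in> \<kappa>" "b \<in> \<kappa>" "\<kappa> - {j} = \<sigma>" using \<sigma> j True by (auto simp: \<kappa>_def)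
    define d where "d i l l' = \<epsilon> \<kappa> i * partial l (partial l' (\<rho> (\<kappa> - {i}))) x" for i l l'
    have asym: "d i l l' = - d l' l i" if "i \<in> \<kappa>" "l' \<in> \<kappa>" for i l l' unfolding d_def by (rule D2[OF \<kappa>(1) that])
    have sym: "d i l l' = d i l' l" for i l l' by (simp add: d_def sw)
    \<comment> \<open>A form antisymmetric in its outer and symmetric in its last two arguments vanishes.\<close>
    have "d j a b = - d b a j" by (rule asym) fact+
    also have "d b a j = d b j a" by (rule sym)
    also have "d b j a = - d a j b" by (rule asym) fact+
    also have "d a j b = d a b j" by (rule sym)
    also have "d a b j = - d j b a" by (rule asym) fact+
    also have "d j b a = d j a b" by (rule sym)
    finally have "\<epsilon> \<kappa> j * partial a (partial b (\<rho> \<sigma>)) x = 0" using \<kappa>(5) by (simp add: d_def)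
    then show ?thesis using \<epsilon>[OF \<kappa>(2)] by simp
  qed
  have one: "\<rho> \<sigma> \<in> poly_fun 1" if "card \<sigma> = k" for \<sigma>
    by (rule poly_fun_zero_second_partials[OF \<rho> second[OF that]])
  have A: "R T x \<in> Alt k" for x using R by (simp add: poly_form_def)
  have "(\<lambda>x. R T x vs) \<in> poly_fun 1" for vs
  proof -
    have "(\<lambda>x. R T x vs) = (\<lambda>x. \<Sum>\<sigma> | card \<sigma> = k. \<rho> \<sigma> x * gram (std_vecs \<sigma>) vs)"
      by (rule ext, subst Alt_expand[OF A]) (simp only: \<rho>_def)
    also have "\<dots> \<in> poly_fun 1" by (intro poly_fun_sum poly_fun_multc one) simp
    finally show ?thesis .
  qed
  then show ?thesis using A by (simp add: poly_form_def)
qed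

section \<open>Jumps of the residual across facets\<close>

lemma partial_coord: "partial i (\<lambda>x. x $ j) = (\<lambda>x. axis j 1 $ i)"
proof -
  have "(\<lambda>x. x $ j) = (\<lambda>x. axis j 1 \<bullet> x + 0)" by (simp add: inner_axis')
  then show ?thesis by (simp only: partial_affine)
qed

lemma form_inner_zero_left: "form_inner k (\<lambda>ws. 0) \<beta> = 0"
  by (simp add: form_inner_def)

lemma form_inner_diff: "form_inner k (\<lambda>ws. \<alpha> ws - \<alpha>' ws) \<beta> = form_inner k \<alpha> \<beta> - form_inner k \<alpha>' \<beta>"
  by (simp add: form_inner_def left_diff_distrib sum_subtractf)

lemma form_inner_ip_linear:
  assumes \<alpha>: "\<alpha> \<in> Alt (Suc k)"
  shows "linear (\<lambda>e. form_inner k \<delta> (ip e \<alpha>))"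
proof (rule linearI)
  fix t t' c
  have l: "linear (\<lambda>t. \<alpha> (t # std_vecs \<sigma>))" if "card \<sigma> = k" for \<sigma>
    using Alt_linear[OF \<alpha>, of "0 # std_vecs \<sigma>" 0] that by simp
  show "form_inner k \<delta> (ip (t + t') \<alpha>) = form_inner k \<delta> (ip t \<alpha>) + form_inner k \<delta> (ip t' \<alpha>)"
    unfolding form_inner_def sum.distrib[symmetric] ip_def
    by (intro sum.cong refl) (use linear_add[OF l] in \<open>simp add: distrib_left\<close>)
  show "form_inner k \<delta> (ip (c *\<^sub>R t) \<alpha>) = c *\<^sub>R form_inner k \<delta> (ip t \<alpha>)"
    unfolding form_inner_def real_scaleR_def sum_distrib_left ip_def
    by (intro sum.cong refl) (use linear_scale[OF l] in \<open>simp add: mult.left_commute\<close>)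
qed

text \<open>Since \<open>k\<close> < n, each \<sigma> can be enlarged by an index \<open>i\<close>.
  Contracting the form of the enlarged set with the \<open>i\<close>-th coordinate vector isolates
  the component at \<sigma>.\<close>

lemma form_zero_from_ip:
  fixes \<delta> :: "'n::{finite,linorder} form"
  assumes \<delta>: "\<delta> \<in> Alt k" and k: "k < CARD('n)"
    and z: "\<And>\<alpha> e. \<alpha> \<in> Alt (Suc k) \<Longrightarrow> form_inner k \<delta> (ip e \<alpha>) = 0"
  shows "\<delta> ws = 0"
proof -
  have "\<delta> (std_vecs \<sigma>) = 0" if \<sigma>: "card \<sigma> = k" for \<sigma>
  proof -
    have "\<sigma> \<noteq> UNIV" using \<sigma> k by auto
    then obtain i where i: "i \<notin> \<sigma>" by blast
    define \<kappa> where "\<kappa> = insert i \<sigma>"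
    have \<kappa>: "card \<kappa> = Suc k" using \<sigma> i by (simp add: \<kappa>_def)
    have A: "gram (std_vecs \<kappa>) \<in> Alt (Suc k)" using gram_Alt[of "std_vecs \<kappa>"] \<kappa> by simp
    have g: "gram (std_vecs \<kappa>) (axis i 1 # std_vecs \<sigma>') \<noteq> 0 \<longleftrightarrow> \<sigma>' = \<sigma>" if "card \<sigma>' = k" for \<sigma>'
      using gram_std_insert[of \<kappa> \<sigma>' i] that \<kappa> i by (auto simp: \<kappa>_def)
    have "form_inner k \<delta> (ip (axis i 1) (gram (std_vecs \<kappa>))) = (\<Sum>\<sigma>' | card \<sigma>' = k. if \<sigma>' = \<sigma> then \<delta> (std_vecs \<sigma>') * gram (std_vecs \<kappa>) (axis i 1 # std_vecs \<sigma>') else 0)"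
      unfolding form_inner_def ip_def
    proof (intro sum.cong refl)
      fix \<sigma>' :: "'n set" assume "\<sigma>' \<in> {\<sigma>'. card \<sigma>' = k}"
      then show "\<delta> (std_vecs \<sigma>') * gram (std_vecs \<kappa>) (axis i 1 # std_vecs \<sigma>') =
          (if \<sigma>' = \<sigma> then \<delta> (std_vecs \<sigma>') * gram (std_vecs \<kappa>) (axis i 1 # std_vecs \<sigma>') else 0)"
        using g[of \<sigma>'] by auto
    qed
    then show ?thesis using \<sigma> g[OF \<sigma>] z[OF A, of "axis i 1"] by simp
  qed
  then show ?thesis by (subst Alt_expand[OF \<delta>]) simp
qed

text \<open>If every coordinate of \<open>K\<close> decreases along \<open>e\<close>, then each term
  of the product rule is nonpositive on the simplex and negative in its interior.\<close>

lemma facet_bubble_sign: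
  fixes C :: "'n::finite pt set"
  assumes C: "simplex_verts C" and K: "K \<subseteq> C" and e: "\<And>w. w \<in> K \<Longrightarrow> bgrad C w \<bullet> e < 0"
  shows "x \<in> convex hull C \<Longrightarrow> dir e (\<lambda>x. \<Prod>w\<in>K. bary C w x) x \<le> 0"
    and "x \<in> interior (convex hull C) \<Longrightarrow> K \<noteq> {} \<Longrightarrow> dir e (\<lambda>x. \<Prod>w\<in>K. bary C w x) x < 0"
proof -
  have fin: "finite K" using K simplex_verts_finite[OF C] finite_subset by blast
  have d: "dir e (\<lambda>x. \<Prod>w\<in>K. bary C w x) x = (\<Sum>w\<in>K. (bgrad C w \<bullet> e) * (\<Prod>u\<in>K - {w}. bary C u x))"
    by (subst dir_prod[OF fin]) (simp_all add: bary_C1 dir_bary)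
  show "dir e (\<lambda>x. \<Prod>w\<in>K. bary C w x) x \<le> 0" if x: "x \<in> convex hull C"
    unfolding d
  proof (rule sum_nonpos)
    fix w assume w: "w \<in> K"
    have "0 \<le> (\<Prod>u\<in>K - {w}. bary C u x)" using bary_nonneg[OF C x] K by (intro prod_nonneg) auto
    then show "(bgrad C w \<bullet> e) * (\<Prod>u\<in>K - {w}. bary C u x) \<le> 0" using e[OF w] by (intro mult_nonpos_nonneg) auto
  qed
  show "dir e (\<lambda>x. \<Prod>w\<in>K. bary C w x) x < 0" if x: "x \<in> interior (convex hull C)" and ne: "K \<noteq> {}"
  proof -
    have "(\<Sum>w\<in>K. (bgrad C w \<bullet> e) * (\<Prod>u\<in>K - {w}. bary C u x)) < (\<Sum>w\<in>K. 0)"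
    proof (rule sum_strict_mono[OF fin ne])
      fix w assume w: "w \<in> K"
      have "0 < (\<Prod>u\<in>K - {w}. bary C u x)" using x K interior_simplex_bary[OF C] by (intro prod_pos) auto
      then show "(bgrad C w \<bullet> e) * (\<Prod>u\<in>K - {w}. bary C u x) < 0" using e[OF w] by (rule mult_neg_pos[rotated])
    qed
    then show ?thesis by (simp add: d)
  qed
qed

text \<open>\<open>R0\<close> is the residual beyond the facet, or 0 when nothing lies beyond, so
  interior and boundary facets are treated together. The test field is the facet bubble times the
  jump \<phi>. Subtracting the divergence theorem for \<open>g S \<rho>0\<close> removes the
  neighbour and leaves on \<open>T\<close> the integral of \<phi> squared times the derivative of
  the bubble along \<open>e\<close>, which is negative inside \<open>T\<close>.\<close>

lemma facet_jump_directional: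
  fixes \<T> :: "'n::{finite,linorder} pt set set"
  assumes m: "simplicial_mesh \<T>" and T: "T \<in> \<T>" and v: "v \<in> verts T"
    and R: "\<And>T. T \<in> \<T> \<Longrightarrow> R T \<in> poly_form (r - 1) (Alt k)" and r: "CARD('n) + 1 \<le> r" and k: "1 \<le> k" "k < CARD('n)"
    and orth: "orthogonal_to_div k r \<T> R" and \<alpha>: "\<alpha> \<in> Alt (Suc k)"
    and R0: "(\<exists>T' v'. T' \<in> \<T> \<and> adjacent T v T' v' \<and> R0 = R T') \<or>
      ((\<forall>T' v'. T' \<in> \<T> \<longrightarrow> \<not> adjacent T v T' v') \<and> R0 = (\<lambda>x ws. 0))"
    and e: "\<And>w. w \<in> verts T - {v} \<Longrightarrow> bgrad (verts T) w \<bullet> e < 0"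
  shows "form_inner k (R T y) (ip e \<alpha>) = form_inner k (R0 y) (ip e \<alpha>)"
proof -
  have r2: "2 \<le> r" using r k by linarith
  define K where "K = verts T - {v}"
  \<comment> \<open>The simplices that carry the facet: \<open>T\<close> and at most one
    neighbour.\<close>
  define N where "N = {S \<in> \<T>. K \<subseteq> verts S}"
  have C: "simplex_verts (verts S)" and hull: "convex hull (verts S) = S" if "S \<in> N" for S
    using mesh_verts[OF m] mesh_hull[OF m] that by (auto simp: N_def)
  have TN: "T \<in> N" using T by (auto simp: N_def K_def)
  have cardK: "card K = CARD('n)" using C[OF TN] v simplex_verts_finite[OF C[OF TN]] by (simp add: K_def simplex_verts_def)
  have finK: "finite K" using simplex_verts_finite[OF C[OF TN]] by (simp add: K_def)
  have Kne: "K \<noteq> {}" using cardK by auto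
  have NT: "N \<subseteq> \<T>" by (auto simp: N_def)
  have mN: "simplicial_mesh N" by (rule mesh_subset[OF m NT])
  have opp: "verts S - {u} = K" if "S \<in> N" "u \<in> verts S" "u \<notin> K" for S u
  proof -
    have "K \<subseteq> verts S - {u}" using that by (auto simp: N_def)
    moreover have "card (verts S - {u}) = CARD('n)" using C[OF that(1)] that(2) simplex_verts_finite[OF C[OF that(1)]] by (simp add: simplex_verts_def)
    moreover have "finite (verts S - {u})" using simplex_verts_finite[OF C[OF that(1)]] by simp
    ultimately show ?thesis using cardK card_seteq[of "verts S - {u}" K] by simp
  qed
  have extra: "\<exists>u. u \<in> verts S \<and> u \<notin> K" if "S \<in> N" for S
  proof (rule ccontr)
    assume "\<nexists>u. u \<in> verts S \<and> u \<notin> K"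
    then have "card (verts S) \<le> card K" using finK by (intro card_mono) auto
    then show False using C[OF that] cardK by (simp add: simplex_verts_def)
  qed
  define \<rho> where "\<rho> S = (\<lambda>x. form_inner k (R S x) (ip e \<alpha>))" for S
  define \<rho>0 where "\<rho>0 = (\<lambda>x. form_inner k (R0 x) (ip e \<alpha>))"
  define \<phi> where "\<phi> = (\<lambda>x. \<rho> T x - \<rho>0 x)"
  have \<rho>1: "\<rho> S \<in> poly_fun 1" if "S \<in> \<T>" for S
    unfolding \<rho>_def by (rule form_inner_poly[OF orthogonal_to_div_affine[OF m that R[OF that] r2 k orth]])
  \<comment> \<open>Along \<open>e\<close> the pairing with the contraction by the same
    \<open>e\<close> is constant, by \<open>divform_zero\<close>. In the products below only the
    bubble is differentiated.\<close>
  have d\<rho>: "dir e (\<rho> S) x = 0" if "S \<in> \<T>" for S x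
    using divform_zero[OF m that R[OF that] r2 \<alpha> k(1) orth] dir_form_inner[OF R[OF that]] by (simp add: \<rho>_def)
  have \<rho>0: "\<rho>0 \<in> poly_fun 1" "dir e \<rho>0 x = 0" for x
  proof -
    have "(\<exists>S\<in>\<T>. \<rho>0 = \<rho> S) \<or> \<rho>0 = (\<lambda>x. 0)" using R0 by (auto simp: \<rho>0_def \<rho>_def form_inner_zero_left)
    then show "\<rho>0 \<in> poly_fun 1" "dir e \<rho>0 x = 0" using \<rho>1 d\<rho> poly_fun_const[of 0 1] by (auto simp: dir_def partial_const)
  qed
  have \<phi>: "\<phi> \<in> poly_fun 1" unfolding \<phi>_def by (intro poly_fun_diff \<rho>1 T \<rho>0)
  note C1s = C1_poly_fun[OF \<rho>1] C1_poly_fun[OF \<rho>0(1)] C1_poly_fun[OF \<phi>]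
  have d\<phi>: "dir e \<phi> x = 0" for x
    using partial_diff[OF C1s(1)[OF T] C1s(2)] d\<rho>[OF T, of x] \<rho>0(2)[of x]
    by (simp add: \<phi>_def dir_def right_diff_distrib sum_subtractf)
  define \<pi> where "\<pi> S = (\<lambda>x. \<Prod>w\<in>K. bary (verts S) w x)" for S
  define g where "g S = (\<lambda>x. \<pi> S x * \<phi> x)" for S
  have \<pi>1: "C1 (\<pi> S)" for S unfolding \<pi>_def by (intro C1_prod finK bary_C1)
  have g1: "C1 (g S)" for S unfolding g_def by (intro C1_mult \<pi>1 C1s)
  have \<pi>0: "\<pi> S x = 0" if "S \<in> N" "u \<in> verts S" "u \<in> K" "x \<in> convex hull (verts S - {u})" for S u x
  proof -
    have "bary (verts S) u x = 0" using convex_hull_bary[OF C[OF that(1)], of "verts S - {u}" x] that by blast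
    then show ?thesis unfolding \<pi>_def using that(3) finK by (intro prod_zero) auto
  qed
  let ?P = "\<lambda>S. if K \<subseteq> verts S then scal (g S) e \<alpha> else (\<lambda>x ws vs. 0)"
  have "normal_family k r \<T> ?P"
    unfolding g_def \<pi>_def by (rule facet_test_normal_family[OF m cardK \<phi> r \<alpha> k(1)])
  then have "(\<Sum>S\<in>\<T>. LINT x|lborel. indicator S x * form_inner k (R S x) (divf (?P S) x)) = 0"
    using orth unfolding orthogonal_to_div_def by blast
  moreover have "(LINT x|lborel. indicator S x * form_inner k (R S x) (divf (?P S) x)) =
      (if K \<subseteq> verts S then LINT x|lborel. indicator S x * (dir e (g S) x * \<rho> S x) else 0)" for S
    by (simp add: divf_zero form_inner_zero form_inner_divf_scal[OF g1] \<rho>_def)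
  ultimately have "(\<Sum>S\<in>\<T>. if K \<subseteq> verts S then LINT x|lborel. indicator S x * (dir e (g S) x * \<rho> S x) else 0) = 0"
    by (simp only:)
  then have 1: "(\<Sum>S\<in>N. LINT x|lborel. indicator S x * (dir e (g S) x * \<rho> S x)) = 0"
    unfolding N_def by (simp only: sum.inter_filter[OF mesh_finite[OF m]])
  have \<rho>N: "\<rho> S = \<rho>0" if S: "S \<in> N" "S \<noteq> T" for S
  proof -
    obtain u where u: "u \<in> verts S" "u \<notin> K" using extra[OF S(1)] by blast
    then have adj: "adjacent T v S u" using opp[OF S(1) u] S(2) by (simp add: adjacent_def K_def)
    have "S \<in> \<T>" using S by (simp add: N_def)
    then obtain T' v' where T': "T' \<in> \<T>" "adjacent T v T' v'" "R0 = R T'" using R0 adj by blast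
    have "S = T'" by (rule adjacent_unique(1)[OF m T \<open>S \<in> \<T>\<close> T'(1) v adj T'(2)])
    then show ?thesis using T'(3) by (simp add: \<rho>_def \<rho>0_def)
  qed
  \<comment> \<open>The field is continuous across the shared facet because the bubbles of both
    sides agree there. On the remaining facets the bubble vanishes, and if \<open>T\<close> has no
    neighbour, \<rho>0 is 0.\<close>
  have "(\<Sum>S\<in>N. LINT x|lborel. indicator S x * dir e (\<lambda>x. g S x * \<rho>0 x) x) = 0"
  proof (rule mesh_dir_zero[OF mN])
    fix S show "C1 (\<lambda>x. g S x * \<rho>0 x)" by (intro C1_mult g1 C1s)
  next
    fix S S' u u' x assume S: "S \<in> N" "S' \<in> N" and u: "u \<in> verts S" and adj: "adjacent S u S' u'"
      and x: "x \<in> convex hull (verts S - {u})"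
    have "\<pi> S x = \<pi> S' x"
    proof (cases "u \<in> K")
      case True
      then have uS': "u \<in> verts S'" using S by (auto simp: N_def)
      have eq: "verts S - {u} = verts S' - {u'}" and u': "u' \<in> verts S'" using adj by (simp_all add: adjacent_def)
      have "u = u'" using eq uS' by blast
      then have "verts S = verts S'" using eq u u' by blast
      then have "S = S'" using hull S by metis
      then show ?thesis by simp
    next
      case False
      then have "x \<in> convex hull K" using opp[OF S(1) u] x by simp
      then show ?thesis unfolding \<pi>_def
        using bary_agree[OF C[OF S(1)] C[OF S(2)]] S by (intro prod.cong refl) (auto simp: N_def)
    qed
    then show "g S x * \<rho>0 x = g S' x * \<rho>0 x" by (simp add: g_def)
  next
    fix S u x assume S: "S \<in> N" and u: "u \<in> verts S" and no: "\<And>T' v'. T' \<in> N \<Longrightarrow> \<not> adjacent S u T' v'"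
      and x: "x \<in> convex hull (verts S - {u})"
    have "\<pi> S x = 0 \<or> \<rho>0 x = 0"
    proof (cases "u \<in> K")
      case True then show ?thesis using \<pi>0[OF S u True x] by simp
    next
      case False
      have SK: "verts S - {u} = K" by (rule opp[OF S u False])
      have "S = T"
      proof (rule ccontr)
        assume "S \<noteq> T"
        then have "adjacent S u T v" using SK v by (simp add: adjacent_def K_def)
        then show False using no[OF TN] by blast
      qed
      then have uv: "u = v" using u False by (auto simp: K_def)
      have "\<not> adjacent T v T' v'" if "T' \<in> \<T>" for T' v'
      proof
        assume a: "adjacent T v T' v'"
        then have "T' \<in> N" using that by (auto simp: N_def K_def adjacent_def)
        then show False using no a \<open>S = T\<close> uv by blast
      qed
      then show ?thesis using R0 by (auto simp: \<rho>0_def form_inner_zero_left)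
    qed
    then show "g S x * \<rho>0 x * (bgrad (verts S) u \<bullet> e) = 0" by (auto simp: g_def)
  qed
  moreover have "dir e (\<lambda>x. g S x * \<rho>0 x) x = dir e (g S) x * \<rho>0 x" for S x
    by (simp add: dir_mult[OF g1 C1s(2)] \<rho>0(2))
  ultimately have 2: "(\<Sum>S\<in>N. LINT x|lborel. indicator S x * (dir e (g S) x * \<rho>0 x)) = 0" by (simp only:)
  have finN: "finite N" by (rule mesh_finite[OF mN])
  have i: "integrable lborel (\<lambda>x. indicator T x * (dir e (g T) x * h x))" if "C1 h" for h
    by (intro integrable_simplex[OF m T] continuous_on_mult dir_continuous[OF g1] C1_continuous that)
  have "(LINT x|lborel. indicator T x * (dir e (g T) x * \<rho> T x)) = (LINT x|lborel. indicator T x * (dir e (g T) x * \<rho>0 x))"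
  proof -
    have "(\<Sum>S\<in>N - {T}. LINT x|lborel. indicator S x * (dir e (g S) x * \<rho> S x)) = (\<Sum>S\<in>N - {T}. LINT x|lborel. indicator S x * (dir e (g S) x * \<rho>0 x))"
      by (intro sum.cong refl) (use \<rho>N in force)
    then show ?thesis using 1 2 sum.remove[OF finN TN, of "\<lambda>S. LINT x|lborel. indicator S x * (dir e (g S) x * \<rho> S x)"]
      sum.remove[OF finN TN, of "\<lambda>S. LINT x|lborel. indicator S x * (dir e (g S) x * \<rho>0 x)"] by linarith
  qed
  then have "(LINT x|lborel. indicator T x * (dir e (g T) x * \<rho> T x) - indicator T x * (dir e (g T) x * \<rho>0 x)) = 0"
    by (simp add: Bochner_Integration.integral_diff[OF i[OF C1s(1)[OF T]] i[OF C1s(2)]])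
  moreover have "indicator T x * (dir e (g T) x * \<rho> T x) - indicator T x * (dir e (g T) x * \<rho>0 x) =
      - (indicator (convex hull (verts T)) x * (- dir e (\<pi> T) x * (\<phi> x)\<^sup>2))" for x
  proof -
    have d: "dir e (g T) x = dir e (\<pi> T) x * \<phi> x" unfolding g_def by (simp add: dir_mult[OF \<pi>1 C1s(3)] d\<phi>)
    have "\<rho> T x = \<phi> x + \<rho>0 x" by (simp add: \<phi>_def)
    then show ?thesis by (simp only: d hull[OF TN]) (simp add: power2_eq_square algebra_simps)
  qed
  ultimately have z: "(LINT x|lborel. indicator (convex hull (verts T)) x * (- dir e (\<pi> T) x * (\<phi> x)\<^sup>2)) = 0"
    by (simp only: Bochner_Integration.integral_minus neg_equal_0_iff_equal)
  have KT: "K \<subseteq> verts T" by (auto simp: K_def)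
  have e': "bgrad (verts T) w \<bullet> e < 0" if "w \<in> K" for w using e that by (simp add: K_def)
  have "\<phi> x = 0" if x: "x \<in> interior (convex hull (verts T))" for x
  proof -
    have "- dir e (\<pi> T) x * (\<phi> x)\<^sup>2 = 0"
    proof (rule weighted_integral_zero[OF C[OF TN] _ _ z x])
      show "continuous_on UNIV (\<lambda>x. - dir e (\<pi> T) x * (\<phi> x)\<^sup>2)"
        by (intro continuous_on_mult continuous_on_minus continuous_on_power dir_continuous[OF \<pi>1] C1_continuous C1s)
      show "0 \<le> - dir e (\<pi> T) x * (\<phi> x)\<^sup>2" if "x \<in> convex hull (verts T)" for x
        using facet_bubble_sign(1)[OF C[OF TN] KT e' that] by (intro mult_nonneg_nonneg) (simp_all add: \<pi>_def)
    qed
    moreover have "dir e (\<pi> T) x < 0" using facet_bubble_sign(2)[OF C[OF TN] KT e' x Kne] by (simp add: \<pi>_def)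
    ultimately show ?thesis by simp
  qed
  moreover obtain x0 where "x0 \<in> interior (convex hull (verts T))" using interior_simplex_nonempty[OF C[OF TN]] by blast
  ultimately have "\<phi> y = 0" using poly_fun_zero_open[OF \<phi> open_interior] by blast
  then show ?thesis by (simp add: \<phi>_def \<rho>_def \<rho>0_def)
qed

text \<open>The directions along which all coordinates of the facet decrease form an open cone, and
  a linear function that vanishes on an open set of vectors is 0.\<close>

lemma facet_jump_zero:
  fixes \<T> :: "'n::{finite,linorder} pt set set"
  assumes m: "simplicial_mesh \<T>" and T: "T \<in> \<T>" and v: "v \<in> verts T"
    and R: "\<And>T. T \<in> \<T> \<Longrightarrow> R T \<in> poly_form (r - 1) (Alt k)" and r: "CARD('n) + 1 \<le> r" and k: "1 \<le> k" "k < CARD('n)"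
    and orth: "orthogonal_to_div k r \<T> R"
    and R0: "(\<exists>T' v'. T' \<in> \<T> \<and> adjacent T v T' v' \<and> R0 = R T') \<or>
      ((\<forall>T' v'. T' \<in> \<T> \<longrightarrow> \<not> adjacent T v T' v') \<and> R0 = (\<lambda>x ws. 0))"
  shows "R T = R0"
proof (intro ext)
  fix x ws
  let ?C = "verts T"
  have C: "simplex_verts ?C" by (rule mesh_verts[OF m T])
  have ind: "\<not> affine_dependent ?C" using C by (simp add: simplex_verts_def)
  have fin: "finite ?C" by (rule simplex_verts_finite[OF C])
  define \<delta> where "\<delta> = (\<lambda>ws. R T x ws - R0 x ws)"
  have "R0 x \<in> Alt k" using R0 R by (auto simp: poly_form_def Alt_zero)
  then have \<delta>: "\<delta> \<in> Alt k" unfolding \<delta>_def using R[OF T] by (intro Alt_diff) (auto simp: poly_form_def)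
  have "form_inner k \<delta> (ip e \<alpha>) = 0" if \<alpha>: "\<alpha> \<in> Alt (Suc k)" for \<alpha> e
  proof -
    define L where "L e = form_inner k \<delta> (ip e \<alpha>)" for e
    have lin: "linear L" unfolding L_def[abs_def] by (rule form_inner_ip_linear[OF \<alpha>])
    have neg: "L e' = 0" if "\<And>w. w \<in> ?C - {v} \<Longrightarrow> bgrad ?C w \<bullet> e' < 0" for e'
      using facet_jump_directional[OF m T v R r k orth \<alpha> R0 that, of x] by (simp add: L_def \<delta>_def form_inner_diff)
    \<comment> \<open>A direction inside that cone: each of the relevant coordinates decreases at
      rate 1, so a small multiple of any \<open>e\<close> may be added.\<close>
    define e0 where "e0 = (\<Sum>u\<in>?C - {v}. v - u)"
    have e0: "bgrad ?C w \<bullet> e0 = - 1" if w: "w \<in> ?C - {v}" for w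
    proof -
      have "bgrad ?C w \<bullet> e0 = (\<Sum>u\<in>?C - {v}. bary ?C w v - bary ?C w u)" by (simp add: e0_def inner_sum_right bary_diff)
      also have "\<dots> = (\<Sum>u\<in>?C - {v}. if u = w then - 1 else 0)"
        using w v by (intro sum.cong refl) (auto simp: bary_vertex[OF ind])
      finally show ?thesis using w fin by simp
    qed
    define s where "s = (\<Sum>w\<in>?C. \<bar>bgrad ?C w \<bullet> e\<bar>)"
    define t where "t = 1 / (1 + s)"
    have s: "0 \<le> s" by (simp add: s_def sum_nonneg)
    have "bgrad ?C w \<bullet> (e0 + t *\<^sub>R e) < 0" if w: "w \<in> ?C - {v}" for w
    proof -
      have "bgrad ?C w \<bullet> e \<le> s" using member_le_sum[of w ?C "\<lambda>w. \<bar>bgrad ?C w \<bullet> e\<bar>"] w fin by (simp add: s_def)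
      then have "t * (bgrad ?C w \<bullet> e) \<le> t * s" using s by (intro mult_left_mono) (auto simp: t_def)
      also have "\<dots> < 1" using s by (simp add: t_def)
      finally show ?thesis using e0[OF w] by (simp add: inner_add_right)
    qed
    then have "L (e0 + t *\<^sub>R e) = 0" by (rule neg)
    moreover have "L e0 = 0" by (rule neg) (simp add: e0)
    ultimately have "t * L e = 0" by (simp add: linear_add[OF lin] linear_scale[OF lin])
    then show ?thesis using s by (simp add: t_def L_def)
  qed
  from form_zero_from_ip[OF \<delta> k(2) this] show "R T x ws = R0 x ws" by (simp add: \<delta>_def)
qed

text \<open>Every facet of a simplex with nonzero residual has a neighbour that also has nonzero
  residual. On the mesh of these simplices the field with the single component \<open>x $ i0\<close>
  meets no boundary, and its divergence is 1; their total volume would be 0.\<close>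

lemma orthogonal_to_div_zero:
  fixes \<T> :: "'n::{finite,linorder} pt set set"
  assumes m: "simplicial_mesh \<T>" and T: "T \<in> \<T>"
    and R: "\<And>T. T \<in> \<T> \<Longrightarrow> R T \<in> poly_form (r - 1) (Alt k)" and r: "CARD('n) + 1 \<le> r" and k: "1 \<le> k" "k < CARD('n)"
    and orth: "orthogonal_to_div k r \<T> R"
  shows "R T = (\<lambda>x ws. 0)"
proof (rule ccontr)
  assume ne: "R T \<noteq> (\<lambda>x ws. 0)"
  define N where "N = {S \<in> \<T>. R S \<noteq> (\<lambda>x ws. 0)}"
  have NT: "N \<subseteq> \<T>" and TN: "T \<in> N" using ne T by (auto simp: N_def)
  have mN: "simplicial_mesh N" by (rule mesh_subset[OF m NT])
  obtain i0 :: 'n where True by simp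
  have nb: "\<exists>S'\<in>N. \<exists>v'. adjacent S v S' v'" if S: "S \<in> N" and v: "v \<in> verts S" for S v
  proof (cases "\<exists>S' v'. S' \<in> \<T> \<and> adjacent S v S' v'")
    case True
    then obtain S' v' where S': "S' \<in> \<T>" "adjacent S v S' v'" by blast
    have "R S = R S'" using S S' by (intro facet_jump_zero[OF m _ v R r k orth]) (auto simp: N_def)
    then show ?thesis using S S' unfolding N_def by force
  next
    case False
    have "R S = (\<lambda>x ws. 0)" using S False by (intro facet_jump_zero[OF m _ v R r k orth]) (auto simp: N_def)
    then show ?thesis using S by (simp add: N_def)
  qed
  have "(\<Sum>S\<in>N. LINT x|lborel. indicator S x * dir (axis i0 1) (\<lambda>x. x $ i0) x) = 0"
  proof (rule mesh_dir_zero[OF mN])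
    fix S v x assume "S \<in> N" "v \<in> verts S" "\<And>S' v'. S' \<in> N \<Longrightarrow> \<not> adjacent S v S' v'"
    then show "x $ i0 * (bgrad (verts S) v \<bullet> axis i0 1) = 0" using nb by blast
  qed (simp_all add: C1_poly_fun[OF poly_fun_coord])
  then have "(\<Sum>S\<in>N. LINT x|lborel. indicator S x * 1) = (0::real)" by (simp add: dir_axis partial_coord)
  then have "(LINT x|lborel. indicator T x * (1::real)) = 0"
    using TN mesh_finite[OF mN] by (subst (asm) sum_nonneg_eq_0_iff) auto
  then have z: "(LINT x|lborel. indicator (convex hull (verts T)) x * (1::real)) = 0" using mesh_hull[OF m T] by simp
  obtain x0 where "x0 \<in> interior (convex hull (verts T))" using interior_simplex_nonempty[OF mesh_verts[OF m T]] by blast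
  from weighted_integral_zero[OF mesh_verts[OF m T] continuous_on_const _ z this] show False by simp
qed


section \<open>Surjectivity of the divergence\<close>

lemma poly_tform_combine:
  assumes "P \<in> poly_tform r (XX k)" "Q \<in> poly_tform r (XX k)"
  shows "(\<lambda>x ws vs. P x ws vs + c * Q x ws vs) \<in> poly_tform r (XX k)"
  using assms unfolding poly_tform_def by (auto intro!: XX_add XX_scale poly_fun_add poly_fun_cmult)

lemma proxy_combine: "proxy (\<lambda>vs. \<alpha> vs + c * \<beta> vs) = proxy \<alpha> + c *\<^sub>R proxy \<beta>"
  by (simp add: proxy_add proxy_scale)

lemma divf_combine:
  assumes P: "P \<in> poly_tform r E" and Q: "Q \<in> poly_tform r E"
  shows "divf (\<lambda>x ws vs. P x ws vs + c * Q x ws vs) x ws = divf P x ws + c * divf Q x ws"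
proof -
  note C = C1_poly_fun[OF proxy_nth_poly[OF P]] C1_poly_fun[OF proxy_nth_poly[OF Q]]
  have "partial i (\<lambda>x. proxy (\<lambda>vs. P x ws vs + c * Q x ws vs) $ i) x =
      partial i (\<lambda>x. proxy (P x ws) $ i) x + c * partial i (\<lambda>x. proxy (Q x ws) $ i) x" for i
  proof -
    have "(\<lambda>x. proxy (\<lambda>vs. P x ws vs + c * Q x ws vs) $ i) = (\<lambda>x. proxy (P x ws) $ i + c * proxy (Q x ws) $ i)"
      by (simp add: proxy_combine)
    then show ?thesis using partial_add[OF C(1) C1_cmult[OF C(2)]] by (simp only: partial_cmult[OF C(2)])
  qed
  then show ?thesis by (simp add: divf_def sum.distrib sum_distrib_left)
qed

lemma normal_family_combine:
  assumes P: "normal_family k r \<T> P" and Q: "normal_family k r \<T> Q"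
  shows "normal_family k r \<T> (\<lambda>T x ws vs. P T x ws vs + c * Q T x ws vs)"
  unfolding normal_family_def
proof (intro conjI ballI allI impI)
  fix T assume "T \<in> \<T>"
  then show "(\<lambda>x ws vs. P T x ws vs + c * Q T x ws vs) \<in> poly_tform r (XX k)"
    using P Q by (intro poly_tform_combine) (simp_all add: normal_family_def)
next
  fix T T' :: "'a pt set" and K ws n x
  assume T: "T \<in> \<T>" "T' \<in> \<T>" and x: "x \<in> convex hull K"
    and K: "K \<subseteq> verts T \<and> K \<subseteq> verts T' \<and> K \<noteq> {} \<and> card K \<le> CARD('a) \<and> (\<forall>w\<in>tangent_space (convex hull K). n \<bullet> w = 0)"
  have "proxy (P T x ws) \<bullet> n = proxy (P T' x ws) \<bullet> n" using P T x K unfolding normal_family_def by blast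
  moreover have "proxy (Q T x ws) \<bullet> n = proxy (Q T' x ws) \<bullet> n" using Q T x K unfolding normal_family_def by blast
  ultimately show "proxy (\<lambda>vs. P T x ws vs + c * Q T x ws vs) \<bullet> n = proxy (\<lambda>vs. P T' x ws vs + c * Q T' x ws vs) \<bullet> n"
    by (simp add: proxy_combine inner_add_left)
qed

lemma normal_family_zero: "normal_family k r \<T> (\<lambda>T x ws vs. 0)"
  by (simp add: normal_family_def poly_tform_def XX_zero poly_fun_const)

lemma divf_poly_form:
  assumes "P \<in> poly_tform r (XX k)" shows "divf P \<in> poly_form (r - 1) (Alt k)"
  using divf_poly[OF assms] divf_Alt[OF assms, of k "CARD('a) - 1"] by (simp add: poly_form_def XX_def)

lemma poly_form_diff:
  "p \<in> poly_form r (Alt k) \<Longrightarrow> q \<in> poly_form r (Alt k) \<Longrightarrow> (\<lambda>x ws. p x ws - q x ws) \<in> poly_form r (Alt k)"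
  by (simp add: poly_form_def Alt_diff poly_fun_diff)

text \<open>Encodes a family of forms as one real function of simplex, index set and point, the
  shape in which \<open>orthogonal_projection\<close> takes its vectors.\<close>

definition form_components :: "nat \<Rightarrow> 'n::{finite,linorder} pt set set \<Rightarrow> ('n pt set \<Rightarrow> 'n pt \<Rightarrow> 'n form) \<Rightarrow>
    'n pt set \<times> 'n set \<times> 'n pt \<Rightarrow> real" where
  "form_components k \<T> F = (\<lambda>(T, \<sigma>, x). if T \<in> \<T> \<and> card \<sigma> = k then F T x (std_vecs \<sigma>) else 0)"

definition component_basis ::
    "'n::finite pt set \<times> 'n set \<times> ('n \<Rightarrow> nat) \<Rightarrow> 'n pt set \<times> 'n set \<times> 'n pt \<Rightarrow> real" where
  "component_basis = (\<lambda>(T, \<sigma>, \<beta>) (T', \<sigma>', x). if T = T' \<and> \<sigma> = \<sigma>' then monomial_fun \<beta> x else 0)"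

text \<open>This is the finite dimension behind the projection: finitely many simplices, index sets
  and monomials.\<close>

lemma form_components_span:
  fixes F :: "'n::{finite,linorder} pt set \<Rightarrow> 'n pt \<Rightarrow> 'n form"
  assumes fin: "finite \<T>" and F: "\<And>T. T \<in> \<T> \<Longrightarrow> F T \<in> poly_form s E"
  shows "\<exists>c. form_components k \<T> F = (\<lambda>z. \<Sum>i\<in>\<T> \<times> UNIV \<times> {\<beta>. (\<Sum>j\<in>UNIV. \<beta> j) \<le> s}. c i *
    component_basis i z)"
proof -
  have "(\<lambda>x. form_components k \<T> F (T, \<sigma>, x)) \<in> poly_fun s" for T \<sigma>
    using F[of T] by (cases "T \<in> \<T> \<and> card \<sigma> = k") (auto simp: form_components_def poly_form_def poly_fun_const)
  then have "\<forall>T \<sigma>. \<exists>c. \<forall>x. form_components k \<T> F (T, \<sigma>, x) = (\<Sum>\<beta> | (\<Sum>j\<in>UNIV. \<beta> j) \<le> s. c \<beta> * monomial_fun \<beta> x)"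
    by (simp add: poly_fun_iff)
  then have "\<exists>c. \<forall>T \<sigma> x. form_components k \<T> F (T, \<sigma>, x) = (\<Sum>\<beta> | (\<Sum>j\<in>UNIV. \<beta> j) \<le> s. c T \<sigma> \<beta> * monomial_fun \<beta> x)"
    by (simp only: choice_iff)
  then obtain c where c: "\<And>T \<sigma> x. form_components k \<T> F (T, \<sigma>, x) = (\<Sum>\<beta> | (\<Sum>j\<in>UNIV. \<beta> j) \<le> s. c T \<sigma> \<beta> * monomial_fun \<beta> x)"
    by blast
  let ?B = "{\<beta> :: 'n \<Rightarrow> nat. (\<Sum>j\<in>UNIV. \<beta> j) \<le> s}"
  have "form_components k \<T> F (T', \<sigma>', x) = (\<Sum>i\<in>\<T> \<times> UNIV \<times> ?B. (case i of (T, \<sigma>, \<beta>) \<Rightarrow> c T \<sigma> \<beta>) * component_basis i (T', \<sigma>', x))" for T' \<sigma>' x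
  proof -
    have "(\<Sum>i\<in>\<T> \<times> UNIV \<times> ?B. (case i of (T, \<sigma>, \<beta>) \<Rightarrow> c T \<sigma> \<beta>) * component_basis i (T', \<sigma>', x)) =
        (\<Sum>T\<in>\<T>. \<Sum>\<sigma>\<in>UNIV. \<Sum>\<beta>\<in>?B. c T \<sigma> \<beta> * (if T = T' \<and> \<sigma> = \<sigma>' then monomial_fun \<beta> x else 0))"
      unfolding sum.cartesian_product component_basis_def by (intro sum.cong refl) auto
    also have "\<dots> = (\<Sum>T\<in>\<T>. if T = T' then form_components k \<T> F (T', \<sigma>', x) else 0)"
    proof (intro sum.cong refl)
      fix T
      have "(\<Sum>\<beta>\<in>?B. c T \<sigma> \<beta> * (if T = T' \<and> \<sigma> = \<sigma>' then monomial_fun \<beta> x else 0)) =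
          (if \<sigma> = \<sigma>' then if T = T' then form_components k \<T> F (T', \<sigma>', x) else 0 else 0)" for \<sigma>
        by (cases "\<sigma> = \<sigma>'"; cases "T = T'") (simp_all add: c)
      then show "(\<Sum>\<sigma>\<in>UNIV. \<Sum>\<beta>\<in>?B. c T \<sigma> \<beta> * (if T = T' \<and> \<sigma> = \<sigma>' then monomial_fun \<beta> x else 0)) =
          (if T = T' then form_components k \<T> F (T', \<sigma>', x) else 0)"
        by (simp only: sum.delta[OF finite_class.finite_UNIV] UNIV_I if_True)
    qed
    also have "\<dots> = (if T' \<in> \<T> then form_components k \<T> F (T', \<sigma>', x) else 0)" by (simp only: sum.delta'[OF fin] sum.delta[OF fin])
    also have "\<dots> = form_components k \<T> F (T', \<sigma>', x)" by (simp add: form_components_def)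
    finally show ?thesis by (rule HOL.sym)
  qed
  then have "form_components k \<T> F z = (\<Sum>i\<in>\<T> \<times> UNIV \<times> ?B. (case i of (T, \<sigma>, \<beta>) \<Rightarrow> c T \<sigma> \<beta>) * component_basis i z)" for z
    by (cases z) (simp only:)
  then show ?thesis by (intro exI[of _ "\<lambda>(T, \<sigma>, \<beta>). c T \<sigma> \<beta>"] ext)
qed

theorem div_surjective:
  fixes \<T> :: "'n::{finite,linorder} pt set set"
  assumes m: "simplicial_mesh \<T>" and r: "CARD('n) + 1 \<le> r" and k: "1 \<le> k" "k < CARD('n)"
    and p: "\<And>T. T \<in> \<T> \<Longrightarrow> p T \<in> poly_form (r - 1) (Alt k)"
  shows "\<exists>P. normal_family k r \<T> P \<and> (\<forall>T\<in>\<T>. divf (P T) = p T)"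
proof -
  \<comment> \<open>Continuity in the point variable makes all products integrable over the
    simplices, on which the linearity of \<open>ip'\<close> rests.\<close>
  define S where "S = {f :: 'n pt set \<times> 'n set \<times> 'n pt \<Rightarrow> real. \<forall>T \<sigma>. continuous_on UNIV (\<lambda>x. f (T, \<sigma>, x))}"
  \<comment> \<open>The inner product of L2 forms, summed over the simplices. On \<open>S\<close> it
    is only semidefinite, because it does not see values outside a simplex.\<close>
  define ip' where "ip' f g = (\<Sum>T\<in>\<T>. \<Sum>\<sigma> | card \<sigma> = k. LINT x|lborel. indicator T x * (f (T, \<sigma>, x) * g (T, \<sigma>, x)))"
    for f g :: "'n pt set \<times> 'n set \<times> 'n pt \<Rightarrow> real"
  define E where "E P = form_components k \<T> (\<lambda>T. divf (P T))" for P :: "'n pt set \<Rightarrow> 'n pt \<Rightarrow> 'n tform"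
  define W where "W = {E P | P. normal_family k r \<T> P}"
  note fin = mesh_finite[OF m]
  have nf: "P T \<in> poly_tform r (XX k)" if "normal_family k r \<T> P" "T \<in> \<T>" for P T using that by (simp add: normal_family_def)
  have comp_S: "form_components k \<T> F \<in> S" if "\<And>T. T \<in> \<T> \<Longrightarrow> F T \<in> poly_form s (Alt k)" for F s
    unfolding S_def
  proof (intro CollectI allI)
    fix T \<sigma>
    show "continuous_on UNIV (\<lambda>x. form_components k \<T> F (T, \<sigma>, x))"
    proof (cases "T \<in> \<T> \<and> card \<sigma> = k")
      case True
      then have "(\<lambda>x. F T x (std_vecs \<sigma>)) \<in> poly_fun s" using that[of T] by (simp add: poly_form_def)
      then show ?thesis using True by (simp add: form_components_def poly_fun_continuous_on)
    next
      case False
      then have "(\<lambda>x. form_components k \<T> F (T, \<sigma>, x)) = (\<lambda>x. 0)" by (auto simp: form_components_def)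
      then show ?thesis by (simp only: continuous_on_const)
    qed
  qed
  have Scont: "continuous_on UNIV (\<lambda>x. f (T, \<sigma>, x))" if "f \<in> S" for f T \<sigma> using that by (simp add: S_def)
  have Sint: "integrable lborel (\<lambda>x. indicator T x * (f (T, \<sigma>, x) * g (T, \<sigma>, x)))" if "f \<in> S" "g \<in> S" "T \<in> \<T>" for f g T \<sigma>
    by (intro integrable_simplex[OF m] continuous_on_mult Scont that)
  have Scl: "(\<lambda>x. f x + c * g x) \<in> S" if "f \<in> S" "g \<in> S" for f g c
    using that unfolding S_def by (auto intro!: continuous_on_add continuous_on_mult continuous_on_const)
  have lin: "ip' (\<lambda>x. f x + c * g x) h = ip' f h + c * ip' g h" if S: "f \<in> S" "g \<in> S" "h \<in> S" for f g h c
  proof -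
    have "(LINT x|lborel. indicator T x * ((f (T, \<sigma>, x) + c * g (T, \<sigma>, x)) * h (T, \<sigma>, x))) =
        (LINT x|lborel. indicator T x * (f (T, \<sigma>, x) * h (T, \<sigma>, x))) + c * (LINT x|lborel. indicator T x * (g (T, \<sigma>, x) * h (T, \<sigma>, x)))"
      if T: "T \<in> \<T>" for T \<sigma>
    proof -
      note i = Sint[OF S(1,3) T, of \<sigma>] Sint[OF S(2,3) T, of \<sigma>]
      have "(LINT x|lborel. indicator T x * ((f (T, \<sigma>, x) + c * g (T, \<sigma>, x)) * h (T, \<sigma>, x))) =
          (LINT x|lborel. indicator T x * (f (T, \<sigma>, x) * h (T, \<sigma>, x)) + c * (indicator T x * (g (T, \<sigma>, x) * h (T, \<sigma>, x))))"
        by (intro Bochner_Integration.integral_cong refl) (simp add: algebra_simps)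
      also have "\<dots> = (LINT x|lborel. indicator T x * (f (T, \<sigma>, x) * h (T, \<sigma>, x))) + (LINT x|lborel. c * (indicator T x * (g (T, \<sigma>, x) * h (T, \<sigma>, x))))"
        by (rule Bochner_Integration.integral_add[OF i(1) integrable_mult_right[OF i(2)]])
      finally show ?thesis by (simp only: integral_mult_right_zero)
    qed
    then show ?thesis unfolding ip'_def by (simp add: sum.distrib sum_distrib_left)
  qed
  have sym: "ip' f g = ip' g f" for f g unfolding ip'_def by (simp add: mult.commute)
  have psd: "0 \<le> ip' f f" for f unfolding ip'_def by (intro sum_nonneg Bochner_Integration.integral_nonneg) simp
  have finI: "finite (\<T> \<times> (UNIV :: 'n set set) \<times> {\<beta> :: 'n \<Rightarrow> nat. (\<Sum>j\<in>UNIV. \<beta> j) \<le> r - 1})"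
    using fin by (intro finite_cartesian_product) auto
  have WS: "W \<subseteq> S" unfolding W_def E_def using comp_S[OF divf_poly_form[OF nf]] by auto
  have W0: "(\<lambda>z. 0) \<in> W"
  proof -
    have "E (\<lambda>T x ws vs. 0) = (\<lambda>z. 0)" by (auto simp: E_def form_components_def divf_zero)
    then show ?thesis unfolding W_def using normal_family_zero by (metis (mono_tags, lifting) mem_Collect_eq)
  qed
  have Wc: "(\<lambda>z. f z + c * g z) \<in> W" if fg: "f \<in> W" "g \<in> W" for f g c
  proof -
    obtain P Q where PQ: "f = E P" "g = E Q" "normal_family k r \<T> P" "normal_family k r \<T> Q" using fg unfolding W_def by blast
    have "E (\<lambda>T x ws vs. P T x ws vs + c * Q T x ws vs) z = E P z + c * E Q z" for z
      using divf_combine[OF nf[OF PQ(3)] nf[OF PQ(4)]] by (auto simp: E_def form_components_def split: prod.split)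
    then have "(\<lambda>z. f z + c * g z) = E (\<lambda>T x ws vs. P T x ws vs + c * Q T x ws vs)" by (simp add: PQ fun_eq_iff)
    then show ?thesis unfolding W_def using normal_family_combine[OF PQ(3,4)] by blast
  qed
  have Wspan: "\<exists>c. f = (\<lambda>z. \<Sum>i\<in>\<T> \<times> UNIV \<times> {\<beta>. (\<Sum>j\<in>UNIV. \<beta> j) \<le> r - 1}. c i *
    component_basis i z)" if f: "f \<in> W" for f
  proof -
    obtain P where P: "f = E P" "normal_family k r \<T> P" using f unfolding W_def by blast
    show ?thesis unfolding P(1) E_def by (rule form_components_span[OF fin divf_poly_form[OF nf[OF P(2)]]])
  qed
  have "\<exists>w\<in>W. \<forall>w'\<in>W. ip' (\<lambda>z. form_components k \<T> p z + (-1) * w z) w' = 0"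
    by (rule orthogonal_projection[where ip = ip' and S = S and W = W and b = component_basis
          and I = "\<T> \<times> (UNIV :: 'n set set) \<times> {\<beta> :: 'n \<Rightarrow> nat. (\<Sum>j\<in>UNIV. \<beta> j) \<le> r - 1}"])
      (erule (2) lin | erule (1) Scl | rule sym | rule psd | rule finI | rule WS | rule W0 | erule (1) Wc | erule Wspan | rule comp_S[OF p] | assumption)+
  then obtain w where w: "w \<in> W" "\<And>w'. w' \<in> W \<Longrightarrow> ip' (\<lambda>z. form_components k \<T> p z + (-1) * w z) w' = 0" by blast
  obtain P where P: "w = E P" "normal_family k r \<T> P" using w(1) unfolding W_def by blast
  define R where "R T = (\<lambda>x ws. p T x ws - divf (P T) x ws)" for T
  have R: "R T \<in> poly_form (r - 1) (Alt k)" if "T \<in> \<T>" for T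
    unfolding R_def by (intro poly_form_diff p divf_poly_form nf[OF P(2)] that)
  have "orthogonal_to_div k r \<T> R"
    unfolding orthogonal_to_div_def
  proof (intro allI impI)
    fix Q assume Q: "normal_family k r \<T> Q"
    have "E Q \<in> W" using Q unfolding W_def by blast
    then have "0 = ip' (\<lambda>z. form_components k \<T> p z + (-1) * w z) (E Q)" using w(2) by simp
    also have "\<dots> = (\<Sum>T\<in>\<T>. LINT x|lborel. indicator T x * form_inner k (R T x) (divf (Q T) x))"
      unfolding ip'_def
    proof (intro sum.cong refl)
      fix T assume T: "T \<in> \<T>"
      have i: "integrable lborel (\<lambda>x. indicator T x * (R T x (std_vecs \<sigma>) * divf (Q T) x (std_vecs \<sigma>)))" for \<sigma>
        using R[OF T] divf_poly_form[OF nf[OF Q T]]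
        by (intro integrable_simplex[OF m T] continuous_on_mult) (auto simp: poly_form_def intro: poly_fun_continuous_on)
      have "(LINT x|lborel. indicator T x * form_inner k (R T x) (divf (Q T) x)) =
          (LINT x|lborel. (\<Sum>\<sigma> | card \<sigma> = k. indicator T x * (R T x (std_vecs \<sigma>) * divf (Q T) x (std_vecs \<sigma>))))"
        by (simp add: form_inner_def sum_distrib_left)
      also have "\<dots> = (\<Sum>\<sigma> | card \<sigma> = k. LINT x|lborel. indicator T x * (R T x (std_vecs \<sigma>) * divf (Q T) x (std_vecs \<sigma>)))"
        by (rule Bochner_Integration.integral_sum[OF i])
      also have "\<dots> = (\<Sum>\<sigma> | card \<sigma> = k. LINT x|lborel. indicator T x * ((form_components k \<T> p (T, \<sigma>, x) + (-1) * w (T, \<sigma>, x)) * E Q (T, \<sigma>, x)))"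
        by (intro sum.cong refl) (simp add: form_components_def E_def P(1) R_def T)
      finally show "(\<Sum>\<sigma> | card \<sigma> = k. LINT x|lborel. indicator T x * ((form_components k \<T> p (T, \<sigma>, x) + (-1) * w (T, \<sigma>, x)) * E Q (T, \<sigma>, x))) =
        (LINT x|lborel. indicator T x * form_inner k (R T x) (divf (Q T) x))" by (rule HOL.sym)
    qed
    finally show "(\<Sum>T\<in>\<T>. LINT x|lborel. indicator T x * form_inner k (R T x) (divf (Q T) x)) = 0" by simp
  qed
  note R0 = orthogonal_to_div_zero[OF m _ R r k this]
  have "divf (P T) x = p T x" if "T \<in> \<T>" for T x
  proof (rule ext)
    fix ws
    show "divf (P T) x ws = p T x ws" using fun_cong[OF fun_cong[OF R0[OF that]], of x ws] by (simp add: R_def)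
  qed
  then have "divf (P T) = p T" if "T \<in> \<T>" for T using that by (intro ext) simp
  with P(2) show ?thesis by (intro exI[of _ P] conjI ballI)
qed

section \<open>Gluing piecewise polynomials\<close>

lemma glue_L2:
  fixes \<T> :: "'n::{finite,linorder} pt set set"
  assumes m: "simplicial_mesh \<T>" and \<Omega>: "open \<Omega>" "bounded \<Omega>" and h: "\<And>T. T \<in> \<T> \<Longrightarrow> continuous_on UNIV (h T)"
  shows "(\<lambda>x. \<Sum>T\<in>\<T>. indicator (interior T) x * h T x) \<in> L2 \<Omega>"
proof -
  let ?g = "\<lambda>x. \<Sum>T\<in>\<T>. indicator (interior T) x * h T x"
  have "\<exists>B\<ge>0. \<forall>x\<in>T. \<bar>h T x\<bar> \<le> B" if T: "T \<in> \<T>" for T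
  proof -
    have "bounded (h T ` T)" using continuous_on_subset[OF h[OF T] subset_UNIV] mesh_compact[OF m T]
      by (intro compact_imp_bounded compact_continuous_image)
    then obtain B where "B > 0" "\<forall>y\<in>h T ` T. norm y \<le> B" unfolding bounded_pos by blast
    then show ?thesis by (intro exI[of _ B]) auto
  qed
  then obtain B where B: "\<And>T. T \<in> \<T> \<Longrightarrow> 0 \<le> B T" "\<And>T x. T \<in> \<T> \<Longrightarrow> x \<in> T \<Longrightarrow> \<bar>h T x\<bar> \<le> B T" by metis
  have bound: "\<bar>?g x\<bar> \<le> (\<Sum>T\<in>\<T>. B T)" for x
  proof -
    have "\<bar>?g x\<bar> \<le> (\<Sum>T\<in>\<T>. \<bar>indicator (interior T) x * h T x\<bar>)" by (rule sum_abs)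
    also have "\<dots> \<le> (\<Sum>T\<in>\<T>. B T)"
    proof (rule sum_mono)
      fix T assume T: "T \<in> \<T>"
      show "\<bar>indicator (interior T) x * h T x\<bar> \<le> B T"
        using B(1)[OF T] B(2)[OF T, of x] interior_subset[of T] by (cases "x \<in> interior T") auto
    qed
    finally show ?thesis .
  qed
  have "?g \<in> borel_measurable borel"
    using borel_measurable_continuous_onI[OF h] by (intro borel_measurable_sum borel_measurable_times borel_measurable_indicator) auto
  then have meas: "?g \<in> borel_measurable lebesgue" by (rule lebesgue_borel_integral(2))
  have fm: "\<Omega> \<in> lmeasurable" using \<Omega> by (rule lmeasurable_open[rotated])
  then have \<Omega>s: "\<Omega> \<in> sets lebesgue" by (rule fmeasurableD)
  have "set_borel_measurable lebesgue \<Omega> ?g"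
    unfolding set_borel_measurable_def using \<Omega>s meas by (intro borel_measurable_scaleR borel_measurable_indicator)
  moreover have "set_integrable lebesgue \<Omega> (\<lambda>x. (?g x)\<^sup>2)"
    unfolding set_integrable_def
  proof (rule integrableI_bounded_set_indicator[OF \<Omega>s, where B = "(\<Sum>T\<in>\<T>. B T)\<^sup>2"])
    show "(\<lambda>x. (?g x)\<^sup>2) \<in> borel_measurable lebesgue" using meas by (rule borel_measurable_power)
    show "emeasure lebesgue \<Omega> < \<infinity>" using fmeasurableD2[OF fm] by (simp add: less_top)
    show "AE x in lebesgue. x \<in> \<Omega> \<longrightarrow> norm ((?g x)\<^sup>2) \<le> (\<Sum>T\<in>\<T>. B T)\<^sup>2"
    proof (intro AE_I2 impI)
      fix x
      have "(?g x)\<^sup>2 \<le> (\<Sum>T\<in>\<T>. B T)\<^sup>2" using bound[of x] by (intro abs_le_square_iff[THEN iffD1]) linarith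
      then show "norm ((?g x)\<^sup>2) \<le> (\<Sum>T\<in>\<T>. B T)\<^sup>2" by simp
    qed
  qed
  ultimately show ?thesis by (simp add: L2_def)
qed

text \<open>The quantifier over \<open>h\<close> stands inside the almost-everywhere statement, so
  one null set serves all arguments of a form at once.\<close>

lemma glue_AE:
  fixes \<T> :: "'n::{finite,linorder} pt set set"
  assumes m: "simplicial_mesh \<T>" and T: "T \<in> \<T>"
  shows "AE x in lebesgue. x \<in> \<Omega> \<inter> T \<longrightarrow> (\<forall>h :: 'n pt set \<Rightarrow> real. (\<Sum>T\<in>\<T>. indicator (interior T) x * h T) = h T)"
  using AE_lebesgue_lborel[OF mesh_AE_interior[OF m]]
proof eventually_elim
  case (elim x)
  show ?case
  proof (intro impI allI)
    fix h :: "'n pt set \<Rightarrow> real"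
    assume "x \<in> \<Omega> \<inter> T"
    then show "(\<Sum>T\<in>\<T>. indicator (interior T) x * h T) = h T" using elim T by (intro mesh_indicator_sum[OF m T]) blast
  qed
qed

lemma XX_sum: "finite J \<Longrightarrow> (\<And>j. j \<in> J \<Longrightarrow> \<omega> j \<in> XX k) \<Longrightarrow> (\<lambda>ws vs. \<Sum>j\<in>J. \<omega> j ws vs) \<in> XX k"
  by (induction rule: finite_induct) (simp_all add: XX_zero XX_add)

lemma V_h_is_div:
  fixes \<T> :: "'n::{finite,linorder} pt set set"
  assumes m: "simplicial_mesh \<T>" and \<Omega>: "open \<Omega>" "\<Omega> \<subseteq> \<Union>\<T>" and k: "1 \<le> k" "k \<le> CARD('n) - 1" and r: "CARD('n) \<le> r"
    and tn: "\<And>l f. l \<le> CARD('n) - 1 \<Longrightarrow> f \<in> subsimplices l \<T> \<Longrightarrow> tn_basis l f (b f)"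
    and P: "dof_family k r \<T> b P"
    and \<omega>: "\<omega> \<in> L2_tform \<Omega> (XX k)" "\<And>T. T \<in> \<T> \<Longrightarrow> AE x in lebesgue. x \<in> \<Omega> \<inter> T \<longrightarrow> \<omega> x = P T x"
    and q: "q \<in> L2_form \<Omega> (Alt k)" "\<And>T. T \<in> \<T> \<Longrightarrow> AE x in lebesgue. x \<in> \<Omega> \<inter> T \<longrightarrow> q x = divf (P T) x"
  shows "is_div k \<Omega> \<omega> q"
proof (rule mesh_weak_divergence[OF m \<Omega> _ _ \<omega> q])
  show "P T \<in> poly_tform r (XX k)" if "T \<in> \<T>" for T by (rule bspec[OF dof_family_poly[OF P] that])
  show "proxy (P T x ws) \<bullet> bgrad (verts T) v = proxy (P T' x ws) \<bullet> bgrad (verts T) v"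
    if "T \<in> \<T>" "T' \<in> \<T>" "v \<in> verts T" "adjacent T v T' v'" "x \<in> convex hull (verts T - {v})" for T T' v v' x ws
    by (rule dof_family_normal_continuous[OF m k r tn P that])
qed

theorem lemma6p10:
  fixes \<Omega> :: "'n::{finite,linorder} pt set"
    and \<T> :: "'n pt set set"
    and b :: "'n pt set \<Rightarrow> 'n \<Rightarrow> 'n pt"
    and k r :: nat
  assumes "2 \<le> CARD('n)"
    and "1 \<le> k" and "k \<le> CARD('n) - 1"
    and "CARD('n) + 1 \<le> r"
    and "open \<Omega>" and "connected \<Omega>" and "bounded \<Omega>" and "\<Omega> \<noteq> {}"
    and "conforming_mesh \<Omega> \<T>"
    and "\<And>l f. l \<le> CARD('n) - 1 \<Longrightarrow> f \<in> subsimplices l \<T> \<Longrightarrow> tn_basis l f (b f)"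
  shows "V_h k r \<Omega> \<T> b \<subseteq> H_div k \<Omega> \<and> div_image k \<Omega> (V_h k r \<Omega> \<T> b) = Q_h k r \<Omega> \<T>"
proof -
  note k = assms(2,3) and r = assms(4) and \<Omega> = assms(5) and bd = assms(7) and tn = assms(10)
  have m: "simplicial_mesh \<T>" and cover: "\<Omega> \<subseteq> \<Union>\<T>"
    using assms(9) closure_subset[of \<Omega>] by (simp_all add: conforming_mesh_def simplicial_mesh_def)
  have r': "CARD('n) \<le> r" and k': "k < CARD('n)" using r k assms(1) by linarith+
  have poly: "P T \<in> poly_tform r (XX k)" if "dof_family k r \<T> b P" "T \<in> \<T>" for P T
    by (rule bspec[OF dof_family_poly[OF that(1)] that(2)])
  have 1: "V_h k r \<Omega> \<T> b \<subseteq> H_div k \<Omega>"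
  proof
    fix \<omega> assume "\<omega> \<in> V_h k r \<Omega> \<T> b"
    then obtain P where \<omega>: "\<omega> \<in> L2_tform \<Omega> (XX k)" and P: "dof_family k r \<T> b P"
      and eq: "\<And>T. T \<in> \<T> \<Longrightarrow> AE x in lebesgue. x \<in> \<Omega> \<inter> T \<longrightarrow> \<omega> x = P T x" unfolding V_h_iff by blast
    \<comment> \<open>On interiors this is the elementwise divergence, elsewhere 0. It is therefore
      a \<open>k\<close>-form at every point, as membership in \<open>L2_form\<close>
      demands.\<close>
    define q where "q = (\<lambda>x ws. \<Sum>T\<in>\<T>. indicator (interior T) x * divf (P T) x ws)"
    have pf: "divf (P T) \<in> poly_form (r - 1) (Alt k)" if "T \<in> \<T>" for T by (rule divf_poly_form[OF poly[OF P that]])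
    have "q x \<in> Alt k" for x
      unfolding q_def using pf by (intro Alt_sum Alt_scale) (simp add: poly_form_def)
    moreover have "(\<lambda>x. q x ws) \<in> L2 \<Omega>" for ws
      unfolding q_def using pf by (intro glue_L2[OF m \<Omega> bd] poly_fun_continuous_on[where r = "r - 1"]) (simp add: poly_form_def)
    ultimately have q: "q \<in> L2_form \<Omega> (Alt k)" by (simp add: L2_form_def)
    have qP: "AE x in lebesgue. x \<in> \<Omega> \<inter> T \<longrightarrow> q x = divf (P T) x" if T: "T \<in> \<T>" for T
      using glue_AE[OF m T, of \<Omega>] by eventually_elim (simp add: q_def)
    have "is_div k \<Omega> \<omega> q" by (rule V_h_is_div[OF m \<Omega> cover k r' tn P \<omega> eq q qP])
    then show "\<omega> \<in> H_div k \<Omega>" using \<omega> q unfolding H_div_def by blast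
  qed
  have 2: "div_image k \<Omega> (V_h k r \<Omega> \<T> b) \<subseteq> Q_h k r \<Omega> \<T>"
  proof
    fix q assume "q \<in> div_image k \<Omega> (V_h k r \<Omega> \<T> b)"
    then obtain \<omega> where q: "q \<in> L2_form \<Omega> (Alt k)" and \<omega>V: "\<omega> \<in> V_h k r \<Omega> \<T> b" and div: "is_div k \<Omega> \<omega> q"
      unfolding div_image_def by blast
    obtain P where \<omega>: "\<omega> \<in> L2_tform \<Omega> (XX k)" and P: "dof_family k r \<T> b P"
      and eq: "\<And>T. T \<in> \<T> \<Longrightarrow> AE x in lebesgue. x \<in> \<Omega> \<inter> T \<longrightarrow> \<omega> x = P T x" using \<omega>V unfolding V_h_iff by blast
    \<comment> \<open>Here \<open>q\<close> is any weak divergence of \<omega>, so uniqueness is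
      what identifies it with a piecewise polynomial.\<close>
    have "\<exists>p\<in>poly_form (r - 1) (Alt k). AE x in lebesgue. x \<in> \<Omega> \<inter> T \<longrightarrow> q x = p x" if T: "T \<in> \<T>" for T
    proof (rule bexI[OF _ divf_poly_form[OF poly[OF P T]]])
      have "int CARD('n) simplex T" using m T by (simp add: simplicial_mesh_def)
      from weak_divergence_unique[OF \<Omega> bd this poly[OF P T] \<omega> eq[OF T] q div]
      show "AE x in lebesgue. x \<in> \<Omega> \<inter> T \<longrightarrow> q x = divf (P T) x" .
    qed
    then show "q \<in> Q_h k r \<Omega> \<T>" using q unfolding Q_h_def by blast
  qed
  have 3: "Q_h k r \<Omega> \<T> \<subseteq> div_image k \<Omega> (V_h k r \<Omega> \<T> b)"
  proof
    fix q assume "q \<in> Q_h k r \<Omega> \<T>"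
    then have q: "q \<in> L2_form \<Omega> (Alt k)"
      and "\<forall>T\<in>\<T>. \<exists>p. p \<in> poly_form (r - 1) (Alt k) \<and> (AE x in lebesgue. x \<in> \<Omega> \<inter> T \<longrightarrow> q x = p x)"
      unfolding Q_h_def by blast+
    from bchoice[OF this(2)] obtain p where p: "\<And>T. T \<in> \<T> \<Longrightarrow> p T \<in> poly_form (r - 1) (Alt k)"
      and qp: "\<And>T. T \<in> \<T> \<Longrightarrow> AE x in lebesgue. x \<in> \<Omega> \<inter> T \<longrightarrow> q x = p T x" by blast
    have "\<exists>P. normal_family k r \<T> P \<and> (\<forall>T\<in>\<T>. divf (P T) = p T)" by (rule div_surjective[OF m r k(1) k' p])
    then obtain P where N: "normal_family k r \<T> P" and div: "\<And>T. T \<in> \<T> \<Longrightarrow> divf (P T) = p T" by blast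
    \<comment> \<open>The preimage was found without reference to \<open>b\<close>; only now are its
      degrees of freedom for the given bases seen to be single-valued.\<close>
    have P: "dof_family k r \<T> b P" by (rule normal_family_dof_family[OF m tn N])
    define \<omega> where "\<omega> = (\<lambda>x ws vs. \<Sum>T\<in>\<T>. indicator (interior T) x * P T x ws vs)"
    have "\<omega> x \<in> XX k" for x
      unfolding \<omega>_def using poly[OF P] by (intro XX_sum XX_scale mesh_finite[OF m]) (simp add: poly_tform_def)
    moreover have "(\<lambda>x. \<omega> x ws vs) \<in> L2 \<Omega>" for ws vs
      unfolding \<omega>_def using poly[OF P] by (intro glue_L2[OF m \<Omega> bd] poly_fun_continuous_on[where r = r]) (simp add: poly_tform_def)
    ultimately have \<omega>: "\<omega> \<in> L2_tform \<Omega> (XX k)" by (simp add: L2_tform_def)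
    have eq: "AE x in lebesgue. x \<in> \<Omega> \<inter> T \<longrightarrow> \<omega> x = P T x" if T: "T \<in> \<T>" for T
      using glue_AE[OF m T, of \<Omega>] by eventually_elim (simp add: \<omega>_def)
    have qP: "AE x in lebesgue. x \<in> \<Omega> \<inter> T \<longrightarrow> q x = divf (P T) x" if T: "T \<in> \<T>" for T
      using qp[OF T] by (simp only: div[OF T])
    have "is_div k \<Omega> \<omega> q" by (rule V_h_is_div[OF m \<Omega> cover k r' tn P \<omega> eq q qP])
    moreover have "\<omega> \<in> V_h k r \<Omega> \<T> b" unfolding V_h_iff using \<omega> P eq by blast
    ultimately show "q \<in> div_image k \<Omega> (V_h k r \<Omega> \<T> b)" using q unfolding div_image_def by blast
  qed
  from 1 2 3 show ?thesis by blast
qed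

end
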